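(* Let $w=w_{63}$ be the Atkin-Lehner involution of $X_0(63)$ attached to $63$. There exist $x,y,t\in\mathbb{Q}(X_0(63))$ such that $\mathbb{Q}(X_0(63))=\mathbb{Q}(x,y,t)$, the subfield of functions invariant under $w^*$ is $\mathbb{Q}(x,y)$, $w^*(t)=-t$, and $$y^2+xy=x^3+x,\qquad t^2=1+9x-24x^2-8x^3-9x^4+3x^5+x^6-3(-2+x)(-1+x)(1+x)(-1+2x)y.$$ In particular these two equations are equations for $X_0(63)$ over $\mathbb{Q}$ (up to birational equivalence over $\mathbb{Q}$).
   Context: $X_0(N)$ denotes the smooth projective curve over $\mathbb{Q}$ attached to $\Gamma_0(N)$, where $\mathbb{Q}(X_0(N))$ is the subfield of $\mathbb{C}(X_0(N))$ of functions with rational $q$-expansion at the cusp $\infty$, $q=e^{2\pi i z}$. For a positive divisor $d$ of $N$ coprime to $N/d$, the Atkin-Lehner involution $w_d$ of $X_0(N)$ is induced by any matrix $\frac{1}{\sqrt d}\begin{pmatrix} A d & B\\ N C & D d\end{pmatrix}$ of determinant $1$ with $A,B,C,D\in\mathbb{Z}$; it is defined over $\mathbb{Q}$. *)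

theory Defs
  imports "HOL-Complex_Analysis.Complex_Analysis"
begin

no_notation fps_nth (infixl \<open>$\<close> 75)

section \<open>The field of meromorphic functions on the upper half-plane\<close>

definition uhp :: "complex set" where
  "uhp = {z. Im z > 0}"

lemma open_uhp: "open uhp"
  unfolding uhp_def by (rule open_halfspace_Im_gt)

lemma connected_uhp: "connected uhp"
  unfolding uhp_def by (rule connected_halfspace_Im_gt)

lemma cosparse_uhp_neq_bot: "cosparse uhp \<noteq> bot"
proof -
  have "\<i> \<in> uhp" by (simp add: uhp_def)
  thus ?thesis by auto
qed

text \<open>Two functions that differ only on a discrete subset (e.g. in the junk values at
  poles) represent the same meromorphic function.\<close>

quotient_type mero_uhp =
  "complex \<Rightarrow> complex" / partial:
  "\<lambda>f g. f meromorphic_on uhp \<and> g meromorphic_on uhp \<and>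
         eventually (\<lambda>z. f z = g z) (cosparse uhp)"
proof (rule part_equivpI)
  show "\<exists>f. f meromorphic_on uhp \<and> f meromorphic_on uhp \<and>
         eventually (\<lambda>z. f z = f z) (cosparse uhp)"
    by (rule exI[of _ "\<lambda>_. 0"]) auto
  show "symp (\<lambda>f g. f meromorphic_on uhp \<and> g meromorphic_on uhp \<and>
         eventually (\<lambda>z. f z = g z) (cosparse uhp))"
    by (auto simp: symp_def elim!: eventually_mono)
  show "transp (\<lambda>f g. f meromorphic_on uhp \<and> g meromorphic_on uhp \<and>
         eventually (\<lambda>z. f z = g z) (cosparse uhp))"
    by (auto simp: transp_def elim: eventually_elim2)
qed

lift_definition const_mero :: "complex \<Rightarrow> mero_uhp" is "\<lambda>c _. c"
  by auto

lemma const_mero_eq_iff: "const_mero c = const_mero d \<longleftrightarrow> c = d"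
  by transfer (use cosparse_uhp_neq_bot in auto)

instantiation mero_uhp :: field
begin

lift_definition zero_mero_uhp :: mero_uhp is "\<lambda>_. 0"
  by auto

lift_definition one_mero_uhp :: mero_uhp is "\<lambda>_. 1"
  by auto

lift_definition plus_mero_uhp :: "mero_uhp \<Rightarrow> mero_uhp \<Rightarrow> mero_uhp" is
  "\<lambda>f g z. f z + g z"
  by (auto intro!: meromorphic_intros elim: eventually_elim2)

lift_definition minus_mero_uhp :: "mero_uhp \<Rightarrow> mero_uhp \<Rightarrow> mero_uhp" is
  "\<lambda>f g z. f z - g z"
  by (auto intro!: meromorphic_intros elim: eventually_elim2)

lift_definition uminus_mero_uhp :: "mero_uhp \<Rightarrow> mero_uhp" is
  "\<lambda>f z. - f z"
  by (auto intro!: meromorphic_intros elim: eventually_mono)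

lift_definition times_mero_uhp :: "mero_uhp \<Rightarrow> mero_uhp \<Rightarrow> mero_uhp" is
  "\<lambda>f g z. f z * g z"
  by (auto intro!: meromorphic_intros elim: eventually_elim2)

lift_definition inverse_mero_uhp :: "mero_uhp \<Rightarrow> mero_uhp" is
  "\<lambda>f z. inverse (f z)"
  by (auto intro!: meromorphic_intros elim: eventually_mono)

lift_definition divide_mero_uhp :: "mero_uhp \<Rightarrow> mero_uhp \<Rightarrow> mero_uhp" is
  "\<lambda>f g z. f z / g z"
  by (auto intro!: meromorphic_intros elim: eventually_elim2)

instance
proof
  fix f g h :: mero_uhp
  show "f + g + h = f + (g + h)" "f + g = g + f" "0 + f = f" "- f + f = 0"
       "f - g = f + - g" "f * g * h = f * (g * h)" "f * g = g * f" "1 * f = f"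
       "(f + g) * h = f * h + g * h" "f div g = f * inverse g" "inverse 0 = (0 :: mero_uhp)"
    by (transfer; auto simp: algebra_simps divide_inverse intro!: meromorphic_intros)+
  show "(0 :: mero_uhp) \<noteq> 1"
    by transfer (use cosparse_uhp_neq_bot in auto)
  show "inverse f * f = 1" if "f \<noteq> 0"
    using that
  proof transfer
    fix f
    assume f: "f meromorphic_on uhp \<and> f meromorphic_on uhp \<and>
                 (\<forall>\<^sub>\<approx>z\<in>uhp. f z = f z)"
    assume nz: "\<not> (f meromorphic_on uhp \<and> (\<lambda>_. 0) meromorphic_on uhp \<and>
                 (\<forall>\<^sub>\<approx>z\<in>uhp. f z = 0))"
    from f have mero: "f meromorphic_on uhp"
      by blast
    have "\<forall>\<^sub>\<approx>z\<in>uhp. f z \<noteq> 0"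
      using meromorphic_imp_constant_or_avoid[OF mero open_uhp connected_uhp, of 0] nz mero
      by auto
    hence "\<forall>\<^sub>\<approx>z\<in>uhp. inverse (f z) * f z = 1"
      by eventually_elim auto
    thus "(\<lambda>z. inverse (f z) * f z) meromorphic_on uhp \<and> (\<lambda>_. 1) meromorphic_on uhp \<and>
          (\<forall>\<^sub>\<approx>z\<in>uhp. inverse (f z) * f z = 1)"
      using mero by (auto intro!: meromorphic_intros)
  qed
qed

end

lemma const_mero_0: "const_mero 0 = 0"
  by transfer auto

lemma const_mero_add_1: "const_mero (c + 1) = const_mero c + 1"
  by transfer auto

lemma of_nat_mero_uhp: "of_nat n = const_mero (of_nat n)"
  by (induction n) (simp_all add: const_mero_0 const_mero_add_1 add.commute[of 1])

instance mero_uhp :: field_char_0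
  by standard (auto simp: inj_def of_nat_mero_uhp const_mero_eq_iff)


section \<open>Subfields and polynomial relations\<close>

definition is_subfield :: "'a :: field set \<Rightarrow> bool" where
  "is_subfield K \<longleftrightarrow> 0 \<in> K \<and> 1 \<in> K \<and>
     (\<forall>x\<in>K. \<forall>y\<in>K. x + y \<in> K \<and> x - y \<in> K \<and> x * y \<in> K) \<and> (\<forall>x\<in>K. inverse x \<in> K)"

text \<open>In characteristic 0 this is the extension \<open>\<rat>(S)\<close> of the prime field \<open>\<rat>\<close>.\<close>

definition rat_adjoin :: "'a :: field_char_0 set \<Rightarrow> 'a set" where
  "rat_adjoin S = \<Inter>{K. is_subfield K \<and> S \<subseteq> K}"

text \<open>Polynomials in three variables over \<open>\<rat>\<close> are elements of \<open>\<rat>[X][Y][T]\<close>,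
  i.e. of type \<^typ>\<open>rat poly poly poly\<close>.\<close>

definition var_X :: "rat poly poly poly" where "var_X = [:[:[:0, 1:]:]:]"
definition var_Y :: "rat poly poly poly" where "var_Y = [:[:0, 1:]:]"
definition var_T :: "rat poly poly poly" where "var_T = [:0, 1:]"

definition eval_XYT :: "'a :: field_char_0 \<Rightarrow> 'a \<Rightarrow> 'a \<Rightarrow> rat poly poly poly \<Rightarrow> 'a" where
  "eval_XYT x y t P =
     poly (map_poly (\<lambda>Q. poly (map_poly (\<lambda>R. poly (map_poly of_rat R) x) Q) y) P) t"

text \<open>
  The affine scheme \<open>F = G = 0\<close> in three-space over \<open>\<rat>\<close> is integral and \<open>K\<close> is its function
  field, with coordinate functions \<open>x\<close>, \<open>y\<close>, \<open>t\<close>: the homomorphism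
  \<open>\<rat>[X,Y,T]/(F,G) \<rightarrow> K\<close>, \<open>(X,Y,T) \<mapsto> (x,y,t)\<close> is well-defined and injective, and \<open>K\<close> is the
  field of fractions of its image. If \<open>K\<close> is the function field of a curve over \<open>\<rat>\<close>, this means
  that the curve is birationally equivalent over \<open>\<rat>\<close> to \<open>F = G = 0\<close> via \<open>(x,y,t)\<close>.
\<close>
definition are_equations_for ::
    "rat poly poly poly \<Rightarrow> rat poly poly poly \<Rightarrow> 'a :: field_char_0 set \<Rightarrow> 'a \<Rightarrow> 'a \<Rightarrow> 'a \<Rightarrow> bool"
  where "are_equations_for F G K x y t \<longleftrightarrow>
     K = rat_adjoin {x, y, t} \<and>
     {P. eval_XYT x y t P = 0} = {A * F + B * G |A B. True}"


section \<open>The action of matrices of positive determinant\<close>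

definition mat2 :: "real \<Rightarrow> real \<Rightarrow> real \<Rightarrow> real \<Rightarrow> real^2^2" where
  "mat2 a b c d = vector [vector [a, b], vector [c, d]]"

lemma mat2_nth [simp]:
  "mat2 a b c d $ 1 $ 1 = a" "mat2 a b c d $ 1 $ 2 = b"
  "mat2 a b c d $ 2 $ 1 = c" "mat2 a b c d $ 2 $ 2 = d"
  by (simp_all add: mat2_def)

lemma det_mat2 [simp]: "det (mat2 a b c d) = a * d - b * c"
  by (simp add: det_2)

lemma mat2_mult:
  "mat2 a b c d ** mat2 a' b' c' d' =
     mat2 (a * a' + b * c') (a * b' + b * d') (c * a' + d * c') (c * b' + d * d')"
  by (simp add: vec_eq_iff forall_2 matrix_matrix_mult_def sum_2)

lemma mat2_eta: "mat2 (M $ 1 $ 1) (M $ 1 $ 2) (M $ 2 $ 1) (M $ 2 $ 2) = M"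
  by (simp add: vec_eq_iff forall_2)

definition act :: "real^2^2 \<Rightarrow> complex \<Rightarrow> complex" where
  "act M = moebius (of_real (M $ 1 $ 1)) (of_real (M $ 1 $ 2))
                   (of_real (M $ 2 $ 1)) (of_real (M $ 2 $ 2))"

lemma act_denom_nonzero:
  fixes M :: "real^2^2"
  assumes "det M > 0" "z \<in> uhp"
  shows   "of_real (M $ 2 $ 1) * z + of_real (M $ 2 $ 2) \<noteq> (0 :: complex)"
proof
  assume "of_real (M $ 2 $ 1) * z + of_real (M $ 2 $ 2) = (0 :: complex)"
  hence "M $ 2 $ 1 * Im z = 0" "M $ 2 $ 1 * Re z + M $ 2 $ 2 = 0"
    by (simp_all add: complex_eq_iff)
  with assms show False
    by (auto simp: uhp_def det_2)
qed

lemma Im_act: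
  "Im (act M z) = det M * Im z / norm (of_real (M $ 2 $ 1) * z + of_real (M $ 2 $ 2)) ^ 2"
  by (simp add: act_def moebius_def Im_divide det_2 cmod_power2 algebra_simps)

lemma act_in_uhp: "det M > 0 \<Longrightarrow> z \<in> uhp \<Longrightarrow> act M z \<in> uhp"
  using act_denom_nonzero[of M z]
  by (auto simp: Im_act uhp_def intro!: divide_pos_pos)

lemma act_mult:
  assumes "det B > 0" "z \<in> uhp" "det A > 0"
  shows   "act (A ** B) z = act A (act B z)"
proof -
  obtain a b c d where A: "A = mat2 a b c d" by (metis mat2_eta)
  obtain a' b' c' d' where B: "B = mat2 a' b' c' d'" by (metis mat2_eta)
  define u v where "u = of_real a' * z + of_real b'" and "v = of_real c' * z + of_real d'"
  have v: "v \<noteq> 0"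
    using act_denom_nonzero[OF assms(1,2)] by (simp add: B v_def)
  have B_z: "act B z = u / v"
    by (simp add: B act_def moebius_def u_def v_def)
  have "act A (act B z) = (of_real a * u + of_real b * v) / (of_real c * u + of_real d * v)"
  proof -
    have "of_real a * (u / v) + of_real b = (of_real a * u + of_real b * v) / v"
         "of_real c * (u / v) + of_real d = (of_real c * u + of_real d * v) / v"
      using v by (simp_all add: field_simps)
    thus ?thesis
      unfolding B_z using v by (simp add: A act_def moebius_def)
  qed
  also have "\<dots> = act (A ** B) z"
    by (simp add: A B mat2_mult act_def moebius_def u_def v_def algebra_simps)
  finally show ?thesis ..
qed

lemma analytic_on_act: "det M > 0 \<Longrightarrow> act M analytic_on uhp"
  unfolding act_def moebius_def
  by (intro analytic_intros) (use act_denom_nonzero in auto)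

lemma inj_on_act: 
  assumes "det M > 0"
  shows   "inj_on (act M) uhp"
proof (rule inj_onI)
  fix z w assume zw: "z \<in> uhp" "w \<in> uhp" "act M z = act M w"
  have "det M * (z - w) = 0"
    using zw(3) act_denom_nonzero[OF assms zw(1)] act_denom_nonzero[OF assms zw(2)]
    by (simp add: act_def moebius_def det_2 frac_eq_eq) algebra
  thus "z = w" using assms by simp
qed

lemma eventually_cosparse_act:
  assumes "det M > 0" "eventually P (cosparse uhp)"
  shows   "eventually (\<lambda>z. P (act M z)) (cosparse uhp)"
proof -
  have "eventually (\<lambda>z. P (act M z)) (at z)" if z: "z \<in> uhp" for z
  proof -
    have "isCont (act M) z"
      using analytic_on_act[OF assms(1)] z
      by (meson analytic_at_imp_isCont analytic_on_analytic_at)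
    hence "filterlim (act M) (nhds (act M z)) (at z)"
      by (simp add: isCont_def)
    moreover have "eventually (\<lambda>w. act M w \<noteq> act M z) (at z)"
    proof -
      have "eventually (\<lambda>w. w \<in> uhp - {z}) (at z)"
        using open_uhp z by (intro eventually_at_in_open) auto
      thus ?thesis
        by eventually_elim (use inj_on_act[OF assms(1)] z in \<open>auto simp: inj_on_def\<close>)
    qed
    ultimately have "filterlim (act M) (at (act M z)) (at z)"
      by (simp add: filterlim_at)
    moreover have "eventually P (at (act M z))"
      using assms(2) act_in_uhp[OF assms(1) z] by (simp add: eventually_cosparse_open_eq open_uhp)
    ultimately show ?thesis
      by (simp add: filterlim_iff)
  qed
  thus ?thesis
    by (simp add: eventually_cosparse_open_eq open_uhp)
qed

lemma meromorphic_on_act: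
  assumes "det M > 0" "f meromorphic_on uhp"
  shows   "(\<lambda>z. f (act M z)) meromorphic_on uhp"
  by (rule meromorphic_on_compose[OF assms(2) analytic_on_act[OF assms(1)]])
     (use act_in_uhp[OF assms(1)] in auto)

text \<open>Only meaningful if the determinant is positive.\<close>

lift_definition pullback :: "real^2^2 \<Rightarrow> mero_uhp \<Rightarrow> mero_uhp" is
  "\<lambda>M f. if det M > 0 then (\<lambda>z. f (act M z)) else f"
proof -
  fix M :: "real^2^2" and f g :: "complex \<Rightarrow> complex"
  assume fg: "f meromorphic_on uhp \<and> g meromorphic_on uhp \<and> (\<forall>\<^sub>\<approx>z\<in>uhp. f z = g z)"
  show "(if det M > 0 then (\<lambda>z. f (act M z)) else f) meromorphic_on uhp \<and>
        (if det M > 0 then (\<lambda>z. g (act M z)) else g) meromorphic_on uhp \<and>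
        (\<forall>\<^sub>\<approx>z\<in>uhp. (if det M > 0 then (\<lambda>z. f (act M z)) else f) z =
                  (if det M > 0 then (\<lambda>z. g (act M z)) else g) z)"
  proof (cases "det M > 0")
    case True
    have "\<forall>\<^sub>\<approx>z\<in>uhp. f (act M z) = g (act M z)"
      by (rule eventually_cosparse_act[OF True]) (use fg in blast)
    thus ?thesis
      using True fg by (simp add: meromorphic_on_act)
  qed (use fg in auto)
qed

lemma pullback_mult:
  assumes "det A > 0" "det B > 0"
  shows   "pullback (A ** B) f = pullback B (pullback A f)"
proof -
  have "det (A ** B) > 0"
    using assms by (simp add: det_mul)
  thus ?thesis using assms
  proof transfer
    fix A B :: "real^2^2" and f :: "complex \<Rightarrow> complex"
    assume pos: "det (A ** B) > 0" "det A > 0" "det B > 0"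
    assume "f meromorphic_on uhp \<and> f meromorphic_on uhp \<and> (\<forall>\<^sub>\<approx>z\<in>uhp. f z = f z)"
    hence f: "f meromorphic_on uhp"
      by blast
    have "\<forall>\<^sub>\<approx>z\<in>uhp. z \<in> uhp"
      by (rule eventually_in_cosparse) (auto simp: open_uhp)
    hence "\<forall>\<^sub>\<approx>z\<in>uhp. f (act (A ** B) z) = f (act A (act B z))"
      by eventually_elim (use pos in \<open>simp add: act_mult\<close>)
    moreover have "(\<lambda>z. f (act A (act B z))) meromorphic_on uhp"
      by (rule meromorphic_on_act[of B "\<lambda>z. f (act A z)"]) (use pos f meromorphic_on_act in auto)
    ultimately show "(if det (A ** B) > 0 then (\<lambda>z. f (act (A ** B) z)) else f) meromorphic_on uhp \<and>
       (if det B > 0 then (\<lambda>z. (if det A > 0 then (\<lambda>z. f (act A z)) else f) (act B z))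
          else (if det A > 0 then (\<lambda>z. f (act A z)) else f)) meromorphic_on uhp \<and>
       (\<forall>\<^sub>\<approx>z\<in>uhp. (if det (A ** B) > 0 then (\<lambda>z. f (act (A ** B) z)) else f) z =
          (if det B > 0 then (\<lambda>z. (if det A > 0 then (\<lambda>z. f (act A z)) else f) (act B z))
          else (if det A > 0 then (\<lambda>z. f (act A z)) else f)) z)"
      using meromorphic_on_act[OF pos(1) f] pos by simp
  qed
qed


section \<open>The function field of \<open>X\<^sub>0(N)\<close> over the rationals\<close>

definition Gamma0 :: "nat \<Rightarrow> (real^2^2) set" where
  "Gamma0 N = {mat2 (of_int a) (of_int b) (of_int c) (of_int d) |a b c d.
                 a * d - b * c = (1 :: int) \<and> int N dvd c}"

text \<open>\<open>f\<close> is given near \<open>\<i>\<infinity>\<close> by the convergent Laurent series \<open>L\<close> in \<open>exp (2 \<pi> \<i> z / h)\<close>.\<close>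

lift_definition has_q_expansion :: "nat \<Rightarrow> mero_uhp \<Rightarrow> complex fls \<Rightarrow> bool" is
  "\<lambda>h f L. fls_conv_radius L > 0 \<and>
     (\<exists>c>0. \<forall>\<^sub>\<approx>z\<in>{z. Im z > c}. f z = eval_fls L (exp (2 * of_real pi * \<i> * z / of_nat h)))"
proof -
  have *: "\<exists>c>0. \<forall>\<^sub>\<approx>z\<in>{z. Im z > c}. g z = E z"
    if "\<forall>\<^sub>\<approx>z\<in>uhp. f z = g z" "\<exists>c>0. \<forall>\<^sub>\<approx>z\<in>{z. Im z > c}. f z = E z"
    for f g E :: "complex \<Rightarrow> complex"
  proof -
    from that obtain c where c: "c > 0" "\<forall>\<^sub>\<approx>z\<in>{z. Im z > c}. f z = E z"
      by blast
    have "\<forall>\<^sub>\<approx>z\<in>{z. Im z > c}. f z = g z"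
      using that(1) unfolding eventually_cosparse
      by (rule sparse_in_subset) (use c(1) in \<open>auto simp: uhp_def\<close>)
    with c(2) have "\<forall>\<^sub>\<approx>z\<in>{z. Im z > c}. g z = E z"
      by eventually_elim auto
    with c(1) show ?thesis by blast
  qed
  fix h :: nat and f g :: "complex \<Rightarrow> complex"
  assume "f meromorphic_on uhp \<and> g meromorphic_on uhp \<and> (\<forall>\<^sub>\<approx>z\<in>uhp. f z = g z)"
  hence 1: "\<forall>\<^sub>\<approx>z\<in>uhp. f z = g z" and 2: "\<forall>\<^sub>\<approx>z\<in>uhp. g z = f z"
    by (auto elim: eventually_mono)
  define E where "E = (\<lambda>(L :: complex fls) z. eval_fls L (exp (2 * of_real pi * \<i> * z / of_nat h)))"
  have "(\<lambda>L. fls_conv_radius L > 0 \<and> (\<exists>c>0. \<forall>\<^sub>\<approx>z\<in>{z. Im z > c}. f z = E L z)) =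
        (\<lambda>L. fls_conv_radius L > 0 \<and> (\<exists>c>0. \<forall>\<^sub>\<approx>z\<in>{z. Im z > c}. g z = E L z))"
    by (intro ext conj_cong refl, rule iffI, erule *[OF 1], erule *[OF 2])
  thus "(\<lambda>L. fls_conv_radius L > 0 \<and>
      (\<exists>c>0. \<forall>\<^sub>\<approx>z\<in>{z. Im z > c}. f z = eval_fls L (exp (2 * of_real pi * \<i> * z / of_nat h)))) =
     (\<lambda>L. fls_conv_radius L > 0 \<and>
      (\<exists>c>0. \<forall>\<^sub>\<approx>z\<in>{z. Im z > c}. g z = eval_fls L (exp (2 * of_real pi * \<i> * z / of_nat h))))"
    unfolding E_def .
qed

text \<open>Every cusp is the image of \<open>\<i>\<infinity>\<close> under \<open>SL\<^sub>2(\<int>)\<close>, which is \<^term>\<open>Gamma0 1\<close>.\<close>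

definition meromorphic_at_cusps :: "mero_uhp \<Rightarrow> bool" where
  "meromorphic_at_cusps f \<longleftrightarrow>
     (\<forall>M\<in>Gamma0 1. \<exists>h>0. \<exists>L. has_q_expansion h (pullback M f) L)"

definition C_X0 :: "nat \<Rightarrow> mero_uhp set" where
  "C_X0 N = {f. (\<forall>M\<in>Gamma0 N. pullback M f = f) \<and> meromorphic_at_cusps f}"

definition Q_X0 :: "nat \<Rightarrow> mero_uhp set" where
  "Q_X0 N = {f \<in> C_X0 N. \<exists>L. has_q_expansion 1 f L \<and> (\<forall>n. fls_nth L n \<in> \<rat>)}"


section \<open>Atkin--Lehner involutions\<close>

definition atkin_lehner_matrices :: "nat \<Rightarrow> nat \<Rightarrow> (real^2^2) set" where
  "atkin_lehner_matrices N d =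
     {M. det M = 1 \<and> (\<exists>A B C D :: int. M = (1 / sqrt (real d)) *\<^sub>R
        mat2 (of_int A * real d) (of_int B) (real N * of_int C) (of_int D * real d))}"

text \<open>The map \<open>w\<^sub>d\<^sup>*\<close> on functions; on \<open>C_X0 N\<close> the chosen matrix does not matter.\<close>

definition atkin_lehner :: "nat \<Rightarrow> nat \<Rightarrow> mero_uhp \<Rightarrow> mero_uhp" where
  "atkin_lehner N d = pullback (SOME M. M \<in> atkin_lehner_matrices N d)"

lemma scaleR_mat2: "r *\<^sub>R mat2 a b c d = mat2 (r * a) (r * b) (r * c) (r * d)"
  by (simp add: vec_eq_iff forall_2)

lemma atkin_lehner_det_iff:
  assumes "d > 0" "d dvd N"
  shows "det ((1 / sqrt (real d)) *\<^sub>R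
          mat2 (of_int A * real d) (of_int B) (real N * of_int C) (of_int D * real d)) = 1
         \<longleftrightarrow> A * D * int d - B * C * int (N div d) = 1"
proof -
  obtain e where e: "N = d * e" using assms(2) by auto
  have "det ((1 / sqrt (real d)) *\<^sub>R
          mat2 (of_int A * real d) (of_int B) (real N * of_int C) (of_int D * real d)) =
        of_int (A * D * int d - B * C * int e)"
    using assms(1) by (simp add: scaleR_mat2 e field_simps)
  moreover have "N div d = e" using e assms(1) by simp
  ultimately show ?thesis
    by (metis of_int_1 of_int_eq_iff)
qed

lemma atkin_lehner_matrices_nonempty:
  assumes "d > 0" "d dvd N" "coprime d (N div d)"
  shows   "atkin_lehner_matrices N d \<noteq> {}"
proof -
  have "coprime (int d) (int (N div d))" using assms(3) by (simp only: coprime_int_iff)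
  then obtain u v where "u * int d + v * int (N div d) = 1"
    by (metis bezout_int coprime_imp_gcd_eq_1)
  hence "u * 1 * int d - (-v) * 1 * int (N div d) = 1" by simp
  hence "det ((1 / sqrt (real d)) *\<^sub>R
          mat2 (of_int u * real d) (of_int (-v)) (real N * of_int 1) (of_int 1 * real d)) = 1"
    by (subst atkin_lehner_det_iff) (use assms in auto)
  thus ?thesis unfolding atkin_lehner_matrices_def by blast
qed

lemma atkin_lehner_eq_pullback:
  assumes "d > 0" "d dvd N" "coprime d (N div d)" "f \<in> C_X0 N" "M \<in> atkin_lehner_matrices N d"
  shows   "atkin_lehner N d f = pullback M f"
proof -
  define W where "W = (SOME M. M \<in> atkin_lehner_matrices N d)"
  have W: "W \<in> atkin_lehner_matrices N d"
    unfolding W_def using atkin_lehner_matrices_nonempty[OF assms(1-3)] by (simp add: some_in_eq)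
  obtain e where e: "N = d * e" using assms(2) by auto
  have e': "N div d = e" using e assms(1) by simp
  define r where "r = 1 / sqrt (real d)"
  have r: "r * r * real d = 1" using assms(1) by (simp add: r_def)
  obtain A B C D :: int where W_eq:
    "W = mat2 (r * (of_int A * real d)) (r * of_int B) (r * (real N * of_int C)) (r * (of_int D * real d))"
    and detW: "A * D * int d - B * C * int e = 1"
    using W atkin_lehner_det_iff[OF assms(1,2)]
    unfolding atkin_lehner_matrices_def e' r_def scaleR_mat2 by blast
  obtain A' B' C' D' :: int where M_eq:
    "M = mat2 (r * (of_int A' * real d)) (r * of_int B') (r * (real N * of_int C')) (r * (of_int D' * real d))"
    and detM: "A' * D' * int d - B' * C' * int e = 1"
    using assms(5) atkin_lehner_det_iff[OF assms(1,2)]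
    unfolding atkin_lehner_matrices_def e' r_def scaleR_mat2 by blast
  have pos: "det W > 0" "det M > 0"
    using W assms(5) by (auto simp: atkin_lehner_matrices_def)
  \<comment> \<open>\<open>G = W M\<^sup>-\<^sup>1\<close>\<close>
  define a b c h where
    "a = A * D' * int d - B * C' * int e" and "b = B * A' - A * B'" and
    "c = int N * (C * D' - D * C')" and "h = D * A' * int d - C * B' * int e"
  define G where "G = mat2 (of_int a) (of_int b) (of_int c) (of_int h)"
  have "a * h - b * c = (A * D * int d - B * C * int e) * (A' * D' * int d - B' * C' * int e)"
    unfolding a_def b_def c_def h_def e of_nat_mult by algebra
  hence "a * h - b * c = 1" by (simp add: detW detM)
  hence G: "G \<in> Gamma0 N"
    unfolding Gamma0_def G_def by (intro CollectI exI conjI) (auto simp: c_def)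
  have "det G = of_int (a * h - b * c)" by (simp add: G_def)
  hence detG: "det G > 0" using \<open>a * h - b * c = 1\<close> by simp
  have 1: "a * A' * int d + b * C' * int N = A * int d"
          "a * B' + b * D' * int d = B"
          "c * A' * int d + h * C' * int N = C * int N"
          "c * B' + h * D' * int d = D * int d"
    unfolding a_def b_def c_def h_def e of_nat_mult using detM by algebra+
  have 2: "of_int a * of_int A' * real d + of_int b * of_int C' * real N = of_int A * real d"
          "of_int a * of_int B' + of_int b * of_int D' * real d = of_int B"
          "of_int c * of_int A' * real d + of_int h * of_int C' * real N = real N * of_int C"
          "of_int c * of_int B' + of_int h * of_int D' * real d = of_int D * real d"
    using 1[THEN arg_cong[where f = "of_int :: int \<Rightarrow> real"]] by (simp_all add: mult.commute)
  have "W = G ** M"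
    unfolding W_eq M_eq G_def mat2_mult 2[symmetric]
    by (simp add: algebra_simps vec_eq_iff forall_2)
  hence "pullback W f = pullback M (pullback G f)"
    using pullback_mult[OF detG pos(2)] by simp
  also have "pullback G f = f" using assms(4) G by (auto simp: C_X0_def)
  finally show ?thesis by (simp add: atkin_lehner_def W_def)
qed

end

theory Submission
  imports Defs
begin

text \<open>
  The functions come from the eta quotients \<open>u = \<eta>(9z)\<^sup>3\<eta>(21z) / (\<eta>(3z)\<eta>(63z)\<^sup>3)\<close>,
  \<open>v = \<eta>(3z)\<eta>(7z)\<^sup>3 / (\<eta>(z)\<^sup>3\<eta>(21z))\<close> and \<open>x = \<eta>(7z)\<eta>(9z) / (\<eta>(z)\<eta>(63z))\<close> of level 63, which
  satisfy \<open>x\<^sup>3 = u v\<close>, \<open>w\<^sup>*u = 7v\<close> and \<open>w\<^sup>*x = x\<close>. One takes \<open>t = u - 7v\<close>, and defines \<open>y\<close> by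
  \<open>u + 7v = x\<^sup>3 - 3x\<^sup>2 + 1 - 3(x - 1)y\<close>. The equation of \<open>y\<close> is a polynomial relation between the
  eta quotients; it is holomorphic on \<open>X\<^sub>0(63)\<close> away from the two cusps \<open>\<infinity>\<close> and \<open>0\<close>, which \<open>w\<close>
  swaps, and has a pole of order at most 12 there, so it is enough to compare 13 coefficients. The
  equation of \<open>t\<close> follows from \<open>t\<^sup>2 = (u + 7v)\<^sup>2 - 28x\<^sup>3\<close>.

  The only poles of \<open>x\<close> are double poles at \<open>\<infinity>\<close> and \<open>0\<close>. A dimension count with orders of vanishing at
  these two cusps therefore shows that any five elements of \<open>\<complex>(X\<^sub>0(63))\<close> are linearly dependent over
  \<open>\<complex>(x)\<close>. Since \<open>1, y, t, yt\<close> are independent, they form a basis. If \<open>f\<close> has a rational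
  \<open>q\<close>-expansion, a \<open>\<rat>\<close>-linear functional \<open>\<complex> \<rightarrow> \<rat>\<close> applied to all coefficients of a dependence
  relation of \<open>1, y, t, yt, f\<close> turns it into one over \<open>\<rat>(x)\<close>.
\<close>

section \<open>Infinite products\<close>

text \<open>The transformation law of the Dedekind eta function and its multiplier never enter. What
  transforms is \<open>phi\<close>, a normalised theta function of u: it and its image under a
  matrix are entire in u with the same zeros and the same quasi-periods, so Liouville's theorem
  identifies them. Values of \<open>phi\<close> at division points of order 3 and 7 (Klein forms)
  are eta(3z)/eta(z)^3 and eta(7z)/eta(z)^7 up to constants.

  The Riemann surface X_0(63) is never built. What one usually reads off from its compactness comes
  from one criterion, \<open>modular_function_zero\<close>: an invariant holomorphic function
  vanishes if it tends to 0 at infinity and is bounded at the other cusps. Hence at the cusps other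
  than infinity and 0 only boundedness of u, v, x has to be known, not their orders, and all
  unwanted poles of other functions are removed by multiplying with polynomials in x.

  The number five comes from the two double poles of x: a combination of five functions with
  coefficients of degree n in x has about 5n free constants, against about 4n conditions at the two
  cusps.\<close>

lemma prodinf_holomorphic:
  fixes f :: "nat \<Rightarrow> complex \<Rightarrow> complex"
  assumes "open A" and hol: "\<And>n. f n holomorphic_on A"
    and bound: "\<And>K. compact K \<Longrightarrow> K \<subseteq> A \<Longrightarrow>
                  \<exists>M. summable M \<and> (\<forall>n. \<forall>x\<in>K. norm (f n x - 1) \<le> M n)"
  shows "(\<lambda>x. \<Prod>n. f n x) holomorphic_on A"
    and "\<And>K. compact K \<Longrightarrow> K \<subseteq> A \<Longrightarrow>
           uniform_limit K (\<lambda>N x. \<Prod>n<N. f n x) (\<lambda>x. \<Prod>n. f n x) sequentially"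
proof -
  show unif: "uniform_limit K (\<lambda>N x. \<Prod>n<N. f n x) (\<lambda>x. \<Prod>n. f n x) sequentially"
    if K: "compact K" "K \<subseteq> A" for K
  proof -
    obtain M where M: "summable M" "\<And>n x. x \<in> K \<Longrightarrow> norm (f n x - 1) \<le> M n"
      using bound[OF K] by blast
    have "uniformly_convergent_on K (\<lambda>N x. \<Sum>n<N. norm (f n x - 1))"
      by (rule Weierstrass_m_test') (use M in auto)
    hence "uniformly_convergent_on K (\<lambda>N x. \<Prod>n<N. f n x)"
      by (intro uniformly_convergent_on_prod' K(1))
         (use hol K(2) in \<open>auto intro: holomorphic_on_imp_continuous_on holomorphic_on_subset\<close>)
    then obtain g where g: "uniform_limit K (\<lambda>N x. \<Prod>n<N. f n x) g sequentially"
      by (auto simp: uniformly_convergent_on_def)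
    have "g x = (\<Prod>n. f n x)" if x: "x \<in> K" for x
    proof -
      have "summable (\<lambda>n. norm (f n x - 1))"
        by (rule summable_comparison_test'[OF M(1), of 0]) (use M(2) x in auto)
      hence "convergent_prod (\<lambda>n. f n x)"
        by (intro abs_convergent_prod_imp_convergent_prod summable_imp_abs_convergent_prod)
      hence "(\<lambda>N. \<Prod>n<N. f n x) \<longlonglongrightarrow> (\<Prod>n. f n x)"
        by (intro has_prod_imp_tendsto' convergent_prod_has_prod)
      moreover have "(\<lambda>N. \<Prod>n<N. f n x) \<longlonglongrightarrow> g x"
        using tendsto_uniform_limitI[OF g x] .
      ultimately show ?thesis by (rule LIMSEQ_unique[symmetric])
    qed
    thus ?thesis using g by (simp cong: uniform_limit_cong')
  qed
  show "(\<lambda>x. \<Prod>n. f n x) holomorphic_on A"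
  proof (rule holomorphic_uniform_sequence[OF \<open>open A\<close>])
    show "(\<lambda>x. \<Prod>n<N. f n x) holomorphic_on A" for N
      by (intro holomorphic_intros hol)
    fix x assume "x \<in> A"
    then obtain d where "d > 0" "cball x d \<subseteq> A"
      using \<open>open A\<close> open_contains_cball by blast
    thus "\<exists>d>0. cball x d \<subseteq> A \<and>
             uniform_limit (cball x d) (\<lambda>N x. \<Prod>n<N. f n x) (\<lambda>x. \<Prod>n. f n x) sequentially"
      using unif[of "cball x d"] by auto
  qed
qed

text \<open>The q-Pochhammer symbol (x; q)_\<infinity>. Two variables are kept because the theta
  function below is holomorphic in x for fixed q, while the eta quotients live in q.\<close>

definition qp :: "complex \<Rightarrow> complex \<Rightarrow> complex" where
  "qp x q = (\<Prod>n. 1 - x * q ^ n)"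

text \<open>This is q^(-1/24) times the eta function; the fractional power of q is left out so that
  the function is holomorphic on the disc.\<close>

definition euler_prod :: "complex \<Rightarrow> complex" where
  "euler_prod q = qp q q"

lemma qp_has_prod:
  assumes "norm q < 1"
  shows   "(\<lambda>n. 1 - x * q ^ n) has_prod qp x q"
proof -
  have "summable (\<lambda>n. norm ((1 - x * q ^ n) - 1))"
    using assms by (simp add: norm_mult norm_power summable_geometric summable_mult)
  hence "convergent_prod (\<lambda>n. 1 - x * q ^ n)"
    by (intro abs_convergent_prod_imp_convergent_prod summable_imp_abs_convergent_prod)
  thus ?thesis unfolding qp_def by (rule convergent_prod_has_prod)
qed

lemma qp_rec:
  assumes "norm q < 1"
  shows   "qp x q = (1 - x) * qp (x * q) q"
proof -
  have "(\<lambda>n. 1 - x * q ^ Suc n) has_prod qp (x * q) q"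
    using qp_has_prod[OF assms, of "x * q"] by (simp add: mult_ac)
  hence "(\<lambda>n. 1 - x * q ^ n) has_prod (qp (x * q) q * (1 - x * q ^ 0))"
    by (rule has_prod_Suc_imp)
  from has_prod_unique2[OF qp_has_prod[OF assms] this] show ?thesis
    by (simp add: mult.commute)
qed

lemma qp_eq_0_iff:
  assumes "norm q < 1"
  shows   "qp x q = 0 \<longleftrightarrow> (\<exists>n. x * q ^ n = 1)"
  using has_prod_eq_0_iff[OF qp_has_prod[OF assms], of x] by (auto simp: image_iff)

lemma qp_holomorphic:
  assumes "norm q < 1"
  shows   "(\<lambda>x. qp x q) holomorphic_on A"
proof -
  have "(\<lambda>x. qp x q) holomorphic_on UNIV"
    unfolding qp_def
  proof (rule prodinf_holomorphic)
    fix K :: "complex set" assume "compact K"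
    then obtain B where B: "\<And>x. x \<in> K \<Longrightarrow> norm x \<le> B"
      using compact_imp_bounded bounded_iff by metis
    show "\<exists>M. summable M \<and> (\<forall>n. \<forall>x\<in>K. norm (1 - x * q ^ n - 1) \<le> M n)"
      by (rule exI[of _ "\<lambda>n. B * norm q ^ n"])
         (use assms B in \<open>auto intro!: summable_mult summable_geometric mult_right_mono
            simp: norm_mult norm_power\<close>)
  qed (auto intro!: holomorphic_intros)
  thus ?thesis by (rule holomorphic_on_subset) auto
qed

text \<open>On a compact subset |q| is at most some r < 1, and r^(n+1) is the majorant. The uniform
  limit is recorded because integrality of the Taylor coefficients is later read off from the
  partial products.\<close>

lemma euler_prod_holomorphic:
  shows "euler_prod holomorphic_on ball 0 1"
    and "\<And>K. compact K \<Longrightarrow> K \<subseteq> ball 0 1 \<Longrightarrow>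
           uniform_limit K (\<lambda>N q. \<Prod>n<N. 1 - q ^ Suc n) euler_prod sequentially"
proof -
  have eq: "euler_prod = (\<lambda>q. \<Prod>n. 1 - q ^ Suc n)"
    by (simp add: euler_prod_def qp_def fun_eq_iff)
  have bound: "\<exists>M. summable M \<and> (\<forall>n. \<forall>x\<in>K. norm (1 - x ^ Suc n - 1) \<le> M n)"
    if K: "compact K" "K \<subseteq> ball 0 1" for K :: "complex set"
  proof -
    have "\<exists>r<1. r \<ge> 0 \<and> (\<forall>x\<in>K. norm x \<le> r)"
    proof (cases "K = {}")
      case False
      have "continuous_on K norm" by (intro continuous_intros)
      then obtain x where "x \<in> K" "\<forall>y\<in>K. norm y \<le> norm x"
        using continuous_attains_sup[OF K(1) False] by blast
      thus ?thesis using K(2) by (intro exI[of _ "norm x"]) auto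
    qed (auto intro: exI[of _ 0])
    then obtain r where r: "r < 1" "r \<ge> 0" "\<And>x. x \<in> K \<Longrightarrow> norm x \<le> r" by blast
    have "norm (1 - x ^ Suc n - 1) \<le> r ^ Suc n" if "x \<in> K" for x n
      using power_mono[OF r(3)[OF that], of "Suc n"] by (simp add: norm_mult norm_power)
    moreover have "summable (\<lambda>n. r ^ Suc n)"
      using r by (simp only: summable_Suc_iff) (auto intro: summable_geometric)
    ultimately show ?thesis by blast
  qed
  show "euler_prod holomorphic_on ball 0 1"
    unfolding eq by (rule prodinf_holomorphic(1)) (use bound in \<open>auto intro!: holomorphic_intros\<close>)
  show "uniform_limit K (\<lambda>N q. \<Prod>n<N. 1 - q ^ Suc n) euler_prod sequentially"
    if "compact K" "K \<subseteq> ball 0 1" for K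
    unfolding eq by (rule prodinf_holomorphic(2)[of "ball 0 1"])
      (use that bound in \<open>auto intro!: holomorphic_intros\<close>)
qed

lemma euler_prod_nonzero: "norm q < 1 \<Longrightarrow> euler_prod q \<noteq> 0"
proof
  assume q: "norm q < 1" "euler_prod q = 0"
  then obtain n where n: "q * q ^ n = 1"
    by (auto simp: euler_prod_def qp_eq_0_iff)
  have "norm (q ^ Suc n) < 1"
    using q(1) power_Suc_less_one[of "norm q" n] by (cases "q = 0") (auto simp: norm_power norm_mult)
  thus False using n by simp
qed

text \<open>Expanding a partial product, its distance to 1 is at most the same expression in
  absolute values, hence at most the exponential of a geometric series minus 1. This explicit bound
  feeds both the size estimates near the cusps and the truncation at q^13.\<close>

lemma norm_qp_minus_1:
  assumes "norm q < 1"
  shows   "norm (qp x q - 1) \<le> exp (norm x / (1 - norm q)) - 1"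
proof (rule tendsto_upperbound)
  show "(\<lambda>N. norm ((\<Prod>n<N. 1 + - (x * q ^ n)) - 1)) \<longlonglongrightarrow> norm (qp x q - 1)"
    using has_prod_imp_tendsto'[OF qp_has_prod[OF assms, of x]] by (auto intro!: tendsto_intros)
  have "norm ((\<Prod>n<N. 1 + - (x * q ^ n)) - 1) \<le> exp (norm x / (1 - norm q)) - 1" for N
  proof -
    have "norm ((\<Prod>n<N. 1 + - (x * q ^ n)) - 1) \<le> (\<Prod>n<N. 1 + norm (- (x * q ^ n))) - 1"
      by (rule norm_prod_minus1_le_prod_minus1)
    also have "(\<Prod>n<N. 1 + norm (- (x * q ^ n))) \<le> exp (\<Sum>n<N. norm (- (x * q ^ n)))"
      by (rule prod_le_exp_sum) auto
    also have "(\<Sum>n<N. norm (- (x * q ^ n))) = norm x * (\<Sum>n<N. norm q ^ n)"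
      by (simp add: norm_mult norm_power sum_distrib_left)
    also have "\<dots> \<le> norm x * (1 / (1 - norm q))"
      using assms by (intro mult_left_mono) (auto simp: sum_gp_strict divide_right_mono)
    finally show ?thesis by simp
  qed
  thus "eventually (\<lambda>N. norm ((\<Prod>n<N. 1 + - (x * q ^ n)) - 1) \<le> exp (norm x / (1 - norm q)) - 1) sequentially"
    by simp
qed auto

text \<open>The n-th factors for all j < N multiply to 1 - (x q^n)^N by the factorisation assumed
  for \<zeta>, and these are the factors of a product of the same kind in q^N.\<close>

lemma prod_qp_root_of_unity:
  assumes "norm q < 1" and \<zeta>: "\<And>y. (\<Prod>j<N. 1 - \<zeta> ^ j * y) = 1 - y ^ N" and "N > 0"
  shows   "(\<Prod>j<N. qp (\<zeta> ^ j * x) q) = qp (x ^ N) (q ^ N)"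
proof -
  have "(\<lambda>n. \<Prod>j<N. 1 - (\<zeta> ^ j * x) * q ^ n) has_prod (\<Prod>j<N. qp (\<zeta> ^ j * x) q)"
    by (intro has_prod_prod qp_has_prod assms)
  also have "(\<lambda>n. \<Prod>j<N. 1 - (\<zeta> ^ j * x) * q ^ n) = (\<lambda>n. 1 - x ^ N * (q ^ N) ^ n)"
  proof
    fix n
    have "(\<Prod>j<N. 1 - (\<zeta> ^ j * x) * q ^ n) = (\<Prod>j<N. 1 - \<zeta> ^ j * (x * q ^ n))"
      by (simp only: mult.assoc)
    also have "\<dots> = 1 - (x * q ^ n) ^ N"
      by (rule \<zeta>)
    also have "(x * q ^ n) ^ N = x ^ N * (q ^ N) ^ n"
      by (simp only: power_mult_distrib power_mult[symmetric] mult.commute[of n])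
    finally show "(\<Prod>j<N. 1 - (\<zeta> ^ j * x) * q ^ n) = 1 - x ^ N * (q ^ N) ^ n" .
  qed
  finally have "(\<lambda>n. 1 - x ^ N * (q ^ N) ^ n) has_prod (\<Prod>j<N. qp (\<zeta> ^ j * x) q)" .
  moreover have "norm (q ^ N) < 1"
    using assms by (simp add: norm_power power_less_one_iff)
  ultimately show ?thesis using has_prod_unique2[OF _ qp_has_prod] by blast
qed

text \<open>The exponents are sorted by their residue modulo N. Taking M full periods of length N
  gives a subsequence of the partial products of \<open>qp x q\<close>, so no infinite product has
  to be rearranged.\<close>

lemma prod_qp_multisection:
  assumes "norm q < 1" "N > 0"
  shows   "(\<Prod>j<N. qp (x * q ^ j) (q ^ N)) = qp x q"
proof -
  have qN: "norm (q ^ N) < 1"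
    using assms by (simp add: norm_power power_less_one_iff)
  have "(\<lambda>n. \<Prod>j<N. 1 - (x * q ^ j) * (q ^ N) ^ n) has_prod (\<Prod>j<N. qp (x * q ^ j) (q ^ N))"
    by (intro has_prod_prod qp_has_prod qN)
  hence "(\<lambda>M. \<Prod>n<M. \<Prod>j<N. 1 - (x * q ^ j) * (q ^ N) ^ n) \<longlonglongrightarrow> (\<Prod>j<N. qp (x * q ^ j) (q ^ N))"
    by (rule has_prod_imp_tendsto')
  also have "(\<lambda>M. \<Prod>n<M. \<Prod>j<N. 1 - (x * q ^ j) * (q ^ N) ^ n) = (\<lambda>M. \<Prod>n<M * N. 1 - x * q ^ n)"
  proof
    fix M
    show "(\<Prod>n<M. \<Prod>j<N. 1 - (x * q ^ j) * (q ^ N) ^ n) = (\<Prod>n<M * N. 1 - x * q ^ n)"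
    proof (induction M)
      case (Suc M)
      have "(\<Prod>n<Suc M * N. 1 - x * q ^ n) =
            (\<Prod>n<M * N. 1 - x * q ^ n) * (\<Prod>n\<in>{M * N..<M * N + N}. 1 - x * q ^ n)"
        by (subst prod.union_disjoint[symmetric]) (auto intro!: prod.cong)
      also have "(\<Prod>n\<in>{M * N..<M * N + N}. 1 - x * q ^ n) = (\<Prod>j<N. 1 - x * q ^ (j + M * N))"
        using prod.shift_bounds_nat_ivl[of "\<lambda>n. 1 - x * q ^ n" 0 "M * N" N]
        by (simp add: atLeast0LessThan add.commute)
      also have "\<dots> = (\<Prod>j<N. 1 - (x * q ^ j) * (q ^ N) ^ M)"
        by (simp add: power_add mult_ac flip: power_mult)
      finally show ?case using Suc.IH by simp
    qed auto
  qed
  finally have "(\<lambda>M. \<Prod>n<M * N. 1 - x * q ^ n) \<longlonglongrightarrow> (\<Prod>j<N. qp (x * q ^ j) (q ^ N))" .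
  moreover have "(\<lambda>M. \<Prod>n<M * N. 1 - x * q ^ n) \<longlonglongrightarrow> qp x q"
    using LIMSEQ_subseq_LIMSEQ[OF has_prod_imp_tendsto'[OF qp_has_prod[OF assms(1), of x]], of "\<lambda>M. M * N"] assms(2)
    by (simp add: o_def strict_mono_def)
  ultimately show ?thesis using LIMSEQ_unique by blast
qed

section \<open>The prime form and its modular transformation law\<close>

definition ex :: "complex \<Rightarrow> complex" where
  "ex z = exp (2 * of_real pi * \<i> * z)"

lemma ex_add: "ex (x + y) = ex x * ex y"
  by (simp add: ex_def exp_add algebra_simps)

lemma ex_0 [simp]: "ex 0 = 1"
  by (simp add: ex_def)

lemma ex_nonzero [simp]: "ex z \<noteq> 0"
  by (simp add: ex_def)

lemma ex_minus: "ex (- x) = inverse (ex x)"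
  by (simp add: ex_def exp_minus)

lemma ex_diff: "ex (x - y) = ex x / ex y"
  by (simp add: ex_def exp_diff algebra_simps)

lemma ex_power: "ex z ^ n = ex (of_nat n * z)"
  by (simp add: ex_def exp_of_nat_mult[symmetric] algebra_simps)

lemma ex_eq_1_iff: "ex z = 1 \<longleftrightarrow> (\<exists>n::int. z = of_int n)"
proof -
  have "ex z = 1 \<longleftrightarrow> Im z = 0 \<and> (\<exists>n::int. 2 * pi * Re z = of_int (2 * n) * pi)"
    by (simp add: ex_def exp_eq_1)
  also have "\<dots> \<longleftrightarrow> (\<exists>n::int. z = of_int n)"
    by (auto simp: complex_eq_iff)
  finally show ?thesis .
qed

lemma ex_of_int [simp]: "ex (of_int n) = 1"
  by (subst ex_eq_1_iff) auto

lemma ex_of_nat [simp]: "ex (of_nat n) = 1"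
  using ex_of_int[of "int n"] by simp

lemma ex_1 [simp]: "ex 1 = 1"
  using ex_of_int[of 1] by simp

lemma ex_half [simp]: "ex (1 / 2) = -1"
  by (simp add: ex_def)

lemma norm_ex: "norm (ex z) = exp (- 2 * pi * Im z)"
  by (simp add: ex_def norm_exp_eq_Re)

lemma norm_ex_less_1: "z \<in> uhp \<Longrightarrow> norm (ex z) < 1"
  by (simp add: norm_ex uhp_def)

lemma ex_holomorphic [holomorphic_intros]:
  "f holomorphic_on A \<Longrightarrow> (\<lambda>z. ex (f z)) holomorphic_on A"
  unfolding ex_def by (intro holomorphic_intros)

lemma ex_eq_iff: "ex x = ex y \<longleftrightarrow> (\<exists>n::int. x = y + of_int n)"
proof -
  have "ex x = ex y \<longleftrightarrow> ex (x - y) = 1"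
    by (simp add: ex_diff)
  thus ?thesis by (simp add: ex_eq_1_iff algebra_simps)
qed

text \<open>This is 2 pi i theta_1(u) / theta_1'(0) for the lattice Z + Z \<tau>, the prime form of
  the elliptic curve. Dividing by the square of \<open>euler_prod\<close> makes the derivative at u
  = 0 equal to 2 pi i for every \<tau>.\<close>

definition phi :: "complex \<Rightarrow> complex \<Rightarrow> complex" where
  "phi u \<tau> = (ex (u / 2) - ex (- u / 2)) *
     (qp (ex (\<tau> + u)) (ex \<tau>) * qp (ex (\<tau> - u)) (ex \<tau>) / euler_prod (ex \<tau>) ^ 2)"

lemma phi_minus: "phi (- u) \<tau> = - phi u \<tau>"
  by (simp add: phi_def algebra_simps diff_divide_distrib)

lemma phi_plus_1: "phi (u + 1) \<tau> = - phi u \<tau>"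
proof -
  have "ex ((u + 1) / 2) = - ex (u / 2)" "ex (- (u + 1) / 2) = - ex (- u / 2)"
    using ex_add[of "u / 2" "1 / 2"] ex_diff[of "- u / 2" "1 / 2"]
    by (simp_all add: add_divide_distrib diff_divide_distrib)
  moreover have "ex (\<tau> + (u + 1)) = ex (\<tau> + u)" "ex (\<tau> - (u + 1)) = ex (\<tau> - u)"
    by (simp_all add: ex_add ex_diff)
  ultimately show ?thesis by (simp only: phi_def) (simp add: algebra_simps diff_divide_distrib)
qed

text \<open>Adding \<tau> to u shifts the argument of one product by q and that of the other by 1/q.
  \<open>qp_rec\<close> exposes the factor gained or lost on each side; with the prefactor they
  combine to the exponential.\<close>

lemma phi_plus_tau:
  assumes "\<tau> \<in> uhp"
  shows   "phi (u + \<tau>) \<tau> = - ex (- u - \<tau> / 2) * phi u \<tau>"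
proof -
  define A B where "A = ex (u / 2)" and "B = ex (\<tau> / 2)"
  have nz: "A \<noteq> 0" "B \<noteq> 0" by (simp_all add: A_def B_def)
  have ex_u: "ex u = A ^ 2" and ex_t: "ex \<tau> = B ^ 2"
    by (simp_all add: A_def B_def ex_power)
  define P Q where "P = qp (ex (2 * \<tau> + u)) (ex \<tau>)" and "Q = qp (ex (\<tau> - u)) (ex \<tau>)"
  have q: "norm (ex \<tau>) < 1" by (rule norm_ex_less_1[OF assms])
  have 1: "qp (ex (\<tau> + u)) (ex \<tau>) = (1 - A ^ 2 * B ^ 2) * P"
    unfolding P_def by (subst qp_rec[OF q])
      (simp add: ex_add[symmetric] flip: ex_u ex_t, simp add: algebra_simps)
  have 2: "qp (ex (- u)) (ex \<tau>) = (1 - 1 / A ^ 2) * Q"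
    unfolding Q_def by (subst qp_rec[OF q])
      (simp add: ex_add[symmetric] flip: ex_u ex_t, simp add: ex_minus field_simps)
  have e: "ex ((u + \<tau>) / 2) = A * B" "ex (- (u + \<tau>) / 2) = 1 / (A * B)"
          "ex (- u - \<tau> / 2) = 1 / (A ^ 2 * B)" "ex (- u / 2) = 1 / A"
    using ex_diff[of "- u / 2" "\<tau> / 2"] ex_diff[of "- u" "\<tau> / 2"]
    by (simp_all add: add_divide_distrib diff_divide_distrib ex_add ex_minus ex_u
           flip: A_def B_def) (simp_all add: field_simps A_def ex_minus)
  have "phi (u + \<tau>) \<tau> = (A * B - 1 / (A * B)) * (P * ((1 - 1 / A ^ 2) * Q) / euler_prod (ex \<tau>) ^ 2)"
  proof -
    have "\<tau> + (u + \<tau>) = 2 * \<tau> + u" "\<tau> - (u + \<tau>) = - u" by simp_all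
    thus ?thesis by (simp only: phi_def e 2 P_def)
  qed
  also have "\<dots> = (A * B - 1 / (A * B)) * (1 - 1 / A ^ 2) * (P * Q / euler_prod (ex \<tau>) ^ 2)"
    by simp
  also have "(A * B - 1 / (A * B)) * (1 - 1 / A ^ 2) =
             - (1 / (A ^ 2 * B)) * (A - 1 / A) * (1 - A ^ 2 * B ^ 2)"
    using nz by (simp add: field_simps power2_eq_square)
  also have "\<dots> * (P * Q / euler_prod (ex \<tau>) ^ 2) = - ex (- u - \<tau> / 2) * phi u \<tau>"
    unfolding phi_def e 1 by (simp add: Q_def flip: A_def)
  finally show ?thesis .
qed

lemma phi_plus_int: "phi (u + of_int n) \<tau> = ex (of_int n / 2) * phi u \<tau>"
proof (induction n rule: int_induct[of _ 0])
  case (step1 n)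
  have "phi (u + of_int (n + 1)) \<tau> = - phi (u + of_int n) \<tau>"
    using phi_plus_1[of "u + of_int n" \<tau>] by (simp add: add_ac)
  thus ?case using step1 by (simp add: add_divide_distrib ex_add)
next
  case (step2 n)
  have "phi (u + of_int n) \<tau> = - phi (u + of_int (n - 1)) \<tau>"
    using phi_plus_1[of "u + of_int (n - 1)" \<tau>] by (simp add: add_ac)
  thus ?case using step2 by (simp add: diff_divide_distrib ex_diff)
qed auto

lemma phi_plus_int_tau:
  assumes "\<tau> \<in> uhp"
  shows "phi (u + of_int m * \<tau>) \<tau> =
           ex (of_int m / 2 - of_int m * u - of_int m ^ 2 * \<tau> / 2) * phi u \<tau>"
proof (induction m rule: int_induct[of _ 0])
  case (step1 m)
  have "phi (u + of_int (m + 1) * \<tau>) \<tau> = phi ((u + of_int m * \<tau>) + \<tau>) \<tau>"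
    by (simp add: algebra_simps)
  also have "\<dots> = ex (1 / 2) * ex (- (u + of_int m * \<tau>) - \<tau> / 2) * phi (u + of_int m * \<tau>) \<tau>"
    by (subst phi_plus_tau[OF assms]) simp
  also have "\<dots> = ex (1 / 2 + (- (u + of_int m * \<tau>) - \<tau> / 2) +
               (of_int m / 2 - of_int m * u - of_int m ^ 2 * \<tau> / 2)) * phi u \<tau>"
    unfolding step1.IH by (simp only: ex_add mult.assoc)
  also have "1 / 2 + (- (u + of_int m * \<tau>) - \<tau> / 2) + (of_int m / 2 - of_int m * u - of_int m ^ 2 * \<tau> / 2)
      = of_int (m + 1) / 2 - of_int (m + 1) * u - of_int (m + 1) ^ 2 * \<tau> / 2"
    by (simp add: field_simps power2_eq_square)
  finally show ?case .
next
  case (step2 m)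
  have "ex (of_int m / 2 - of_int m * u - of_int m ^ 2 * \<tau> / 2) * phi u \<tau> =
        phi ((u + of_int (m - 1) * \<tau>) + \<tau>) \<tau>"
    unfolding step2.IH[symmetric] by (simp add: algebra_simps)
  also have "\<dots> = ex (1 / 2) * ex (- (u + of_int (m - 1) * \<tau>) - \<tau> / 2) * phi (u + of_int (m - 1) * \<tau>) \<tau>"
    by (subst phi_plus_tau[OF assms]) simp
  finally have "phi (u + of_int (m - 1) * \<tau>) \<tau> =
      ex (- (1 / 2 + (- (u + of_int (m - 1) * \<tau>) - \<tau> / 2)) +
          (of_int m / 2 - of_int m * u - of_int m ^ 2 * \<tau> / 2)) * phi u \<tau>"
    unfolding ex_add ex_minus[of "1 / 2 + _"] by (simp add: field_simps ex_add)
  also have "- (1 / 2 + (- (u + of_int (m - 1) * \<tau>) - \<tau> / 2)) +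
          (of_int m / 2 - of_int m * u - of_int m ^ 2 * \<tau> / 2) =
        of_int (m - 1) / 2 - of_int (m - 1) * u - of_int (m - 1) ^ 2 * \<tau> / 2"
    by (simp add: field_simps power2_eq_square)
  finally show ?case .
qed auto

lemma phi_quasi_periodic:
  assumes "\<tau> \<in> uhp"
  shows "phi (u + of_int m * \<tau> + of_int n) \<tau> =
           ex ((of_int m + of_int n) / 2 - of_int m * u - of_int m ^ 2 * \<tau> / 2) * phi u \<tau>"
  unfolding phi_plus_int phi_plus_int_tau[OF assms]
  by (simp add: ex_add ex_diff add_divide_distrib)

text \<open>The prefactor vanishes at the integers, and the two products at the lattice points with
  negative and positive \<tau>-coordinate. The converse is quasi-periodicity applied to u =
  0.\<close>

lemma phi_eq_0_iff:
  assumes "\<tau> \<in> uhp"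
  shows   "phi u \<tau> = 0 \<longleftrightarrow> (\<exists>m n :: int. u = of_int m * \<tau> + of_int n)"
proof
  assume "\<exists>m n :: int. u = of_int m * \<tau> + of_int n"
  then obtain m n :: int where "u = 0 + of_int m * \<tau> + of_int n" by auto
  thus "phi u \<tau> = 0" by (simp only: phi_quasi_periodic[OF assms]) (simp add: phi_def)
next
  have q: "norm (ex \<tau>) < 1" by (rule norm_ex_less_1[OF assms])
  assume "phi u \<tau> = 0"
  hence "ex (u / 2) = ex (- u / 2) \<or> qp (ex (\<tau> + u)) (ex \<tau>) = 0 \<or> qp (ex (\<tau> - u)) (ex \<tau>) = 0"
    using euler_prod_nonzero[OF q] by (auto simp: phi_def)
  thus "\<exists>m n :: int. u = of_int m * \<tau> + of_int n"
  proof (elim disjE)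
    assume "ex (u / 2) = ex (- u / 2)"
    then obtain n :: int where "u / 2 = - u / 2 + of_int n" unfolding ex_eq_iff by blast
    hence "u = of_int 0 * \<tau> + of_int n" by (simp add: field_simps)
    thus ?thesis by blast
  next
    assume "qp (ex (\<tau> + u)) (ex \<tau>) = 0"
    then obtain k n where "\<tau> + u + of_nat k * \<tau> = of_int n"
      by (auto simp: qp_eq_0_iff[OF q] ex_power ex_eq_1_iff simp flip: ex_add)
    hence "u = of_int (- int (Suc k)) * \<tau> + of_int n" by (simp add: algebra_simps)
    thus ?thesis by blast
  next
    assume "qp (ex (\<tau> - u)) (ex \<tau>) = 0"
    then obtain k n where "\<tau> - u + of_nat k * \<tau> = of_int n"
      by (auto simp: qp_eq_0_iff[OF q] ex_power ex_eq_1_iff simp flip: ex_add)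
    hence "u = of_int (int (Suc k)) * \<tau> + of_int (- n)" by (simp add: algebra_simps)
    thus ?thesis by blast
  qed
qed

lemma phi_holomorphic:
  assumes "\<tau> \<in> uhp"
  shows   "(\<lambda>u. phi u \<tau>) holomorphic_on A"
proof -
  have q: "norm (ex \<tau>) < 1" by (rule norm_ex_less_1[OF assms])
  have 1: "(\<lambda>u. qp (ex (f u)) (ex \<tau>)) holomorphic_on A" if "f holomorphic_on A" for f
    using holomorphic_on_compose[of "\<lambda>u. ex (f u)" A "\<lambda>x. qp x (ex \<tau>)"] qp_holomorphic[OF q] that
    by (auto simp: o_def intro!: holomorphic_intros)
  show ?thesis unfolding phi_def
    by (intro holomorphic_intros 1) (use euler_prod_nonzero[OF q] in auto)
qed

text \<open>This normalisation fixes the constant in the modular law: it is independent of \<tau>,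
  so the quotient in \<open>phi_modular\<close> tends to 1 at 0.\<close>

lemma phi_over_u_tendsto:
  assumes "\<tau> \<in> uhp"
  shows   "((\<lambda>u. phi u \<tau> / u) \<longlongrightarrow> 2 * of_real pi * \<i>) (at 0)"
proof -
  have q: "norm (ex \<tau>) < 1" by (rule norm_ex_less_1[OF assms])
  define h where "h = (\<lambda>u. qp (ex (\<tau> + u)) (ex \<tau>) * qp (ex (\<tau> - u)) (ex \<tau>) / euler_prod (ex \<tau>) ^ 2)"
  have 1: "(\<lambda>u. qp (ex (f u)) (ex \<tau>)) holomorphic_on UNIV" if "f holomorphic_on UNIV" for f
    using holomorphic_on_compose[of "\<lambda>u. ex (f u)" UNIV "\<lambda>x. qp x (ex \<tau>)"] qp_holomorphic[OF q] that
    by (auto simp: o_def intro!: holomorphic_intros)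
  have "h holomorphic_on UNIV"
    unfolding h_def by (intro holomorphic_intros 1) (use euler_prod_nonzero[OF q] in auto)
  hence "isCont h 0"
    using holomorphic_on_imp_continuous_on continuous_on_eq_continuous_at open_UNIV by blast
  hence h: "(h \<longlongrightarrow> 1) (at 0)"
    using euler_prod_nonzero[OF q] by (simp add: isCont_def h_def euler_prod_def power2_eq_square)
  have "((\<lambda>u. ex (u / 2) - ex (- u / 2)) has_field_derivative 2 * of_real pi * \<i>) (at 0)"
    unfolding ex_def by (auto intro!: derivative_eq_intros)
  hence "((\<lambda>u. (ex (u / 2) - ex (- u / 2)) / u) \<longlongrightarrow> 2 * of_real pi * \<i>) (at 0)"
    by (simp add: has_field_derivative_iff)
  from tendsto_mult[OF this h] show ?thesis
    by (simp add: phi_def h_def mult_ac)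
qed

text \<open>All values are already taken on the compact parallelogram spanned by the periods, so the
  function is bounded and Liouville's theorem applies. The real span of the periods is the form of
  nondegeneracy that reduces a point to that parallelogram.\<close>

lemma doubly_periodic_holomorphic_constant:
  fixes H :: "complex \<Rightarrow> complex"
  assumes "H holomorphic_on UNIV" "\<And>u. H (u + \<omega>\<^sub>1) = H u" "\<And>u. H (u + \<omega>\<^sub>2) = H u"
    and span: "\<And>u. \<exists>s t :: real. u = of_real s * \<omega>\<^sub>1 + of_real t * \<omega>\<^sub>2"
  shows "H u = H 0"
proof -
  have per1: "H (v + of_int n * \<omega>\<^sub>1) = H v" for v n
  proof (induction n rule: int_induct[of _ 0])
    case (step1 n) thus ?case using assms(2)[of "v + of_int n * \<omega>\<^sub>1"] by (simp add: algebra_simps)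
  next
    case (step2 n) thus ?case using assms(2)[of "v + of_int (n - 1) * \<omega>\<^sub>1"] by (simp add: algebra_simps)
  qed auto
  have per2: "H (v + of_int n * \<omega>\<^sub>2) = H v" for v n
  proof (induction n rule: int_induct[of _ 0])
    case (step1 n) thus ?case using assms(3)[of "v + of_int n * \<omega>\<^sub>2"] by (simp add: algebra_simps)
  next
    case (step2 n) thus ?case using assms(3)[of "v + of_int (n - 1) * \<omega>\<^sub>2"] by (simp add: algebra_simps)
  qed auto
  define K where "K = (\<lambda>(s, t). of_real s * \<omega>\<^sub>1 + of_real t * \<omega>\<^sub>2) ` ({0..1::real} \<times> {0..1::real})"
  have "compact K"
    unfolding K_def case_prod_unfold
    by (intro compact_continuous_image continuous_intros compact_Times compact_Icc)
  hence "compact (H ` K)"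
    using assms(1) by (intro compact_continuous_image)
      (auto intro: holomorphic_on_imp_continuous_on holomorphic_on_subset)
  moreover have "range H \<subseteq> H ` K"
  proof safe
    fix v
    obtain s t :: real where st: "v = of_real s * \<omega>\<^sub>1 + of_real t * \<omega>\<^sub>2" using span by blast
    define v' where "v' = of_real (frac s) * \<omega>\<^sub>1 + of_real (frac t) * \<omega>\<^sub>2"
    have "v = v' + of_int \<lfloor>s\<rfloor> * \<omega>\<^sub>1 + of_int \<lfloor>t\<rfloor> * \<omega>\<^sub>2"
      by (simp add: st v'_def frac_def algebra_simps)
    hence "H v = H v'" by (simp only: per1 per2)
    moreover have "v' \<in> K"
      unfolding K_def v'_def by (rule image_eqI[of _ _ "(frac s, frac t)"]) (auto simp: less_imp_le frac_lt_1)
    ultimately show "H v \<in> H ` K" by simp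
  qed
  ultimately have "bounded (range H)"
    using bounded_subset compact_imp_bounded by blast
  with Liouville_theorem[OF assms(1)] show ?thesis
    by (metis UNIV_I constant_on_def)
qed

definition mob :: "int \<Rightarrow> int \<Rightarrow> int \<Rightarrow> int \<Rightarrow> complex \<Rightarrow> complex" where
  "mob a b c d z = (of_int a * z + of_int b) / (of_int c * z + of_int d)"

lemma mob_denom_nonzero:
  assumes "a * d - b * c > 0" "z \<in> uhp"
  shows   "of_int c * z + of_int d \<noteq> (0 :: complex)"
proof
  assume "of_int c * z + of_int d = (0 :: complex)"
  hence "of_int c * Im z = 0" "of_int c * Re z + of_int d = 0"
    by (simp_all add: complex_eq_iff)
  with assms show False by (auto simp: uhp_def)
qed

lemma Im_mob: "Im (mob a b c d z) = of_int (a * d - b * c) * Im z / norm (of_int c * z + of_int d) ^ 2"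
  by (simp add: mob_def Im_divide cmod_power2 algebra_simps)

lemma mob_in_uhp: "a * d - b * c > 0 \<Longrightarrow> z \<in> uhp \<Longrightarrow> mob a b c d z \<in> uhp"
  using mob_denom_nonzero[of a d b c z] by (auto simp: Im_mob uhp_def intro!: mult_pos_pos divide_pos_pos)
    (metis of_int_less_iff of_int_mult)

text \<open>Put l = a \<tau> + b, so that j and l span the same lattice as 1 and \<tau>. As
  functions of u both sides vanish exactly on this lattice and have the same multipliers under u ->
  u + j and u -> u + l; the Gaussian factor on the right compensates the quadratic exponents of
  \<open>phi_quasi_periodic\<close>. The quotient is therefore entire and doubly periodic, hence
  constant.\<close>

theorem phi_modular:
  fixes a b c d :: int
  assumes "\<tau> \<in> uhp" and det: "a * d - b * c = 1"
  defines "j \<equiv> of_int c * \<tau> + of_int d"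
  shows   "j * phi (u / j) (mob a b c d \<tau>) = ex (of_int c * u ^ 2 / (2 * j)) * phi u \<tau>"
proof -
  define l where "l = of_int a * \<tau> + of_int b"
  define \<tau>' where "\<tau>' = mob a b c d \<tau>"
  have j0: "j \<noteq> 0" unfolding j_def by (rule mob_denom_nonzero[of a d b]) (use assms in auto)
  have \<tau>': "\<tau>' \<in> uhp" unfolding \<tau>'_def by (rule mob_in_uhp) (use assms in auto)
  have l: "l = j * \<tau>'" using j0 by (simp add: l_def j_def \<tau>'_def mob_def)
  have det': "of_int a * of_int d - of_int b * of_int c = (1 :: complex)"
    using det by (metis of_int_1 of_int_diff of_int_mult)
  have cl: "of_int c * l = of_int a * j - 1"
    using det' by (simp add: l_def j_def algebra_simps)
  have tau_eq: "of_int d * l - of_int b * j = \<tau>" "of_int a * j - of_int c * l = 1"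
  proof -
    have "of_int d * l - of_int b * j = (of_int a * of_int d - of_int b * of_int c) * \<tau>"
      by (simp add: l_def j_def algebra_simps)
    thus "of_int d * l - of_int b * j = \<tau>" by (simp add: det')
  qed (simp add: cl)
  define f where "f = (\<lambda>u. j * phi (u / j) \<tau>')"
  define g where "g = (\<lambda>u. ex (of_int c * u ^ 2 / (2 * j)) * phi u \<tau>)"
  have f0: "f u = 0 \<longleftrightarrow> (\<exists>m n :: int. u = of_int m * l + of_int n * j)" for u
    using j0 by (auto simp: f_def phi_eq_0_iff[OF \<tau>'] l field_simps)
  have g0: "g u = 0 \<longleftrightarrow> (\<exists>m n :: int. u = of_int m * l + of_int n * j)" for u
  proof -
    have "g u = 0 \<longleftrightarrow> (\<exists>m n :: int. u = of_int m * \<tau> + of_int n)"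
      by (simp add: g_def phi_eq_0_iff[OF assms(1)])
    also have "\<dots> \<longleftrightarrow> (\<exists>m n :: int. u = of_int m * l + of_int n * j)"
    proof safe
      fix m n :: int
      have "of_int m * \<tau> + of_int n = of_int m * (of_int d * l - of_int b * j) + of_int n * (of_int a * j - of_int c * l)"
        by (simp add: tau_eq)
      also have "\<dots> = of_int (m * d - n * c) * l + of_int (n * a - m * b) * j"
        by (simp add: algebra_simps)
      finally show "\<exists>m' n' :: int. of_int m * \<tau> + of_int n = of_int m' * l + of_int n' * j" by blast
    next
      fix m n :: int
      have "of_int m * l + of_int n * j = of_int (m * a + n * c) * \<tau> + of_int (m * b + n * d)"
        by (simp add: l_def j_def algebra_simps)
      thus "\<exists>m' n' :: int. of_int m * l + of_int n * j = of_int m' * \<tau> + of_int n'" by blast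
    qed
    finally show ?thesis .
  qed
  have fj: "f (u + j) = - f u" for u
    using phi_plus_1[of "u / j" \<tau>'] j0 by (simp add: f_def add_divide_distrib)
  have fl: "f (u + l) = - ex (- (u / j) - \<tau>' / 2) * f u" for u
    using phi_plus_tau[OF \<tau>', of "u / j"] j0 by (simp add: f_def add_divide_distrib l)
  \<comment> \<open>The constants left over in the multipliers of \<open>g\<close> are (-1)^(cd+c+d)
    and (-1)^(ab+a+b). Both are -1, since the entries of a row of a matrix of determinant 1 are not
    both even.\<close>
  have parity: "ex (of_int (k * m + k + m) / 2) = - 1" if "odd k \<or> odd m" for k m :: int
  proof -
    have "even (k * m + k + m - 1)" using that by auto
    then obtain r where "k * m + k + m - 1 = 2 * r" by (elim evenE)
    hence eq: "k * m + k + m = 2 * r + 1" by simp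
    have "of_int (k * m + k + m) / 2 = (of_int r + 1 / 2 :: complex)"
      unfolding eq by (simp add: field_simps)
    thus ?thesis by (simp only: ex_add ex_of_int ex_half) simp
  qed
  have "odd (a * d - b * c)" by (simp add: det)
  hence odd: "odd c \<or> odd d" "odd a \<or> odd b" by auto
  have gj: "g (u + j) = - g u" for u
  proof -
    have "g (u + j) = ex (of_int c * (u + j) ^ 2 / (2 * j)) *
            (ex ((of_int c + of_int d) / 2 - of_int c * u - of_int c ^ 2 * \<tau> / 2) * phi u \<tau>)"
      using phi_quasi_periodic[OF assms(1), of u c d] by (simp add: g_def j_def add.assoc)
    also have "\<dots> = ex (of_int c * (u + j) ^ 2 / (2 * j) +
            ((of_int c + of_int d) / 2 - of_int c * u - of_int c ^ 2 * \<tau> / 2)) * phi u \<tau>"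
      by (simp add: ex_add)
    also have "of_int c * (u + j) ^ 2 / (2 * j) + ((of_int c + of_int d) / 2 - of_int c * u - of_int c ^ 2 * \<tau> / 2)
        = of_int c * u ^ 2 / (2 * j) + of_int (c * d + c + d) / 2"
    proof -
      have "of_int c * (u + j) ^ 2 / (2 * j) = of_int c * u ^ 2 / (2 * j) + of_int c * u + of_int c * j / 2"
        using j0 by (simp add: field_simps power2_eq_square)
      moreover have "of_int c * j / 2 = of_int c ^ 2 * \<tau> / 2 + of_int (c * d) / 2"
        by (simp add: j_def field_simps power2_eq_square)
      ultimately show ?thesis by (simp add: add_divide_distrib)
    qed
    also have "ex \<dots> = - ex (of_int c * u ^ 2 / (2 * j))"
      by (subst ex_add, subst parity) (use odd in auto)
    finally show ?thesis by (simp add: g_def)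
  qed
  have gl: "g (u + l) = - ex (- (u / j) - \<tau>' / 2) * g u" for u
  proof -
    have "g (u + l) = ex (of_int c * (u + l) ^ 2 / (2 * j)) *
            (ex ((of_int a + of_int b) / 2 - of_int a * u - of_int a ^ 2 * \<tau> / 2) * phi u \<tau>)"
      using phi_quasi_periodic[OF assms(1), of u a b] by (simp add: g_def l_def add.assoc)
    also have "\<dots> = ex (of_int c * (u + l) ^ 2 / (2 * j) +
            ((of_int a + of_int b) / 2 - of_int a * u - of_int a ^ 2 * \<tau> / 2)) * phi u \<tau>"
      by (simp add: ex_add)
    also have "of_int c * (u + l) ^ 2 / (2 * j) + ((of_int a + of_int b) / 2 - of_int a * u - of_int a ^ 2 * \<tau> / 2)
        = of_int c * u ^ 2 / (2 * j) + (- (u / j) - \<tau>' / 2) + of_int (a * b + a + b) / 2"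
    proof -
      have "of_int c * (u + l) ^ 2 / (2 * j) = of_int c * u ^ 2 / (2 * j) + (of_int c * l) * u / j + (of_int c * l) * l / (2 * j)"
        using j0 by (simp add: field_simps power2_eq_square)
      also have "\<dots> = of_int c * u ^ 2 / (2 * j) + of_int a * u - u / j + of_int a * l / 2 - \<tau>' / 2"
        unfolding cl using j0 by (simp add: l field_simps)
      also have "of_int a * l / 2 = of_int a ^ 2 * \<tau> / 2 + of_int (a * b) / 2"
        by (simp add: l_def field_simps power2_eq_square)
      finally show ?thesis by (simp add: add_divide_distrib)
    qed
    also have "ex \<dots> = - (ex (of_int c * u ^ 2 / (2 * j)) * ex (- (u / j) - \<tau>' / 2))"
      by (subst ex_add, subst parity) (use odd in \<open>auto simp: ex_add ex_diff\<close>)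
    finally show ?thesis by (simp add: g_def)
  qed
  \<comment> \<open>\<open>f / g\<close> extends to an entire function with periods \<open>j\<close> and \<open>l\<close>.\<close>
  define H where "H = (\<lambda>u. if g u = 0 then 1 else f u / g u)"
  have Hj: "H (u + j) = H u" for u by (auto simp: H_def fj gj)
  have Hl: "H (u + l) = H u" for u by (auto simp: H_def fl gl)
  have hol_f: "f holomorphic_on A" for A
  proof -
    have "(\<lambda>u. u / j) holomorphic_on A"
      using j0 by (intro holomorphic_intros) auto
    hence "((\<lambda>u. phi u \<tau>') \<circ> (\<lambda>u. u / j)) holomorphic_on A"
      by (rule holomorphic_on_compose) (rule phi_holomorphic[OF \<tau>'])
    thus ?thesis unfolding f_def o_def by (intro holomorphic_intros)
  qed
  have hol_g: "g holomorphic_on A" for A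
    unfolding g_def by (intro holomorphic_intros phi_holomorphic[OF assms(1)]) (use j0 in auto)
  \<comment> \<open>Both functions behave like 2 pi i u at 0, so the value 1 given to
    \<open>H\<close> at the zeros removes the singularity. Only u = 0 has to be examined, because
    the periods carry it to every other lattice point.\<close>
  have lim: "(\<lambda>u. f u / g u) \<midarrow>0\<rightarrow> 1"
  proof -
    have "((\<lambda>u. u / j) \<longlongrightarrow> 0) (at 0)" using j0 by (auto intro!: tendsto_eq_intros)
    hence "filterlim (\<lambda>u. u / j) (at 0) (at 0)"
      by (rule filterlim_atI) (use j0 in \<open>auto simp: eventually_at_filter\<close>)
    from filterlim_compose[OF phi_over_u_tendsto[OF \<tau>'] this]
    have 1: "((\<lambda>u. phi (u / j) \<tau>' / (u / j)) \<longlongrightarrow> 2 * of_real pi * \<i>) (at 0)" .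
    have 2: "((\<lambda>u. ex (of_int c * u ^ 2 / (2 * j)) * (phi u \<tau> / u)) \<longlongrightarrow> 1 * (2 * of_real pi * \<i>)) (at 0)"
      unfolding ex_def by (intro tendsto_mult phi_over_u_tendsto[OF assms(1)]) (use j0 in \<open>auto intro!: tendsto_eq_intros\<close>)
    have "((\<lambda>u. (phi (u / j) \<tau>' / (u / j)) / (ex (of_int c * u ^ 2 / (2 * j)) * (phi u \<tau> / u))) \<longlongrightarrow> 1) (at 0)"
      using tendsto_divide[OF 1 2] by simp
    thus ?thesis
      by (rule Lim_transform_eventually)
         (use j0 in \<open>auto simp: eventually_at_filter f_def g_def divide_simps intro!: always_eventually\<close>)
  qed
  have nz: "eventually (\<lambda>u. g u \<noteq> 0) (at 0)"
  proof -
    have "eventually (\<lambda>u. f u / g u \<noteq> 0) (at 0)"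
      by (rule tendsto_imp_eventually_ne[OF lim]) auto
    thus ?thesis by eventually_elim auto
  qed
  have an0: "H analytic_on {0}"
  proof -
    obtain r where r: "r > 0" "\<And>u. u \<in> ball 0 r - {0} \<Longrightarrow> g u \<noteq> 0"
      using nz unfolding eventually_at by (auto simp: dist_commute)
    have eq: "H u = f u / g u" if "u \<in> ball 0 r - {0}" for u
      using r(2)[OF that] by (simp add: H_def)
    have "H holomorphic_on ball 0 r"
    proof (rule no_isolated_singularity'[of "{0}"])
      have "(\<lambda>u. f u / g u) holomorphic_on ball 0 r - {0}"
        by (intro holomorphic_intros hol_f hol_g) (use r(2) in auto)
      thus "H holomorphic_on ball 0 r - {0}"
        using eq by (metis (no_types, lifting) holomorphic_cong)
      fix z :: complex assume "z \<in> {0}"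
      moreover have "H \<midarrow>0\<rightarrow> 1"
      proof (rule Lim_transform_eventually[OF lim])
        show "eventually (\<lambda>u. f u / g u = H u) (at 0)"
          using nz by eventually_elim (auto simp: H_def)
      qed
      moreover have "H 0 = 1" by (simp add: H_def g_def phi_def)
      ultimately show "(H \<longlongrightarrow> H z) (at z within ball 0 r)"
        by (auto intro: tendsto_within_subset)
    qed auto
    thus ?thesis
      using r(1) unfolding analytic_at by (intro exI[of _ "ball 0 r"]) auto
  qed
  have "H analytic_on {v}" for v
  proof (cases "g v = 0")
    case False
    have "open (g -` (- {0}))"
      by (rule open_vimage) (use hol_g in \<open>auto intro: holomorphic_on_imp_continuous_on\<close>)
    moreover have "(\<lambda>u. f u / g u) holomorphic_on (g -` (- {0}))"
      by (intro holomorphic_intros hol_f hol_g) auto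
    hence "H holomorphic_on (g -` (- {0}))"
      by (rule holomorphic_transform) (auto simp: H_def)
    ultimately show ?thesis
      using False unfolding analytic_at by (intro exI[of _ "g -` (- {0})"]) auto
  next
    case True
    then obtain m n :: int where mn: "v = of_int m * l + of_int n * j" using g0 by blast
    have "H (u - v) = H u" for u
    proof -
      have 1: "H (w - of_int m * l) = H w" for w
      proof (induction m arbitrary: w rule: int_induct[of _ 0])
        case (step1 m) thus ?case using Hl[of "w - of_int (m + 1) * l"] by (simp add: algebra_simps)
      next
        case (step2 m) thus ?case using Hl[of "w - of_int m * l"] by (simp add: algebra_simps)
      qed auto
      have 2: "H (w - of_int n * j) = H w" for w
      proof (induction n arbitrary: w rule: int_induct[of _ 0])
        case (step1 m) thus ?case using Hj[of "w - of_int (m + 1) * j"] by (simp add: algebra_simps)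
      next
        case (step2 m) thus ?case using Hj[of "w - of_int m * j"] by (simp add: algebra_simps)
      qed auto
      show ?thesis using 1[of "u"] 2[of "u - of_int m * l"] by (simp add: mn algebra_simps)
    qed
    moreover have "(H \<circ> (\<lambda>u. u - v)) analytic_on {v}"
      by (rule analytic_on_compose) (use an0 in \<open>auto intro!: analytic_intros\<close>)
    ultimately show ?thesis by (simp add: o_def)
  qed
  hence "H holomorphic_on UNIV"
    by (meson analytic_on_analytic_at analytic_imp_holomorphic)
  hence "H u = H 0"
  proof (rule doubly_periodic_holomorphic_constant[OF _ Hj Hl])
    fix v :: complex
    define \<tau>i where "\<tau>i = Im \<tau>'"
    have "\<tau>i > 0" using \<tau>' by (simp add: uhp_def \<tau>i_def)
    define t where "t = Im (v / j) / \<tau>i"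
    define s where "s = Re (v / j) - t * Re \<tau>'"
    have "v / j = of_real s + of_real t * \<tau>'"
      using \<open>\<tau>i > 0\<close> by (auto simp: complex_eq_iff s_def t_def simp flip: \<tau>i_def)
    hence "v = of_real s * j + of_real t * l"
      using j0 by (simp add: l field_simps)
    thus "\<exists>s t :: real. v = of_real s * j + of_real t * l" by blast
  qed
  also have "H 0 = 1" by (simp add: H_def g_def phi_def)
  finally have "f u = g u"
    using f0[of u] g0[of u] by (auto simp: H_def split: if_splits)
  thus ?thesis by (simp add: f_def g_def \<tau>'_def)
qed

section \<open>Klein forms and eta quotients\<close>

text \<open>Up to a constant factor the classical Klein form, of weight -1. The exponential in front
  absorbs the Gaussian factor of \<open>phi_modular\<close>, so that a matrix simply acts on the row
  (r, s) from the right.\<close>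

definition klein :: "complex \<Rightarrow> complex \<Rightarrow> complex \<Rightarrow> complex" where
  "klein r s \<tau> = ex (r * (r * \<tau> + s) / 2) * phi (r * \<tau> + s) \<tau>"

text \<open>With u the argument belonging to the new row, r + c u = (r a + s c) j. By this identity
  the old prefactor and the Gaussian factor combine to the prefactor of the new row.\<close>

lemma klein_modular:
  assumes "\<tau> \<in> uhp" "a * d - b * c = 1"
  shows   "(of_int c * \<tau> + of_int d) * klein r s (mob a b c d \<tau>) =
             klein (r * of_int a + s * of_int c) (r * of_int b + s * of_int d) \<tau>"
proof -
  define j where "j = of_int c * \<tau> + of_int d"
  have j0: "j \<noteq> 0" unfolding j_def by (rule mob_denom_nonzero[of a d b]) (use assms in auto)
  define u where "u = (r * of_int a + s * of_int c) * \<tau> + (r * of_int b + s * of_int d)"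
  have det: "of_int a * of_int d - of_int b * of_int c = (1 :: complex)"
    using assms(2) by (metis of_int_1 of_int_diff of_int_mult)
  have uj: "r * mob a b c d \<tau> + s = u / j"
    using j0 by (simp add: mob_def u_def flip: j_def) (simp add: j_def field_simps)
  have "r + of_int c * u - (r * of_int a + s * of_int c) * j =
          r * (1 - (of_int a * of_int d - of_int b * of_int c))"
    by (simp add: u_def j_def algebra_simps)
  hence e: "r + of_int c * u = (r * of_int a + s * of_int c) * j" by (simp add: det)
  have "j * klein r s (mob a b c d \<tau>) = ex (r * (u / j) / 2) * (j * phi (u / j) (mob a b c d \<tau>))"
    by (simp add: klein_def uj)
  also have "\<dots> = ex (r * (u / j) / 2 + of_int c * u ^ 2 / (2 * j)) * phi u \<tau>"
    unfolding j_def phi_modular[OF assms] by (simp add: ex_add)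
  also have "r * (u / j) / 2 + of_int c * u ^ 2 / (2 * j) = (r + of_int c * u) * u / (2 * j)"
    using j0 by (simp add: field_simps power2_eq_square)
  also have "\<dots> = (r * of_int a + s * of_int c) * u / 2"
    unfolding e using j0 by (simp add: field_simps)
  finally show ?thesis by (simp add: klein_def u_def j_def)
qed

lemma klein_minus: "klein (- r) (- s) \<tau> = - klein r s \<tau>"
proof -
  have "- r * \<tau> + - s = - (r * \<tau> + s)" by simp
  thus ?thesis by (simp only: klein_def phi_minus) (simp add: algebra_simps)
qed

lemma klein_shift1:
  assumes "\<tau> \<in> uhp"
  shows   "klein (r + of_int m) s \<tau> = ex (of_int m * (1 - s) / 2) * klein r s \<tau>"
proof -
  have "klein (r + of_int m) s \<tau> =
          ex ((r + of_int m) * ((r + of_int m) * \<tau> + s) / 2) * phi ((r * \<tau> + s) + of_int m * \<tau>) \<tau>"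
    by (simp add: klein_def algebra_simps)
  also have "\<dots> = ex ((r + of_int m) * ((r + of_int m) * \<tau> + s) / 2 +
          (of_int m / 2 - of_int m * (r * \<tau> + s) - of_int m ^ 2 * \<tau> / 2)) * phi (r * \<tau> + s) \<tau>"
    unfolding phi_plus_int_tau[OF assms] by (simp add: ex_add)
  also have "(r + of_int m) * ((r + of_int m) * \<tau> + s) / 2 +
          (of_int m / 2 - of_int m * (r * \<tau> + s) - of_int m ^ 2 * \<tau> / 2) =
          of_int m * (1 - s) / 2 + r * (r * \<tau> + s) / 2"
    by (simp add: field_simps power2_eq_square)
  finally show ?thesis by (simp add: klein_def ex_add)
qed

lemma klein_shift2: "klein r (s + of_int n) \<tau> = ex (of_int n * (1 + r) / 2) * klein r s \<tau>"
proof -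
  have "klein r (s + of_int n) \<tau> =
          ex (r * (r * \<tau> + (s + of_int n)) / 2) * phi ((r * \<tau> + s) + of_int n) \<tau>"
    by (simp add: klein_def algebra_simps)
  also have "\<dots> = ex (r * (r * \<tau> + (s + of_int n)) / 2 + of_int n / 2) * phi (r * \<tau> + s) \<tau>"
    unfolding phi_plus_int by (simp add: ex_add)
  also have "r * (r * \<tau> + (s + of_int n)) / 2 + of_int n / 2 =
             of_int n * (1 + r) / 2 + r * (r * \<tau> + s) / 2"
    by (simp add: field_simps)
  finally show ?thesis by (simp add: klein_def ex_add)
qed

section \<open>Klein forms at the division points of order 3 and 7 as eta quotients\<close>

lemma prod_roots_of_unity:
  assumes "N > 0"
  shows   "(\<Prod>j<N. 1 - ex (1 / of_nat N) ^ j * y) = 1 - y ^ N"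
proof -
  define \<zeta> where "\<zeta> = ex (1 / of_nat N)"
  have inj: "inj_on (\<lambda>j. \<zeta> ^ j) {..<N}"
  proof (rule inj_onI)
    fix i j assume ij: "i \<in> {..<N}" "j \<in> {..<N}" "\<zeta> ^ i = \<zeta> ^ j"
    then obtain n :: int where "of_nat i / of_nat N = of_nat j / of_nat N + (of_int n :: complex)"
      by (auto simp: \<zeta>_def ex_power ex_eq_iff)
    hence "of_int (int i) = (of_int (int j + n * int N) :: complex)"
      using assms by (simp add: field_simps)
    hence "int i = int j + n * int N" by (simp only: of_int_eq_iff)
    hence "int i mod int N = int j mod int N" by simp
    thus "i = j" using ij by (simp add: zmod_int[symmetric])
  qed
  have root: "(\<zeta> ^ j) ^ N = 1" for j
    using assms by (simp add: \<zeta>_def ex_power)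
  \<comment> \<open>The difference of two monic polynomials of degree N has degree less than N but
    vanishes at the N distinct powers of \<zeta>, so it is zero.\<close>
  define p where "p = (\<Prod>j<N. [:- (\<zeta> ^ j), 1:]) - (monom 1 N - 1)"
  have deg: "degree (\<Prod>j<N. [:- (\<zeta> ^ j), 1:]) = N"
    by (subst degree_prod_eq_sum_degree) auto
  have "p = 0"
  proof (rule ccontr)
    assume "p \<noteq> 0"
    have "coeff (\<Prod>j<N. [:- (\<zeta> ^ j), 1:]) N = 1"
    proof -
      have "lead_coeff (\<Prod>j<N. [:- (\<zeta> ^ j), 1:]) = (\<Prod>j<N. lead_coeff [:- (\<zeta> ^ j), 1:])"
        by (rule lead_coeff_prod)
      thus ?thesis using deg by simp
    qed
    hence "coeff p N = 0" using assms by (simp add: p_def)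
    moreover have "degree p \<le> N"
      unfolding p_def by (intro degree_diff_le) (use deg in \<open>auto simp: degree_monom_le\<close>)
    ultimately have "degree p < N"
      using \<open>p \<noteq> 0\<close> by (metis le_neq_implies_less leading_coeff_0_iff)
    have "(\<lambda>j. \<zeta> ^ j) ` {..<N} \<subseteq> {x. poly p x = 0}"
      using root by (auto simp: p_def poly_prod poly_monom intro!: prod_zero)
    hence "card ((\<lambda>j. \<zeta> ^ j) ` {..<N}) \<le> card {x. poly p x = 0}"
      by (intro card_mono poly_roots_finite \<open>p \<noteq> 0\<close>)
    also have "\<dots> \<le> degree p" by (rule card_poly_roots_bound[OF \<open>p \<noteq> 0\<close>])
    finally show False using \<open>degree p < N\<close> inj by (simp add: card_image)
  qed
  have eq: "(\<Prod>j<N. x - \<zeta> ^ j) = x ^ N - 1" for x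
  proof -
    have "poly (\<Prod>j<N. [:- (\<zeta> ^ j), 1:]) x = poly (monom 1 N - 1) x"
      using \<open>p = 0\<close> by (simp add: p_def)
    thus ?thesis by (simp add: poly_prod poly_monom)
  qed
  show ?thesis
  proof (cases "y = 0")
    case False
    have "1 - y ^ N = y ^ N * ((1 / y) ^ N - 1)"
      using False by (simp add: field_simps)
    also have "\<dots> = (\<Prod>j<N. y * (1 / y - \<zeta> ^ j))"
      unfolding eq[symmetric] by (simp add: prod.distrib)
    also have "\<dots> = (\<Prod>j<N. 1 - \<zeta> ^ j * y)"
      using False by (intro prod.cong) (auto simp: field_simps)
    finally show ?thesis by (simp add: \<zeta>_def)
  qed (use assms in \<open>simp add: power_0_left\<close>)
qed

lemma lessThan_3: "{..<3::nat} = {0, 1, 2}" and lessThan_7: "{..<7::nat} = {0, 1, 2, 3, 4, 5, 6}"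
  by auto

lemma klein_zero_left:
  assumes "\<tau> \<in> uhp"
  shows "klein 0 s \<tau> = (ex (s / 2) - ex (- s / 2)) *
           (qp (ex s * ex \<tau>) (ex \<tau>) * qp (ex (- s) * ex \<tau>) (ex \<tau>) / euler_prod (ex \<tau>) ^ 2)"
  by (simp add: klein_def phi_def ex_add ex_diff ex_minus field_simps)

text \<open>Up to a constant, eta(3 \<tau>) / eta(\<tau>)^3.\<close>

definition T3 :: "complex \<Rightarrow> complex" where
  "T3 \<tau> = klein 0 (1 / 3) \<tau>"

text \<open>1, 2, 3 represent the units modulo 7 up to sign, so the product is, up to a constant,
  eta(7 \<tau>) / eta(\<tau>)^7.\<close>

definition T7 :: "complex \<Rightarrow> complex" where
  "T7 \<tau> = klein 0 (1 / 7) \<tau> * klein 0 (2 / 7) \<tau> * klein 0 (3 / 7) \<tau>"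

lemma ex_reflect: "ex (- z) = ex w" if "z + w = 1"
proof -
  have z: "z = 1 - w" using that by (simp add: eq_diff_eq)
  show ?thesis unfolding z by (simp add: ex_diff)
qed

text \<open>The values of \<open>qp\<close> at the three cube roots of unity multiply to the Euler
  product in q^3, and the trivial root contributes the Euler product in q itself.\<close>

lemma T3_product:
  assumes "\<tau> \<in> uhp"
  shows "T3 \<tau> = (ex (1 / 6) - ex (- (1 / 6))) * (euler_prod (ex \<tau> ^ 3) / euler_prod (ex \<tau>) ^ 3)"
proof -
  define q where "q = ex \<tau>"
  have q: "norm q < 1" unfolding q_def by (rule norm_ex_less_1[OF assms])
  have "euler_prod (q ^ 3) = (\<Prod>j<3. qp (ex (1 / of_nat 3) ^ j * q) q)"
    unfolding euler_prod_def by (rule prod_qp_root_of_unity[symmetric, OF q prod_roots_of_unity]) auto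
  hence "euler_prod (q ^ 3) = euler_prod q * (qp (ex (1 / 3) * q) q * qp (ex (2 / 3) * q) q)"
    by (simp add: lessThan_3 euler_prod_def ex_power)
  moreover have "ex (- (1 / 3)) = ex (2 / 3)" by (rule ex_reflect) simp
  ultimately show ?thesis
    using euler_prod_nonzero[OF q]
    by (simp add: T3_def klein_zero_left[OF assms] power3_eq_cube power2_eq_square flip: q_def)
qed

text \<open>Pairing s with 1 - s yields all six nontrivial seventh roots of unity. The constant
  stays anonymous because \<open>T7\<close> is used in quotients, where it cancels.\<close>

lemma T7_product:
  obtains C where "C \<noteq> 0"
    "\<And>\<tau>. \<tau> \<in> uhp \<Longrightarrow> T7 \<tau> = C * (euler_prod (ex \<tau> ^ 7) / euler_prod (ex \<tau>) ^ 7)"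
proof -
  define C where "C = (ex (1 / 7 / 2) - ex (- (1 / 7) / 2)) * (ex (2 / 7 / 2) - ex (- (2 / 7) / 2)) *
                       (ex (3 / 7 / 2) - ex (- (3 / 7) / 2))"
  have ne: "ex (of_int k / 7 / 2) - ex (- (of_int k / 7) / 2) \<noteq> 0" if "k \<in> {1, 2, 3}" for k :: int
  proof
    assume "ex (of_int k / 7 / 2) - ex (- (of_int k / 7) / 2) = 0"
    then obtain n :: int where "of_int k / 7 / 2 = - (of_int k / 7) / 2 + (of_int n :: complex)"
      by (auto simp: ex_eq_iff)
    hence "of_int k = (of_int (7 * n) :: complex)" by (simp add: field_simps)
    hence "k = 7 * n" by (simp only: of_int_eq_iff)
    thus False using that by auto presburger+
  qed
  show ?thesis
  proof (rule that[of C])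
    show "C \<noteq> 0" using ne[of 1] ne[of 2] ne[of 3] by (simp add: C_def)
    fix \<tau> :: complex assume \<tau>: "\<tau> \<in> uhp"
    define q where "q = ex \<tau>"
    have q: "norm q < 1" unfolding q_def by (rule norm_ex_less_1[OF \<tau>])
    have "euler_prod (q ^ 7) = (\<Prod>j<7. qp (ex (1 / of_nat 7) ^ j * q) q)"
      unfolding euler_prod_def by (rule prod_qp_root_of_unity[symmetric, OF q prod_roots_of_unity]) auto
    hence "euler_prod (q ^ 7) = euler_prod q *
       (qp (ex (1 / 7) * q) q * (qp (ex (2 / 7) * q) q * (qp (ex (3 / 7) * q) q *
       (qp (ex (4 / 7) * q) q * (qp (ex (5 / 7) * q) q * qp (ex (6 / 7) * q) q)))))"
      by (simp add: lessThan_7 euler_prod_def ex_power)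
    moreover define A1 A2 A3 A4 A5 A6 E where "A1 = qp (ex (1 / 7) * q) q" and "A2 = qp (ex (2 / 7) * q) q"
      and "A3 = qp (ex (3 / 7) * q) q" and "A4 = qp (ex (4 / 7) * q) q"
      and "A5 = qp (ex (5 / 7) * q) q" and "A6 = qp (ex (6 / 7) * q) q" and "E = euler_prod q"
    note A_defs = A1_def A2_def A3_def A4_def A5_def A6_def E_def
    ultimately have E7: "euler_prod (q ^ 7) = E * (A1 * (A2 * (A3 * (A4 * (A5 * A6)))))"
      by simp
    have refl: "ex (- (1 / 7)) = ex (6 / 7)" "ex (- (2 / 7)) = ex (5 / 7)" "ex (- (3 / 7)) = ex (4 / 7)"
      by (rule ex_reflect, simp)+
    have "E \<noteq> 0" unfolding E_def by (rule euler_prod_nonzero[OF q])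
    have "T7 \<tau> = C * ((A1 * A6 / E ^ 2) * (A2 * A5 / E ^ 2) * (A3 * A4 / E ^ 2))"
      unfolding T7_def klein_zero_left[OF \<tau>] C_def q_def[symmetric] refl A_defs[symmetric]
      by (simp add: mult_ac)
    also have "(A1 * A6 / E ^ 2) * (A2 * A5 / E ^ 2) * (A3 * A4 / E ^ 2) = euler_prod (q ^ 7) / E ^ 7"
      unfolding E7 using \<open>E \<noteq> 0\<close> by (simp add: field_simps eval_nat_numeral)
    finally show "T7 \<tau> = C * (euler_prod (ex \<tau> ^ 7) / euler_prod (ex \<tau>) ^ 7)"
      by (simp add: q_def E_def)
  qed
qed

text \<open>The expansion of the Klein forms that appear after z -> -1/z, in powers of w =
  e(\<tau>/N). The exponents in the two products are congruent to b and -b modulo N, so suitable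
  products over b rebuild the Euler product of w; the leading exponent b (b - N) / (2 N^2) is the
  source of the poles at the cusps.\<close>

lemma klein_zero_right:
  assumes "\<tau> \<in> uhp" "0 < b" "b < N"
  defines "w \<equiv> ex (\<tau> / of_nat N)"
  shows "klein (of_nat b / of_nat N) 0 \<tau> =
           - ex (of_nat b * (of_nat b - of_nat N) / (2 * of_nat N ^ 2) * \<tau>) *
           (qp (w ^ b) (w ^ N) * qp (w ^ (N - b)) (w ^ N) / euler_prod (w ^ N) ^ 2)"
proof -
  define r :: complex where "r = of_nat b / of_nat N"
  have N: "N > 0" using assms by simp
  have wN: "w ^ N = ex \<tau>" using N by (simp add: w_def ex_power)
  have wb: "w ^ b = ex (r * \<tau>)" by (simp add: w_def ex_power r_def)
  have wNb: "w ^ (N - b) = ex (\<tau> - r * \<tau>)"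
    using assms(2,3) N by (simp add: w_def ex_power r_def of_nat_diff field_simps)
  have q: "norm (ex \<tau>) < 1" by (rule norm_ex_less_1[OF assms(1)])
  define v where "v = r * \<tau>"
  have 1: "ex (v / 2) - ex (- v / 2) = - ex (- v / 2) * (1 - ex v)"
  proof -
    have "ex (- v / 2) * ex v = ex (v / 2)"
      by (simp flip: ex_add)
    thus ?thesis by (simp add: algebra_simps)
  qed
  have "klein r 0 \<tau> = ex (r * v / 2) * phi v \<tau>"
    by (simp add: klein_def v_def)
  also have "\<dots> = ex (r * v / 2) * (- ex (- v / 2)) *
     (((1 - ex v) * qp (ex v * ex \<tau>) (ex \<tau>)) * qp (ex (\<tau> - v)) (ex \<tau>) / euler_prod (ex \<tau>) ^ 2)"
    unfolding phi_def 1 by (simp add: ex_add mult_ac)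
  also have "(1 - ex v) * qp (ex v * ex \<tau>) (ex \<tau>) = qp (ex v) (ex \<tau>)"
    by (rule qp_rec[OF q, symmetric])
  also have "ex (r * v / 2) * (- ex (- v / 2)) = - ex (r * v / 2 + - v / 2)"
    by (simp only: ex_add mult_minus_right)
  also have "r * v / 2 + - v / 2 = of_nat b * (of_nat b - of_nat N) / (2 * of_nat N ^ 2) * \<tau>"
    using N by (simp add: r_def v_def field_simps power2_eq_square)
  finally show ?thesis by (simp add: r_def v_def wN wb wNb)
qed

lemma euler_prod_multisection:
  assumes "norm w < 1" "N > 0"
  shows   "(\<Prod>j<N. qp (w ^ Suc j) (w ^ N)) = euler_prod w"
  using prod_qp_multisection[OF assms, of w] by (simp add: euler_prod_def)

text \<open>The residues 1, 2 and 0 modulo 3 make up the Euler product of e(\<tau>/3). The leading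
  exponent is (1 - 3) / 18 = -1/9.\<close>

lemma klein_third_0:
  assumes "\<tau> \<in> uhp"
  shows "klein (1 / 3) 0 \<tau> = - ex (- \<tau> / 9) * (euler_prod (ex (\<tau> / 3)) / euler_prod (ex \<tau>) ^ 3)"
proof -
  define w where "w = ex (\<tau> / 3)"
  have w: "norm w < 1" unfolding w_def by (rule norm_ex_less_1) (use assms in \<open>auto simp: uhp_def\<close>)
  have w3: "w ^ 3 = ex \<tau>" by (simp add: w_def ex_power)
  have w3': "norm (ex \<tau>) < 1" by (rule norm_ex_less_1[OF assms])
  have 1: "euler_prod w = qp w (w ^ 3) * qp (w ^ 2) (w ^ 3) * euler_prod (w ^ 3)"
    using euler_prod_multisection[OF w, of 3] by (simp add: lessThan_3 euler_prod_def eval_nat_numeral mult_ac)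
  show ?thesis
  proof -
    define P C where "P = qp w (w ^ 3) * qp (w ^ 2) (w ^ 3)" and "C = euler_prod (w ^ 3)"
    have "C \<noteq> 0" using euler_prod_nonzero[OF w3'] by (simp add: C_def w3)
    have "klein (1 / 3) 0 \<tau> = - ex (- \<tau> / 9) * (P / C ^ 2)"
      using klein_zero_right[OF assms, of 1 3] by (simp add: P_def C_def flip: w_def)
    also have "P / C ^ 2 = euler_prod w / C ^ 3"
      unfolding 1 P_def[symmetric] C_def[symmetric] using \<open>C \<noteq> 0\<close>
      by (simp add: power3_eq_cube power2_eq_square)
    finally show ?thesis unfolding C_def w3 unfolding w_def .
  qed
qed

text \<open>The leading exponents -6/98, -10/98 and -12/98 add up to -2/7, and the six residues
  together with 0 rebuild the Euler product of e(\<tau>/7).\<close>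

lemma klein_seventh_0:
  assumes "\<tau> \<in> uhp"
  shows "klein (1 / 7) 0 \<tau> * klein (2 / 7) 0 \<tau> * klein (3 / 7) 0 \<tau> =
           - ex (- 2 * \<tau> / 7) * (euler_prod (ex (\<tau> / 7)) / euler_prod (ex \<tau>) ^ 7)"
proof -
  define w where "w = ex (\<tau> / 7)"
  have w: "norm w < 1" unfolding w_def by (rule norm_ex_less_1) (use assms in \<open>auto simp: uhp_def\<close>)
  have w7: "w ^ 7 = ex \<tau>" by (simp add: w_def ex_power)
  have w7': "euler_prod (ex \<tau>) \<noteq> 0" by (rule euler_prod_nonzero[OF norm_ex_less_1[OF assms]])
  have 1: "euler_prod w = qp w (w ^ 7) * qp (w ^ 2) (w ^ 7) * qp (w ^ 3) (w ^ 7) * qp (w ^ 4) (w ^ 7) *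
          qp (w ^ 5) (w ^ 7) * qp (w ^ 6) (w ^ 7) * euler_prod (w ^ 7)"
    using euler_prod_multisection[OF w, of 7] by (simp add: lessThan_7 euler_prod_def eval_nat_numeral mult_ac)
  have 2: "klein (1 / 7) 0 \<tau> = - ex (- 6 / 98 * \<tau>) * (qp w (w ^ 7) * qp (w ^ 6) (w ^ 7) / euler_prod (w ^ 7) ^ 2)"
          "klein (2 / 7) 0 \<tau> = - ex (- 10 / 98 * \<tau>) * (qp (w ^ 2) (w ^ 7) * qp (w ^ 5) (w ^ 7) / euler_prod (w ^ 7) ^ 2)"
          "klein (3 / 7) 0 \<tau> = - ex (- 12 / 98 * \<tau>) * (qp (w ^ 3) (w ^ 7) * qp (w ^ 4) (w ^ 7) / euler_prod (w ^ 7) ^ 2)"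
    using klein_zero_right[OF assms, of 1 7] klein_zero_right[OF assms, of 2 7] klein_zero_right[OF assms, of 3 7]
    by (simp_all flip: w_def)
  have 3: "ex (- 6 / 98 * \<tau>) * ex (- 10 / 98 * \<tau>) * ex (- 12 / 98 * \<tau>) = ex (- 2 * \<tau> / 7)"
    by (simp flip: ex_add)
  define A1 A2 A3 A4 A5 A6 C where "A1 = qp w (w ^ 7)" and "A2 = qp (w ^ 2) (w ^ 7)"
    and "A3 = qp (w ^ 3) (w ^ 7)" and "A4 = qp (w ^ 4) (w ^ 7)" and "A5 = qp (w ^ 5) (w ^ 7)"
    and "A6 = qp (w ^ 6) (w ^ 7)" and "C = euler_prod (w ^ 7)"
  note A_defs = A1_def A2_def A3_def A4_def A5_def A6_def C_def
  have "C \<noteq> 0" using w7' by (simp add: C_def w7)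
  hence "A1 * A6 / C ^ 2 * (A2 * A5 / C ^ 2) * (A3 * A4 / C ^ 2) = euler_prod w / C ^ 7"
    unfolding 1 A_defs[symmetric] by (simp add: field_simps eval_nat_numeral)
  hence "euler_prod (ex (\<tau> / 7)) / euler_prod (ex \<tau>) ^ 7 =
           A1 * A6 / C ^ 2 * (A2 * A5 / C ^ 2) * (A3 * A4 / C ^ 2)"
    by (simp only: C_def w7 flip: w_def)
  thus ?thesis unfolding 2 3[symmetric] A_defs[symmetric] by (simp add: mult_ac)
qed

text \<open>Up to sign d is 1 modulo 3. The absolute value of the factor is recorded because the
  lemma serves size estimates as well as invariance.\<close>

lemma klein_third_norm:
  assumes "\<not> 3 dvd (d::int)"
  obtains \<epsilon> where "norm \<epsilon> = 1" "\<And>\<tau>. \<tau> \<in> uhp \<Longrightarrow> klein 0 (of_int d / 3) \<tau> = \<epsilon> * T3 \<tau>"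
proof -
  define n where "n = d div 3"
  have "d = 3 * n + 1 \<or> d = 3 * n + 2" using assms unfolding n_def by presburger
  thus ?thesis
  proof
    assume n: "d = 3 * n + 1"
    show ?thesis
    proof (rule that[of "ex (of_int n / 2)"])
      have eq: "of_int d / 3 = (1 / 3 + of_int n :: complex)" by (simp add: n field_simps)
      show "klein 0 (of_int d / 3) \<tau> = ex (of_int n / 2) * T3 \<tau>" for \<tau>
        unfolding eq klein_shift2 T3_def by simp
    qed (simp add: norm_ex)
  next
    assume n: "d = 3 * n + 2"
    show ?thesis
    proof (rule that[of "- ex (of_int (n + 1) / 2)"])
      have eq: "of_int d / 3 = (- (1 / 3) + of_int (n + 1) :: complex)" by (simp add: n field_simps)
      show "klein 0 (of_int d / 3) \<tau> = - ex (of_int (n + 1) / 2) * T3 \<tau>" for \<tau>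
        unfolding eq klein_shift2 T3_def using klein_minus[of 0 "1 / 3" \<tau>] by simp
    qed (simp add: norm_ex)
  qed
qed

text \<open>Multiplication by d permutes the classes 1, 2, 3 modulo 7 up to sign, and changing a
  representative costs a nonzero factor. This is the reason for taking the product of three Klein
  forms.\<close>

lemma klein_sevenths:
  assumes "\<not> 7 dvd (d::int)"
  obtains \<epsilon> where "\<epsilon> \<noteq> 0"
    "\<And>\<tau>. \<tau> \<in> uhp \<Longrightarrow> klein 0 (of_int d / 7) \<tau> * klein 0 (2 * of_int d / 7) \<tau> * klein 0 (3 * of_int d / 7) \<tau> = \<epsilon> * T7 \<tau>"
proof -
  have shift: "klein 0 (s + of_int n) \<tau> = ex (of_int n / 2) * klein 0 s \<tau>" for s n \<tau>
    by (simp add: klein_shift2)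
  have refl: "klein 0 (1 - s) \<tau> = klein 0 s \<tau>" for s \<tau>
    using shift[of "- s" 1 \<tau>] klein_minus[of 0 s \<tau>] by simp
  have refl': "klein 0 (4 / 7) \<tau> = klein 0 (3 / 7) \<tau>" "klein 0 (6 / 7) \<tau> = klein 0 (1 / 7) \<tau>"
              "klein 0 (9 / 7) \<tau> = - klein 0 (2 / 7) \<tau>" for \<tau>
    using refl[of "3 / 7"] refl[of "1 / 7"] shift[of "2 / 7" 1 \<tau>] by simp_all
  have main: "\<exists>\<epsilon>. \<epsilon> \<noteq> 0 \<and> (\<forall>\<tau>. klein 0 (of_int d / 7) \<tau> * klein 0 (2 * of_int d / 7) \<tau> * klein 0 (3 * of_int d / 7) \<tau> = \<epsilon> * T7 \<tau>)"
    if d: "d mod 7 \<in> {1, 2, 3}" for d :: int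
  proof -
    define n e where "n = d div 7" and "e = d mod 7"
    have "d = 7 * n + e" by (simp add: n_def e_def)
    hence eq: "of_int d / 7 = (of_int e / 7 + of_int n :: complex)"
         "2 * of_int d / 7 = (2 * of_int e / 7 + of_int (2 * n) :: complex)"
         "3 * of_int d / 7 = (3 * of_int e / 7 + of_int (3 * n) :: complex)"
      by (simp_all add: field_simps)
    \<comment> \<open>For e = 3 the numerators are 3, 6 and 9 = 2 + 7; the shift by 7 in the last
      one produces the sign.\<close>
    have "klein 0 (of_int e / 7) \<tau> * klein 0 (2 * of_int e / 7) \<tau> * klein 0 (3 * of_int e / 7) \<tau> =
            (if e = 3 then -1 else 1) * T7 \<tau>" for \<tau>
      using d unfolding e_def[symmetric] by (auto simp: T7_def refl')
    thus ?thesis unfolding eq shift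
      by (intro exI[of _ "ex (of_int n / 2) * ex (of_int (2 * n) / 2) * ex (of_int (3 * n) / 2) * (if e = 3 then -1 else 1)"])
         (auto simp: mult_ac)
  qed
  have "d mod 7 \<in> {1, 2, 3} \<or> (- d) mod 7 \<in> {1, 2, 3}" using assms by auto presburger
  thus ?thesis
  proof
    assume "d mod 7 \<in> {1, 2, 3}"
    from main[OF this] show ?thesis using that by blast
  next
    assume "(- d) mod 7 \<in> {1, 2, 3}"
    from main[OF this] obtain \<epsilon> where \<epsilon>: "\<epsilon> \<noteq> 0"
      "\<And>\<tau>. klein 0 (of_int (- d) / 7) \<tau> * klein 0 (2 * of_int (- d) / 7) \<tau> * klein 0 (3 * of_int (- d) / 7) \<tau> = \<epsilon> * T7 \<tau>"
      by blast
    have neg: "klein 0 (- s) \<tau> = - klein 0 s \<tau>" for s \<tau>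
      using klein_minus[of 0 s \<tau>] by simp
    have "klein 0 (of_int d / 7) \<tau> * klein 0 (2 * of_int d / 7) \<tau> * klein 0 (3 * of_int d / 7) \<tau> = (- \<epsilon>) * T7 \<tau>"
      (is "?l = _") for \<tau>
    proof -
      have "- ?l = \<epsilon> * T7 \<tau>"
        using \<epsilon>(2)[of \<tau>] by (simp add: neg)
      thus ?thesis by (metis minus_minus mult_minus_left)
    qed
    thus ?thesis using \<epsilon>(1) by (intro that[of "- \<epsilon>"]) simp_all
  qed
qed

section \<open>The functions $u$, $v$ and $x$ of level 63\<close>

text \<open>\<open>QU\<close>, \<open>QV\<close> and \<open>QX\<close> are the eta quotients \<open>u\<close>, \<open>v\<close> and \<open>x\<close> without the leading power of \<open>q\<close>.\<close>

definition QU :: "complex \<Rightarrow> complex" where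
  "QU q = euler_prod (q ^ 21) * euler_prod (q ^ 9) ^ 3 / (euler_prod (q ^ 63) ^ 3 * euler_prod (q ^ 3))"

definition QV :: "complex \<Rightarrow> complex" where
  "QV q = euler_prod (q ^ 3) * euler_prod (q ^ 7) ^ 3 / (euler_prod q ^ 3 * euler_prod (q ^ 21))"

definition QX :: "complex \<Rightarrow> complex" where
  "QX q = euler_prod (q ^ 7) * euler_prod (q ^ 9) / (euler_prod q * euler_prod (q ^ 63))"

text \<open>The exponents 6, 0 and 2 come from the factors q^(1/24) of eta: (21 + 27 - 189 - 3)/24 =
  -6 for u, (3 + 21 - 3 - 21)/24 = 0 for v and (7 + 9 - 1 - 63)/24 = -2 for x.\<close>

definition fu :: "complex \<Rightarrow> complex" where "fu z = QU (ex z) / ex z ^ 6"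
definition fv :: "complex \<Rightarrow> complex" where "fv z = QV (ex z)"
definition fx :: "complex \<Rightarrow> complex" where "fx z = QX (ex z) / ex z ^ 2"

text \<open>\<open>u\<close> and \<open>v\<close> are quotients of products of Klein forms, but \<open>x\<close> is not. However \<open>x\<^sup>3 = u v\<close> and
  \<open>x\<^sup>8\<close>, the product of the following two functions, are, which determines how \<open>x\<close> transforms.\<close>

definition gX :: "complex \<Rightarrow> complex" where
  "gX z = euler_prod (ex z ^ 7) * euler_prod (ex z ^ 9) ^ 7 / (euler_prod (ex z) ^ 7 * euler_prod (ex z ^ 63))"

definition gX' :: "complex \<Rightarrow> complex" where
  "gX' z = euler_prod (ex z ^ 9) * euler_prod (ex z ^ 7) ^ 7 /
             (euler_prod (ex z ^ 63) ^ 7 * euler_prod (ex z) * ex z ^ 16)"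

section \<open>Holomorphy of the eta quotients and identities between their powers\<close>

lemma euler_prod_power_nonzero:
  assumes "norm q < 1" "n > 0" shows "euler_prod (q ^ n) \<noteq> 0"
  by (rule euler_prod_nonzero) (use assms in \<open>simp add: norm_power power_less_one_iff\<close>)

lemma euler_prod_power_holomorphic:
  assumes "n > 0" shows "(\<lambda>q. euler_prod (q ^ n)) holomorphic_on ball 0 1"
proof -
  have "(euler_prod \<circ> (\<lambda>q. q ^ n)) holomorphic_on ball 0 1"
    by (rule holomorphic_on_compose_gen[OF _ euler_prod_holomorphic(1)])
       (use assms in \<open>auto intro!: holomorphic_intros simp: norm_power power_less_one_iff\<close>)
  thus ?thesis by (simp add: o_def)
qed

lemma Q_holomorphic:
  "QU holomorphic_on ball 0 1" "QV holomorphic_on ball 0 1" "QX holomorphic_on ball 0 1"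
  unfolding QU_def QV_def QX_def
  by (intro holomorphic_intros euler_prod_power_holomorphic euler_prod_holomorphic(1);
      auto simp: euler_prod_power_nonzero euler_prod_nonzero)+

lemma Q_nonzero:
  assumes "norm q < 1" shows "QU q \<noteq> 0" "QV q \<noteq> 0" "QX q \<noteq> 0"
  using assms by (auto simp: QU_def QV_def QX_def euler_prod_power_nonzero euler_prod_nonzero)

lemma compose_ex_holomorphic:
  assumes "f holomorphic_on ball 0 1" shows "(\<lambda>z. f (ex z)) holomorphic_on uhp"
proof -
  have "(f \<circ> ex) holomorphic_on uhp"
    by (rule holomorphic_on_compose_gen[OF _ assms])
       (auto intro!: holomorphic_intros norm_ex_less_1)
  thus ?thesis by (simp add: o_def)
qed

lemma f_holomorphic: "fu holomorphic_on uhp" "fv holomorphic_on uhp" "fx holomorphic_on uhp"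
  unfolding fu_def fv_def fx_def
  by (intro holomorphic_intros compose_ex_holomorphic Q_holomorphic; simp)+

lemma fx_nonzero: "z \<in> uhp \<Longrightarrow> fx z \<noteq> 0"
  by (simp add: fx_def Q_nonzero norm_ex_less_1)

lemma fx_cube:
  assumes "z \<in> uhp" shows "fx z ^ 3 = fu z * fv z"
proof -
  define q where "q = ex z"
  have q: "norm q < 1" unfolding q_def by (rule norm_ex_less_1[OF assms])
  have "q \<noteq> 0" by (simp add: q_def)
  have nz: "euler_prod q \<noteq> 0" "euler_prod (q ^ 3) \<noteq> 0" "euler_prod (q ^ 21) \<noteq> 0" "euler_prod (q ^ 63) \<noteq> 0"
    by (simp_all add: euler_prod_power_nonzero euler_prod_nonzero q)
  have "QX q ^ 3 = QU q * QV q"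
    unfolding QX_def QU_def QV_def using nz
    by (simp add: divide_simps power_mult_distrib)
  thus ?thesis by (simp add: fx_def fu_def fv_def power_divide flip: q_def power_mult)
qed

lemma fx_eighth:
  assumes "z \<in> uhp" shows "fx z ^ 8 = gX z * gX' z"
proof -
  define A B C D where "A = euler_prod (ex z)" and "B = euler_prod (ex z ^ 7)"
    and "C = euler_prod (ex z ^ 9)" and "D = euler_prod (ex z ^ 63)"
  have "(B * C / (A * D)) ^ 8 = B * C ^ 7 / (A ^ 7 * D) * (C * B ^ 7 / (D ^ 7 * A))"
    by (simp add: power_divide power_mult_distrib mult_ac flip: power_Suc2 power_Suc)
       (simp add: eval_nat_numeral mult_ac)
  moreover have "fx z ^ 8 = (B * C / (A * D)) ^ 8 / ex z ^ 16"
    unfolding fx_def QX_def A_def B_def C_def D_def power_divide by (simp flip: power_mult)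
  moreover have "gX z * gX' z = B * C ^ 7 / (A ^ 7 * D) * (C * B ^ 7 / (D ^ 7 * A)) / ex z ^ 16"
    unfolding gX_def gX'_def A_def B_def C_def D_def by (simp add: mult.assoc)
  ultimately show ?thesis by (simp only:)
qed

section \<open>Invariance under Gamma0(63)\<close>

lemma uhp_mult_numeral: "z \<in> uhp \<Longrightarrow> numeral n * z \<in> uhp"
  by (auto simp: uhp_def)

lemma ex_numeral_mult: "ex (numeral n * z) = ex z ^ numeral n"
  by (simp add: ex_power)

lemma fv_T3:
  assumes "z \<in> uhp" shows "fv z = T3 z / T3 (7 * z)"
proof -
  define \<kappa> where "\<kappa> = ex (1 / 6) - ex (- (1 / 6))"
  have "\<kappa> \<noteq> 0"
  proof
    assume "\<kappa> = 0"
    then obtain n :: int where "1 / 6 = - (1 / 6) + (of_int n :: complex)"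
      by (auto simp: \<kappa>_def ex_eq_iff)
    hence "(of_int 1 :: complex) = of_int (3 * n)" by (simp add: field_simps)
    hence "1 = 3 * n" by (simp only: of_int_eq_iff)
    thus False by presburger
  qed
  define q where "q = ex z"
  have q: "norm q < 1" unfolding q_def by (rule norm_ex_less_1[OF assms])
  have nz: "euler_prod q \<noteq> 0" "euler_prod (q ^ 3) \<noteq> 0" "euler_prod (q ^ 7) \<noteq> 0" "euler_prod (q ^ 21) \<noteq> 0"
    by (simp_all add: euler_prod_power_nonzero euler_prod_nonzero q)
  show ?thesis
    unfolding T3_product[OF assms] T3_product[OF uhp_mult_numeral[OF assms]] ex_numeral_mult \<kappa>_def[symmetric]
    using \<open>\<kappa> \<noteq> 0\<close> nz by (simp add: fv_def QV_def flip: q_def power_mult)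
qed

lemma T_nonzero:
  assumes "z \<in> uhp" shows "T3 z \<noteq> 0" "T7 z \<noteq> 0"
proof -
  have ne: "klein 0 (of_int k / of_int N) z \<noteq> 0" if "\<not> N dvd k" "N > 0" for k N :: int
  proof
    assume "klein 0 (of_int k / of_int N) z = 0"
    then obtain m n :: int where mn: "of_int k / of_int N = of_int m * z + of_int n"
      using assms by (auto simp: klein_def phi_eq_0_iff)
    have "of_int k / of_int N = (of_real (of_int k / of_int N) :: complex)" by simp
    hence "m = 0" using mn assms by (auto simp: complex_eq_iff uhp_def)
    with that(2) have "of_int k = (of_int (N * n) :: complex)" using mn by (simp add: field_simps)
    hence "k = N * n" by (simp only: of_int_eq_iff)
    thus False using that by simp
  qed
  show "T3 z \<noteq> 0" using ne[of 3 1] by (simp add: T3_def)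
  show "T7 z \<noteq> 0" using ne[of 7 1] ne[of 7 2] ne[of 7 3] by (simp add: T7_def)
qed

lemma gX_T7:
  assumes "z \<in> uhp" shows "gX z = T7 z / T7 (9 * z)"
proof -
  obtain C where C: "C \<noteq> 0" "\<And>\<tau>. \<tau> \<in> uhp \<Longrightarrow> T7 \<tau> = C * (euler_prod (ex \<tau> ^ 7) / euler_prod (ex \<tau>) ^ 7)"
    by (rule T7_product) blast
  show ?thesis
    unfolding C(2)[OF assms] C(2)[OF uhp_mult_numeral[OF assms]] ex_numeral_mult
    using C(1) by (simp add: gX_def flip: power_mult)
qed

text \<open>Conjugation by the diagonal matrix with entries n and 1 keeps d and the automorphy
  factor. Hence numerator and denominator of a quotient like \<open>T3 z / T3 (7 * z)\<close>
  transform with the same weight factor.\<close>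

lemma mob_scale:
  assumes "n > 0" "n dvd c" "a * d - b * c = 1" "z \<in> uhp"
  shows "of_int n * mob a b c d z = mob a (n * b) (c div n) d (of_int n * z)"
    and "a * d - (n * b) * (c div n) = 1"
    and "of_int (c div n) * (of_int n * z) + of_int d = of_int c * z + (of_int d :: complex)"
proof -
  obtain k where k: "c = n * k" using assms(2) by blast
  show "of_int n * mob a b c d z = mob a (n * b) (c div n) d (of_int n * z)"
    using assms(1) by (simp add: mob_def k) (simp add: algebra_simps)
  show "a * d - (n * b) * (c div n) = 1" using assms(1,3) by (simp add: k mult_ac)
  show "of_int (c div n) * (of_int n * z) + of_int d = of_int c * z + (of_int d :: complex)"
    using assms(1) by (simp add: k)
qed

lemma T3_modular:
  assumes "\<tau> \<in> uhp" "a * d - b * c = 1"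
  shows   "(of_int c * \<tau> + of_int d) * T3 (mob a b c d \<tau>) = klein (of_int c / 3) (of_int d / 3) \<tau>"
  using klein_modular[OF assms, of 0 "1 / 3"] by (simp add: T3_def)

text \<open>Numerator and denominator acquire the same automorphy factor and the same \<epsilon>,
  which depends only on d. With c = 63 k, the first coordinates are shifted by 21 k and 3 k, and the
  two phases agree because 18 k (1 - d/3) / 2 = 9 k - 3 k d is an integer.\<close>

lemma fv_invariant:
  assumes "a * d - b * c = 1" "63 dvd c" "z \<in> uhp"
  shows   "fv (mob a b c d z) = fv z"
proof -
  obtain k where k: "c = 63 * k" using assms(2) by blast
  define j where "j = of_int c * z + (of_int d :: complex)"
  have j: "j \<noteq> 0" unfolding j_def by (rule mob_denom_nonzero[of a d b]) (use assms in auto)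
  have mz: "mob a b c d z \<in> uhp" by (rule mob_in_uhp) (use assms in auto)
  have z7: "7 * z \<in> uhp" by (rule uhp_mult_numeral[OF assms(3)])
  have 7: "7 * mob a b c d z = mob a (7 * b) (9 * k) d (7 * z)" "a * d - (7 * b) * (9 * k) = 1"
          "of_int (9 * k) * (7 * z) + of_int d = j"
    using mob_scale[of 7 c a d b z] assms by (simp_all add: k j_def)
  have "\<not> 3 dvd d"
  proof
    assume "3 dvd d"
    hence "3 dvd a * d - b * c" by (simp add: k)
    thus False using assms(1) by simp
  qed
  then obtain \<epsilon> where \<epsilon>: "norm \<epsilon> = 1" "\<And>\<tau>. \<tau> \<in> uhp \<Longrightarrow> klein 0 (of_int d / 3) \<tau> = \<epsilon> * T3 \<tau>"
    by (rule klein_third_norm) blast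
  have shift: "klein (of_int (3 * m) / 3) (of_int d / 3) \<tau> = ex (of_int m * (1 - of_int d / 3) / 2) * (\<epsilon> * T3 \<tau>)"
    if "\<tau> \<in> uhp" for \<tau> m
    using klein_shift1[OF that, of 0 m "of_int d / 3"] that by (simp add: \<epsilon>(2))
  have "j * T3 (mob a b c d z) = ex (of_int (21 * k) * (1 - of_int d / 3) / 2) * (\<epsilon> * T3 z)"
    using T3_modular[OF assms(3,1)] shift[OF assms(3), of "21 * k"] by (simp add: k j_def)
  moreover have "j * T3 (7 * mob a b c d z) = ex (of_int (3 * k) * (1 - of_int d / 3) / 2) * (\<epsilon> * T3 (7 * z))"
    using T3_modular[OF z7 7(2)] shift[OF z7, of "3 * k"] unfolding 7(1) 7(3) by simp
  moreover have "ex (of_int (21 * k) * (1 - of_int d / 3) / 2) = ex (of_int (3 * k) * (1 - of_int d / 3) / 2)"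
    unfolding ex_eq_iff by (rule exI[of _ "9 * k - 3 * k * d"]) (simp add: field_simps)
  ultimately have *: "T3 (mob a b c d z) = (ex (of_int (3 * k) * (1 - of_int d / 3) / 2) * \<epsilon> / j) * T3 z"
         "T3 (7 * mob a b c d z) = (ex (of_int (3 * k) * (1 - of_int d / 3) / 2) * \<epsilon> / j) * T3 (7 * z)"
    using j by (simp_all add: field_simps)
  have "\<epsilon> \<noteq> 0" using \<epsilon>(1) by auto
  show ?thesis unfolding fv_T3[OF mz] fv_T3[OF assms(3)] * using j \<open>\<epsilon> \<noteq> 0\<close> by simp
qed

lemma T7_modular:
  assumes "\<tau> \<in> uhp" "a * d - b * c = 1"
  shows   "(of_int c * \<tau> + of_int d) ^ 3 * T7 (mob a b c d \<tau>) =
             klein (of_int c / 7) (of_int d / 7) \<tau> * klein (2 * of_int c / 7) (2 * of_int d / 7) \<tau> *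
             klein (3 * of_int c / 7) (3 * of_int d / 7) \<tau>"
proof -
  define j where "j = of_int c * \<tau> + (of_int d :: complex)"
  define k where "k = (\<lambda>s. klein 0 s (mob a b c d \<tau>))"
  have K: "j * k s = klein (s * of_int c) (s * of_int d) \<tau>" for s
    using klein_modular[OF assms, of 0 s] by (simp add: j_def k_def)
  have "j ^ 3 * T7 (mob a b c d \<tau>) = (j * k (1 / 7)) * (j * k (2 / 7)) * (j * k (3 / 7))"
    unfolding T7_def k_def power3_eq_cube by (simp only: mult_ac)
  thus ?thesis unfolding K by (simp add: j_def)
qed

text \<open>The phases of the shifts by m, 2 m, 3 m add up to the integer 3 m - m d, because 1 + 4 +
  9 = 14. The factor \<epsilon> is passed in, since the same one has to be used at z and at 9
  z.\<close>

lemma T7_Gamma0: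
  assumes "\<tau> \<in> uhp" "a * d - b * (7 * m) = 1"
    and \<epsilon>: "klein 0 (of_int d / 7) \<tau> * klein 0 (2 * of_int d / 7) \<tau> * klein 0 (3 * of_int d / 7) \<tau> = \<epsilon> * T7 \<tau>"
  shows "(of_int (7 * m) * \<tau> + of_int d) ^ 3 * T7 (mob a b (7 * m) d \<tau>) = \<epsilon> * T7 \<tau>"
proof -
  have shift: "klein (of_int (n * m)) s \<tau> = ex (of_int (n * m) * (1 - s) / 2) * klein 0 s \<tau>" for n s
    using klein_shift1[OF assms(1), of 0 "n * m"] by simp
  have "(of_int (7 * m) * \<tau> + of_int d) ^ 3 * T7 (mob a b (7 * m) d \<tau>) =
          klein (of_int (1 * m)) (of_int d / 7) \<tau> * klein (of_int (2 * m)) (2 * of_int d / 7) \<tau> *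
          klein (of_int (3 * m)) (3 * of_int d / 7) \<tau>"
    unfolding T7_modular[OF assms(1,2)] by simp
  also have "\<dots> = ex (of_int (1 * m) * (1 - of_int d / 7) / 2) * ex (of_int (2 * m) * (1 - 2 * of_int d / 7) / 2) *
      ex (of_int (3 * m) * (1 - 3 * of_int d / 7) / 2) *
      (klein 0 (of_int d / 7) \<tau> * klein 0 (2 * of_int d / 7) \<tau> * klein 0 (3 * of_int d / 7) \<tau>)"
    unfolding shift by (simp only: mult_ac)
  also have "ex (of_int (1 * m) * (1 - of_int d / 7) / 2) * ex (of_int (2 * m) * (1 - 2 * of_int d / 7) / 2) *
      ex (of_int (3 * m) * (1 - 3 * of_int d / 7) / 2) = ex (of_int (3 * m - m * d))"
    unfolding ex_add[symmetric] by (rule arg_cong[of _ _ ex]) (simp add: field_simps)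
  also have "\<dots> = 1" by (rule ex_of_int)
  finally show ?thesis by (simp add: \<epsilon>)
qed

lemma gX_invariant:
  assumes "a * d - b * c = 1" "63 dvd c" "z \<in> uhp"
  shows   "gX (mob a b c d z) = gX z"
proof -
  obtain k where k: "c = 63 * k" using assms(2) by blast
  define j where "j = of_int c * z + (of_int d :: complex)"
  have j: "j \<noteq> 0" unfolding j_def by (rule mob_denom_nonzero[of a d b]) (use assms in auto)
  have mz: "mob a b c d z \<in> uhp" by (rule mob_in_uhp) (use assms in auto)
  have z9: "9 * z \<in> uhp" by (rule uhp_mult_numeral[OF assms(3)])
  have 9: "9 * mob a b c d z = mob a (9 * b) (7 * k) d (9 * z)" "a * d - (9 * b) * (7 * k) = 1"
          "of_int (7 * k) * (9 * z) + of_int d = j"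
    using mob_scale[of 9 c a d b z] assms by (simp_all add: k j_def)
  have "\<not> 7 dvd d"
  proof
    assume "7 dvd d"
    hence "7 dvd a * d - b * c" by (simp add: k)
    thus False using assms(1) by simp
  qed
  then obtain \<epsilon> where \<epsilon>: "\<epsilon> \<noteq> 0" "\<And>\<tau>. \<tau> \<in> uhp \<Longrightarrow>
      klein 0 (of_int d / 7) \<tau> * klein 0 (2 * of_int d / 7) \<tau> * klein 0 (3 * of_int d / 7) \<tau> = \<epsilon> * T7 \<tau>"
    by (rule klein_sevenths) blast
  have "j ^ 3 * T7 (mob a b c d z) = \<epsilon> * T7 z"
    using T7_Gamma0[OF assms(3) _ \<epsilon>(2)[OF assms(3)], of a b "9 * k"] assms(1) by (simp add: j_def k)
  moreover have "j ^ 3 * T7 (9 * mob a b c d z) = \<epsilon> * T7 (9 * z)"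
    using T7_Gamma0[OF z9 _ \<epsilon>(2)[OF z9], of a "9 * b" k] 9 by simp
  ultimately have *: "T7 (mob a b c d z) = \<epsilon> / j ^ 3 * T7 z" "T7 (9 * mob a b c d z) = \<epsilon> / j ^ 3 * T7 (9 * z)"
    using j by (simp_all add: field_simps)
  show ?thesis unfolding gX_T7[OF mz] gX_T7[OF assms(3)] * using j \<epsilon>(1) by simp
qed

section \<open>The Fricke involution\<close>

definition fricke :: "complex \<Rightarrow> complex" where "fricke z = - 1 / (63 * z)"

lemma uhp_nonzero: "z \<in> uhp \<Longrightarrow> z \<noteq> 0" by (auto simp: uhp_def)

lemma neg_inverse_in_uhp: "z \<in> uhp \<Longrightarrow> - 1 / z \<in> uhp"
  using mob_in_uhp[of 0 0 "-1" 1 z] by (simp add: mob_def)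

lemma fricke_in_uhp: "z \<in> uhp \<Longrightarrow> fricke z \<in> uhp"
  unfolding fricke_def by (rule neg_inverse_in_uhp[OF uhp_mult_numeral])

lemma fricke_fricke: "z \<in> uhp \<Longrightarrow> fricke (fricke z) = z"
  by (simp add: fricke_def uhp_nonzero)

text \<open>z -> -1/z turns the row (0, 1/3) into (1/3, 0), whose Klein form begins with
  e(-\<tau>/9). At 63 z and 9 z this gives q^(-7) and q^(-1), hence the pole of order 6 of u; the 7
  is the ratio of the automorphy factors 63 z and 9 z.\<close>

lemma fv_fricke:
  assumes "z \<in> uhp" shows "fv (fricke z) = fu z / 7"
proof -
  have T3S: "T3 (- 1 / \<tau>) = klein (1 / 3) 0 \<tau> / \<tau>" if "\<tau> \<in> uhp" for \<tau>
    using T3_modular[OF that, of 0 0 "-1" 1] uhp_nonzero[OF that] by (simp add: mob_def field_simps)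
  have 7: "7 * fricke z = - 1 / (9 * z)" using uhp_nonzero[OF assms] by (simp add: fricke_def field_simps)
  have "fv (fricke z) = T3 (- 1 / (63 * z)) / T3 (- 1 / (9 * z))"
    unfolding fv_T3[OF fricke_in_uhp[OF assms]] 7 by (simp only: fricke_def)
  also have "\<dots> = (klein (1 / 3) 0 (63 * z) / (63 * z)) / (klein (1 / 3) 0 (9 * z) / (9 * z))"
    by (simp only: T3S uhp_mult_numeral[OF assms])
  also have "\<dots> = (klein (1 / 3) 0 (63 * z) / klein (1 / 3) 0 (9 * z)) / 7"
    using uhp_nonzero[OF assms] by simp
  also have "klein (1 / 3) 0 (63 * z) / klein (1 / 3) 0 (9 * z) = fu z"
  proof -
    define q where "q = ex z"
    have q: "norm q < 1" unfolding q_def by (rule norm_ex_less_1[OF assms])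
    have nz: "euler_prod (q ^ 3) \<noteq> 0" "euler_prod (q ^ 9) \<noteq> 0" "euler_prod (q ^ 63) \<noteq> 0" "q \<noteq> 0"
      by (simp_all add: euler_prod_power_nonzero q) (simp add: q_def)
    have e: "ex (63 * z / 3) = q ^ 21" "ex (63 * z) = q ^ 63" "ex (9 * z / 3) = q ^ 3" "ex (9 * z) = q ^ 9"
            "ex (- (63 * z) / 9) = 1 / q ^ 7" "ex (- (9 * z) / 9) = 1 / q"
      by (simp_all add: q_def ex_power flip: ex_minus inverse_eq_divide)
    have "- (1 / q ^ 7) * (A / B ^ 3) / (- (1 / q) * (C / D ^ 3)) = (A * D ^ 3 / (B ^ 3 * C)) / q ^ 6"
      if "B \<noteq> 0" "C \<noteq> 0" "D \<noteq> 0" for A B C D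
    proof -
      have "q ^ 7 = q * q ^ 6" by (simp flip: power_Suc)
      thus ?thesis using that nz(4) by (simp add: divide_simps)
    qed
    thus ?thesis
      unfolding klein_third_0[OF uhp_mult_numeral[OF assms]] e fu_def QU_def q_def[symmetric]
      using nz by blast
  qed
  finally show ?thesis .
qed

lemma fu_fricke: "z \<in> uhp \<Longrightarrow> fu (fricke z) = 7 * fv z"
  using fv_fricke[OF fricke_in_uhp] by (simp add: fricke_fricke field_simps)

text \<open>The analogous computation in weight -3: 729 is the cube of the ratio 9 of the automorphy
  factors 63 z and 7 z, and q^(-18) over q^(-2) gives the exponent 16.\<close>

lemma gX_fricke:
  assumes "z \<in> uhp" shows "gX (fricke z) = gX' z / 729"
proof -
  define K where "K = (\<lambda>\<tau>. klein (1 / 7) 0 \<tau> * klein (2 / 7) 0 \<tau> * klein (3 / 7) 0 \<tau>)"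
  have T7S: "T7 (- 1 / \<tau>) = K \<tau> / \<tau> ^ 3" if "\<tau> \<in> uhp" for \<tau>
    using T7_modular[OF that, of 0 0 "-1" 1] uhp_nonzero[OF that] by (simp add: mob_def K_def field_simps)
  have 9: "9 * fricke z = - 1 / (7 * z)" using uhp_nonzero[OF assms] by (simp add: fricke_def field_simps)
  have "gX (fricke z) = T7 (- 1 / (63 * z)) / T7 (- 1 / (7 * z))"
    unfolding gX_T7[OF fricke_in_uhp[OF assms]] 9 by (simp only: fricke_def)
  also have "\<dots> = (K (63 * z) / (63 * z) ^ 3) / (K (7 * z) / (7 * z) ^ 3)"
    by (simp only: T7S uhp_mult_numeral[OF assms])
  also have "\<dots> = (K (63 * z) / K (7 * z)) / 729"
    using uhp_nonzero[OF assms] by (simp add: power_mult_distrib)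
  also have "K (63 * z) / K (7 * z) = gX' z"
  proof -
    define q where "q = ex z"
    have q: "norm q < 1" unfolding q_def by (rule norm_ex_less_1[OF assms])
    have nz: "euler_prod q \<noteq> 0" "euler_prod (q ^ 7) \<noteq> 0" "euler_prod (q ^ 63) \<noteq> 0" "q \<noteq> 0"
      by (simp_all add: euler_prod_power_nonzero euler_prod_nonzero q) (simp add: q_def)
    have e: "ex (63 * z / 7) = q ^ 9" "ex (63 * z) = q ^ 63" "ex (7 * z / 7) = q" "ex (7 * z) = q ^ 7"
            "ex (- 2 * (63 * z) / 7) = 1 / q ^ 18" "ex (- 2 * (7 * z) / 7) = 1 / q ^ 2"
      by (simp_all add: q_def ex_power flip: ex_minus inverse_eq_divide)
    have "- (1 / q ^ 18) * (A / B ^ 7) / (- (1 / q ^ 2) * (C / D ^ 7)) = A * D ^ 7 / (B ^ 7 * C * q ^ 16)"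
      if "B \<noteq> 0" "C \<noteq> 0" "D \<noteq> 0" for A B C D
    proof -
      have "q ^ 18 = q ^ 2 * q ^ 16" by (simp flip: power_add)
      thus ?thesis using that nz(4) by (simp add: divide_simps)
    qed
    thus ?thesis
      unfolding K_def klein_seventh_0[OF uhp_mult_numeral[OF assms]] e gX'_def q_def[symmetric]
      using nz by blast
  qed
  finally show ?thesis .
qed

text \<open>The Fricke involution normalises Gamma0(63). This carries the invariance of
  \<open>fv\<close> and \<open>gX\<close> over to \<open>fu\<close> and \<open>gX'\<close>.\<close>

lemma fricke_mob:
  assumes "a * d - b * c = 1" "63 dvd c" "z \<in> uhp"
  shows "fricke (mob a b c d z) = mob d (- (c div 63)) (- 63 * b) a (fricke z)"
    and "d * a - (- (c div 63)) * (- 63 * b) = 1" "63 dvd - 63 * b"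
proof -
  obtain k where k: "c = 63 * k" using assms(2) by blast
  show det: "d * a - (- (c div 63)) * (- 63 * b) = 1" using assms(1) by (simp add: k algebra_simps)
  have 1: "of_int a * z + of_int b \<noteq> 0"
    using mob_denom_nonzero[of d a c b] assms mob_denom_nonzero[of "-c" b "-d" a z] by (simp add: algebra_simps)
  have 2: "of_int c * z + of_int d \<noteq> 0"
    by (rule mob_denom_nonzero[of a d b]) (use assms in auto)
  have z: "z \<noteq> 0" by (rule uhp_nonzero[OF assms(3)])
  have "mob d (- (c div 63)) (- 63 * b) a (fricke z) =
      (- (of_int c * z + of_int d) / (63 * z)) / ((of_int a * z + of_int b) / z)"
    using z by (simp add: mob_def fricke_def k field_simps)
  also have "\<dots> = fricke (mob a b c d z)"
    using z 1 2 by (simp add: mob_def fricke_def)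
  finally show "fricke (mob a b c d z) = mob d (- (c div 63)) (- 63 * b) a (fricke z)" ..
qed auto

lemma fu_invariant:
  assumes "a * d - b * c = 1" "63 dvd c" "z \<in> uhp"
  shows   "fu (mob a b c d z) = fu z"
proof -
  have mz: "mob a b c d z \<in> uhp" by (rule mob_in_uhp) (use assms in auto)
  have "fu (mob a b c d z) = 7 * fv (fricke (mob a b c d z))" by (simp add: fv_fricke[OF mz])
  also have "fv (fricke (mob a b c d z)) = fv (fricke z)"
    unfolding fricke_mob(1)[OF assms] by (rule fv_invariant[OF fricke_mob(2,3)[OF assms] fricke_in_uhp[OF assms(3)]])
  finally show ?thesis by (simp add: fv_fricke[OF assms(3)])
qed

lemma gX'_invariant:
  assumes "a * d - b * c = 1" "63 dvd c" "z \<in> uhp"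
  shows   "gX' (mob a b c d z) = gX' z"
proof -
  have mz: "mob a b c d z \<in> uhp" by (rule mob_in_uhp) (use assms in auto)
  have "gX' (mob a b c d z) = 729 * gX (fricke (mob a b c d z))" by (simp add: gX_fricke[OF mz])
  also have "gX (fricke (mob a b c d z)) = gX (fricke z)"
    unfolding fricke_mob(1)[OF assms] by (rule gX_invariant[OF fricke_mob(2,3)[OF assms] fricke_in_uhp[OF assms(3)]])
  finally show ?thesis by (simp add: gX_fricke[OF assms(3)])
qed

text \<open>The cube determines x^9, and x = x^9 / x^8.\<close>

lemma eq_if_cubes_and_eighths_eq:
  fixes x y :: complex
  assumes "x ^ 3 = y ^ 3" "x ^ 8 = y ^ 8" "y \<noteq> 0" shows "x = y"
proof -
  have "x \<noteq> 0" using assms by auto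
  have "x * x ^ 8 = y * y ^ 8"
    using arg_cong[OF assms(1), of "\<lambda>t. t ^ 3"] by (simp flip: power_Suc power_mult)
  thus ?thesis using assms by simp
qed

lemma fx_invariant:
  assumes "a * d - b * c = 1" "63 dvd c" "z \<in> uhp"
  shows   "fx (mob a b c d z) = fx z"
proof (rule eq_if_cubes_and_eighths_eq)
  have mz: "mob a b c d z \<in> uhp" by (rule mob_in_uhp) (use assms in auto)
  show "fx (mob a b c d z) ^ 3 = fx z ^ 3"
    by (simp add: fx_cube[OF mz] fx_cube[OF assms(3)] fu_invariant[OF assms] fv_invariant[OF assms])
  show "fx (mob a b c d z) ^ 8 = fx z ^ 8"
    by (simp add: fx_eighth[OF mz] fx_eighth[OF assms(3)] gX_invariant[OF assms] gX'_invariant[OF assms])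
qed (rule fx_nonzero[OF assms(3)])

lemma fx_fricke:
  assumes "z \<in> uhp" shows "fx (fricke z) = fx z"
proof (rule eq_if_cubes_and_eighths_eq)
  note w = fricke_in_uhp[OF assms]
  show "fx (fricke z) ^ 3 = fx z ^ 3"
    by (simp add: fx_cube[OF w] fx_cube[OF assms] fu_fricke[OF assms] fv_fricke[OF assms])
  have "gX' (fricke z) = 729 * gX z"
    using gX_fricke[OF w] by (simp add: fricke_fricke[OF assms] field_simps)
  thus "fx (fricke z) ^ 8 = fx z ^ 8"
    by (simp add: fx_eighth[OF w] fx_eighth[OF assms] gX_fricke[OF assms])
qed (rule fx_nonzero[OF assms])

section \<open>The modular group and functions on the disc\<close>

lemma mob_mob:
  assumes "a' * d' - b' * c' > 0" "z \<in> uhp"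
  shows "mob a b c d (mob a' b' c' d' z) =
           mob (a * a' + b * c') (a * b' + b * d') (c * a' + d * c') (c * b' + d * d') z"
proof -
  define u v where "u = of_int a' * z + (of_int b' :: complex)" and "v = of_int c' * z + (of_int d' :: complex)"
  have v: "v \<noteq> 0" unfolding v_def by (rule mob_denom_nonzero[OF assms])
  have eq: "of_int a * (u / v) + of_int b = (of_int a * u + of_int b * v) / v"
       "of_int c * (u / v) + of_int d = (of_int c * u + of_int d * v) / v"
    using v by (simp_all add: field_simps)
  have "mob a b c d (mob a' b' c' d' z) = (of_int a * u + of_int b * v) / (of_int c * u + of_int d * v)"
    unfolding mob_def u_def[symmetric] v_def[symmetric] eq using v by simp
  thus ?thesis by (simp add: mob_def u_def v_def algebra_simps)
qed

lemma det_mult_eq: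
  fixes a b c d :: int
  assumes "a * d - b * c = 1" "a' * d' - b' * c' = 1"
  shows "(a * a' + b * c') * (c * b' + d * d') - (a * b' + b * d') * (c * a' + d * c') = 1"
proof -
  have "(a * a' + b * c') * (c * b' + d * d') - (a * b' + b * d') * (c * a' + d * c') =
        (a * d - b * c) * (a' * d' - b' * c')" by algebra
  thus ?thesis using assms by simp
qed

lemma mob_inverse:
  assumes "a * d - b * c = 1" "z \<in> uhp"
  shows "mob a b c d (mob d (- b) (- c) a z) = z" "mob d (- b) (- c) a (mob a b c d z) = z"
proof -
  have "a * d + b * (- c) = 1" "c * (- b) + d * a = 1" "d * a + (- b) * c = 1" "(- c) * b + a * d = 1"
    using assms(1) by (simp_all add: algebra_simps)
  thus "mob a b c d (mob d (- b) (- c) a z) = z" "mob d (- b) (- c) a (mob a b c d z) = z"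
    using assms by (subst mob_mob; simp add: mob_def algebra_simps)+
qed

text \<open>A weak substitute for the standard fundamental domain. With y = Im z and N =
  floor(1/sqrt y), Dirichlet's theorem gives coprime h, k with 0 < k \<le> N and |k Re z - h| < 1/N
  \<le> 2 sqrt y. Hence |k z - h|^2 \<le> 4 y + y, and completing the row (k, -h) to determinant 1
  gives an image of imaginary part at least y / (5 y).\<close>

lemma modular_reduce:
  assumes "z \<in> uhp"
  obtains a b c d where "a * d - b * c = 1" "Im (mob a b c d z) \<ge> 1 / 5"
proof (cases "Im z \<ge> 1 / 5")
  case True
  thus ?thesis by (intro that[of 1 1 0 0]) (simp_all add: mob_def)
next
  case False
  define y where "y = Im z"
  have y: "y > 0" "y < 1 / 5" using False assms by (auto simp: uhp_def y_def)
  define N where "N = nat \<lfloor>1 / sqrt y\<rfloor>"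
  have "sqrt y \<le> 1" using y by simp
  hence ge1: "1 / sqrt y \<ge> 1" using y by simp
  have fl: "\<lfloor>1 / sqrt y\<rfloor> \<ge> 1" using ge1 by (simp add: le_floor_iff)
  have Nf: "real N = of_int \<lfloor>1 / sqrt y\<rfloor>" unfolding N_def by (rule of_nat_nat) (use fl in linarith)
  have N1: "real N \<ge> 1" unfolding Nf using fl by (simp only: of_int_1_le_iff)
  have N2: "real N \<le> 1 / sqrt y" unfolding Nf by (rule of_int_floor_le)
  have N3: "real N \<ge> 1 / (2 * sqrt y)"
  proof -
    have "real N > 1 / sqrt y - 1" unfolding Nf by linarith
    moreover have "1 / (2 * sqrt y) = (1 / sqrt y) / 2" by simp
    ultimately show ?thesis using N1 by linarith
  qed
  obtain h k where hk: "coprime h k" "0 < k" "k \<le> int N" "\<bar>of_int k * Re z - of_int h\<bar> < 1 / real N"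
    using Dirichlet_approx_coprime[of N "Re z"] N1 by auto
  obtain u v where uv: "u * h + v * k = 1"
    using hk(1) by (metis bezout_int coprime_imp_gcd_eq_1)
  have det: "(- u) * (- h) - (- v) * k = 1" using uv by (simp add: algebra_simps)
  have "norm (of_int k * z + of_int (- h)) ^ 2 = (of_int k * Re z - of_int h) ^ 2 + (of_int k * y) ^ 2"
    by (simp add: cmod_power2 y_def)
  also have "(of_int k * Re z - of_int h) ^ 2 \<le> (1 / real N) ^ 2"
    using hk(4) by (intro abs_le_square_iff[THEN iffD1]) auto
  also have "(1 / real N) ^ 2 \<le> 4 * y"
  proof -
    have "1 / real N \<le> 2 * sqrt y" using N3 N1 y by (simp add: field_simps)
    hence "(1 / real N) ^ 2 \<le> (2 * sqrt y) ^ 2" by (intro power_mono) auto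
    thus ?thesis using y by (simp add: power_mult_distrib)
  qed
  also have "(of_int k * y) ^ 2 \<le> y"
  proof -
    have "of_int k \<le> 1 / sqrt y" using hk(3) N2 by linarith
    hence "of_int k * y \<le> 1 / sqrt y * y" using y by (intro mult_right_mono) auto
    also have "\<dots> = sqrt y" using y by (simp add: real_div_sqrt)
    finally have "(of_int k * y) ^ 2 \<le> sqrt y ^ 2" using hk(2) y by (intro power_mono) auto
    thus ?thesis using y by simp
  qed
  finally have le: "norm (of_int k * z + of_int (- h)) ^ 2 \<le> 5 * y" by simp
  have "of_int k * z + of_int (- h) \<noteq> (0 :: complex)"
    by (rule mob_denom_nonzero[of "- u" _ "- v"]) (use det assms in auto)
  hence "norm (of_int k * z + of_int (- h)) ^ 2 > 0" by simp
  hence "Im (mob (- u) (- v) k (- h) z) \<ge> 1 / 5"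
    unfolding Im_mob det using le y by (simp add: y_def field_simps)
  with det show ?thesis by (rule that)
qed

section \<open>Cosets of Gamma0(63) in SL2(Z)\<close>

definition SL2Z :: "(int \<times> int \<times> int \<times> int) set" where
  "SL2Z = {(a, b, c, d). a * d - b * c = 1}"

text \<open>Pointwise invariance of an actual function, unlike equality in \<open>mero_uhp\<close>:
  the maximum principle below compares individual values.\<close>

definition G0_invariant :: "(complex \<Rightarrow> complex) \<Rightarrow> bool" where
  "G0_invariant g \<longleftrightarrow> (\<forall>a b c d z. a * d - b * c = 1 \<longrightarrow> 63 dvd c \<longrightarrow> z \<in> uhp \<longrightarrow> g (mob a b c d z) = g z)"

text \<open>c d' - c' d is the lower left entry of the first matrix times the inverse of the
  second.\<close>

lemma G0_invariant_same_coset: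
  assumes "G0_invariant g" "a * d - b * c = 1" "a' * d' - b' * c' = 1"
    "63 dvd c * d' - c' * d" "z \<in> uhp"
  shows "g (mob a b c d z) = g (mob a' b' c' d' z)"
proof -
  define w where "w = mob a' b' c' d' z"
  have w: "w \<in> uhp" unfolding w_def by (rule mob_in_uhp) (use assms in auto)
  have z: "z = mob d' (- b') (- c') a' w" unfolding w_def by (rule mob_inverse(2)[symmetric]) fact+
  have dvd: "63 dvd c * d' + d * - c'" using assms(4) by (simp add: algebra_simps)
  have det': "d' * a' - (- b') * (- c') = 1" using assms(3) by (simp add: algebra_simps)
  have "g (mob a b c d (mob d' (- b') (- c') a' w)) = g w"
    unfolding mob_mob[OF det'[THEN ssubst[of _ _ "\<lambda>x. x > 0"], OF zero_less_one] w]
    using assms(1) dvd det_mult_eq[OF assms(2) det'] w unfolding G0_invariant_def by blast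
  thus ?thesis by (simp add: z[symmetric] w_def[symmetric])
qed

lemma G0_invariant_cong_row:
  assumes "G0_invariant g" "a * d - b * c = 1" "a' * d' - b' * c' = 1"
    "c mod 63 = c' mod 63" "d mod 63 = d' mod 63" "z \<in> uhp"
  shows "g (mob a b c d z) = g (mob a' b' c' d' z)"
proof (rule G0_invariant_same_coset[OF assms(1-3) _ assms(6)])
  have "c * d' mod 63 = c' * d mod 63"
    using assms(4,5) by (metis mod_mult_cong)
  thus "63 dvd c * d' - c' * d" by (simp add: mod_eq_dvd_iff)
qed

text \<open>One matrix is kept for each bottom row that occurs modulo 63. The list meets some cosets
  of Gamma0(63) repeatedly, but the compactness arguments use only that it is finite.\<close>

lemma finite_coset_representatives:
  obtains R where "finite R" "R \<subseteq> SL2Z"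
    "\<And>a b c d. a * d - b * c = 1 \<Longrightarrow> \<exists>(a', b', c', d')\<in>R. c mod 63 = c' mod 63 \<and> d mod 63 = d' mod 63"
proof -
  define f :: "int \<times> int \<times> int \<times> int \<Rightarrow> int \<times> int" where "f = (\<lambda>(a, b, c, d). (c mod 63, d mod 63))"
  have "f ` SL2Z \<subseteq> {0..<63} \<times> {0..<63}" by (auto simp: f_def)
  hence fin: "finite (f ` SL2Z)" by (rule finite_subset) auto
  define R where "R = inv_into SL2Z f ` (f ` SL2Z)"
  show ?thesis
  proof (rule that[of R])
    show "finite R" using fin by (simp add: R_def)
    show "R \<subseteq> SL2Z" using inv_into_into[of _ f SL2Z] unfolding R_def by blast
    fix a b c d :: int assume "a * d - b * c = 1"
    hence mem: "(a, b, c, d) \<in> SL2Z" by (simp add: SL2Z_def)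
    have "inv_into SL2Z f (f (a, b, c, d)) \<in> R" using mem by (auto simp: R_def)
    moreover have "f (inv_into SL2Z f (f (a, b, c, d))) = f (a, b, c, d)"
      by (rule f_inv_into_f) (use mem in auto)
    ultimately show "\<exists>(a', b', c', d')\<in>R. c mod 63 = c' mod 63 \<and> d mod 63 = d' mod 63"
      by (intro bexI[of _ "inv_into SL2Z f (f (a, b, c, d))"])
         (auto simp: f_def split: prod.splits)
  qed
qed

lemma mob_translate: "mob a (b + n * a) c (d + n * c) z = mob a b c d (z + of_int n)"
  by (simp add: mob_def algebra_simps)

text \<open>Translating by 63 n leaves the bottom row unchanged modulo 63, so 63 serves as a common
  width for all cusps.\<close>

lemma G0_invariant_period:
  assumes "G0_invariant g" "a * d - b * c = 1" "z \<in> uhp"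
  shows "g (mob a b c d (z + of_int (63 * n))) = g (mob a b c d z)"
proof -
  have "g (mob a (b + 63 * n * a) c (d + 63 * n * c) z) = g (mob a b c d z)"
    by (rule G0_invariant_cong_row[OF assms(1) _ assms(2) _ _ assms(3)])
       (use assms(2) in \<open>simp_all add: algebra_simps mod_add_eq[symmetric] mult.assoc\<close>)
  thus ?thesis by (simp only: mob_translate)
qed

section \<open>Periodic functions as functions of q\<close>

lemma exists_ex_preimage:
  assumes "q \<noteq> 0" "norm q < 1" "h > 0"
  obtains z where "z \<in> uhp" "ex (z / of_nat h) = q" "Im z = - of_nat h * ln (norm q) / (2 * pi)"
proof
  define z where "z = of_nat h * Ln q / (2 * of_real pi * \<i>)"
  show "ex (z / of_nat h) = q" using assms by (simp add: ex_def z_def field_simps)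
  have "z = - \<i> * of_real (of_nat h / (2 * pi)) * Ln q" by (simp add: z_def field_simps)
  hence "Im z = - (of_nat h / (2 * pi)) * Re (Ln q)" by simp
  thus Im: "Im z = - of_nat h * ln (norm q) / (2 * pi)" using assms by (simp add: Re_Ln)
  have "ln (norm q) < 0" using assms by simp
  hence "of_nat h * ln (norm q) < 0" using assms by (intro mult_pos_neg) auto
  thus "z \<in> uhp" unfolding uhp_def mem_Collect_eq Im by (intro divide_pos_pos) auto
qed

text \<open>Values are transported along an arbitrary choice \<open>P\<close> of preimages.
  Periodicity makes the choice invisible, so holomorphy can be checked locally with any branch of
  the logarithm.\<close>

lemma periodic_function_on_disc:
  assumes hol: "f holomorphic_on uhp" and h: "h > 0"
    and per: "\<And>z n. z \<in> uhp \<Longrightarrow> f (z + of_int (int h * n)) = f z"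
  obtains F where "F holomorphic_on (ball 0 1 - {0})" "\<And>z. z \<in> uhp \<Longrightarrow> f z = F (ex (z / of_nat h))"
proof -
  have same: "f z = f w" if "z \<in> uhp" and w: "w \<in> uhp" and eq: "ex (z / of_nat h) = ex (w / of_nat h)" for z w
  proof -
    obtain n :: int where "z / of_nat h = w / of_nat h + of_int n" using eq unfolding ex_eq_iff by blast
    hence "z = w + of_int (int h * n)" using h by (simp add: field_simps)
    thus ?thesis using per[OF w] by simp
  qed
  define P where "P = (\<lambda>q. SOME z. z \<in> uhp \<and> ex (z / of_nat h) = q)"
  have P: "P q \<in> uhp \<and> ex (P q / of_nat h) = q" if "q \<in> ball 0 1 - {0}" for q
    unfolding P_def by (rule someI_ex) (use exists_ex_preimage[of q h] that h in auto)
  define F where "F = (\<lambda>q. f (P q))"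
  have F: "f z = F (ex (z / of_nat h))" if "z \<in> uhp" for z
  proof -
    have "ex (z / of_nat h) \<in> ball 0 1 - {0}"
      using norm_ex_less_1[of "z / of_nat h"] that h by (auto simp: uhp_def)
    from P[OF this] show ?thesis unfolding F_def using that by (intro same) auto
  qed
  have "F analytic_on {q0}" if "q0 \<in> ball 0 1 - {0}" for q0
  proof -
    have q0: "q0 \<in> ball 0 1" "q0 \<noteq> 0" using that by auto
    define r where "r = min (norm q0) (1 - norm q0)"
    have r: "r > 0" using q0 by (simp add: r_def)
    \<comment> \<open>A branch of the logarithm around \<open>q0\<close>: the quotient q / q0 stays
      within distance 1 of 1, so the cut of \<open>Ln\<close> is avoided even when \<open>q0\<close>
      lies on it.\<close>
    define L where "L = (\<lambda>q. of_nat h / (2 * of_real pi * \<i>) * (Ln (q / q0) + Ln q0))"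
    have sub: "q \<in> ball 0 1 - {0}" "q / q0 \<notin> \<real>\<^sub>\<le>\<^sub>0" if "q \<in> ball q0 r" for q
    proof -
      have d: "norm (q0 - q) < norm q0" "norm (q0 - q) < 1 - norm q0" using that by (auto simp: r_def dist_norm)
      have "norm q \<le> norm q0 + norm (q0 - q)" using norm_triangle_ineq4[of q0 "q0 - q"] by simp
      thus "q \<in> ball 0 1 - {0}" using d by auto
      have "norm (1 - q / q0) < 1"
      proof -
        have "1 - q / q0 = (q0 - q) / q0" using q0 by (simp add: field_simps)
        thus ?thesis using d(1) q0 by (simp add: norm_divide)
      qed
      hence "Re (1 - q / q0) < 1" using complex_Re_le_cmod[of "1 - q / q0"] by linarith
      thus "q / q0 \<notin> \<real>\<^sub>\<le>\<^sub>0" by (auto simp: complex_nonpos_Reals_iff)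
    qed
    have exL: "ex (L q / of_nat h) = q" if "q \<in> ball q0 r" for q
    proof -
      have "2 * of_real pi * \<i> * (L q / of_nat h) = Ln (q / q0) + Ln q0"
        using h by (simp add: L_def)
      thus ?thesis using sub(1)[OF that] q0 by (simp add: ex_def exp_add)
    qed
    have L_uhp: "L q \<in> uhp" if "q \<in> ball q0 r" for q
    proof -
      have "norm (ex (L q / of_nat h)) < 1"
        using sub(1)[OF that] by (simp add: exL[OF that])
      hence "exp (- (2 * pi * (Im (L q) / real h))) < exp 0" by (simp add: norm_ex)
      hence "0 < (2 * pi) * (Im (L q) / real h)" by (simp only: exp_less_cancel_iff)
      hence "0 < Im (L q) / real h" by (rule zero_less_mult_pos) simp
      thus ?thesis using h by (simp add: uhp_def zero_less_divide_iff)
    qed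
    have "L holomorphic_on ball q0 r"
      unfolding L_def using sub(2) q0 by (intro holomorphic_intros) auto
    hence "(f \<circ> L) holomorphic_on ball q0 r"
      by (rule holomorphic_on_compose_gen[OF _ hol]) (use L_uhp in auto)
    moreover have "(f \<circ> L) q = F q" if "q \<in> ball q0 r" for q
      using F[OF L_uhp[OF that]] exL[OF that] by simp
    ultimately have "F holomorphic_on ball q0 r"
      by (metis (no_types, lifting) holomorphic_transform)
    thus "F analytic_on {q0}" using r unfolding analytic_at by (intro exI[of _ "ball q0 r"]) auto
  qed
  hence "F analytic_on (ball 0 1 - {0})" using analytic_on_analytic_at by blast
  hence "F holomorphic_on (ball 0 1 - {0})" by (rule analytic_imp_holomorphic)
  with F show ?thesis using that by blast
qed

text \<open>For q = e(z/h) the bound reads |f| \<le> B |q|^(-N). Multiplied by q^N the function is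
  bounded near 0, and the singularity is removable.\<close>

lemma periodic_function_on_disc_bounded:
  assumes hol: "f holomorphic_on uhp" and h: "h > 0"
    and per: "\<And>z n. z \<in> uhp \<Longrightarrow> f (z + of_int (int h * n)) = f z"
    and bound: "\<And>z. Im z > y0 \<Longrightarrow> norm (f z) \<le> B * exp (2 * pi * real N / real h * Im z)"
  obtains G where "G holomorphic_on ball 0 1"
    "\<And>z. z \<in> uhp \<Longrightarrow> f z = G (ex (z / of_nat h)) / ex (z / of_nat h) ^ N"
proof -
  obtain F where F: "F holomorphic_on (ball 0 1 - {0})" "\<And>z. z \<in> uhp \<Longrightarrow> f z = F (ex (z / of_nat h))"
    using periodic_function_on_disc[OF hol h per] by blast
  define F' where "F' = (\<lambda>q. F q * q ^ N)"
  have holF': "F' holomorphic_on (ball 0 1 - {0})"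
    unfolding F'_def by (intro holomorphic_intros F(1))
  define r where "r = exp (- 2 * pi * (\<bar>y0\<bar> + 1) / real h)"
  have "norm (F' q) \<le> B" if q: "q \<in> ball 0 r" "q \<noteq> 0" for q
  proof -
    have "r < 1" using h by (simp add: r_def divide_neg_pos mult_pos_pos add_nonneg_pos)
    hence "norm q < 1" using q by simp
    then obtain z where z: "z \<in> uhp" "ex (z / of_nat h) = q" "Im z = - of_nat h * ln (norm q) / (2 * pi)"
      using exists_ex_preimage[OF q(2) _ h] by blast
    have "ln (norm q) < ln r" by (subst ln_less_cancel_iff) (use q in \<open>auto simp: r_def\<close>)
    also have "\<dots> = - 2 * pi * (\<bar>y0\<bar> + 1) / real h" by (simp add: r_def)
    finally have "real h * ln (norm q) < - (2 * pi) * (\<bar>y0\<bar> + 1)"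
      using h by (simp add: field_simps)
    hence "Im z > \<bar>y0\<bar> + 1" unfolding z(3) by (simp add: field_simps)
    hence "norm (f z) \<le> B * exp (2 * pi * real N / real h * Im z)" by (intro bound) auto
    moreover have "norm q ^ N = exp (- (2 * pi * real N / real h * Im z))"
      using z(2)[symmetric] h by (simp add: norm_ex exp_of_nat_mult[symmetric] field_simps)
    ultimately have "norm (f z) * norm q ^ N \<le>
        B * exp (2 * pi * real N / real h * Im z) * exp (- (2 * pi * real N / real h * Im z))"
      by (metis mult_right_mono exp_ge_zero)
    also have "\<dots> = B" by (simp add: exp_minus)
    finally show ?thesis using F(2)[OF z(1)] by (simp add: F'_def z(2) norm_mult norm_power)
  qed
  hence "eventually (\<lambda>q. norm (F' q) \<le> B) (at 0)"
    unfolding eventually_at using exp_gt_zero by (intro exI[of _ r]) (auto simp: r_def)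
  moreover have "(\<exists>g. g holomorphic_on ball 0 1 \<and> (\<forall>z\<in>ball 0 1 - {0}. g z = F' z)) \<longleftrightarrow>
                 (\<exists>B. eventually (\<lambda>z. norm (F' z) \<le> B) (at 0))"
    by (rule holomorphic_on_extend_bounded[OF holF']) auto
  ultimately obtain G where G: "G holomorphic_on ball 0 1" "\<And>q. q \<in> ball 0 1 - {0} \<Longrightarrow> G q = F' q" by blast
  show ?thesis
  proof (rule that[OF G(1)])
    fix z assume z: "z \<in> uhp"
    have "ex (z / of_nat h) \<in> ball 0 1 - {0}"
      using norm_ex_less_1[of "z / of_nat h"] z h by (auto simp: uhp_def)
    thus "f z = G (ex (z / of_nat h)) / ex (z / of_nat h) ^ N"
      using F(2)[OF z] G(2) by (simp add: F'_def)
  qed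
qed

lemma mob_holomorphic: "a * d - b * c > 0 \<Longrightarrow> mob a b c d holomorphic_on uhp"
  unfolding mob_def by (intro holomorphic_intros) (use mob_denom_nonzero in auto)

lemma compose_mob_holomorphic:
  assumes "g holomorphic_on uhp" "a * d - b * c > 0"
  shows "(\<lambda>z. g (mob a b c d z)) holomorphic_on uhp"
proof -
  have "(g \<circ> mob a b c d) holomorphic_on uhp"
    by (rule holomorphic_on_compose_gen[OF mob_holomorphic[OF assms(2)] assms(1)])
       (use mob_in_uhp[OF assms(2)] in auto)
  thus ?thesis by (simp add: o_def)
qed

text \<open>This is the compactness of \<open>X\<^sub>0(63)\<close>: the finitely many functions \<open>g \<circ> \<gamma>\<close>, viewed on the disc,
  take all their values on a compact subdisc, so the maximum modulus principle applies.\<close>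

theorem bounded_modular_function_zero:
  assumes hol: "g holomorphic_on uhp" and inv: "G0_invariant g"
    and bound: "\<And>a b c d. a * d - b * c = 1 \<Longrightarrow> \<exists>B y0. \<forall>z. Im z > y0 \<longrightarrow> norm (g (mob a b c d z)) \<le> B"
    and lim: "\<And>\<epsilon>. \<epsilon> > 0 \<Longrightarrow> \<exists>y0. \<forall>z. Im z > y0 \<longrightarrow> norm (g z) < \<epsilon>"
    and "z \<in> uhp"
  shows "g z = 0"
proof -
  obtain R where R: "finite R" "R \<subseteq> SL2Z"
    "\<And>a b c d. a * d - b * c = 1 \<Longrightarrow> \<exists>(a', b', c', d')\<in>R. c mod 63 = c' mod 63 \<and> d mod 63 = d' mod 63"
    by (rule finite_coset_representatives) blast
  have ex_F: "\<exists>F. F holomorphic_on ball 0 1 \<and> (\<forall>z\<in>uhp. (case \<rho> of (a, b, c, d) \<Rightarrow> g (mob a b c d z)) = F (ex (z / 63)))"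
    if "\<rho> \<in> R" for \<rho>
  proof -
    obtain a b c d where \<rho>: "\<rho> = (a, b, c, d)" by (cases \<rho>)
    have det: "a * d - b * c = 1" using that R(2) by (auto simp: \<rho> SL2Z_def)
    obtain B y0 where B: "\<And>z. Im z > y0 \<Longrightarrow> norm (g (mob a b c d z)) \<le> B" using bound[OF det] by blast
    obtain G where "G holomorphic_on ball 0 1"
      "\<And>z. z \<in> uhp \<Longrightarrow> g (mob a b c d z) = G (ex (z / of_nat 63)) / ex (z / of_nat 63) ^ 0"
      by (rule periodic_function_on_disc_bounded[of "\<lambda>z. g (mob a b c d z)" 63 y0 B 0])
         (use B G0_invariant_period[OF inv det] compose_mob_holomorphic[OF hol] det in auto)
    thus ?thesis by (intro exI[of _ G]) (auto simp: \<rho>)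
  qed
  then obtain F where F: "\<And>\<rho>. \<rho> \<in> R \<Longrightarrow> F \<rho> holomorphic_on ball 0 1"
      "\<And>a b c d z. (a, b, c, d) \<in> R \<Longrightarrow> z \<in> uhp \<Longrightarrow> g (mob a b c d z) = F (a, b, c, d) (ex (z / 63))"
  proof -
    have "\<exists>F. \<forall>\<rho>\<in>R. F \<rho> holomorphic_on ball 0 1 \<and>
            (\<forall>z\<in>uhp. (case \<rho> of (a, b, c, d) \<Rightarrow> g (mob a b c d z)) = F \<rho> (ex (z / 63)))"
      using ex_F by (intro bchoice) blast
    then obtain F where F: "\<And>\<rho>. \<rho> \<in> R \<Longrightarrow> F \<rho> holomorphic_on ball 0 1"
      "\<And>\<rho> z. \<rho> \<in> R \<Longrightarrow> z \<in> uhp \<Longrightarrow> (case \<rho> of (a, b, c, d) \<Rightarrow> g (mob a b c d z)) = F \<rho> (ex (z / 63))"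
      by blast
    show ?thesis by (rule that[of F]) (use F(1) F(2)[of "(_, _, _, _)"] in auto)
  qed
  \<comment> \<open>315 = 5 * 63: this is |e(z/63)| at height 1/5, the height guaranteed by
    \<open>modular_reduce\<close>.\<close>
  define r where "r = exp (- 2 * pi / 315)"
  have r: "0 < r" "r < 1" by (simp_all add: r_def)
  have sub: "cball 0 r \<subseteq> ball (0 :: complex) 1" using r by auto
  have val: "\<exists>\<rho>\<in>R. \<exists>q\<in>cball 0 r. g w = F \<rho> q" if w: "w \<in> uhp" for w
  proof -
    obtain a b c d where det: "a * d - b * c = 1" and Im: "Im (mob a b c d w) \<ge> 1 / 5"
      using modular_reduce[OF w] .
    define w' where "w' = mob a b c d w"
    have w': "w' \<in> uhp" unfolding w'_def by (rule mob_in_uhp) (use det w in auto)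
    have ww': "w = mob d (- b) (- c) a w'" unfolding w'_def by (rule mob_inverse(2)[symmetric]) fact+
    have det': "d * a - (- b) * (- c) = 1" using det by (simp add: algebra_simps)
    obtain a' b' c' d' where \<rho>: "(a', b', c', d') \<in> R" "(- c) mod 63 = c' mod 63" "a mod 63 = d' mod 63"
      using R(3)[OF det'] by auto
    have "a' * d' - b' * c' = 1" using \<rho>(1) R(2) by (auto simp: SL2Z_def)
    from G0_invariant_cong_row[OF inv det' this \<rho>(2,3) w']
    have "g w = F (a', b', c', d') (ex (w' / 63))"
      unfolding F(2)[OF \<rho>(1) w', symmetric] ww'[symmetric] .
    moreover have "ex (w' / 63) \<in> cball 0 r"
      using Im by (simp add: norm_ex r_def w'_def)
    ultimately show ?thesis using \<rho>(1) by blast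
  qed
  have "R \<noteq> {}" using R(3)[of 1 1 0 0] by auto
  have "\<exists>q\<in>cball 0 r. \<forall>q'\<in>cball 0 r. norm (F \<rho> q') \<le> norm (F \<rho> q)" if "\<rho> \<in> R" for \<rho>
  proof (rule continuous_attains_sup)
    show "continuous_on (cball 0 r) (\<lambda>q. norm (F \<rho> q))"
      by (intro continuous_intros holomorphic_on_imp_continuous_on holomorphic_on_subset[OF F(1)[OF that] sub])
  qed (use r in auto)
  then obtain m where m: "\<And>\<rho>. \<rho> \<in> R \<Longrightarrow> m \<rho> \<in> cball 0 r"
    "\<And>\<rho> q. \<rho> \<in> R \<Longrightarrow> q \<in> cball 0 r \<Longrightarrow> norm (F \<rho> q) \<le> norm (F \<rho> (m \<rho>))" by metis
  obtain \<rho> where \<rho>: "\<rho> \<in> R" "\<And>\<sigma>. \<sigma> \<in> R \<Longrightarrow> norm (F \<sigma> (m \<sigma>)) \<le> norm (F \<rho> (m \<rho>))"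
  proof -
    define S where "S = (\<lambda>\<rho>. norm (F \<rho> (m \<rho>))) ` R"
    have S: "finite S" "S \<noteq> {}" using R(1) \<open>R \<noteq> {}\<close> by (auto simp: S_def)
    hence "Max S \<in> S" by (rule Max_in)
    then obtain \<rho> where "\<rho> \<in> R" "Max S = norm (F \<rho> (m \<rho>))" by (auto simp: S_def)
    moreover have "norm (F \<sigma> (m \<sigma>)) \<le> Max S" if "\<sigma> \<in> R" for \<sigma>
      by (rule Max_ge[OF S(1)]) (use that in \<open>auto simp: S_def\<close>)
    ultimately show ?thesis using that by metis
  qed
  obtain a b c d where \<rho>eq: "\<rho> = (a, b, c, d)" by (cases \<rho>)
  have det: "a * d - b * c = 1" using \<rho>(1) R(2) by (auto simp: \<rho>eq SL2Z_def)
  have le: "norm (g w) \<le> norm (F \<rho> (m \<rho>))" if "w \<in> uhp" for w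
    using val[OF that] m(2) \<rho>(2) by (metis order_trans)
  \<comment> \<open>Every value of g is some \<open>F \<sigma> q\<close> with |q| \<le> r, so |g| is
    bounded by the largest of the finitely many maxima. It is attained at \<open>m \<rho>\<close>,
    an interior point of the unit disc.\<close>
  have "F \<rho> constant_on ball 0 1"
  proof (rule maximum_modulus_principle[OF F(1)[OF \<rho>(1)], of "ball 0 1" "m \<rho>"])
    fix q :: complex assume q: "q \<in> ball 0 1"
    show "norm (F \<rho> q) \<le> norm (F \<rho> (m \<rho>))"
    proof (cases "q = 0")
      case True
      thus ?thesis using m(2)[OF \<rho>(1), of 0] r by simp
    next
      case False
      then obtain w where w: "w \<in> uhp" "ex (w / of_nat 63) = q"
        using exists_ex_preimage[of q 63] q by auto
      hence "F \<rho> q = g (mob a b c d w)"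
        using F(2)[of a b c d w] \<rho>(1) by (simp add: \<rho>eq)
      thus ?thesis using le[OF mob_in_uhp[of a d b c w]] det w(1) by simp
    qed
  qed (use m(1)[OF \<rho>(1)] sub in auto)
  then obtain C where C: "\<And>q. q \<in> ball 0 1 \<Longrightarrow> F \<rho> q = C" by (auto simp: constant_on_def)
  have const: "g w = C" if w: "w \<in> uhp" for w
  proof -
    define w' where "w' = mob d (- b) (- c) a w"
    have w': "w' \<in> uhp" unfolding w'_def by (rule mob_in_uhp) (use det w in \<open>auto simp: algebra_simps\<close>)
    have "w = mob a b c d w'" unfolding w'_def by (rule mob_inverse(1)[symmetric]) fact+
    hence "g w = F \<rho> (ex (w' / 63))" using F(2)[of a b c d w'] \<rho>(1) w' by (simp add: \<rho>eq)
    also have "\<dots> = C" by (rule C) (use norm_ex_less_1[of "w' / 63"] w' in \<open>auto simp: uhp_def\<close>)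
    finally show ?thesis .
  qed
  have "C = 0"
  proof (rule ccontr)
    assume "C \<noteq> 0"
    then obtain y0 where y0: "\<And>z. Im z > y0 \<Longrightarrow> norm (g z) < norm C" using lim[of "norm C"] by auto
    define w where "w = Complex 0 (\<bar>y0\<bar> + 1)"
    have "norm (g w) < norm C" by (rule y0) (simp add: w_def)
    moreover have "w \<in> uhp" by (simp add: w_def uhp_def)
    ultimately show False using const by simp
  qed
  with const[OF assms(5)] show ?thesis by simp
qed

subsection \<open>Growth at the cusps\<close>

text \<open>Hermite normal form: an integral matrix of positive determinant is an element of SL2(Z)
  times an upper triangular matrix with rows (\<alpha>, \<beta>) and (0, \<delta>). It turns 7 times
  \<gamma> z, or the Fricke image of \<gamma> z, into \<gamma>' z' with \<gamma>' in SL2(Z); the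
  last conclusion compares the automorphy factors.\<close>

lemma hermite_decomposition:
  fixes p q r s :: int
  assumes "p * s - q * r > 0"
  obtains a b c d \<beta> \<alpha> \<delta> :: int where "a * d - b * c = 1" "\<alpha> > 0" "\<delta> > 0" "\<alpha> * \<delta> = p * s - q * r"
    "p = a * \<alpha>" "r = c * \<alpha>" "\<alpha> = gcd p r"
    "\<And>z. z \<in> uhp \<Longrightarrow> mob p q r s z = mob a b c d ((of_int \<alpha> * z + of_int \<beta>) / of_int \<delta>)"
    "\<And>z. of_int c * ((of_int \<alpha> * z + of_int \<beta>) / of_int \<delta>) + of_int d = (of_int r * z + of_int s) / (of_int \<delta> :: complex)"
proof -
  define \<alpha> where "\<alpha> = gcd p r"
  have "p \<noteq> 0 \<or> r \<noteq> 0" using assms by auto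
  hence \<alpha>: "\<alpha> > 0" by (simp add: \<alpha>_def)
  obtain a where a: "p = a * \<alpha>" by (metis \<alpha>_def dvdE gcd_dvd1 mult.commute)
  obtain c where c: "r = c * \<alpha>" by (metis \<alpha>_def dvdE gcd_dvd2 mult.commute)
  obtain u v where "u * p + v * r = \<alpha>" unfolding \<alpha>_def using bezout_int by blast
  hence "(u * a + v * c) * \<alpha> = 1 * \<alpha>" by (simp add: a c algebra_simps)
  hence uv: "u * a + v * c = 1" using \<alpha> by (metis less_irrefl mult_cancel_right)
  define \<delta> where "\<delta> = a * s - c * q"
  define \<beta> where "\<beta> = u * q + v * s"
  have det: "a * u - (- v) * c = 1" using uv by (simp add: algebra_simps)
  have \<alpha>\<delta>: "\<alpha> * \<delta> = p * s - q * r" by (simp add: \<delta>_def a c algebra_simps)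
  have \<delta>: "\<delta> > 0" using assms \<alpha> unfolding \<alpha>\<delta>[symmetric] by (simp add: zero_less_mult_iff)
  have q: "a * \<beta> + (- v) * \<delta> = q"
  proof -
    have "a * \<beta> + (- v) * \<delta> = (u * a + v * c) * q" by (simp add: \<beta>_def \<delta>_def algebra_simps)
    thus ?thesis by (simp add: uv)
  qed
  have s: "c * \<beta> + u * \<delta> = s"
  proof -
    have "c * \<beta> + u * \<delta> = (u * a + v * c) * s" by (simp add: \<beta>_def \<delta>_def algebra_simps)
    thus ?thesis by (simp add: uv)
  qed
  have 1: "of_int c * ((of_int \<alpha> * z + of_int \<beta>) / of_int \<delta>) + of_int u = (of_int r * z + of_int s) / (of_int \<delta> :: complex)"
    and 2: "of_int a * ((of_int \<alpha> * z + of_int \<beta>) / of_int \<delta>) + of_int (- v) = (of_int p * z + of_int q) / (of_int \<delta> :: complex)"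
    for z
    unfolding s[symmetric] q[symmetric] a c using \<delta> by (simp_all add: field_simps)
  show ?thesis
    by (rule that[OF det \<alpha> \<delta> \<alpha>\<delta> a c \<alpha>_def _ 1]) (unfold mob_def 1 2, use \<delta> in simp)
qed

lemma exp_ge_7: "exp (2 * pi) \<ge> 7"
  using exp_ge_add_one_self[of "2 * pi"] pi_gt3 by linarith

text \<open>1/7 bounds exp(-2 pi), the size of q at height 1. Then |q| / (1 - |q|) \<le> 1/6 and
  exp(1/6) \<le> 6/5. The lower bound keeps denominators away from 0.\<close>

lemma euler_prod_bounds:
  assumes "norm q \<le> 1 / 7"
  shows "norm (euler_prod q) \<ge> 4 / 5" "norm (euler_prod q) \<le> 6 / 5"
proof -
  have le: "norm q / (1 - norm q) \<le> 1 / 6" using assms by (simp add: field_simps)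
  have "norm (euler_prod q - 1) \<le> exp (norm q / (1 - norm q)) - 1"
    unfolding euler_prod_def by (rule norm_qp_minus_1) (use assms in auto)
  also have "\<dots> \<le> exp (1 / 6) - 1" using le by simp
  also have "exp (1 / 6 :: real) \<le> 6 / 5"
  proof -
    have "1 - 1 / 6 \<le> inverse (exp (1 / 6 :: real))"
      using exp_ge_add_one_self[of "- (1 / 6) :: real"] by (simp only: exp_minus)
    thus ?thesis by (simp add: field_simps)
  qed
  finally have "norm (euler_prod q - 1) \<le> 1 / 5" by simp
  thus "norm (euler_prod q) \<ge> 4 / 5" "norm (euler_prod q) \<le> 6 / 5"
    using norm_triangle_ineq2[of "euler_prod q" 1] norm_triangle_ineq2[of 1 "euler_prod q"]
    by (simp_all add: norm_minus_commute)
qed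

lemma norm_ex_le:
  assumes "Im z \<ge> 1" shows "norm (ex z) \<le> 1 / 7"
proof -
  have "exp (2 * pi) \<le> exp (2 * pi * Im z)" using assms by simp
  hence "7 \<le> exp (2 * pi * Im z)" using exp_ge_7 by linarith
  thus ?thesis by (simp add: norm_ex exp_minus field_simps)
qed

lemma quotient_bounds:
  fixes x y :: complex
  assumes "norm x \<ge> 4 / 5" "norm x \<le> 6 / 5" "norm y \<ge> 4 / 5" "norm y \<le> 6 / 5"
  shows "norm (x / y ^ 3) \<ge> 1 / 3" "norm (x / y ^ 3) \<le> 3"
proof -
  have 1: "norm y ^ 3 \<ge> (4 / 5) ^ 3" "norm y ^ 3 \<le> (6 / 5) ^ 3"
    using assms by (intro power_mono; simp)+
  have pos: "norm y ^ 3 > 0" using 1(1) by (smt (verit) zero_less_power divide_pos_pos)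
  show "norm (x / y ^ 3) \<ge> 1 / 3" "norm (x / y ^ 3) \<le> 3"
    using 1 assms pos by (simp_all add: norm_divide norm_power field_simps)
qed

text \<open>The size of a Klein form with row (c/3, d/3) near infinity. Its leading exponent is b (b
  - 3) / 18 for the residue b of c modulo 3, which is 0 for b = 0 and -1/9 for b = 1, 2.\<close>

definition cusp_size :: "int \<Rightarrow> complex \<Rightarrow> real" where
  "cusp_size c z = (if 3 dvd c then 1 else exp (2 * pi * Im z / 9))"

text \<open>The bounds are two-sided because Klein forms also occur in denominators, and uniform in
  c, d: shifts and a sign reduce every row to (0, 1/3) or (1/3, d/3), and the latter comes from
  (1/3, 0) by translating z by d. Height 3 makes |e(z/3)| \<le> 1/7.\<close>

lemma klein_cusp_bounds:
  obtains A B where "A > 0"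
    "\<And>c d z. coprime c d \<Longrightarrow> Im z \<ge> 3 \<Longrightarrow> A * cusp_size c z \<le> norm (klein (of_int c / 3) (of_int d / 3) z)"
    "\<And>c d z. coprime c d \<Longrightarrow> Im z \<ge> 3 \<Longrightarrow> norm (klein (of_int c / 3) (of_int d / 3) z) \<le> B * cusp_size c z"
proof -
  define \<kappa> where "\<kappa> = norm (ex (1 / 6) - ex (- (1 / 6)))"
  have \<kappa>: "\<kappa> > 0"
  proof -
    have "T3 \<i> \<noteq> 0" by (rule T_nonzero) (simp add: uhp_def)
    moreover have "\<i> \<in> uhp" by (simp add: uhp_def)
    ultimately show ?thesis by (auto simp: \<kappa>_def T3_product)
  qed
  have T3_bounds: "norm (T3 z) \<ge> \<kappa> * (1 / 3)" "norm (T3 z) \<le> \<kappa> * 3" if "Im z \<ge> 3" for z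
  proof -
    have z: "z \<in> uhp" using that by (simp add: uhp_def)
    have "norm (ex z) \<le> 1 / 7" "norm (ex z ^ 3) \<le> 1 / 7"
      using norm_ex_le[of z] norm_ex_le[of "3 * z"] that by (simp_all add: ex_power)
    from quotient_bounds[OF euler_prod_bounds[OF this(2)] euler_prod_bounds[OF this(1)]]
    show "norm (T3 z) \<ge> \<kappa> * (1 / 3)" "norm (T3 z) \<le> \<kappa> * 3"
      unfolding T3_product[OF z] norm_mult \<kappa>_def[symmetric] using \<kappa>
      by (meson mult_left_mono less_imp_le)+
  qed
  have K3: "norm (klein (1 / 3) (of_int d / 3) z) \<ge> exp (2 * pi * Im z / 9) * (1 / 3)"
           "norm (klein (1 / 3) (of_int d / 3) z) \<le> exp (2 * pi * Im z / 9) * 3" if "Im z \<ge> 3" for z d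
  proof -
    have z: "z \<in> uhp" and z': "z + of_int d \<in> uhp" using that by (simp_all add: uhp_def)
    have "klein (1 / 3) (of_int d / 3) z = klein (1 / 3) 0 (z + of_int d)"
      using klein_modular[OF z, of 1 1 d 0 "1 / 3" 0] by (simp add: mob_def)
    also have "\<dots> = - ex (- (z + of_int d) / 9) * (euler_prod (ex ((z + of_int d) / 3)) / euler_prod (ex (z + of_int d)) ^ 3)"
      by (rule klein_third_0[OF z'])
    finally have eq: "norm (klein (1 / 3) (of_int d / 3) z) = exp (2 * pi * Im z / 9) *
        norm (euler_prod (ex ((z + of_int d) / 3)) / euler_prod (ex (z + of_int d)) ^ 3)"
      by (simp add: norm_mult norm_divide norm_power norm_ex)
    have "norm (ex ((z + of_int d) / 3)) \<le> 1 / 7" "norm (ex (z + of_int d)) \<le> 1 / 7"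
      using that by (intro norm_ex_le; simp)+
    from quotient_bounds[OF euler_prod_bounds[OF this(1)] euler_prod_bounds[OF this(2)]]
    show "norm (klein (1 / 3) (of_int d / 3) z) \<ge> exp (2 * pi * Im z / 9) * (1 / 3)"
         "norm (klein (1 / 3) (of_int d / 3) z) \<le> exp (2 * pi * Im z / 9) * 3"
      unfolding eq by (intro mult_left_mono; simp)+
  qed
  have reduce: "(3 dvd c \<and> norm (klein (of_int c / 3) (of_int d / 3) z) = norm (T3 z)) \<or>
     (\<not> 3 dvd c \<and> (\<exists>d'. norm (klein (of_int c / 3) (of_int d / 3) z) = norm (klein (1 / 3) (of_int d' / 3) z)))"
    if "coprime c d" "z \<in> uhp" for c d z
  proof -
    have shift: "norm (klein (r + of_int m) (of_int e / 3) z) = norm (klein r (of_int e / 3) z)" for r m e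
      unfolding klein_shift1[OF that(2)] by (simp add: norm_mult norm_ex)
    define m where "m = c div 3"
    have "c = 3 * m \<or> c = 3 * m + 1 \<or> c = 3 * m + 2" unfolding m_def by presburger
    thus ?thesis
    proof (elim disjE)
      assume c: "c = 3 * m"
      have "\<not> 3 dvd d"
      proof
        assume "3 dvd d"
        hence "is_unit (3 :: int)" using coprime_common_divisor[OF that(1), of 3] c by simp
        thus False by simp
      qed
      then obtain \<epsilon> where "norm \<epsilon> = 1" "\<And>\<tau>. \<tau> \<in> uhp \<Longrightarrow> klein 0 (of_int d / 3) \<tau> = \<epsilon> * T3 \<tau>"
        by (rule klein_third_norm) blast
      thus ?thesis using shift[of 0 m d] that(2) by (simp add: c norm_mult)
    next
      assume c: "c = 3 * m + 1"
      have "of_int c / 3 = (1 / 3 + of_int m :: complex)" by (simp add: c field_simps)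
      hence "norm (klein (of_int c / 3) (of_int d / 3) z) = norm (klein (1 / 3) (of_int d / 3) z)"
        using shift[of "1 / 3" m d] by (simp only:)
      moreover have "\<not> 3 dvd c" using c by presburger
      ultimately show ?thesis by blast
    next
      assume c: "c = 3 * m + 2"
      have "of_int c / 3 = (- (1 / 3) + of_int (m + 1) :: complex)" by (simp add: c field_simps)
      hence "norm (klein (of_int c / 3) (of_int d / 3) z) = norm (klein (- (1 / 3)) (of_int d / 3) z)"
        using shift[of "- (1 / 3)" "m + 1" d] by (simp only:)
      also have "klein (- (1 / 3)) (of_int d / 3) z = - klein (1 / 3) (of_int (- d) / 3) z"
        using klein_minus[of "1 / 3" "of_int (- d) / 3" z] by simp
      finally have "norm (klein (of_int c / 3) (of_int d / 3) z) = norm (klein (1 / 3) (of_int (- d) / 3) z)"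
        by simp
      moreover have "\<not> 3 dvd c" using c by presburger
      ultimately show ?thesis by blast
    qed
  qed
  show ?thesis
  proof (rule that[of "min (\<kappa> * (1 / 3)) (1 / 3)" "max (\<kappa> * 3) 3"])
    fix c d :: int and z :: complex assume *: "coprime c d" "Im z \<ge> 3"
    hence z: "z \<in> uhp" by (simp add: uhp_def)
    have mm: "min x y * e \<le> y * e" "y * e \<le> max x y * e" if "e \<ge> 0" for x y e :: real
      using that by (auto intro: mult_right_mono)
    show "min (\<kappa> * (1 / 3)) (1 / 3) * cusp_size c z \<le> norm (klein (of_int c / 3) (of_int d / 3) z)"
      using reduce[OF *(1) z]
    proof (elim disjE conjE exE)
      fix d' assume **: "\<not> 3 dvd c" "norm (klein (of_int c / 3) (of_int d / 3) z) = norm (klein (1 / 3) (of_int d' / 3) z)"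
      have "min (\<kappa> * (1 / 3)) (1 / 3) * exp (2 * pi * Im z / 9) \<le> 1 / 3 * exp (2 * pi * Im z / 9)"
        by (rule mm(1)) simp
      also have "\<dots> \<le> norm (klein (1 / 3) (of_int d' / 3) z)"
        using K3(1)[OF *(2), of d'] by (simp only: mult.commute)
      finally show ?thesis using ** by (simp add: cusp_size_def)
    qed (use T3_bounds(1)[OF *(2)] in \<open>auto simp: cusp_size_def\<close>)
    show "norm (klein (of_int c / 3) (of_int d / 3) z) \<le> max (\<kappa> * 3) 3 * cusp_size c z"
      using reduce[OF *(1) z]
    proof (elim disjE conjE exE)
      fix d' assume **: "\<not> 3 dvd c" "norm (klein (of_int c / 3) (of_int d / 3) z) = norm (klein (1 / 3) (of_int d' / 3) z)"
      have "norm (klein (1 / 3) (of_int d' / 3) z) \<le> 3 * exp (2 * pi * Im z / 9)"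
        using K3(2)[OF *(2), of d'] by (simp only: mult.commute)
      also have "\<dots> \<le> max (\<kappa> * 3) 3 * exp (2 * pi * Im z / 9)"
        by (rule mm(2)) simp
      finally show ?thesis using ** by (simp add: cusp_size_def)
    qed (use T3_bounds(2)[OF *(2)] in \<open>auto simp: cusp_size_def\<close>)
  qed (use \<kappa> in auto)
qed

lemma coprime_row: "a * d - b * c = 1 \<Longrightarrow> coprime c (d::int)"
  by (intro coprimeI) (metis dvd_diff dvd_mult)

text \<open>Writing 7 times \<gamma> z as \<gamma>' z' makes \<open>fv\<close> a quotient of two
  Klein forms. If 3 divides c, the numerator is bounded. If 7 divides c but 3 does not, then
  \<alpha> = 7, \<delta> = 1, and the denominator outgrows the numerator. Since \<delta> \<le> 7,
  height 21 for z gives height 3 for z'.\<close>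

lemma fv_cusp_bounds:
  obtains B where "B > 0"
    "\<And>a b c d z. a * d - b * c = 1 \<Longrightarrow> Im z \<ge> 21 \<Longrightarrow> norm (fv (mob a b c d z)) \<le> B * exp (Im z)"
    "\<And>a b c d z. a * d - b * c = 1 \<Longrightarrow> 3 dvd c \<or> 7 dvd c \<Longrightarrow> Im z \<ge> 21 \<Longrightarrow> norm (fv (mob a b c d z)) \<le> B"
proof -
  obtain A B where A: "A > 0" and
    AB: "\<And>c d z. coprime c d \<Longrightarrow> Im z \<ge> 3 \<Longrightarrow> A * cusp_size c z \<le> norm (klein (of_int c / 3) (of_int d / 3) z)"
    "\<And>c d z. coprime c d \<Longrightarrow> Im z \<ge> 3 \<Longrightarrow> norm (klein (of_int c / 3) (of_int d / 3) z) \<le> B * cusp_size c z"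
    using klein_cusp_bounds by metis
  have size1: "cusp_size c z \<ge> 1" if "Im z \<ge> 0" for c z using that by (simp add: cusp_size_def)
  have B: "B > 0"
  proof -
    have "coprime (0::int) 1" "Im (3 * \<i>) \<ge> 3" by simp_all
    from order_trans[OF AB(1)[OF this] AB(2)[OF this]] show ?thesis using A by (simp add: cusp_size_def)
  qed
  have main: "norm (fv (mob a b c d z)) \<le> B / A * exp (Im z) \<and>
      (3 dvd c \<or> 7 dvd c \<longrightarrow> norm (fv (mob a b c d z)) \<le> B / A)"
    if det: "a * d - b * c = 1" and Im: "Im z \<ge> 21" for a b c d z
  proof -
    have z: "z \<in> uhp" using Im by (simp add: uhp_def)
    have "(7 * a) * d - (7 * b) * c = 7" using det by (simp add: algebra_simps)
    then have pos: "(7 * a) * d - (7 * b) * c > 0" and eq7: "(7 * a) * d - (7 * b) * c = 7" by simp_all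
    obtain a' b' c' d' \<beta> \<alpha> \<delta> where h: "a' * d' - b' * c' = 1" "\<alpha> > 0" "\<delta> > 0"
      "\<alpha> * \<delta> = (7 * a) * d - (7 * b) * c" "7 * a = a' * \<alpha>" "c = c' * \<alpha>" "\<alpha> = gcd (7 * a) c"
      "\<And>z. z \<in> uhp \<Longrightarrow> mob (7 * a) (7 * b) c d z = mob a' b' c' d' ((of_int \<alpha> * z + of_int \<beta>) / of_int \<delta>)"
      "\<And>z. of_int c' * ((of_int \<alpha> * z + of_int \<beta>) / of_int \<delta>) + of_int d' = (of_int c * z + of_int d) / (of_int \<delta> :: complex)"
      by (rule hermite_decomposition[OF pos]) (rule that; assumption)
    have \<alpha>\<delta>: "\<alpha> * \<delta> = 7" using h(4) eq7 by simp
    define z' where "z' = (of_int \<alpha> * z + of_int \<beta>) / (of_int \<delta> :: complex)"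
    have "\<alpha> dvd 7" "\<delta> dvd 7" using \<alpha>\<delta> by (metis dvd_triv_left, metis dvd_triv_right)
    hence "\<alpha> \<le> 7" "\<delta> \<le> 7" using zdvd_imp_le by auto
    hence \<delta>7: "real_of_int \<delta> \<le> 7" by simp
    have Imz': "Im z' = of_int \<alpha> * Im z / of_int \<delta>" by (simp add: z'_def)
    have "21 * of_int \<delta> \<le> 7 * Im z" "real_of_int \<alpha> \<ge> 1" using Im \<delta>7 h(2) by auto
    have "3 * real_of_int \<delta> \<le> of_int \<alpha> * Im z"
    proof -
      have "3 * real_of_int \<delta> \<le> 1 * Im z" using Im \<delta>7 by simp
      also have "\<dots> \<le> of_int \<alpha> * Im z" using \<open>real_of_int \<alpha> \<ge> 1\<close> Im by (intro mult_right_mono) auto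
      finally show ?thesis .
    qed
    hence Im3: "Im z' \<ge> 3" using h(3) unfolding Imz' by (simp add: field_simps)
    hence z': "z' \<in> uhp" by (simp add: uhp_def)
    define j where "j = of_int c * z + (of_int d :: complex)"
    have j: "j \<noteq> 0" unfolding j_def by (rule mob_denom_nonzero[of a d b]) (use det z in auto)
    have mz: "mob a b c d z \<in> uhp" by (rule mob_in_uhp) (use det z in auto)
    have 7: "7 * mob a b c d z = mob a' b' c' d' z'"
      using h(8)[OF z] by (simp add: z'_def[symmetric]) (simp add: mob_def algebra_simps)
    define K where "K = klein (of_int c / 3) (of_int d / 3) z"
    define K' where "K' = klein (of_int c' / 3) (of_int d' / 3) z'"
    have T: "T3 (mob a b c d z) = K / j"
      using T3_modular[OF z det] j by (simp add: j_def K_def field_simps)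
    have T': "T3 (mob a' b' c' d' z') = K' * of_int \<delta> / j"
    proof -
      have "of_int c' * z' + of_int d' = j / of_int \<delta>" using h(9)[of z] by (simp add: j_def z'_def)
      from T3_modular[OF z' h(1), unfolded this] have "j / of_int \<delta> * T3 (mob a' b' c' d' z') = K'"
        by (simp add: K'_def)
      thus ?thesis using j h(3) by (simp add: field_simps)
    qed
    have "norm (fv (mob a b c d z)) = norm K / (norm K' * of_int \<delta>)"
      unfolding fv_T3[OF mz] 7 T T' using j h(3) by (simp add: norm_divide norm_mult)
    also have "\<dots> \<le> norm K / (norm K' * 1)"
    proof (cases "norm K' = 0")
      case False
      thus ?thesis using h(3) by (intro divide_left_mono mult_left_mono mult_pos_pos) auto
    qed auto
    also have "\<dots> \<le> B * cusp_size c z / (A * cusp_size c' z')"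
      unfolding mult_1_right K_def K'_def
      using AB(1)[OF coprime_row[OF h(1)] Im3] AB(2)[OF coprime_row[OF det], of z] Im A B size1[of z' c'] Im3
      by (intro frac_le mult_nonneg_nonneg mult_pos_pos) (auto simp: cusp_size_def)
    finally have le: "norm (fv (mob a b c d z)) \<le> B / A * (cusp_size c z / cusp_size c' z')" by simp
    have "cusp_size c z \<le> exp (Im z)"
    proof -
      have "2 * pi * Im z / 9 \<le> Im z" using pi_less_4 Im by (simp add: field_simps)
      thus ?thesis using Im by (auto simp: cusp_size_def)
    qed
    hence "cusp_size c z / cusp_size c' z' \<le> exp (Im z) / 1"
      using size1[of z' c'] Im3 by (intro frac_le) auto
    hence 1: "B / A * (cusp_size c z / cusp_size c' z') \<le> B / A * exp (Im z)"
      using A B by (intro mult_left_mono) auto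
    have 2: "cusp_size c z / cusp_size c' z' \<le> 1" if "3 dvd c \<or> 7 dvd c"
    proof (cases "3 dvd c")
      case True
      thus ?thesis using size1[of z' c'] Im3 by (simp add: cusp_size_def)
    next
      case False
      hence "7 dvd c" using that by simp
      hence "7 dvd \<alpha>" unfolding h(7) by simp
      hence "\<alpha> = 7" using h(2) \<open>\<alpha> \<le> 7\<close> zdvd_imp_le by fastforce
      moreover from this have "\<delta> = 1" using \<alpha>\<delta> by simp
      moreover have "\<not> 3 dvd c'" using False h(6) by auto
      ultimately show ?thesis using False Im by (simp add: cusp_size_def Imz')
    qed
    have "B / A * (cusp_size c z / cusp_size c' z') \<le> B / A * 1" if "3 dvd c \<or> 7 dvd c"
      using A B by (intro mult_left_mono 2 that) auto
    thus ?thesis using le 1 by fastforce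
  qed
  show ?thesis by (rule that[of "B / A"]) (use main A B in auto)
qed

text \<open>Since u is 7 v after the Fricke involution, a matrix of determinant 63 has to be
  decomposed. If 63 does not divide c, then \<delta> \<noteq> 1, so 3 or 7 divides c' = a \<delta>
  and the sharper bound for \<open>fv\<close> applies. The height 1323 is 63 * 21.\<close>

lemma fu_cusp_bounds:
  obtains B where "B > 0"
    "\<And>a b c d z. a * d - b * c = 1 \<Longrightarrow> Im z \<ge> 1323 \<Longrightarrow> norm (fu (mob a b c d z)) \<le> B * exp (63 * Im z)"
    "\<And>a b c d z. a * d - b * c = 1 \<Longrightarrow> \<not> 63 dvd c \<Longrightarrow> Im z \<ge> 1323 \<Longrightarrow> norm (fu (mob a b c d z)) \<le> B"
proof -
  obtain B where B: "B > 0"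
    "\<And>a b c d z. a * d - b * c = 1 \<Longrightarrow> Im z \<ge> 21 \<Longrightarrow> norm (fv (mob a b c d z)) \<le> B * exp (Im z)"
    "\<And>a b c d z. a * d - b * c = 1 \<Longrightarrow> 3 dvd c \<or> 7 dvd c \<Longrightarrow> Im z \<ge> 21 \<Longrightarrow> norm (fv (mob a b c d z)) \<le> B"
    using fv_cusp_bounds by metis
  have main: "norm (fu (mob a b c d z)) \<le> 7 * B * exp (63 * Im z) \<and>
      (\<not> 63 dvd c \<longrightarrow> norm (fu (mob a b c d z)) \<le> 7 * B)"
    if det: "a * d - b * c = 1" and Im: "Im z \<ge> 1323" for a b c d z
  proof -
    have z: "z \<in> uhp" using Im by (simp add: uhp_def)
    have "(- c) * (63 * b) - (- d) * (63 * a) = 63" using det by (simp add: algebra_simps)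
    then have pos: "(- c) * (63 * b) - (- d) * (63 * a) > 0" and eq63: "(- c) * (63 * b) - (- d) * (63 * a) = 63" by simp_all
    obtain a' b' c' d' \<beta> \<alpha> \<delta> where h: "a' * d' - b' * c' = 1" "\<alpha> > 0" "\<delta> > 0"
      "\<alpha> * \<delta> = (- c) * (63 * b) - (- d) * (63 * a)" "- c = a' * \<alpha>" "63 * a = c' * \<alpha>"
      "\<And>z. z \<in> uhp \<Longrightarrow> mob (- c) (- d) (63 * a) (63 * b) z = mob a' b' c' d' ((of_int \<alpha> * z + of_int \<beta>) / of_int \<delta>)"
      by (rule hermite_decomposition[OF pos]) (rule that; assumption)
    have \<alpha>\<delta>: "\<alpha> * \<delta> = 63" using h(4) eq63 by simp
    define z' where "z' = (of_int \<alpha> * z + of_int \<beta>) / (of_int \<delta> :: complex)"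
    have dvd: "\<alpha> dvd 63" "\<delta> dvd 63" using \<alpha>\<delta> by (metis dvd_triv_left, metis dvd_triv_right)
    hence "\<alpha> \<le> 63" "\<delta> \<le> 63" using zdvd_imp_le by auto
    hence le63: "real_of_int \<alpha> \<le> 63" "real_of_int \<delta> \<le> 63" "real_of_int \<alpha> \<ge> 1" "real_of_int \<delta> \<ge> 1"
      using h(2,3) by auto
    have Imz': "Im z' = of_int \<alpha> * Im z / of_int \<delta>" by (simp add: z'_def)
    have "21 * real_of_int \<delta> \<le> of_int \<alpha> * Im z"
    proof -
      have "21 * real_of_int \<delta> \<le> 1 * Im z" using Im le63 by simp
      also have "\<dots> \<le> of_int \<alpha> * Im z" using le63 Im by (intro mult_right_mono) auto
      finally show ?thesis .
    qed
    hence Im21: "Im z' \<ge> 21" using h(3) unfolding Imz' by (simp add: field_simps)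
    have "of_int \<alpha> * Im z / of_int \<delta> \<le> 63 * Im z / 1"
      using le63 Im by (intro frac_le mult_right_mono) auto
    hence Im63: "Im z' \<le> 63 * Im z" by (simp add: Imz')
    have mz: "mob a b c d z \<in> uhp" by (rule mob_in_uhp) (use det z in auto)
    have num: "of_int a * z + of_int b \<noteq> (0 :: complex)"
      using mob_denom_nonzero[of "- c" b "- d" a z] det z by (simp add: algebra_simps)
    have den: "of_int c * z + of_int d \<noteq> (0 :: complex)"
      by (rule mob_denom_nonzero[of a d b]) (use det z in auto)
    have "fricke (mob a b c d z) = mob (- c) (- d) (63 * a) (63 * b) z"
      using num den by (simp add: fricke_def mob_def)
    also have "\<dots> = mob a' b' c' d' z'" using h(7)[OF z] by (simp add: z'_def)
    finally have "fu (mob a b c d z) = 7 * fv (mob a' b' c' d' z')"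
      using fv_fricke[OF mz] by (simp add: field_simps)
    hence eq: "norm (fu (mob a b c d z)) = 7 * norm (fv (mob a' b' c' d' z'))"
      by (simp add: norm_mult)
    have "B * exp (Im z') \<le> B * exp (63 * Im z)" using Im63 B(1) by simp
    hence 1: "norm (fv (mob a' b' c' d' z')) \<le> B * exp (63 * Im z)"
      using B(2)[OF h(1) Im21] by linarith
    have 2: "norm (fv (mob a' b' c' d' z')) \<le> B" if "\<not> 63 dvd c"
    proof (rule B(3)[OF h(1) _ Im21])
      have "\<delta> \<noteq> 1"
      proof
        assume "\<delta> = 1"
        hence "\<alpha> = 63" using \<alpha>\<delta> by simp
        hence "63 dvd - c" unfolding h(5) by simp
        thus False using that by simp
      qed
      have "a * \<delta> * \<alpha> = a * (\<alpha> * \<delta>)" by (simp only: mult_ac)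
      also have "\<dots> = c' * \<alpha>" using \<alpha>\<delta> h(6) by simp
      finally have "c' * \<alpha> = a * \<delta> * \<alpha>" ..
      hence c': "c' = a * \<delta>" using h(2) by simp
      have "\<delta> dvd 3 * 3 * 7" using dvd(2) by simp
      have "3 dvd \<delta> \<or> 7 dvd \<delta>"
      proof (rule ccontr)
        assume "\<not> (3 dvd \<delta> \<or> 7 dvd \<delta>)"
        hence "coprime \<delta> 3" "coprime \<delta> 7"
          using prime_imp_coprime[of 3 \<delta>] prime_imp_coprime[of 7 \<delta>] by (auto simp: coprime_commute)
        hence "\<delta> dvd 1" using \<open>\<delta> dvd 3 * 3 * 7\<close>
          by (metis coprime_dvd_mult_left_iff mult.right_neutral coprime_mult_right_iff coprime_absorb_left)
        thus False using \<open>\<delta> \<noteq> 1\<close> h(3) by simp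
      qed
      thus "3 dvd c' \<or> 7 dvd c'" unfolding c' by auto
    qed
    show ?thesis unfolding eq using 1 2 by auto
  qed
  show ?thesis by (rule that[of "7 * B"]) (use main B(1) in auto)
qed

section \<open>The fields of modular functions\<close>

lift_definition mero_of :: "(complex \<Rightarrow> complex) \<Rightarrow> mero_uhp" is
  "\<lambda>f. if f meromorphic_on uhp then f else (\<lambda>_. 0)"
  by auto

lemma mero_of_exhaust:
  obtains f where "f meromorphic_on uhp" "F = mero_of f"
proof -
  have "\<exists>f. f meromorphic_on uhp \<and> F = mero_of f"
  proof transfer
    fix F :: "complex \<Rightarrow> complex"
    assume "F meromorphic_on uhp \<and> F meromorphic_on uhp \<and> (\<forall>\<^sub>\<approx>z\<in>uhp. F z = F z)"
    thus "\<exists>f. f meromorphic_on uhp \<and> F meromorphic_on uhp \<and>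
        (if f meromorphic_on uhp then f else (\<lambda>_. 0)) meromorphic_on uhp \<and>
        (\<forall>\<^sub>\<approx>z\<in>uhp. F z = (if f meromorphic_on uhp then f else (\<lambda>_. 0)) z)"
      by (intro exI[of _ F]) simp
  qed
  thus ?thesis using that by blast
qed

lemma mero_of_eq_iff:
  assumes "f meromorphic_on uhp" "g meromorphic_on uhp"
  shows "mero_of f = mero_of g \<longleftrightarrow> (\<forall>\<^sub>\<approx>z\<in>uhp. f z = g z)"
  using assms by transfer auto

lemma eventually_in_uhp: "\<forall>\<^sub>\<approx>z\<in>uhp. z \<in> uhp"
  by (rule eventually_in_cosparse) (auto simp: open_uhp)

lemma mero_of_eqI:
  assumes "f meromorphic_on uhp" "g meromorphic_on uhp" "\<And>z. z \<in> uhp \<Longrightarrow> f z = g z"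
  shows "mero_of f = mero_of g"
  unfolding mero_of_eq_iff[OF assms(1,2)] using eventually_in_uhp
  by eventually_elim (rule assms(3))

lemma mero_of_add: "f meromorphic_on uhp \<Longrightarrow> g meromorphic_on uhp \<Longrightarrow> mero_of f + mero_of g = mero_of (\<lambda>z. f z + g z)"
  and mero_of_diff: "f meromorphic_on uhp \<Longrightarrow> g meromorphic_on uhp \<Longrightarrow> mero_of f - mero_of g = mero_of (\<lambda>z. f z - g z)"
  and mero_of_mult: "f meromorphic_on uhp \<Longrightarrow> g meromorphic_on uhp \<Longrightarrow> mero_of f * mero_of g = mero_of (\<lambda>z. f z * g z)"
  and mero_of_inverse: "f meromorphic_on uhp \<Longrightarrow> inverse (mero_of f) = mero_of (\<lambda>z. inverse (f z))"
  by (transfer; auto intro!: meromorphic_intros)+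

lemma mero_of_const: "mero_of (\<lambda>_. c) = const_mero c"
  by transfer auto

lemma mero_of_power: "f meromorphic_on uhp \<Longrightarrow> mero_of f ^ n = mero_of (\<lambda>z. f z ^ n)"
proof (induction n)
  case 0
  show ?case using mero_of_const[of 1] by (simp add: one_mero_uhp_def const_mero_def)
next
  case (Suc n)
  thus ?case by (simp add: mero_of_mult meromorphic_intros)
qed

lemma pullback_mero_of:
  assumes "det M > 0" "f meromorphic_on uhp"
  shows "pullback M (mero_of f) = mero_of (\<lambda>z. f (act M z))"
  using assms by transfer (auto intro!: meromorphic_on_act)

lemma pullback_ring:
  "pullback M (F + G) = pullback M F + pullback M G"
  "pullback M (F - G) = pullback M F - pullback M G"
  "pullback M (F * G) = pullback M F * pullback M G"
  "pullback M (inverse F) = inverse (pullback M F)"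
  "pullback M (const_mero c) = const_mero c"
  by (transfer; auto intro!: meromorphic_intros meromorphic_on_act)+

lemma act_mat2: "act (mat2 (of_int a) (of_int b) (of_int c) (of_int d)) = mob a b c d"
  by (simp add: act_def moebius_def mob_def fun_eq_iff)

subsection \<open>Laurent expansions at the cusps\<close>

lemma has_q_expansion_mero_of:
  assumes "f meromorphic_on uhp"
  shows "has_q_expansion h (mero_of f) L \<longleftrightarrow> fls_conv_radius L > 0 \<and>
           (\<exists>c>0. \<forall>\<^sub>\<approx>z\<in>{z. Im z > c}. f z = eval_fls L (ex (z / of_nat h)))"
  using assms by transfer (simp add: ex_def)

lemma cosparse_half_plane_mono:
  assumes "\<forall>\<^sub>\<approx>z\<in>{z. Im z > c}. P z" "c \<le> c'"
  shows "\<forall>\<^sub>\<approx>z\<in>{z. Im z > c'}. P z"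
  using assms(1) unfolding eventually_cosparse
  by (rule sparse_in_subset) (use assms(2) in auto)

lemma eventually_in_half_plane: "\<forall>\<^sub>\<approx>z\<in>{z. Im z > c}. Im z > c"
  using eventually_in_cosparse[of "{z. Im z > c}" "{z. Im z > c}"] by (simp add: open_halfspace_Im_gt)

text \<open>z -> e(z/h) maps high half-planes into small punctured discs, so local statements at q =
  0 become statements for large Im z.\<close>

lemma eventually_at_0_ex:
  assumes "eventually P (at (0::complex))" "h > (0::nat)"
  obtains c where "c > 0" "\<And>z. Im z > c \<Longrightarrow> P (ex (z / of_nat h))"
proof -
  obtain r where r: "r > 0" "\<And>q. q \<noteq> 0 \<Longrightarrow> norm q < r \<Longrightarrow> P q"
    using assms(1) unfolding eventually_at by auto
  define c where "c = real h * (\<bar>ln r\<bar> + 1)"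
  show ?thesis
  proof (rule that[of c])
    show "c > 0" using assms(2) unfolding c_def by (intro mult_pos_pos) auto
    fix z :: complex assume "Im z > c"
    hence "\<bar>ln r\<bar> + 1 < Im z / real h" using assms(2) by (simp add: c_def field_simps)
    moreover have "0 \<le> Im z / real h" using calculation by linarith
    moreover have "1 * (Im z / real h) \<le> 2 * pi * (Im z / real h)"
      using calculation(2) pi_gt3 by (intro mult_right_mono) auto
    ultimately have "- (2 * pi * (Im z / real h)) < ln r" by linarith
    hence "exp (- (2 * pi * (Im z / real h))) < exp (ln r)" by (simp only: exp_less_cancel_iff)
    thus "P (ex (z / of_nat h))" using r(1) by (intro r(2)) (simp_all add: norm_ex)
  qed
qed

lemma has_q_expansionI:
  assumes "f meromorphic_on uhp" "h > 0" "\<Phi> has_laurent_expansion L"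
    "\<forall>\<^sub>\<approx>z\<in>{z. Im z > c}. f z = \<Phi> (ex (z / of_nat h))"
  shows "has_q_expansion h (mero_of f) L"
proof -
  have L: "fls_conv_radius L > 0" "eventually (\<lambda>q. eval_fls L q = \<Phi> q) (at 0)"
    using assms(3) by (auto simp: has_laurent_expansion_def)
  obtain c' where c': "c' > 0" "\<And>z. Im z > c' \<Longrightarrow> eval_fls L (ex (z / of_nat h)) = \<Phi> (ex (z / of_nat h))"
    using eventually_at_0_ex[OF L(2) assms(2)] by blast
  define c'' where "c'' = max c c'"
  have 1: "\<forall>\<^sub>\<approx>z\<in>{z. Im z > c''}. f z = \<Phi> (ex (z / of_nat h))"
    by (rule cosparse_half_plane_mono[OF assms(4)]) (simp add: c''_def)
  have "\<forall>\<^sub>\<approx>z\<in>{z. Im z > c''}. f z = eval_fls L (ex (z / of_nat h))"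
    using 1 eventually_in_half_plane[of c'']
  proof eventually_elim
    case (elim z)
    thus ?case using c'(2)[of z] by (simp add: c''_def)
  qed
  moreover have "c'' > 0" using c'(1) by (simp add: c''_def)
  ultimately show ?thesis unfolding has_q_expansion_mero_of[OF assms(1)] using L(1) by blast
qed

lemma has_q_expansionE:
  assumes "has_q_expansion h (mero_of f) L" "f meromorphic_on uhp"
  obtains c where "c > 0" "eval_fls L has_laurent_expansion L"
    "\<forall>\<^sub>\<approx>z\<in>{z. Im z > c}. f z = eval_fls L (ex (z / of_nat h))"
  using assms unfolding has_q_expansion_mero_of[OF assms(2)]
  by (auto intro: eval_fls_has_laurent_expansion)

lemma has_q_expansion_binop:
  assumes "has_q_expansion h F L" "has_q_expansion h G M" "h > 0"
  shows "has_q_expansion h (F + G) (L + M)" "has_q_expansion h (F - G) (L - M)"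
        "has_q_expansion h (F * G) (L * M)"
proof -
  obtain f where f: "f meromorphic_on uhp" "F = mero_of f" using mero_of_exhaust .
  obtain g where g: "g meromorphic_on uhp" "G = mero_of g" using mero_of_exhaust .
  obtain c where c: "c > 0" "eval_fls L has_laurent_expansion L"
    "\<forall>\<^sub>\<approx>z\<in>{z. Im z > c}. f z = eval_fls L (ex (z / of_nat h))"
    using has_q_expansionE[OF assms(1)[unfolded f(2)] f(1)] .
  obtain c' where c': "c' > 0" "eval_fls M has_laurent_expansion M"
    "\<forall>\<^sub>\<approx>z\<in>{z. Im z > c'}. g z = eval_fls M (ex (z / of_nat h))"
    using has_q_expansionE[OF assms(2)[unfolded g(2)] g(1)] .
  define d where "d = max c c'"
  have ev: "\<forall>\<^sub>\<approx>z\<in>{z. Im z > d}. f z = eval_fls L (ex (z / of_nat h)) \<and> g z = eval_fls M (ex (z / of_nat h))"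
    by (intro eventually_conj cosparse_half_plane_mono[OF c(3)] cosparse_half_plane_mono[OF c'(3)])
       (auto simp: d_def)
  show "has_q_expansion h (F + G) (L + M)"
    unfolding f g mero_of_add[OF f(1) g(1)]
    by (rule has_q_expansionI[OF _ assms(3) has_laurent_expansion_add[OF c(2) c'(2)]])
       (use f g in \<open>auto intro!: meromorphic_intros eventually_mono[OF ev]\<close>)
  show "has_q_expansion h (F - G) (L - M)"
    unfolding f g mero_of_diff[OF f(1) g(1)]
    by (rule has_q_expansionI[OF _ assms(3) has_laurent_expansion_diff[OF c(2) c'(2)]])
       (use f g in \<open>auto intro!: meromorphic_intros eventually_mono[OF ev]\<close>)
  show "has_q_expansion h (F * G) (L * M)"
    unfolding f g mero_of_mult[OF f(1) g(1)]
    by (rule has_q_expansionI[OF _ assms(3) has_laurent_expansion_mult[OF c(2) c'(2)]])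
       (use f g in \<open>auto intro!: meromorphic_intros eventually_mono[OF ev]\<close>)
qed

lemma has_q_expansion_inverse:
  assumes "has_q_expansion h F L" "h > 0"
  shows "has_q_expansion h (inverse F) (inverse L)"
proof -
  obtain f where f: "f meromorphic_on uhp" "F = mero_of f" using mero_of_exhaust .
  obtain c where c: "c > 0" "eval_fls L has_laurent_expansion L"
    "\<forall>\<^sub>\<approx>z\<in>{z. Im z > c}. f z = eval_fls L (ex (z / of_nat h))"
    using has_q_expansionE[OF assms(1)[unfolded f(2)] f(1)] .
  show ?thesis
    unfolding f mero_of_inverse[OF f(1)]
    by (rule has_q_expansionI[OF _ assms(2) has_laurent_expansion_inverse[OF c(2)]])
       (use f in \<open>auto intro!: meromorphic_intros eventually_mono[OF c(3)]\<close>)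
qed

lemma has_q_expansion_const: "h > 0 \<Longrightarrow> has_q_expansion h (const_mero c) (fls_const c)"
  unfolding mero_of_const[symmetric]
  by (rule has_q_expansionI[of _ _ "\<lambda>_. c" _ 0]) auto

text \<open>Substituting q^k for q passes to a finer parameter. Two functions may come with
  different widths at the same cusp, and h * k is a common one.\<close>

lemma has_q_expansion_refine:
  assumes "has_q_expansion h F L" "h > 0" "k > 0"
  obtains L' where "has_q_expansion (h * k) F L'"
proof -
  obtain f where f: "f meromorphic_on uhp" "F = mero_of f" using mero_of_exhaust .
  obtain c where c: "c > 0" "eval_fls L has_laurent_expansion L"
    "\<forall>\<^sub>\<approx>z\<in>{z. Im z > c}. f z = eval_fls L (ex (z / of_nat h))"
    using has_q_expansionE[OF assms(1)[unfolded f(2)] f(1)] .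
  have "(\<lambda>q::complex. q ^ k) has_fps_expansion fps_X ^ k"
    by (intro fps_expansion_intros)
  hence "(\<lambda>q::complex. q ^ k) has_laurent_expansion fps_to_fls (fps_X ^ k)"
    by (rule has_laurent_expansion_fps)
  hence *: "(eval_fls L \<circ> (\<lambda>q. q ^ k)) has_laurent_expansion fls_compose_fps L (fps_X ^ k)"
    by (rule has_laurent_expansion_compose[OF c(2)]) (use assms(3) in \<open>auto simp: fps_X_power_nth\<close>)
  have "ex (z / of_nat (h * k)) ^ k = ex (z / of_nat h)" for z
    using assms by (simp add: ex_power)
  hence "has_q_expansion (h * k) F (fls_compose_fps L (fps_X ^ k))"
    unfolding f(2) by (intro has_q_expansionI[OF f(1) _ *]) (use assms c(3) in auto)
  thus ?thesis by (rule that)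
qed

lemma is_subfield_C_X0: "is_subfield (C_X0 N)" and const_mero_in_C_X0: "const_mero c \<in> C_X0 N"
proof -
  show const: "const_mero c \<in> C_X0 N" for c
    using has_q_expansion_const[of 1 c]
    by (auto simp: C_X0_def pullback_ring meromorphic_at_cusps_def intro!: exI[of _ "1::nat"])
  have cusps: "meromorphic_at_cusps (F + G)" "meromorphic_at_cusps (F - G)" "meromorphic_at_cusps (F * G)"
    if FG: "meromorphic_at_cusps F" "meromorphic_at_cusps G" for F G
  proof -
    have "\<exists>h>0. \<exists>L M. has_q_expansion h (pullback A F) L \<and> has_q_expansion h (pullback A G) M"
      if "A \<in> Gamma0 1" for A
    proof -
      obtain h L where h: "h > 0" "has_q_expansion h (pullback A F) L"
        using FG(1) \<open>A \<in> _\<close> unfolding meromorphic_at_cusps_def by blast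
      obtain k M where k: "k > 0" "has_q_expansion k (pullback A G) M"
        using FG(2) \<open>A \<in> _\<close> unfolding meromorphic_at_cusps_def by blast
      obtain L' where L': "has_q_expansion (h * k) (pullback A F) L'"
        using has_q_expansion_refine[OF h(2,1) k(1)] .
      obtain M' where "has_q_expansion (k * h) (pullback A G) M'"
        using has_q_expansion_refine[OF k(2,1) h(1)] .
      with L' show ?thesis using h(1) k(1) by (metis mult.commute mult_pos_pos)
    qed
    thus "meromorphic_at_cusps (F + G)" "meromorphic_at_cusps (F - G)" "meromorphic_at_cusps (F * G)"
      unfolding meromorphic_at_cusps_def pullback_ring by (meson has_q_expansion_binop)+
  qed
  have inv: "meromorphic_at_cusps (inverse F)" if "meromorphic_at_cusps F" for F
    using that unfolding meromorphic_at_cusps_def pullback_ring by (meson has_q_expansion_inverse)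
  have "0 = const_mero 0" "1 = const_mero (1::complex)"
    by (simp_all add: const_mero_0 zero_mero_uhp_def one_mero_uhp_def const_mero_def)
  thus "is_subfield (C_X0 N)"
    unfolding is_subfield_def using const[of 0] const[of 1] cusps inv
    by (auto simp: C_X0_def pullback_ring)
qed

section \<open>Rationality of the coefficients\<close>

definition rational_fls :: "complex fls \<Rightarrow> bool" where
  "rational_fls L \<longleftrightarrow> (\<forall>n. fls_nth L n \<in> \<rat>)"

lemma rational_fps_inverse:
  fixes f :: "complex fps"
  assumes "\<And>n. fps_nth f n \<in> \<rat>" "fps_nth f 0 \<noteq> 0"
  shows "fps_nth (inverse f) n \<in> \<rat>"
proof (induction n rule: less_induct)
  case (less n)
  have "inverse f * f = 1" using assms(2) by (rule inverse_mult_eq_1)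
  hence "fps_nth (inverse f * f) n = fps_nth 1 n" by simp
  hence "(\<Sum>i<n. fps_nth (inverse f) i * fps_nth f (n - i)) + fps_nth (inverse f) n * fps_nth f 0 =
           (if n = 0 then 1 else 0)"
    by (simp add: fps_mult_nth atLeast0AtMost flip: lessThan_Suc_atMost)
  hence "fps_nth (inverse f) n = ((if n = 0 then 1 else 0) -
           (\<Sum>i<n. fps_nth (inverse f) i * fps_nth f (n - i))) / fps_nth f 0"
    using assms(2) by (simp add: field_simps)
  also have "\<dots> \<in> \<rat>"
    by (intro Rats_divide Rats_diff Rats_sum Rats_mult assms(1) less) auto
  finally show ?case .
qed

lemma rational_fls_ops:
  assumes "rational_fls L" "rational_fls M"
  shows "rational_fls (L + M)" "rational_fls (L - M)" "rational_fls (L * M)" "rational_fls (inverse L)"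
proof -
  show "rational_fls (L + M)" "rational_fls (L - M)"
    using assms by (auto simp: rational_fls_def)
  show "rational_fls (L * M)"
    using assms by (auto simp: rational_fls_def fls_times_nth(2) intro!: Rats_sum)
  show "rational_fls (inverse L)"
  proof (cases "L = 0")
    case False
    have "fps_nth (inverse (fls_base_factor_to_fps L)) n \<in> \<rat>" for n
      using assms(1) False by (intro rational_fps_inverse) (auto simp: rational_fls_def)
    thus ?thesis by (auto simp: rational_fls_def fls_inverse_def)
  qed (auto simp: rational_fls_def)
qed

lemma Q_X0_iff: "F \<in> Q_X0 N \<longleftrightarrow> F \<in> C_X0 N \<and> (\<exists>L. has_q_expansion 1 F L \<and> rational_fls L)"
  by (simp add: Q_X0_def rational_fls_def)

lemma is_subfield_Q_X0: "is_subfield (Q_X0 N)"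
proof -
  have c01: "0 = const_mero 0" "1 = const_mero (1::complex)"
    by (simp_all add: const_mero_0 zero_mero_uhp_def one_mero_uhp_def const_mero_def)
  have "const_mero 0 \<in> Q_X0 N" "const_mero 1 \<in> Q_X0 N"
    using const_mero_in_C_X0 has_q_expansion_const[of 1] unfolding Q_X0_iff
    by (auto simp: rational_fls_def intro!: exI[of _ "fls_const _"])
  moreover note C = is_subfield_C_X0[of N, unfolded is_subfield_def]
  have "F + G \<in> Q_X0 N \<and> F - G \<in> Q_X0 N \<and> F * G \<in> Q_X0 N \<and> inverse F \<in> Q_X0 N"
    if FG: "F \<in> Q_X0 N" "G \<in> Q_X0 N" for F G
  proof -
    obtain L M where L: "has_q_expansion 1 F L" "rational_fls L" and M: "has_q_expansion 1 G M" "rational_fls M"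
      using FG unfolding Q_X0_iff by blast
    show ?thesis
      using C FG has_q_expansion_binop[OF L(1) M(1) zero_less_one] has_q_expansion_inverse[OF L(1) zero_less_one]
        rational_fls_ops[OF L(2) M(2)] unfolding Q_X0_iff by blast
  qed
  ultimately show ?thesis unfolding is_subfield_def c01 by blast
qed

subsection \<open>Rational expansions of the eta quotients\<close>

text \<open>The partial products have integer coefficients. Uniform convergence makes each Taylor
  coefficient a limit of integers, hence an integer, because the integers are closed.\<close>

lemma euler_prod_fps_rational:
  assumes "k > 0"
  obtains E where "(\<lambda>q. euler_prod (q ^ k)) has_fps_expansion E" "\<And>n. fps_nth E n \<in> \<rat>"
proof -
  define f where "f = (\<lambda>q. euler_prod (q ^ k))"
  define P where "P = (\<lambda>N q::complex. \<Prod>n<N. 1 - (q ^ k) ^ Suc n)"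
  have "f holomorphic_on ball 0 1" unfolding f_def by (rule euler_prod_power_holomorphic[OF assms])
  hence f: "f has_fps_expansion fps_expansion f 0"
    by (intro analytic_at_imp_has_fps_expansion_0) (auto simp: analytic_at intro!: exI[of _ "ball 0 1"])
  have "uniform_limit (cball 0 (1 / 2)) (\<lambda>N q. \<Prod>n<N. 1 - q ^ Suc n) euler_prod sequentially"
    by (rule euler_prod_holomorphic(2)) auto
  hence ul: "\<forall>\<^sub>F N in sequentially. \<forall>q\<in>cball 0 (1 / 2). dist (\<Prod>n<N. 1 - q ^ Suc n) (euler_prod q) < e"
    if "e > 0" for e using that by (rule uniform_limitD)
  have "uniform_limit (ball 0 (1 / 2)) P f sequentially"
  proof (rule uniform_limitI)
    fix e :: real assume "e > 0"
    from ul[OF this] show "\<forall>\<^sub>F N in sequentially. \<forall>q\<in>ball 0 (1 / 2). dist (P N q) (f q) < e"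
    proof eventually_elim
      case (elim N)
      have "q ^ k \<in> cball 0 (1 / 2)" if "q \<in> ball 0 (1 / 2)" for q :: complex
      proof -
        have "norm q ^ k \<le> norm q ^ 1" using that assms by (intro power_decreasing) auto
        thus ?thesis using that by (simp add: norm_power)
      qed
      thus ?case using elim unfolding P_def f_def by blast
    qed
  qed
  hence lim: "(\<lambda>N. (deriv ^^ m) (P N) 0) \<longlonglongrightarrow> (deriv ^^ m) f 0" for m
    by (rule higher_deriv_complex_uniform_limit) (auto simp: P_def intro!: holomorphic_intros always_eventually)
  have "\<exists>p. P N has_fps_expansion p \<and> (\<forall>n. fps_nth p n \<in> \<int>)" for N
  proof (induction N)
    case 0
    show ?case by (rule exI[of _ 1]) (auto simp: P_def)
  next
    case (Suc N)
    then obtain p where p: "P N has_fps_expansion p" "\<And>n. fps_nth p n \<in> \<int>" by blast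
    have "P (Suc N) has_fps_expansion p * (1 - (fps_X ^ k) ^ Suc N)"
      using p(1) unfolding P_def prod.lessThan_Suc by (intro fps_expansion_intros)
    moreover have "fps_nth (p * (1 - (fps_X ^ k) ^ Suc N)) n \<in> \<int>" for n
      unfolding fps_mult_nth power_mult[symmetric]
      by (intro Ints_sum Ints_mult p(2)) (auto simp: fps_X_power_nth)
    ultimately show ?case by blast
  qed
  then obtain p where p: "\<And>N. P N has_fps_expansion p N" "\<And>N n. fps_nth (p N) n \<in> \<int>" by metis
  have nth: "(deriv ^^ m) (P N) 0 = fact m * fps_nth (p N) m" for m N
    using fps_nth_fps_expansion[OF p(1), of N m] by (simp add: field_simps)
  have "fps_nth (fps_expansion f 0) m \<in> \<int>" for m
  proof (rule closed_sequentially[OF closed_Ints])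
    show "(\<lambda>N. fps_nth (p N) m) \<longlonglongrightarrow> fps_nth (fps_expansion f 0) m"
      using tendsto_divide[OF lim[of m] tendsto_const[of "fact m"]]
      by (simp add: nth fps_expansion_def)
  qed (use p(2) in auto)
  hence "fps_nth (fps_expansion f 0) m \<in> \<rat>" for m
    using Ints_subset_Rats by blast
  with f show ?thesis unfolding f_def by (rule that)
qed

definition rational_at_0 :: "(complex \<Rightarrow> complex) \<Rightarrow> bool" where
  "rational_at_0 f \<longleftrightarrow> (\<exists>L. f has_laurent_expansion L \<and> rational_fls L)"

lemma rational_at_0_ops:
  assumes "rational_at_0 f" "rational_at_0 g"
  shows "rational_at_0 (\<lambda>q. f q * g q)" "rational_at_0 (\<lambda>q. f q / g q)"
proof -
  obtain L M where LM: "f has_laurent_expansion L" "rational_fls L" "g has_laurent_expansion M" "rational_fls M"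
    using assms by (auto simp: rational_at_0_def)
  show "rational_at_0 (\<lambda>q. f q * g q)"
    unfolding rational_at_0_def
    by (rule exI[of _ "L * M"]) (use LM in \<open>auto intro: has_laurent_expansion_mult rational_fls_ops\<close>)
  have "(\<lambda>q. f q * inverse (g q)) has_laurent_expansion L * inverse M"
    by (intro has_laurent_expansion_mult has_laurent_expansion_inverse LM)
  thus "rational_at_0 (\<lambda>q. f q / g q)"
    unfolding rational_at_0_def divide_inverse
    by (intro exI[of _ "L * inverse M"]) (use LM in \<open>auto intro: rational_fls_ops\<close>)
qed

lemma rational_at_0_const: "rational_at_0 (\<lambda>_. 1)"
  unfolding rational_at_0_def by (rule exI[of _ 1]) (auto simp: rational_fls_def)

lemma rational_at_0_power: "rational_at_0 f \<Longrightarrow> rational_at_0 (\<lambda>q. f q ^ n)"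
  by (induction n) (auto intro: rational_at_0_const rational_at_0_ops)

lemma rational_at_0_X: "rational_at_0 (\<lambda>q. q)"
  unfolding rational_at_0_def
proof (intro exI[of _ fls_X] conjI)
  show "(\<lambda>q::complex. q) has_laurent_expansion fls_X"
    by (rule has_laurent_expansion_fps_X)
qed (auto simp: rational_fls_def fls_X_nth)

lemma rational_at_0_euler_prod: "k > 0 \<Longrightarrow> rational_at_0 (\<lambda>q. euler_prod (q ^ k))"
  by (rule euler_prod_fps_rational[of k])
     (auto simp: rational_at_0_def rational_fls_def intro!: exI[of _ "fps_to_fls _"] has_laurent_expansion_fps)

lemma rational_at_0_Q:
  "rational_at_0 (\<lambda>q. QU q / q ^ 6)" "rational_at_0 QV" "rational_at_0 (\<lambda>q. QX q / q ^ 2)"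
proof -
  have 1: "rational_at_0 euler_prod" using rational_at_0_euler_prod[of 1] by simp
  show "rational_at_0 (\<lambda>q. QU q / q ^ 6)" "rational_at_0 QV" "rational_at_0 (\<lambda>q. QX q / q ^ 2)"
    unfolding QU_def QV_def QX_def
    by (intro rational_at_0_ops rational_at_0_power rational_at_0_euler_prod rational_at_0_X 1; simp)+
qed

subsection \<open>Membership of the eta quotients\<close>

lemma holomorphic_imp_meromorphic_on_uhp: "f holomorphic_on uhp \<Longrightarrow> f meromorphic_on uhp"
  by (intro analytic_on_imp_meromorphic_on) (simp add: analytic_on_open open_uhp)

lemma Gamma0E:
  assumes "M \<in> Gamma0 N"
  obtains a b c d where "M = mat2 (of_int a) (of_int b) (of_int c) (of_int d)" "a * d - b * c = 1" "int N dvd c"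
  using assms unfolding Gamma0_def by blast

lemma det_mat2_int: "a * d - b * c = 1 \<Longrightarrow> det (mat2 (of_int a) (of_int b) (of_int c) (of_int d)) > 0"
  by (simp flip: of_int_mult)

text \<open>Exponential growth at a cusp means a pole there. In the parameter e(z/63) its order is
  at most 63 N, which gives the required Laurent expansion of width 63.\<close>

lemma mero_of_in_C_X0:
  assumes hol: "f holomorphic_on uhp" and inv: "G0_invariant f"
    and growth: "\<And>a b c d. a * d - b * c = 1 \<Longrightarrow>
      \<exists>B N y0. \<forall>z. Im z > y0 \<longrightarrow> norm (f (mob a b c d z)) \<le> B * exp (real N * Im z)"
  shows "mero_of f \<in> C_X0 63"
proof -
  note mero = holomorphic_imp_meromorphic_on_uhp[OF hol]
  have comp: "(\<lambda>z. f (mob a b c d z)) meromorphic_on uhp" if "a * d - b * c = 1" for a b c d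
    by (intro holomorphic_imp_meromorphic_on_uhp compose_mob_holomorphic[OF hol]) (use that in auto)
  have pb: "pullback (mat2 (of_int a) (of_int b) (of_int c) (of_int d)) (mero_of f) = mero_of (\<lambda>z. f (mob a b c d z))"
    if "a * d - b * c = 1" for a b c d
    by (subst pullback_mero_of[OF det_mat2_int[OF that] mero]) (simp add: act_mat2)
  have "pullback M (mero_of f) = mero_of f" if "M \<in> Gamma0 63" for M
    using that
  proof (rule Gamma0E)
    fix a b c d assume *: "M = mat2 (of_int a) (of_int b) (of_int c) (of_int d)" "a * d - b * c = 1" "int 63 dvd c"
    show ?thesis unfolding *(1) pb[OF *(2)]
      by (rule mero_of_eqI[OF comp[OF *(2)] mero]) (use inv * in \<open>auto simp: G0_invariant_def\<close>)
  qed
  moreover have "meromorphic_at_cusps (mero_of f)"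
    unfolding meromorphic_at_cusps_def
  proof
    fix M :: "real^2^2" assume "M \<in> Gamma0 1"
    thus "\<exists>h>0. \<exists>L. has_q_expansion h (pullback M (mero_of f)) L"
    proof (rule Gamma0E)
      fix a b c d assume *: "M = mat2 (of_int a) (of_int b) (of_int c) (of_int d)" "a * d - b * c = 1"
      obtain B N y0 where B: "\<And>z. Im z > y0 \<Longrightarrow> norm (f (mob a b c d z)) \<le> B * exp (real N * Im z)"
        using growth[OF *(2)] by blast
      have "B * exp (real N) * 1 \<ge> 0"
      proof -
        have "0 \<le> B * exp (real N * Im (Complex 0 (\<bar>y0\<bar> + 1)))"
          using order_trans[OF norm_ge_zero B[of "Complex 0 (\<bar>y0\<bar> + 1)"]] by simp
        hence "B \<ge> 0" by (simp add: zero_le_mult_iff)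
        thus ?thesis by simp
      qed
      hence B0: "B \<ge> 0" by (simp add: zero_le_mult_iff)
      obtain G where G: "G holomorphic_on ball 0 1"
        "\<And>z. z \<in> uhp \<Longrightarrow> f (mob a b c d z) = G (ex (z / of_nat 63)) / ex (z / of_nat 63) ^ (63 * N)"
      proof (rule periodic_function_on_disc_bounded[of "\<lambda>z. f (mob a b c d z)" 63 "max 0 y0" B "63 * N"])
        show "(\<lambda>z. f (mob a b c d z)) holomorphic_on uhp"
          by (rule compose_mob_holomorphic[OF hol]) (use * in auto)
        show "f (mob a b c d (z + of_int (int 63 * n))) = f (mob a b c d z)" if "z \<in> uhp" for z n
          using G0_invariant_period[OF inv *(2) that, of n] by simp
        fix z assume z: "Im z > max 0 y0"
        have "real N * Im z \<le> 2 * pi * real N * Im z"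
          using pi_gt3 z by (intro mult_right_mono mult_left_le_one_le) (auto simp: mult_le_cancel_right1)
        hence "B * exp (real N * Im z) \<le> B * exp (2 * pi * real (63 * N) / real 63 * Im z)"
          using B0 by (intro mult_left_mono) auto
        thus "norm (f (mob a b c d z)) \<le> B * exp (2 * pi * real (63 * N) / real 63 * Im z)"
          using B[of z] z by simp
      qed (use that in auto)
      have "G analytic_on {0}" using G(1) by (auto simp: analytic_at intro!: exI[of _ "ball 0 1"])
      hence "G has_laurent_expansion fps_to_fls (fps_expansion G 0)"
        by (intro has_laurent_expansion_fps analytic_at_imp_has_fps_expansion_0)
      hence lau: "(\<lambda>q. G q / q ^ (63 * N)) has_laurent_expansion (fps_to_fls (fps_expansion G 0) / fls_X ^ (63 * N))"
        by (intro laurent_expansion_intros)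
      have "has_q_expansion 63 (mero_of (\<lambda>z. f (mob a b c d z))) (fps_to_fls (fps_expansion G 0) / fls_X ^ (63 * N))"
        by (rule has_q_expansionI[OF comp[OF *(2)] _ lau eventually_mono[OF eventually_in_half_plane[of 0]]])
           (use G(2) in \<open>auto simp: uhp_def\<close>)
      thus ?thesis unfolding *(1) pb[OF *(2)] by (intro exI[of _ "63::nat"]) auto
    qed
  qed
  ultimately show ?thesis by (simp add: C_X0_def)
qed

lemma mero_of_in_Q_X0:
  assumes "mero_of f \<in> C_X0 63" "f meromorphic_on uhp" "rational_at_0 \<Phi>" "\<And>z. z \<in> uhp \<Longrightarrow> f z = \<Phi> (ex z)"
  shows "mero_of f \<in> Q_X0 63"
proof -
  obtain L where L: "\<Phi> has_laurent_expansion L" "rational_fls L" using assms(3) by (auto simp: rational_at_0_def)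
  have "has_q_expansion 1 (mero_of f) L"
    by (rule has_q_expansionI[OF assms(2) _ L(1) eventually_mono[OF eventually_in_half_plane[of 0]]])
       (use assms(4) in \<open>auto simp: uhp_def\<close>)
  with L(2) assms(1) show ?thesis by (auto simp: Q_X0_iff)
qed

definition Xm :: mero_uhp where "Xm = mero_of fx"
definition Um :: mero_uhp where "Um = mero_of fu"
definition Vm :: mero_uhp where "Vm = mero_of fv"

lemma f_G0_invariant: "G0_invariant fu" "G0_invariant fv" "G0_invariant fx"
  by (auto simp: G0_invariant_def fu_invariant fv_invariant fx_invariant)

lemmas f_meromorphic = f_holomorphic[THEN holomorphic_imp_meromorphic_on_uhp]

text \<open>Combines t \<le> 1 + t^3 with x^3 = u v, so that growth estimates for u and v pass to
  x.\<close>

lemma fx_norm_le: "z \<in> uhp \<Longrightarrow> norm (fx z) \<le> 1 + norm (fu z) * norm (fv z)"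
proof -
  assume z: "z \<in> uhp"
  have "t \<le> 1 + t ^ 3" if "t \<ge> 0" for t :: real
  proof (cases "t \<le> 1")
    case False
    hence "t ^ 1 \<le> t ^ 3" by (intro power_increasing) auto
    thus ?thesis by simp
  qed (use that in \<open>simp add: add_increasing2\<close>)
  from this[of "norm (fx z)"] show ?thesis
    using fx_cube[OF z] by (metis norm_ge_zero norm_mult norm_power)
qed

lemma f_in_Q_X0: "Um \<in> Q_X0 63" "Vm \<in> Q_X0 63" "Xm \<in> Q_X0 63"
proof -
  obtain B1 where B1: "B1 > 0"
    "\<And>a b c d z. a * d - b * c = 1 \<Longrightarrow> Im z \<ge> 1323 \<Longrightarrow> norm (fu (mob a b c d z)) \<le> B1 * exp (63 * Im z)"
    using fu_cusp_bounds by metis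
  obtain B2 where B2: "B2 > 0"
    "\<And>a b c d z. a * d - b * c = 1 \<Longrightarrow> Im z \<ge> 21 \<Longrightarrow> norm (fv (mob a b c d z)) \<le> B2 * exp (Im z)"
    using fv_cusp_bounds by metis
  have "Um \<in> C_X0 63" unfolding Um_def
    by (rule mero_of_in_C_X0[OF f_holomorphic(1) f_G0_invariant(1)])
       (intro exI[of _ B1] exI[of _ "63::nat"] exI[of _ 1323], use B1 in auto)
  thus "Um \<in> Q_X0 63" unfolding Um_def
    by (rule mero_of_in_Q_X0[OF _ f_meromorphic(1) rational_at_0_Q(1)]) (simp add: fu_def)
  have "Vm \<in> C_X0 63" unfolding Vm_def
    by (rule mero_of_in_C_X0[OF f_holomorphic(2) f_G0_invariant(2)])
       (intro exI[of _ B2] exI[of _ "1::nat"] exI[of _ 21], use B2 in auto)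
  thus "Vm \<in> Q_X0 63" unfolding Vm_def
    by (rule mero_of_in_Q_X0[OF _ f_meromorphic(2) rational_at_0_Q(2)]) (simp add: fv_def)
  have "Xm \<in> C_X0 63" unfolding Xm_def
  proof (rule mero_of_in_C_X0[OF f_holomorphic(3) f_G0_invariant(3)])
    fix a b c d :: int assume det: "a * d - b * c = 1"
    show "\<exists>B N y0. \<forall>z. Im z > y0 \<longrightarrow> norm (fx (mob a b c d z)) \<le> B * exp (real N * Im z)"
    proof (intro exI allI impI)
      fix z :: complex assume Im: "Im z > 1323"
      hence z: "z \<in> uhp" by (simp add: uhp_def)
      have "norm (fx (mob a b c d z)) \<le> 1 + norm (fu (mob a b c d z)) * norm (fv (mob a b c d z))"
        by (rule fx_norm_le[OF mob_in_uhp]) (use det z in auto)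
      also have "\<dots> \<le> exp (64 * Im z) + (B1 * exp (63 * Im z)) * (B2 * exp (Im z))"
        using B1 B2 det Im by (intro add_mono mult_mono) auto
      also have "\<dots> = (1 + B1 * B2) * exp (real 64 * Im z)"
        by (simp add: algebra_simps flip: exp_add)
      finally show "norm (fx (mob a b c d z)) \<le> (1 + B1 * B2) * exp (real 64 * Im z)" .
    qed
  qed
  thus "Xm \<in> Q_X0 63" unfolding Xm_def
    by (rule mero_of_in_Q_X0[OF _ f_meromorphic(3) rational_at_0_Q(3)]) (simp add: fx_def)
qed

text \<open>The entries A = D = 0, B = -1, C = 1 are left in the shape used by
  \<open>atkin_lehner_matrices\<close>, so that \<open>atkin_lehner_det_iff\<close> applies
  literally.\<close>

definition fricke_matrix :: "real^2^2" where
  "fricke_matrix = (1 / sqrt (real 63)) *\<^sub>R mat2 (of_int 0 * real 63) (of_int (-1)) (real 63 * of_int 1) (of_int 0 * real 63)"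

lemma fricke_matrix: "fricke_matrix \<in> atkin_lehner_matrices 63 63" "det fricke_matrix = 1"
proof -
  show det: "det fricke_matrix = 1"
    unfolding fricke_matrix_def by (subst atkin_lehner_det_iff) auto
  show "fricke_matrix \<in> atkin_lehner_matrices 63 63"
    unfolding atkin_lehner_matrices_def
  proof (intro CollectI conjI det)
    show "\<exists>A B C D :: int. fricke_matrix = (1 / sqrt (real 63)) *\<^sub>R
        mat2 (of_int A * real 63) (of_int B) (real 63 * of_int C) (of_int D * real 63)"
      by (rule exI[of _ 0], rule exI[of _ "-1"], rule exI[of _ 1], rule exI[of _ 0], rule fricke_matrix_def)
  qed
qed

lemma act_fricke_matrix: "act fricke_matrix = fricke"
  by (simp add: act_def moebius_def fricke_matrix_def scaleR_mat2 fricke_def fun_eq_iff divide_simps)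

lemma atkin_lehner_eq:
  assumes "F \<in> C_X0 63" shows "atkin_lehner 63 63 F = pullback fricke_matrix F"
  by (rule atkin_lehner_eq_pullback) (use assms fricke_matrix in auto)

lemma atkin_lehner_f:
  "atkin_lehner 63 63 Um = 7 * Vm" "atkin_lehner 63 63 Vm = Um / 7" "atkin_lehner 63 63 Xm = Xm"
proof -
  have C: "F \<in> Q_X0 63 \<Longrightarrow> F \<in> C_X0 63" for F by (simp add: Q_X0_iff)
  have pb: "pullback fricke_matrix (mero_of f) = mero_of (\<lambda>z. f (fricke z))" if "f meromorphic_on uhp" for f
    using pullback_mero_of[OF _ that, of fricke_matrix] by (simp add: fricke_matrix act_fricke_matrix)
  have mero: "(\<lambda>z. f (fricke z)) meromorphic_on uhp" if "f meromorphic_on uhp" for f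
    using meromorphic_on_act[OF _ that, of fricke_matrix] by (simp add: fricke_matrix act_fricke_matrix)
  have 7: "7 = mero_of (\<lambda>_. 7)"
    using of_nat_mero_uhp[of 7] by (simp add: mero_of_const)
  show "atkin_lehner 63 63 Um = 7 * Vm"
    unfolding atkin_lehner_eq[OF C[OF f_in_Q_X0(1)]]
    unfolding Um_def Vm_def pb[OF f_meromorphic(1)] 7
    by (subst mero_of_mult) (auto intro!: meromorphic_intros f_meromorphic mero mero_of_eqI simp: fu_fricke)
  have "atkin_lehner 63 63 Vm * 7 = Um"
    unfolding atkin_lehner_eq[OF C[OF f_in_Q_X0(2)]]
    unfolding Um_def Vm_def pb[OF f_meromorphic(2)] 7
    by (subst mero_of_mult) (auto intro!: meromorphic_intros f_meromorphic mero mero_of_eqI simp: fv_fricke)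
  thus "atkin_lehner 63 63 Vm = Um / 7" by (simp add: field_simps)
  show "atkin_lehner 63 63 Xm = Xm"
    unfolding atkin_lehner_eq[OF C[OF f_in_Q_X0(3)]]
    unfolding Xm_def pb[OF f_meromorphic(3)]
    by (auto intro!: f_meromorphic mero mero_of_eqI simp: fx_fricke)
qed

lemma Xm_cube: "Xm ^ 3 = Um * Vm"
  unfolding Xm_def Um_def Vm_def mero_of_power[OF f_meromorphic(3)] mero_of_mult[OF f_meromorphic(1,2)]
  by (rule mero_of_eqI) (auto intro!: meromorphic_intros f_meromorphic simp: fx_cube)

section \<open>The relation between the eta quotients\<close>

text \<open>In the rules below, the polynomial \<open>w\<close> collects the terms of degree at least 13 that are cut off.\<close>

definition trunc13 :: "(complex \<Rightarrow> complex) \<Rightarrow> complex poly \<Rightarrow> bool" where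
  "trunc13 f p \<longleftrightarrow> (\<lambda>q. f q - poly p q) \<in> O[at 0](\<lambda>q. q ^ 13)"

definition shift13 :: "complex poly \<Rightarrow> complex poly" where
  "shift13 w = pCons 0 (pCons 0 (pCons 0 (pCons 0 (pCons 0 (pCons 0 (pCons 0 (pCons 0
                 (pCons 0 (pCons 0 (pCons 0 (pCons 0 (pCons 0 w))))))))))))"

lemma poly_shift13: "poly (shift13 w) q = q ^ 13 * poly w q"
  by (simp add: shift13_def eval_nat_numeral mult.assoc)

lemma poly_bigo_1: "(\<lambda>q. poly p q) \<in> O[at 0](\<lambda>_. 1 :: complex)"
proof -
  have "((\<lambda>q. poly p q) \<longlongrightarrow> poly p 0) (at 0)" by (intro tendsto_intros)
  thus ?thesis by (intro bigoI_tendsto[of _ _ "poly p 0"]) auto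
qed

lemma poly_shift13_bigo: "(\<lambda>q. poly (shift13 w) q) \<in> O[at 0](\<lambda>q. q ^ 13)"
  unfolding poly_shift13 using landau_o.big.mult[OF landau_o.big_refl[of "\<lambda>q. q ^ 13"] poly_bigo_1[of w]] by simp

lemma trunc13_bounded:
  assumes "trunc13 f p" shows "f \<in> O[at 0](\<lambda>_. 1)"
proof -
  have "(\<lambda>q::complex. q ^ 13) \<in> O[at 0](\<lambda>_. 1)"
    using poly_bigo_1[of "monom 1 13"] by (simp add: poly_monom)
  hence "(\<lambda>q. f q - poly p q) \<in> O[at 0](\<lambda>_. 1)"
    using assms unfolding trunc13_def by (rule landau_o.big_trans[rotated])
  from sum_in_bigo(1)[OF this poly_bigo_1[of p]] show ?thesis by simp
qed

lemma trunc13_mult: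
  assumes "trunc13 f p" "trunc13 g r" "p * r = t + shift13 w"
  shows "trunc13 (\<lambda>q. f q * g q) t"
proof -
  have "(\<lambda>q. (f q - poly p q) * g q) \<in> O[at 0](\<lambda>q. q ^ 13)"
    using landau_o.big.mult[OF assms(1)[unfolded trunc13_def] trunc13_bounded[OF assms(2)]] by simp
  moreover have "(\<lambda>q. poly p q * (g q - poly r q)) \<in> O[at 0](\<lambda>q. q ^ 13)"
    using landau_o.big.mult[OF poly_bigo_1[of p] assms(2)[unfolded trunc13_def]] by simp
  ultimately have "(\<lambda>q. (f q - poly p q) * g q + poly p q * (g q - poly r q) + poly (shift13 w) q) \<in> O[at 0](\<lambda>q. q ^ 13)"
    by (intro sum_in_bigo poly_shift13_bigo)
  also have "(\<lambda>q. (f q - poly p q) * g q + poly p q * (g q - poly r q) + poly (shift13 w) q) =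
             (\<lambda>q. f q * g q - poly t q)"
  proof
    fix q
    have "poly p q * poly r q = poly t q + poly (shift13 w) q"
      using arg_cong[OF assms(3), of "\<lambda>p. poly p q"] by simp
    thus "(f q - poly p q) * g q + poly p q * (g q - poly r q) + poly (shift13 w) q = f q * g q - poly t q"
      by (simp add: algebra_simps)
  qed
  finally show ?thesis unfolding trunc13_def .
qed

lemma trunc13_poly: "(\<And>q. f q = poly p q) \<Longrightarrow> trunc13 f p"
  by (simp add: trunc13_def)

lemma trunc13_cong_eventually:
  assumes "trunc13 f p" "eventually (\<lambda>q. f q = g q) (at 0)"
  shows "trunc13 g p"
proof -
  have "eventually (\<lambda>q. f q - poly p q = g q - poly p q) (at 0)"
    using assms(2) by eventually_elim simp
  from landau_o.big.in_cong[OF this] assms(1) show ?thesis by (simp add: trunc13_def)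
qed

lemma trunc13_cong: "trunc13 f p \<Longrightarrow> (\<And>q. f q = g q) \<Longrightarrow> p = r \<Longrightarrow> trunc13 g r"
  by (auto simp: trunc13_def)

lemma trunc13_add: "trunc13 f p \<Longrightarrow> trunc13 g r \<Longrightarrow> trunc13 (\<lambda>q. f q + g q) (p + r)"
  using sum_in_bigo(1)[of "\<lambda>q. f q - poly p q" "at 0" "\<lambda>q. q ^ 13" "\<lambda>q. g q - poly r q"]
  by (simp add: trunc13_def algebra_simps)

lemma trunc13_diff: "trunc13 f p \<Longrightarrow> trunc13 g r \<Longrightarrow> trunc13 (\<lambda>q. f q - g q) (p - r)"
  using sum_in_bigo(2)[of "\<lambda>q. f q - poly p q" "at 0" "\<lambda>q. q ^ 13" "\<lambda>q. g q - poly r q"]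
  by (simp add: trunc13_def algebra_simps)

lemma trunc13_scale: "trunc13 f p \<Longrightarrow> trunc13 (\<lambda>q. c * f q) (smult c p)"
  using landau_o.big.mult[OF poly_bigo_1[of "[:c:]"], of "\<lambda>q. f q - poly p q" "\<lambda>q. q ^ 13"]
  by (simp add: trunc13_def algebra_simps)

text \<open>The quotient p is certified by multiplying back. Since g tends to the constant term of
  b, which is not 0, 1/g is bounded and preserves the error term.\<close>

lemma trunc13_divide:
  assumes "trunc13 f a" "trunc13 g b" "p * b = a + shift13 w" "coeff b 0 \<noteq> 0" "\<And>q. h q = f q / g q"
  shows "trunc13 h p"
proof -
  have "(\<lambda>q. q ^ 13) \<in> o[at 0](\<lambda>_. 1 :: complex)"
    by (rule smalloI_tendsto) (auto intro!: tendsto_eq_intros)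
  with assms(2) have "(\<lambda>q. g q - poly b q) \<in> o[at 0](\<lambda>_. 1)"
    unfolding trunc13_def by (rule landau_o.big_small_trans)
  hence "((\<lambda>q. (g q - poly b q) / 1) \<longlongrightarrow> 0) (at 0)" by (rule smalloD_tendsto)
  hence "((\<lambda>q. (g q - poly b q) + poly b q) \<longlongrightarrow> 0 + poly b 0) (at 0)"
    by (intro tendsto_intros) simp
  hence g: "(g \<longlongrightarrow> poly b 0) (at 0)" by simp
  have nz: "poly b 0 \<noteq> 0" using assms(4) by (simp add: poly_0_coeff_0)
  have ev: "eventually (\<lambda>q. g q \<noteq> 0) (at 0)" by (rule tendsto_imp_eventually_ne[OF g nz])
  have "((\<lambda>q. inverse (g q)) \<longlongrightarrow> inverse (poly b 0)) (at 0)"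
    by (rule tendsto_inverse[OF g nz])
  hence inv: "(\<lambda>q. inverse (g q)) \<in> O[at 0](\<lambda>_. 1)"
    by (intro bigoI_tendsto[of _ _ "inverse (poly b 0)"]) auto
  have "(\<lambda>q. poly p q * (g q - poly b q)) \<in> O[at 0](\<lambda>q. q ^ 13)"
    using landau_o.big.mult[OF poly_bigo_1[of p] assms(2)[unfolded trunc13_def]] by simp
  hence "(\<lambda>q. (f q - poly a q) - poly p q * (g q - poly b q) - poly (shift13 w) q) \<in> O[at 0](\<lambda>q. q ^ 13)"
    by (rule sum_in_bigo(2)[OF sum_in_bigo(2)[OF assms(1)[unfolded trunc13_def]] poly_shift13_bigo])
  from landau_o.big.mult[OF this inv]
  have 1: "(\<lambda>q. ((f q - poly a q) - poly p q * (g q - poly b q) - poly (shift13 w) q) * inverse (g q)) \<in> O[at 0](\<lambda>q. q ^ 13)"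
    by simp
  have "eventually (\<lambda>q. ((f q - poly a q) - poly p q * (g q - poly b q) - poly (shift13 w) q) * inverse (g q) =
          h q - poly p q) (at 0)"
    using ev
  proof eventually_elim
    case (elim q)
    have "poly p q * poly b q = poly a q + poly (shift13 w) q"
      using arg_cong[OF assms(3), of "\<lambda>p. poly p q"] by simp
    hence "(f q - poly a q) - poly p q * (g q - poly b q) - poly (shift13 w) q = f q - poly p q * g q"
      by (simp add: algebra_simps)
    thus ?case using elim by (simp add: assms(5) field_simps)
  qed
  from landau_o.big.in_cong[OF this] 1 show ?thesis by (simp add: trunc13_def)
qed

lemma eventually_norm_less_1: "eventually (\<lambda>q::complex. norm q < 1) (at 0)"
  unfolding eventually_at by (rule exI[of _ 1]) auto

text \<open>All factors differ from 1 only from q^13 on. \<open>norm_qp_minus_1\<close> bounds the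
  whole tail at once, and exp s \<le> 1 + s + s^2 makes the bound linear in |q|^13.\<close>

lemma trunc13_tail:
  assumes "m \<ge> 13" "k > 0"
  shows "trunc13 (\<lambda>q. qp (q ^ m) (q ^ k)) [:1:]"
  unfolding trunc13_def
proof (rule landau_o.bigI[of 4])
  have "eventually (\<lambda>q::complex. norm q < 1 / 2) (at 0)"
    unfolding eventually_at by (rule exI[of _ "1 / 2"]) auto
  thus "eventually (\<lambda>q. norm (qp (q ^ m) (q ^ k) - poly [:1:] q) \<le> 4 * norm (q ^ 13)) (at 0)"
  proof eventually_elim
    case (elim q)
    have "norm q ^ k \<le> norm q ^ 1" using elim assms(2) by (intro power_decreasing) auto
    hence qk: "norm (q ^ k) < 1 / 2" using elim by (simp add: norm_power)
    have qm: "norm (q ^ m) \<le> norm q ^ 13"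
      unfolding norm_power using elim assms(1) by (intro power_decreasing) auto
    have "norm q ^ 13 \<le> norm q ^ 1" using elim by (intro power_decreasing) auto
    hence small: "2 * norm q ^ 13 \<le> 1" using elim by simp
    have "norm (q ^ m) / (1 - norm (q ^ k)) \<le> norm q ^ 13 / (1 / 2)"
      using qk qm by (intro frac_le) auto
    hence "exp (norm (q ^ m) / (1 - norm (q ^ k))) \<le> exp (2 * norm q ^ 13)" by simp
    also have "\<dots> \<le> 1 + 2 * norm q ^ 13 + (2 * norm q ^ 13) ^ 2"
      by (rule exp_bound) (use small in auto)
    also have "(2 * norm q ^ 13) ^ 2 \<le> 2 * norm q ^ 13"
      using small unfolding power2_eq_square by (intro mult_left_le) auto
    finally have "exp (norm (q ^ m) / (1 - norm (q ^ k))) - 1 \<le> 4 * norm q ^ 13" by simp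
    moreover have "norm (qp (q ^ m) (q ^ k) - 1) \<le> exp (norm (q ^ m) / (1 - norm (q ^ k))) - 1"
      by (rule norm_qp_minus_1) (use qk in simp)
    ultimately show ?case by (simp add: norm_power)
  qed
qed auto

text \<open>Factors are attached one at a time, from the exponents above 12 downwards, by the
  recursion for \<open>qp\<close>.\<close>

lemma trunc13_step:
  assumes "trunc13 (\<lambda>q. qp (q ^ m') (q ^ k)) r" "m' = m + k" "k > 0"
    "\<And>q. poly p q = 1 - q ^ m" "p * r = t + shift13 w"
  shows "trunc13 (\<lambda>q. qp (q ^ m) (q ^ k)) t"
proof -
  have "trunc13 (\<lambda>q. 1 - q ^ m) p" by (rule trunc13_poly) (simp add: assms(4))
  from trunc13_mult[OF this assms(1,5)] have "trunc13 (\<lambda>q. (1 - q ^ m) * qp (q ^ m') (q ^ k)) t" .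
  moreover have "eventually (\<lambda>q. (1 - q ^ m) * qp (q ^ m') (q ^ k) = qp (q ^ m) (q ^ k)) (at 0)"
    using eventually_norm_less_1
  proof eventually_elim
    case (elim q)
    hence "norm (q ^ k) < 1" using assms(3) by (simp add: norm_power power_less_one_iff)
    from qp_rec[OF this, of "q ^ m"] show ?case by (simp add: assms(2) power_add)
  qed
  ultimately show ?thesis by (rule trunc13_cong_eventually)
qed

section \<open>Truncated expansions of the Euler products and of the relation\<close>

lemma trunc13_euler_prod_1: "trunc13 (\<lambda>q. euler_prod q) [:1, -1, -1, 0, 0, 1, 0, 1, 0, 0, 0, 0, -1:]"
proof -
  have s13: "trunc13 (\<lambda>q. qp (q ^ 13) (q ^ 1)) [:1:]" by (rule trunc13_tail) simp_all
  have s12: "trunc13 (\<lambda>q. qp (q ^ 12) (q ^ 1)) [:1, 0, 0, 0, 0, 0, 0, 0, 0, 0, 0, 0, -1:]"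
    by (rule trunc13_step[OF s13, where p = "[:1, 0, 0, 0, 0, 0, 0, 0, 0, 0, 0, 0, -1:]" and w = "0"]) (simp_all add: shift13_def eval_nat_numeral)
  have s11: "trunc13 (\<lambda>q. qp (q ^ 11) (q ^ 1)) [:1, 0, 0, 0, 0, 0, 0, 0, 0, 0, 0, -1, -1:]"
    by (rule trunc13_step[OF s12, where p = "[:1, 0, 0, 0, 0, 0, 0, 0, 0, 0, 0, -1:]" and w = "[:0, 0, 0, 0, 0, 0, 0, 0, 0, 0, 1:]"]) (simp_all add: shift13_def eval_nat_numeral)
  have s10: "trunc13 (\<lambda>q. qp (q ^ 10) (q ^ 1)) [:1, 0, 0, 0, 0, 0, 0, 0, 0, 0, -1, -1, -1:]"
    by (rule trunc13_step[OF s11, where p = "[:1, 0, 0, 0, 0, 0, 0, 0, 0, 0, -1:]" and w = "[:0, 0, 0, 0, 0, 0, 0, 0, 1, 1:]"]) (simp_all add: shift13_def eval_nat_numeral)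
  have s9: "trunc13 (\<lambda>q. qp (q ^ 9) (q ^ 1)) [:1, 0, 0, 0, 0, 0, 0, 0, 0, -1, -1, -1, -1:]"
    by (rule trunc13_step[OF s10, where p = "[:1, 0, 0, 0, 0, 0, 0, 0, 0, -1:]" and w = "[:0, 0, 0, 0, 0, 0, 1, 1, 1:]"]) (simp_all add: shift13_def eval_nat_numeral)
  have s8: "trunc13 (\<lambda>q. qp (q ^ 8) (q ^ 1)) [:1, 0, 0, 0, 0, 0, 0, 0, -1, -1, -1, -1, -1:]"
    by (rule trunc13_step[OF s9, where p = "[:1, 0, 0, 0, 0, 0, 0, 0, -1:]" and w = "[:0, 0, 0, 0, 1, 1, 1, 1:]"]) (simp_all add: shift13_def eval_nat_numeral)
  have s7: "trunc13 (\<lambda>q. qp (q ^ 7) (q ^ 1)) [:1, 0, 0, 0, 0, 0, 0, -1, -1, -1, -1, -1, -1:]"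
    by (rule trunc13_step[OF s8, where p = "[:1, 0, 0, 0, 0, 0, 0, -1:]" and w = "[:0, 0, 1, 1, 1, 1, 1:]"]) (simp_all add: shift13_def eval_nat_numeral)
  have s6: "trunc13 (\<lambda>q. qp (q ^ 6) (q ^ 1)) [:1, 0, 0, 0, 0, 0, -1, -1, -1, -1, -1, -1, -1:]"
    by (rule trunc13_step[OF s7, where p = "[:1, 0, 0, 0, 0, 0, -1:]" and w = "[:1, 1, 1, 1, 1, 1:]"]) (simp_all add: shift13_def eval_nat_numeral)
  have s5: "trunc13 (\<lambda>q. qp (q ^ 5) (q ^ 1)) [:1, 0, 0, 0, 0, -1, -1, -1, -1, -1, -1:]"
    by (rule trunc13_step[OF s6, where p = "[:1, 0, 0, 0, 0, -1:]" and w = "[:1, 1, 1, 1, 1:]"]) (simp_all add: shift13_def eval_nat_numeral)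
  have s4: "trunc13 (\<lambda>q. qp (q ^ 4) (q ^ 1)) [:1, 0, 0, 0, -1, -1, -1, -1, -1, 0, 0, 1, 1:]"
    by (rule trunc13_step[OF s5, where p = "[:1, 0, 0, 0, -1:]" and w = "[:1, 1:]"]) (simp_all add: shift13_def eval_nat_numeral)
  have s3: "trunc13 (\<lambda>q. qp (q ^ 3) (q ^ 1)) [:1, 0, 0, -1, -1, -1, -1, 0, 0, 1, 1, 2, 1:]"
    by (rule trunc13_step[OF s4, where p = "[:1, 0, 0, -1:]" and w = "[:0, -1, -1:]"]) (simp_all add: shift13_def eval_nat_numeral)
  have s2: "trunc13 (\<lambda>q. qp (q ^ 2) (q ^ 1)) [:1, 0, -1, -1, -1, 0, 0, 1, 1, 1, 1, 1:]"
    by (rule trunc13_step[OF s3, where p = "[:1, 0, -1:]" and w = "[:-2, -1:]"]) (simp_all add: shift13_def eval_nat_numeral)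
  \<comment> \<open>The beginning of Euler's pentagonal number series 1 - q - q^2 + q^5 + q^7 -
    q^12.\<close>
  have s1: "trunc13 (\<lambda>q. qp (q ^ 1) (q ^ 1)) [:1, -1, -1, 0, 0, 1, 0, 1, 0, 0, 0, 0, -1:]"
    by (rule trunc13_step[OF s2, where p = "[:1, -1:]" and w = "0"]) (simp_all add: shift13_def eval_nat_numeral)
  from s1 show ?thesis by (simp add: euler_prod_def)
qed

lemma trunc13_euler_prod_3: "trunc13 (\<lambda>q. euler_prod (q ^ 3)) [:1, 0, 0, -1, 0, 0, -1:]"
proof -
  have s15: "trunc13 (\<lambda>q. qp (q ^ 15) (q ^ 3)) [:1:]" by (rule trunc13_tail) simp_all
  have s12: "trunc13 (\<lambda>q. qp (q ^ 12) (q ^ 3)) [:1, 0, 0, 0, 0, 0, 0, 0, 0, 0, 0, 0, -1:]"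
    by (rule trunc13_step[OF s15, where p = "[:1, 0, 0, 0, 0, 0, 0, 0, 0, 0, 0, 0, -1:]" and w = "0"]) (simp_all add: shift13_def eval_nat_numeral)
  have s9: "trunc13 (\<lambda>q. qp (q ^ 9) (q ^ 3)) [:1, 0, 0, 0, 0, 0, 0, 0, 0, -1, 0, 0, -1:]"
    by (rule trunc13_step[OF s12, where p = "[:1, 0, 0, 0, 0, 0, 0, 0, 0, -1:]" and w = "[:0, 0, 0, 0, 0, 0, 0, 0, 1:]"]) (simp_all add: shift13_def eval_nat_numeral)
  have s6: "trunc13 (\<lambda>q. qp (q ^ 6) (q ^ 3)) [:1, 0, 0, 0, 0, 0, -1, 0, 0, -1, 0, 0, -1:]"
    by (rule trunc13_step[OF s9, where p = "[:1, 0, 0, 0, 0, 0, -1:]" and w = "[:0, 0, 1, 0, 0, 1:]"]) (simp_all add: shift13_def eval_nat_numeral)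
  have s3: "trunc13 (\<lambda>q. qp (q ^ 3) (q ^ 3)) [:1, 0, 0, -1, 0, 0, -1:]"
    by (rule trunc13_step[OF s6, where p = "[:1, 0, 0, -1:]" and w = "[:0, 0, 1:]"]) (simp_all add: shift13_def eval_nat_numeral)
  from s3 show ?thesis by (simp add: euler_prod_def)
qed

lemma trunc13_euler_prod_7: "trunc13 (\<lambda>q. euler_prod (q ^ 7)) [:1, 0, 0, 0, 0, 0, 0, -1:]"
proof -
  have s14: "trunc13 (\<lambda>q. qp (q ^ 14) (q ^ 7)) [:1:]" by (rule trunc13_tail) simp_all
  have s7: "trunc13 (\<lambda>q. qp (q ^ 7) (q ^ 7)) [:1, 0, 0, 0, 0, 0, 0, -1:]"
    by (rule trunc13_step[OF s14, where p = "[:1, 0, 0, 0, 0, 0, 0, -1:]" and w = "0"]) (simp_all add: shift13_def eval_nat_numeral)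
  from s7 show ?thesis by (simp add: euler_prod_def)
qed

lemma trunc13_euler_prod_9: "trunc13 (\<lambda>q. euler_prod (q ^ 9)) [:1, 0, 0, 0, 0, 0, 0, 0, 0, -1:]"
proof -
  have s18: "trunc13 (\<lambda>q. qp (q ^ 18) (q ^ 9)) [:1:]" by (rule trunc13_tail) simp_all
  have s9: "trunc13 (\<lambda>q. qp (q ^ 9) (q ^ 9)) [:1, 0, 0, 0, 0, 0, 0, 0, 0, -1:]"
    by (rule trunc13_step[OF s18, where p = "[:1, 0, 0, 0, 0, 0, 0, 0, 0, -1:]" and w = "0"]) (simp_all add: shift13_def eval_nat_numeral)
  from s9 show ?thesis by (simp add: euler_prod_def)
qed

lemma trunc13_euler_prod_21: "trunc13 (\<lambda>q. euler_prod (q ^ 21)) [:1:]"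
proof -
  have s21: "trunc13 (\<lambda>q. qp (q ^ 21) (q ^ 21)) [:1:]" by (rule trunc13_tail) simp_all
  from s21 show ?thesis by (simp add: euler_prod_def)
qed

lemma trunc13_euler_prod_63: "trunc13 (\<lambda>q. euler_prod (q ^ 63)) [:1:]"
proof -
  have s63: "trunc13 (\<lambda>q. qp (q ^ 63) (q ^ 63)) [:1:]" by (rule trunc13_tail) simp_all
  from s63 show ?thesis by (simp add: euler_prod_def)
qed

text \<open>The function n is q^6 times \<open>fN\<close>, and the truncated expression is q^12
  times \<open>fR\<close>; every power of q in it clears the pole of a term. That all 13
  coefficients vanish means that \<open>fR\<close> vanishes at infinity.\<close>

lemma relation_q_expansion:
  fixes n :: "complex \<Rightarrow> complex"
  defines "n \<equiv> \<lambda>q. QX q * QX q * QX q - 3 * (q ^ 2 * (QX q * QX q)) + q ^ 6 - QU q - 7 * (q ^ 6 * QV q)"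
  shows "trunc13 (\<lambda>q. n q * n q + 3 * (q ^ 2 * (QX q * (QX q - q ^ 2) * n q)) -
           9 * (q ^ 2 * ((QX q - q ^ 2) * (QX q - q ^ 2) * (QX q * QX q * QX q + q ^ 4 * QX q)))) 0"
proof -
  note e1 = trunc13_euler_prod_1
  note e3 = trunc13_euler_prod_3
  note e7 = trunc13_euler_prod_7
  note e9 = trunc13_euler_prod_9
  note e21 = trunc13_euler_prod_21
  note e63 = trunc13_euler_prod_63
  have x1: "trunc13 (\<lambda>q. euler_prod (q ^ 7) * euler_prod (q ^ 9)) [:1, 0, 0, 0, 0, 0, 0, -1, 0, -1:]"
    by (rule trunc13_mult[OF e7 e9, where w = "[:0, 0, 0, 1:]"]) (simp add: shift13_def)
  have x2: "trunc13 (\<lambda>q. euler_prod q * euler_prod (q ^ 63)) [:1, -1, -1, 0, 0, 1, 0, 1, 0, 0, 0, 0, -1:]"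
    by (rule trunc13_mult[OF e1 e63, where w = "0"]) (simp add: shift13_def)
  have X: "trunc13 QX [:1, 1, 2, 3, 5, 7, 11, 14, 21, 27, 38, 49, 67:]"
    by (rule trunc13_divide[OF x1 x2, where w = "[:-85, -28, 56, 71, 98, 38, 53, -21, -27, -38, -49, -67:]"])
       (simp_all add: shift13_def QX_def)
  have v1: "trunc13 (\<lambda>q. euler_prod (q ^ 7) * euler_prod (q ^ 7)) [:1, 0, 0, 0, 0, 0, 0, -2:]"
    by (rule trunc13_mult[OF e7 e7, where w = "[:0, 1:]"]) (simp add: shift13_def)
  have v2: "trunc13 (\<lambda>q. euler_prod (q ^ 7) * euler_prod (q ^ 7) * euler_prod (q ^ 7)) [:1, 0, 0, 0, 0, 0, 0, -3:]"
    by (rule trunc13_mult[OF v1 e7, where w = "[:0, 2:]"]) (simp add: shift13_def)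
  have v3: "trunc13 (\<lambda>q. euler_prod (q ^ 3) * (euler_prod (q ^ 7) * euler_prod (q ^ 7) * euler_prod (q ^ 7))) [:1, 0, 0, -1, 0, 0, -1, -3, 0, 0, 3:]"
    by (rule trunc13_mult[OF e3 v2, where w = "[:3:]"]) (simp add: shift13_def)
  have v4: "trunc13 (\<lambda>q. euler_prod q * euler_prod q) [:1, -2, -1, 2, 1, 2, -2, 0, -2, -2, 1:]"
    by (rule trunc13_mult[OF e1 e1, where w = "[:2, 3, 0, 0, -2, 0, -2, 0, 0, 0, 0, 1:]"]) (simp add: shift13_def)
  \<comment> \<open>Jacobi's series for the cube of the Euler product, 1 - 3 q + 5 q^3 - 7 q^6 + 9
    q^10.\<close>
  have v5: "trunc13 (\<lambda>q. euler_prod q * euler_prod q * euler_prod q) [:1, -3, 0, 5, 0, 0, -7, 0, 0, 0, 9:]"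
    by (rule trunc13_mult[OF v4 e1, where w = "[:-2, -1, -3, -3, -1, 2, 0, 2, 2, -1:]"]) (simp add: shift13_def)
  have v6: "trunc13 (\<lambda>q. euler_prod q * euler_prod q * euler_prod q * euler_prod (q ^ 21)) [:1, -3, 0, 5, 0, 0, -7, 0, 0, 0, 9:]"
    by (rule trunc13_mult[OF v5 e21, where w = "0"]) (simp add: shift13_def)
  have V: "trunc13 QV [:1, 3, 9, 21, 48, 99, 198, 372, 684, 1209, 2097, 3537, 5871:]"
    by (rule trunc13_divide[OF v3 v6, where w = "[:-9543, 13329, 21783, -12897, -21411, -34941, 10881, 18873, 31833, 52839:]"])
       (simp_all add: shift13_def QV_def power3_eq_cube)
  have u1: "trunc13 (\<lambda>q. euler_prod (q ^ 9) * euler_prod (q ^ 9)) [:1, 0, 0, 0, 0, 0, 0, 0, 0, -2:]"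
    by (rule trunc13_mult[OF e9 e9, where w = "[:0, 0, 0, 0, 0, 1:]"]) (simp add: shift13_def)
  have u2: "trunc13 (\<lambda>q. euler_prod (q ^ 9) * euler_prod (q ^ 9) * euler_prod (q ^ 9)) [:1, 0, 0, 0, 0, 0, 0, 0, 0, -3:]"
    by (rule trunc13_mult[OF u1 e9, where w = "[:0, 0, 0, 0, 0, 2:]"]) (simp add: shift13_def)
  have u3: "trunc13 (\<lambda>q. euler_prod (q ^ 21) * (euler_prod (q ^ 9) * euler_prod (q ^ 9) * euler_prod (q ^ 9))) [:1, 0, 0, 0, 0, 0, 0, 0, 0, -3:]"
    by (rule trunc13_mult[OF e21 u2, where w = "0"]) (simp add: shift13_def)
  have u4: "trunc13 (\<lambda>q. euler_prod (q ^ 63) * euler_prod (q ^ 63)) [:1:]"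
    by (rule trunc13_mult[OF e63 e63, where w = "0"]) (simp add: shift13_def)
  have u5: "trunc13 (\<lambda>q. euler_prod (q ^ 63) * euler_prod (q ^ 63) * euler_prod (q ^ 63)) [:1:]"
    by (rule trunc13_mult[OF u4 e63, where w = "0"]) (simp add: shift13_def)
  have u6: "trunc13 (\<lambda>q. euler_prod (q ^ 63) * euler_prod (q ^ 63) * euler_prod (q ^ 63) * euler_prod (q ^ 3)) [:1, 0, 0, -1, 0, 0, -1:]"
    by (rule trunc13_mult[OF u5 e3, where w = "0"]) (simp add: shift13_def)
  have U: "trunc13 QU [:1, 0, 0, 1, 0, 0, 2, 0, 0, 0, 0, 0, 2:]"
    by (rule trunc13_divide[OF u3 u6, where w = "[:0, 0, -2, 0, 0, -2:]"])
       (simp_all add: shift13_def QU_def power3_eq_cube)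
  have m2: "trunc13 (\<lambda>q. q ^ 2) [:0, 0, 1:]"
    by (rule trunc13_poly) (simp add: eval_nat_numeral)
  have m4: "trunc13 (\<lambda>q. q ^ 4) [:0, 0, 0, 0, 1:]"
    by (rule trunc13_poly) (simp add: eval_nat_numeral)
  have m6: "trunc13 (\<lambda>q. q ^ 6) [:0, 0, 0, 0, 0, 0, 1:]"
    by (rule trunc13_poly) (simp add: eval_nat_numeral)
  have X2: "trunc13 (\<lambda>q. QX q * QX q) [:1, 2, 5, 10, 20, 36, 65, 108, 181, 288, 457, 702, 1073:]"
    by (rule trunc13_mult[OF X X, where w = "[:1430, 1978, 2606, 3389, 4214, 5171, 5986, 6904, 7342, 7493, 6566, 4489:]"]) (simp add: shift13_def)
  have X3: "trunc13 (\<lambda>q. QX q * QX q * QX q) [:1, 3, 9, 22, 51, 108, 221, 426, 801, 1449, 2565, 4419, 7478:]"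
    by (rule trunc13_mult[OF X2 X, where w = "[:10708, 15978, 22671, 31629, 42267, 55529, 69152, 85092, 97336, 105791, 99611, 71891:]"]) (simp add: shift13_def)
  have qX2: "trunc13 (\<lambda>q. q ^ 2 * (QX q * QX q)) [:0, 0, 1, 2, 5, 10, 20, 36, 65, 108, 181, 288, 457:]"
    by (rule trunc13_mult[OF m2 X2, where w = "[:702, 1073:]"]) (simp add: shift13_def)
  have qV: "trunc13 (\<lambda>q. q ^ 6 * QV q) [:0, 0, 0, 0, 0, 0, 1, 3, 9, 21, 48, 99, 198:]"
    by (rule trunc13_mult[OF m6 V, where w = "[:372, 684, 1209, 2097, 3537, 5871:]"]) (simp add: shift13_def)
  have n: "trunc13 n [:0, 3, 6, 15, 36, 78, 153, 297, 543, 978, 1686, 2862, 4719:]"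
    by (rule trunc13_cong[OF trunc13_diff[OF trunc13_diff[OF trunc13_add[OF trunc13_diff[OF X3 trunc13_scale[OF qX2, of 3]] m6] U] trunc13_scale[OF qV, of 7]]]) (simp_all add: n_def)
  have A: "trunc13 (\<lambda>q. QX q - q ^ 2) [:1, 1, 1, 3, 5, 7, 11, 14, 21, 27, 38, 49, 67:]"
    by (rule trunc13_cong[OF trunc13_diff[OF X m2]]) simp_all
  have A2: "trunc13 (\<lambda>q. (QX q - q ^ 2) * (QX q - q ^ 2)) [:1, 2, 3, 8, 17, 30, 55, 94, 159, 260, 415, 648, 997:]"
    by (rule trunc13_mult[OF A A, where w = "[:1332, 1844, 2606, 3389, 4214, 5171, 5986, 6904, 7342, 7493, 6566, 4489:]"]) (simp add: shift13_def)
  have qX4: "trunc13 (\<lambda>q. q ^ 4 * QX q) [:0, 0, 0, 0, 1, 1, 2, 3, 5, 7, 11, 14, 21:]"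
    by (rule trunc13_mult[OF m4 X, where w = "[:27, 38, 49, 67:]"]) (simp add: shift13_def)
  have B: "trunc13 (\<lambda>q. QX q * QX q * QX q + q ^ 4 * QX q) [:1, 3, 9, 22, 52, 109, 223, 429, 806, 1456, 2576, 4433, 7499:]"
    by (rule trunc13_cong[OF trunc13_add[OF X3 qX4]]) simp_all
  have n2: "trunc13 (\<lambda>q. n q * n q) [:0, 0, 9, 36, 126, 396, 1125, 2934, 7254, 17028, 38394, 83394, 175581:]"
    by (rule trunc13_mult[OF n n, where w = "[:359244, 670815, 1232460, 2177937, 3675528, 5931522, 9209034, 13565502, 18881028, 24103512, 27011556, 22268961:]"]) (simp add: shift13_def)
  have C: "trunc13 (\<lambda>q. QX q * (QX q - q ^ 2)) [:1, 2, 4, 9, 18, 33, 60, 101, 170, 274, 436, 675, 1035:]"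
    by (rule trunc13_mult[OF X A, where w = "[:1381, 1911, 2606, 3389, 4214, 5171, 5986, 6904, 7342, 7493, 6566, 4489:]"]) (simp add: shift13_def)
  have D: "trunc13 (\<lambda>q. QX q * (QX q - q ^ 2) * n q) [:0, 3, 12, 39, 117, 318, 795, 1887, 4257, 9237, 19332, 39246, 77493:]"
    by (rule trunc13_mult[OF C n, where w = "[:141675, 249246, 429393, 709632, 1126272, 1722372, 2525451, 3543669, 4691118, 5734344, 6147495, 4884165:]"]) (simp add: shift13_def)
  have F: "trunc13 (\<lambda>q. (QX q - q ^ 2) * (QX q - q ^ 2) * (QX q * QX q * QX q + q ^ 4 * QX q)) [:1, 5, 18, 57, 164, 432, 1071, 2521, 5685, 12345, 25953, 52998, 105488:]"
    by (rule trunc13_mult[OF A2 B, where w = "[:191198, 338695, 595533, 993732, 1583205, 2452104, 3633754, 5161031, 6910315, 8552941, 9279053, 7476503:]"]) (simp add: shift13_def)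
  have qD: "trunc13 (\<lambda>q. q ^ 2 * (QX q * (QX q - q ^ 2) * n q)) [:0, 0, 0, 3, 12, 39, 117, 318, 795, 1887, 4257, 9237, 19332:]"
    by (rule trunc13_mult[OF m2 D, where w = "[:39246, 77493:]"]) (simp add: shift13_def)
  have qF: "trunc13 (\<lambda>q. q ^ 2 * ((QX q - q ^ 2) * (QX q - q ^ 2) * (QX q * QX q * QX q + q ^ 4 * QX q))) [:0, 0, 1, 5, 18, 57, 164, 432, 1071, 2521, 5685, 12345, 25953:]"
    by (rule trunc13_mult[OF m2 F, where w = "[:52998, 105488:]"]) (simp add: shift13_def)
  show ?thesis
    by (rule trunc13_cong[OF trunc13_diff[OF trunc13_add[OF n2 trunc13_scale[OF qD, of 3]] trunc13_scale[OF qF, of 9]]])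
       simp_all
qed

section \<open>A vanishing criterion in terms of the cusps\<close>

definition bounded_at_cusp :: "(complex \<Rightarrow> complex) \<Rightarrow> bool" where
  "bounded_at_cusp f \<longleftrightarrow> (\<exists>B y0. \<forall>z. Im z > y0 \<longrightarrow> norm (f z) \<le> B)"

lemma bounded_at_cusp_const: "bounded_at_cusp (\<lambda>_. c)"
  unfolding bounded_at_cusp_def by (rule exI[of _ "norm c"]) auto

lemma bounded_at_cusp_add:
  assumes "bounded_at_cusp f" "bounded_at_cusp g" shows "bounded_at_cusp (\<lambda>z. f z + g z)"
proof -
  obtain A y B y' where *: "\<And>z. Im z > y \<Longrightarrow> norm (f z) \<le> A" "\<And>z. Im z > y' \<Longrightarrow> norm (g z) \<le> B"
    using assms unfolding bounded_at_cusp_def by metis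
  have "norm (f z + g z) \<le> A + B" if "Im z > max y y'" for z
    using *(1)[of z] *(2)[of z] that norm_triangle_ineq[of "f z" "g z"] by simp
  thus ?thesis unfolding bounded_at_cusp_def by blast
qed

lemma bounded_at_cusp_mult:
  assumes "bounded_at_cusp f" "bounded_at_cusp g" shows "bounded_at_cusp (\<lambda>z. f z * g z)"
proof -
  obtain A y B y' where *: "\<And>z. Im z > y \<Longrightarrow> norm (f z) \<le> A" "\<And>z. Im z > y' \<Longrightarrow> norm (g z) \<le> B"
    using assms unfolding bounded_at_cusp_def by metis
  have "norm (f z * g z) \<le> A * B" if "Im z > max y y'" for z
    unfolding norm_mult using *(1)[of z] *(2)[of z] that
    by (intro mult_mono) (auto intro: order_trans[OF norm_ge_zero])
  thus ?thesis unfolding bounded_at_cusp_def by blast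
qed

lemma bounded_at_cusp_diff:
  assumes "bounded_at_cusp f" "bounded_at_cusp g" shows "bounded_at_cusp (\<lambda>z. f z - g z)"
  using bounded_at_cusp_add[OF assms(1) bounded_at_cusp_mult[OF bounded_at_cusp_const[of "-1"] assms(2)]] by simp

lemma bounded_at_cusp_power: "bounded_at_cusp f \<Longrightarrow> bounded_at_cusp (\<lambda>z. f z ^ n)"
  by (induction n) (auto intro: bounded_at_cusp_const bounded_at_cusp_mult)

lemma bounded_at_cusp_sum:
  "(\<And>i. i \<in> I \<Longrightarrow> bounded_at_cusp (f i)) \<Longrightarrow> bounded_at_cusp (\<lambda>z. \<Sum>i\<in>I. f i z)"
  by (induction I rule: infinite_finite_induct) (auto intro: bounded_at_cusp_const bounded_at_cusp_add)

lemma bounded_at_cusp_cong: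
  assumes "bounded_at_cusp f" "\<And>z. z \<in> uhp \<Longrightarrow> f z = g z" shows "bounded_at_cusp g"
proof -
  obtain B y where *: "\<And>z. Im z > y \<Longrightarrow> norm (f z) \<le> B"
    using assms(1) unfolding bounded_at_cusp_def by blast
  have "norm (g z) \<le> B" if "Im z > max y 0" for z
    using *[of z] assms(2)[of z] that by (simp add: uhp_def)
  thus ?thesis unfolding bounded_at_cusp_def by blast
qed

text \<open>The cusps fall into three kinds: 63 divides c, equivalent to infinity; c prime to 63,
  equivalent to 0; and the remaining ones, where 3 or 7 divides c. The hypotheses follow this
  division.\<close>

theorem modular_function_zero:
  assumes hol: "g holomorphic_on uhp" and inv: "G0_invariant g"
    and lim: "\<And>\<epsilon>. \<epsilon> > 0 \<Longrightarrow> \<exists>y0. \<forall>z. Im z > y0 \<longrightarrow> norm (g z) < \<epsilon>"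
    and zero_cusp: "bounded_at_cusp (\<lambda>z. g (- 1 / z))"
    and other: "\<And>a b c d. a * d - b * c = 1 \<Longrightarrow> \<not> 63 dvd c \<Longrightarrow> 3 dvd c \<or> 7 dvd c \<Longrightarrow>
                  bounded_at_cusp (\<lambda>z. g (mob a b c d z))"
    and "z \<in> uhp"
  shows "g z = 0"
proof (rule bounded_modular_function_zero[OF hol inv _ lim assms(6)])
  fix a b c d :: int assume det: "a * d - b * c = 1"
  have "bounded_at_cusp (\<lambda>z. g (mob a b c d z))"
  proof (cases "63 dvd c")
    case True
    obtain y0 where "\<And>z. Im z > y0 \<Longrightarrow> norm (g z) < 1" using lim[of 1] by auto
    hence "bounded_at_cusp g" unfolding bounded_at_cusp_def by (meson less_imp_le)
    thus ?thesis
      by (rule bounded_at_cusp_cong) (use inv det True in \<open>auto simp: G0_invariant_def\<close>)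
  next
    case False
    show ?thesis
    proof (cases "3 dvd c \<or> 7 dvd c")
      case True
      thus ?thesis using other[OF det False] by blast
    next
      case nd: False
      have "coprime c 3" "coprime c 7"
        using nd prime_imp_coprime[of 3 c] prime_imp_coprime[of 7 c] by (auto simp: coprime_commute)
      hence "coprime c (3 * 3 * 7)" by (simp only: coprime_mult_right_iff)
      hence "coprime c 63" by simp
      then obtain u v where uv: "u * c + v * 63 = 1" by (metis bezout_int coprime_imp_gcd_eq_1)
      \<comment> \<open>u inverts c modulo 63, so k is d / c modulo 63. This puts the matrix with
        rows (0, -1) and (1, k) into the given coset, and it differs from z -> -1/z only by a
        translation.\<close>
      define k where "k = u * d"
      have "c * k - 1 * d = d * (u * c) - d" by (simp add: k_def mult_ac)
      also have "u * c = 1 - v * 63" using uv by simp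
      also have "d * (1 - v * 63) - d = 63 * (- (d * v))" by (simp add: algebra_simps)
      finally have dvd: "63 dvd c * k - 1 * d" by (rule dvdI)
      obtain B y0 where B: "\<And>z. Im z > y0 \<Longrightarrow> norm (g (- 1 / z)) \<le> B"
        using zero_cusp unfolding bounded_at_cusp_def by blast
      have "bounded_at_cusp (\<lambda>z. g (mob 0 (- 1) 1 k z))"
        unfolding bounded_at_cusp_def
      proof (intro exI allI impI)
        fix z assume "Im z > y0"
        thus "norm (g (mob 0 (- 1) 1 k z)) \<le> B" using B[of "z + of_int k"] by (simp add: mob_def)
      qed
      thus ?thesis
      proof (rule bounded_at_cusp_cong)
        fix z assume "z \<in> uhp"
        show "g (mob 0 (- 1) 1 k z) = g (mob a b c d z)"
          by (rule G0_invariant_same_coset[OF inv det _ dvd \<open>z \<in> uhp\<close>, symmetric]) simp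
      qed
    qed
  qed
  thus "\<exists>B y0. \<forall>z. Im z > y0 \<longrightarrow> norm (g (mob a b c d z)) \<le> B"
    unfolding bounded_at_cusp_def .
qed

lemma f_bounded_at_other_cusps:
  assumes "a * d - b * c = 1" "\<not> 63 dvd c" "3 dvd c \<or> 7 dvd c"
  shows "bounded_at_cusp (\<lambda>z. fu (mob a b c d z))" "bounded_at_cusp (\<lambda>z. fv (mob a b c d z))"
        "bounded_at_cusp (\<lambda>z. fx (mob a b c d z))"
proof -
  obtain B where "\<And>a b c d z. a * d - b * c = 1 \<Longrightarrow> \<not> 63 dvd c \<Longrightarrow> Im z \<ge> 1323 \<Longrightarrow> norm (fu (mob a b c d z)) \<le> B"
    using fu_cusp_bounds by metis
  hence B: "norm (fu (mob a b c d z)) \<le> B" if "Im z > 1323" for z using assms that by simp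
  obtain B' where "\<And>a b c d z. a * d - b * c = 1 \<Longrightarrow> 3 dvd c \<or> 7 dvd c \<Longrightarrow> Im z \<ge> 21 \<Longrightarrow> norm (fv (mob a b c d z)) \<le> B'"
    using fv_cusp_bounds by metis
  hence B': "norm (fv (mob a b c d z)) \<le> B'" if "Im z > 21" for z using assms that by simp
  show u: "bounded_at_cusp (\<lambda>z. fu (mob a b c d z))" unfolding bounded_at_cusp_def using B by blast
  show v: "bounded_at_cusp (\<lambda>z. fv (mob a b c d z))" unfolding bounded_at_cusp_def using B' by blast
  show "bounded_at_cusp (\<lambda>z. fx (mob a b c d z))"
    unfolding bounded_at_cusp_def
  proof (intro exI allI impI)
    fix z :: complex assume Im: "Im z > 1323"
    hence z: "z \<in> uhp" by (simp add: uhp_def)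
    have "norm (fx (mob a b c d z)) \<le> 1 + norm (fu (mob a b c d z)) * norm (fv (mob a b c d z))"
      by (rule fx_norm_le[OF mob_in_uhp]) (use assms z in auto)
    also have "\<dots> \<le> 1 + B * B'"
      using B[OF Im] B'[of z] Im
      by (intro add_left_mono mult_mono) (auto intro: order_trans[OF norm_ge_zero])
    finally show "norm (fx (mob a b c d z)) \<le> 1 + B * B'" .
  qed
qed

section \<open>The relation as a vanishing modular function\<close>

definition fN :: "complex \<Rightarrow> complex" where
  "fN z = fx z ^ 3 - 3 * fx z ^ 2 + 1 - (fu z + 7 * fv z)"

text \<open>The equation of y multiplied by 9 (x - 1)^2, with \<open>fN\<close> in place of 3 (x -
  1) y. Free of division, it is holomorphic on the upper half-plane and polynomial in u, v,
  x.\<close>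

definition fR :: "complex \<Rightarrow> complex" where
  "fR z = fN z ^ 2 + 3 * fx z * (fx z - 1) * fN z - 9 * (fx z - 1) ^ 2 * (fx z ^ 3 + fx z)"

lemma fR_tends_to_0:
  assumes "\<epsilon> > 0" shows "\<exists>y0. \<forall>z. Im z > y0 \<longrightarrow> norm (fR z) < \<epsilon>"
proof -
  define n where "n = (\<lambda>q. QX q * QX q * QX q - 3 * (q ^ 2 * (QX q * QX q)) + q ^ 6 - QU q - 7 * (q ^ 6 * QV q))"
  define \<Phi> where "\<Phi> = (\<lambda>q. n q * n q + 3 * (q ^ 2 * (QX q * (QX q - q ^ 2) * n q)) -
           9 * (q ^ 2 * ((QX q - q ^ 2) * (QX q - q ^ 2) * (QX q * QX q * QX q + q ^ 4 * QX q))))"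
  have "\<Phi> \<in> O[at 0](\<lambda>q. q ^ 13)"
    using relation_q_expansion by (simp add: trunc13_def \<Phi>_def n_def)
  hence "(\<lambda>q. \<Phi> q / q ^ 12) \<in> O[at 0](\<lambda>q. q ^ 13 / q ^ 12)"
    by (intro landau_o.big.divide_right) (auto simp: eventually_at_filter)
  also have "(\<lambda>q::complex. q ^ 13 / q ^ 12) \<in> o[at 0](\<lambda>_. 1)"
  proof (rule smalloI_tendsto)
    have "((\<lambda>q::complex. q) \<longlongrightarrow> 0) (at 0)" by (rule tendsto_ident_at)
    thus "((\<lambda>q::complex. q ^ 13 / q ^ 12 / 1) \<longlongrightarrow> 0) (at 0)"
      by (rule Lim_transform_eventually) (auto simp: eventually_at_filter eval_nat_numeral)
  qed auto
  finally have "((\<lambda>q. \<Phi> q / q ^ 12 / 1) \<longlongrightarrow> 0) (at 0)" by (rule smalloD_tendsto)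
  hence ev: "eventually (\<lambda>q. norm (\<Phi> q / q ^ 12) < \<epsilon>) (at 0)"
    using tendstoD[OF _ assms, of "\<lambda>q. \<Phi> q / q ^ 12" 0 "at 0"] by simp
  obtain c where "c > 0" "\<And>z. Im z > c \<Longrightarrow> norm (\<Phi> (ex (z / of_nat 1)) / ex (z / of_nat 1) ^ 12) < \<epsilon>"
    by (rule eventually_at_0_ex[OF ev zero_less_one]) blast
  hence c: "norm (\<Phi> (ex z) / ex z ^ 12) < \<epsilon>" if "Im z > c" for z using that by simp
  have "fR z = \<Phi> (ex z) / ex z ^ 12" for z
  proof -
    define q where "q = ex z"
    have q: "q \<noteq> 0" by (simp add: q_def)
    have N: "fN z = n q / q ^ 6"
      using q by (simp add: fN_def fx_def fu_def fv_def n_def power_divide diff_divide_distrib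
          add_divide_distrib flip: q_def) (simp add: field_simps eval_nat_numeral)
    have x: "fx z = QX q / q ^ 2" and x1: "fx z - 1 = (QX q - q ^ 2) / q ^ 2"
      and x3: "fx z ^ 3 + fx z = (QX q * QX q * QX q + q ^ 4 * QX q) / q ^ 6"
      using q by (simp_all add: fx_def diff_divide_distrib flip: q_def) (simp add: field_simps eval_nat_numeral)
    have "A / q ^ 6 * (A / q ^ 6) + 3 * (B / q ^ 2) * (C / q ^ 2) * (A / q ^ 6) -
            9 * (C / q ^ 2 * (C / q ^ 2)) * (D / q ^ 6) =
          (A * A + 3 * (q ^ 2 * (B * C * A)) - 9 * (q ^ 2 * (C * C * D))) / q ^ 12" for A B C D
      using q by (simp add: field_simps eval_nat_numeral)
    thus ?thesis
      unfolding fR_def N x1 x3 unfolding x power2_eq_square[of "_ / _"] \<Phi>_def q_def[symmetric] by blast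
  qed
  hence "\<forall>z. Im z > c \<longrightarrow> norm (fR z) < \<epsilon>" using c by simp
  thus ?thesis by blast
qed

text \<open>The Fricke involution exchanges u and 7 v and fixes x, so it fixes \<open>fR\<close>;
  the behaviour at 0 is thus that at infinity. At the other cusps \<open>fR\<close> is a polynomial
  in bounded functions.\<close>

lemma fR_eq_0: "z \<in> uhp \<Longrightarrow> fR z = 0"
proof (rule modular_function_zero[OF _ _ fR_tends_to_0])
  show "fR holomorphic_on uhp"
    unfolding fR_def fN_def by (intro holomorphic_intros f_holomorphic)
  show inv: "G0_invariant fR"
    using f_G0_invariant by (simp add: G0_invariant_def fR_def fN_def)
  have fricke: "fR (fricke z) = fR z" if "z \<in> uhp" for z
    using that by (simp add: fR_def fN_def fx_fricke fu_fricke fv_fricke add.commute)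
  obtain y0 where y0: "\<And>z. Im z > y0 \<Longrightarrow> norm (fR z) < 1" using fR_tends_to_0[of 1] by auto
  show "bounded_at_cusp (\<lambda>z. fR (- 1 / z))"
    unfolding bounded_at_cusp_def
  proof (intro exI allI impI)
    fix z :: complex assume z: "Im z > 63 * max 0 y0"
    have "fR (- 1 / z) = fR (fricke (z / 63))" by (simp add: fricke_def)
    also have "\<dots> = fR (z / 63)" by (rule fricke) (use z in \<open>auto simp: uhp_def\<close>)
    also have "norm (fR (z / 63)) < 1" by (rule y0) (use z in \<open>auto simp: max_def split: if_splits\<close>)
    finally show "norm (fR (- 1 / z)) \<le> 1" by simp
  qed
  show "bounded_at_cusp (\<lambda>z. fR (mob a b c d z))"
    if "a * d - b * c = 1" "\<not> 63 dvd c" "3 dvd c \<or> 7 dvd c" for a b c d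
    unfolding fR_def fN_def
    by (intro bounded_at_cusp_add bounded_at_cusp_diff bounded_at_cusp_mult bounded_at_cusp_power
        bounded_at_cusp_const f_bounded_at_other_cusps[OF that])
qed

lemma numeral_mero_uhp: "numeral n = mero_of (\<lambda>_. numeral n)"
  using of_nat_mero_uhp[of "numeral n"] by (simp add: mero_of_const)

lemma one_mero_uhp: "1 = mero_of (\<lambda>_. 1)" and zero_mero_uhp: "0 = mero_of (\<lambda>_. 0)"
  using of_nat_mero_uhp[of 1] by (simp_all add: mero_of_const const_mero_0)

lemma eta_relation:
  defines "N \<equiv> Xm ^ 3 - 3 * Xm ^ 2 + 1 - (Um + 7 * Vm)"
  shows "N ^ 2 + 3 * Xm * (Xm - 1) * N - 9 * (Xm - 1) ^ 2 * (Xm ^ 3 + Xm) = 0"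
proof -
  have N: "N = mero_of fN"
    unfolding N_def fN_def Xm_def Um_def Vm_def numeral_mero_uhp one_mero_uhp
    by (simp add: mero_of_add mero_of_diff mero_of_mult mero_of_power f_meromorphic meromorphic_intros)
  have mN: "fN meromorphic_on uhp"
    unfolding fN_def by (intro meromorphic_intros f_meromorphic)
  have "N ^ 2 + 3 * Xm * (Xm - 1) * N - 9 * (Xm - 1) ^ 2 * (Xm ^ 3 + Xm) = mero_of fR"
    unfolding N fR_def Xm_def numeral_mero_uhp one_mero_uhp
    by (simp add: mero_of_add mero_of_diff mero_of_mult mero_of_power f_meromorphic mN meromorphic_intros)
  also have "\<dots> = 0"
    unfolding zero_mero_uhp
  proof (rule mero_of_eqI)
    show "fR meromorphic_on uhp"
      unfolding fR_def by (intro meromorphic_intros f_meromorphic mN)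
  qed (auto simp: fR_eq_0)
  finally show ?thesis .
qed

section \<open>The degree of the function field over $\mathbb{C}(x)$\<close>

subsection \<open>Invariant representatives\<close>

lemma mob_filterlim:
  assumes "a * d - b * c = 1" "z \<in> uhp"
  shows "filterlim (mob a b c d) (at (mob a b c d z)) (at z)"
proof -
  have "isCont (mob a b c d) z"
    using mob_holomorphic[of a d b c] assms open_uhp
    by (metis holomorphic_on_imp_continuous_on continuous_on_eq_continuous_at zero_less_one)
  hence "filterlim (mob a b c d) (nhds (mob a b c d z)) (at z)" by (simp add: isCont_def)
  moreover have "eventually (\<lambda>w. mob a b c d w \<noteq> mob a b c d z) (at z)"
  proof -
    have "eventually (\<lambda>w. w \<in> uhp - {z}) (at z)"
      using open_uhp assms(2) by (intro eventually_at_in_open) auto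
    thus ?thesis
    proof eventually_elim
      case (elim w)
      thus ?case using mob_inverse(2)[OF assms] mob_inverse(2)[OF assms(1), of w] by auto
    qed
  qed
  ultimately show ?thesis by (simp add: filterlim_at)
qed

lemma tendsto_compose_mob:
  assumes "a * d - b * c = 1" "z \<in> uhp" "g \<midarrow>mob a b c d z\<rightarrow> l"
  shows "(\<lambda>w. g (mob a b c d w)) \<midarrow>z\<rightarrow> l"
  using filterlim_compose[OF assms(3) mob_filterlim[OF assms(1,2)]] .

lemma tendsto_at_mob:
  assumes det: "a * d - b * c = 1" and z: "z \<in> uhp" and lim: "(\<lambda>w. g (mob a b c d w)) \<midarrow>z\<rightarrow> l"
  shows "g \<midarrow>mob a b c d z\<rightarrow> l"
proof -
  have det': "d * a - (- b) * (- c) = 1" using det by (simp add: algebra_simps)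
  have mz: "mob a b c d z \<in> uhp" by (rule mob_in_uhp) (use det z in auto)
  have "(\<lambda>w. g (mob a b c d (mob d (- b) (- c) a w))) \<midarrow>mob a b c d z\<rightarrow> l"
    by (rule tendsto_compose_mob[OF det' mz]) (simp add: mob_inverse(2)[OF det z] lim)
  moreover have "eventually (\<lambda>w. g (mob a b c d (mob d (- b) (- c) a w)) = g w) (at (mob a b c d z))"
    using eventually_at_in_open'[OF open_uhp mz] by eventually_elim (simp add: mob_inverse(1)[OF det])
  ultimately show ?thesis by (rule Lim_transform_eventually)
qed

lemma remove_sings_eq_if:
  assumes "\<And>l. f \<midarrow>z\<rightarrow> l \<longleftrightarrow> g \<midarrow>w\<rightarrow> l"
  shows "remove_sings f z = remove_sings g w"
  by (simp add: remove_sings_def t2_space_class.Lim_def assms)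

text \<open>The value of \<open>remove_sings\<close> at a point depends only on the limit there, and
  limits are transported by Moebius maps. Invariance near each point thereby becomes invariance at
  every point.\<close>

lemma remove_sings_G0_invariant:
  assumes "\<And>a b c d z. a * d - b * c = 1 \<Longrightarrow> 63 dvd c \<Longrightarrow> z \<in> uhp \<Longrightarrow>
             eventually (\<lambda>w. g (mob a b c d w) = g w) (at z)"
  shows "G0_invariant (remove_sings g)"
  unfolding G0_invariant_def
proof (intro allI impI)
  fix a b c d :: int and z :: complex assume *: "a * d - b * c = 1" "63 dvd c" "z \<in> uhp"
  note ev = assms[OF *]
  show "remove_sings g (mob a b c d z) = remove_sings g z"
  proof (rule remove_sings_eq_if)
    fix l
    have "g \<midarrow>mob a b c d z\<rightarrow> l \<longleftrightarrow> (\<lambda>w. g (mob a b c d w)) \<midarrow>z\<rightarrow> l"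
      using tendsto_compose_mob[OF *(1,3)] tendsto_at_mob[OF *(1,3)] by blast
    also have "\<dots> \<longleftrightarrow> g \<midarrow>z\<rightarrow> l" by (rule tendsto_cong[OF ev])
    finally show "g \<midarrow>mob a b c d z\<rightarrow> l \<longleftrightarrow> g \<midarrow>z\<rightarrow> l" .
  qed
qed

lemma mob_compose_meromorphic:
  assumes "a * d - b * c = 1" "f meromorphic_on uhp"
  shows "(\<lambda>z. f (mob a b c d z)) meromorphic_on uhp"
  using meromorphic_on_act[OF det_mat2_int[OF assms(1)] assms(2)] by (simp add: act_mat2)

lemma pullback_mob:
  assumes "a * d - b * c = 1" "f meromorphic_on uhp"
  shows "pullback (mat2 (of_int a) (of_int b) (of_int c) (of_int d)) (mero_of f) = mero_of (\<lambda>z. f (mob a b c d z))"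
  by (subst pullback_mero_of[OF det_mat2_int[OF assms(1)] assms(2)]) (simp add: act_mat2)

lemma C_X0_representative:
  assumes "F \<in> C_X0 63"
  obtains f where "f meromorphic_on uhp" "G0_invariant f" "F = mero_of f"
proof -
  obtain f where f: "f meromorphic_on uhp" "F = mero_of f" using mero_of_exhaust .
  show ?thesis
  proof (rule that[of "remove_sings f"])
    show m: "remove_sings f meromorphic_on uhp" using f(1) by (rule remove_sings_meromorphic)
    show "F = mero_of (remove_sings f)"
      unfolding f(2) mero_of_eq_iff[OF f(1) m]
      using eventually_remove_sings_eq[OF f(1)] by eventually_elim simp
    show "G0_invariant (remove_sings f)"
    proof (rule remove_sings_G0_invariant)
      fix a b c d :: int and z :: complex assume *: "a * d - b * c = 1" "63 dvd c" "z \<in> uhp"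
      have "mat2 (of_int a) (of_int b) (of_int c) (of_int d) \<in> Gamma0 63"
        unfolding Gamma0_def using * by auto
      hence "mero_of (\<lambda>z. f (mob a b c d z)) = mero_of f"
        using assms pullback_mob[OF *(1) f(1)] by (auto simp: C_X0_def f(2))
      hence "\<forall>\<^sub>\<approx>w\<in>uhp. f (mob a b c d w) = f w"
        by (simp add: mero_of_eq_iff mob_compose_meromorphic[OF *(1) f(1)] f(1))
      thus "eventually (\<lambda>w. f (mob a b c d w) = f w) (at z)"
        using *(3) by (simp add: eventually_cosparse_open_eq open_uhp)
    qed
  qed
qed

subsection \<open>Clearing poles by polynomials in $x$\<close>

text \<open>For a meromorphic function this says that there is no pole. Unlike pole orders, it
  passes directly through products and changes of coset.\<close>

definition has_limit_at :: "(complex \<Rightarrow> complex) \<Rightarrow> complex \<Rightarrow> bool" where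
  "has_limit_at f z \<longleftrightarrow> (\<exists>l. f \<midarrow>z\<rightarrow> l)"

lemma has_limit_at_mult: "has_limit_at f z \<Longrightarrow> has_limit_at g z \<Longrightarrow> has_limit_at (\<lambda>w. f w * g w) z"
  unfolding has_limit_at_def by (auto intro: tendsto_mult)

lemma has_limit_at_cong: "has_limit_at f z \<Longrightarrow> eventually (\<lambda>w. f w = g w) (at z) \<Longrightarrow> has_limit_at g z"
  unfolding has_limit_at_def by (auto intro: Lim_transform_eventually)

lemma holomorphic_has_limit_at: "f holomorphic_on uhp \<Longrightarrow> z \<in> uhp \<Longrightarrow> has_limit_at f z"
  unfolding has_limit_at_def using open_uhp
  by (metis holomorphic_on_imp_continuous_on continuous_on_eq_continuous_at isContD)

lemma poly_compose_holomorphic: "f holomorphic_on A \<Longrightarrow> (\<lambda>z. poly P (f z)) holomorphic_on A"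
  by (induction P) (auto intro!: holomorphic_intros)

lemma fx_mob_holomorphic: "a * d - b * c = 1 \<Longrightarrow> (\<lambda>z. fx (mob a b c d z)) holomorphic_on uhp"
  by (intro compose_mob_holomorphic f_holomorphic) auto

text \<open>The polynomial is (X - x(\<gamma> p))^m with m the order of the pole: composed with x
  and \<gamma> it vanishes at p to order at least m. Should that power vanish identically, the
  product is 0 and still has a limit.\<close>

lemma clear_pole_at:
  assumes f: "f meromorphic_on uhp" and det: "a * d - b * c = 1" and p: "p \<in> uhp"
  shows "\<exists>D. D \<noteq> 0 \<and> has_limit_at (\<lambda>w. poly D (fx (mob a b c d w)) * f (mob a b c d w)) p"
proof -
  have "(\<lambda>z. f (mob a b c d z)) meromorphic_on {p}"
    by (rule meromorphic_on_subset[OF mob_compose_meromorphic[OF det f]]) (use p in auto)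
  then obtain F where F: "(\<lambda>w. f (mob a b c d (p + w))) has_laurent_expansion F"
    unfolding meromorphic_on_def by auto
  define k where "k = (\<lambda>z. fx (mob a b c d z) - fx (mob a b c d p))"
  have "k holomorphic_on uhp"
    unfolding k_def by (intro holomorphic_intros fx_mob_holomorphic[OF det])
  hence "k analytic_on {p}" using p open_uhp unfolding analytic_at by blast
  hence A: "(\<lambda>w. k (p + w)) has_fps_expansion fps_expansion k p"
    by (rule analytic_at_imp_has_fps_expansion)
  define A' where "A' = fps_to_fls (fps_expansion k p)"
  have A': "(\<lambda>w. k (p + w)) has_laurent_expansion A'"
    unfolding A'_def by (rule has_laurent_expansion_fps[OF A])
  have "fps_nth (fps_expansion k p) 0 = 0"
    by (simp add: fps_expansion_def k_def)
  hence A'_deg: "fls_subdegree A' \<ge> 1" if "A' \<noteq> 0"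
    using that unfolding A'_def fls_subdegree_fls_to_fps
    by (metis One_nat_def Suc_leI fps_to_fls_eq_0_iff of_nat_1 of_nat_mono subdegree_eq_0_iff zero_less_iff_neq_zero)
  define m where "m = nat (- fls_subdegree F)"
  have L: "(\<lambda>w. k (p + w) ^ m * f (mob a b c d (p + w))) has_laurent_expansion A' ^ m * F"
    by (intro has_laurent_expansion_mult has_laurent_expansion_power A' F)
  have "fls_subdegree (A' ^ m * F) \<ge> 0"
  proof (cases "A' ^ m * F = 0")
    case False
    hence nz: "A' ^ m \<noteq> 0" "F \<noteq> 0" by auto
    have "int m \<le> fls_subdegree (A' ^ m)"
    proof (cases "m = 0")
      case False
      hence "A' \<noteq> 0" using nz by auto
      from A'_deg[OF this] have "int m * 1 \<le> int m * fls_subdegree A'" by (intro mult_left_mono) auto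
      thus ?thesis by (simp add: fls_subdegree_pow)
    qed auto
    hence "int m + fls_subdegree F \<le> fls_subdegree (A' ^ m * F)" using nz by simp
    thus ?thesis unfolding m_def by linarith
  next
    case True
    show ?thesis unfolding True by simp
  qed
  from has_laurent_expansion_imp_tendsto[of "\<lambda>z. k z ^ m * f (mob a b c d z)" p, OF L this]
  have "has_limit_at (\<lambda>z. k z ^ m * f (mob a b c d z)) p" unfolding has_limit_at_def by blast
  moreover have "k z ^ m = poly ([:- fx (mob a b c d p), 1:] ^ m) (fx (mob a b c d z))" for z
    by (simp add: k_def poly_power)
  ultimately show ?thesis
    by (intro exI[of _ "[:- fx (mob a b c d p), 1:] ^ m"]) auto
qed

lemma has_limit_at_dvd:
  assumes "has_limit_at (\<lambda>w. poly D (fx (mob a b c d w)) * f w) p" "D dvd E" "a * d - b * c = 1" "p \<in> uhp"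
  shows "has_limit_at (\<lambda>w. poly E (fx (mob a b c d w)) * f w) p"
proof -
  obtain D' where "E = D * D'" using assms(2) by blast
  hence eq: "(\<lambda>w. poly D' (fx (mob a b c d w)) * (poly D (fx (mob a b c d w)) * f w)) =
             (\<lambda>w. poly E (fx (mob a b c d w)) * f w)"
    by (simp add: fun_eq_iff mult_ac)
  have "has_limit_at (\<lambda>w. poly D' (fx (mob a b c d w))) p"
    by (intro holomorphic_has_limit_at poly_compose_holomorphic fx_mob_holomorphic assms)
  from has_limit_at_mult[OF this assms(1)] show ?thesis unfolding eq .
qed

text \<open>A convergent Laurent series is holomorphic in a punctured disc, so there are no poles
  above a certain height.\<close>

lemma has_limit_near_cusp:
  assumes "f meromorphic_on uhp" "mero_of f \<in> C_X0 63" "a * d - b * c = 1"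
  obtains y where "\<And>z. Im z > y \<Longrightarrow> has_limit_at (\<lambda>w. f (mob a b c d w)) z"
proof -
  have "mat2 (of_int a) (of_int b) (of_int c) (of_int d) \<in> Gamma0 1"
    unfolding Gamma0_def using assms(3) by auto
  moreover have "meromorphic_at_cusps (mero_of f)" using assms(2) by (simp add: C_X0_def)
  ultimately have "\<exists>h>0. \<exists>L. has_q_expansion h (mero_of (\<lambda>z. f (mob a b c d z))) L"
    unfolding meromorphic_at_cusps_def pullback_mob[OF assms(3,1), symmetric] by blast
  then obtain h L where h: "h > 0" "has_q_expansion h (mero_of (\<lambda>z. f (mob a b c d z))) L" by blast
  note m = mob_compose_meromorphic[OF assms(3,1)]
  obtain c' where c': "c' > 0" "eval_fls L has_laurent_expansion L"
    "\<forall>\<^sub>\<approx>z\<in>{z. Im z > c'}. f (mob a b c d z) = eval_fls L (ex (z / of_nat h))"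
    using has_q_expansionE[OF h(2) m] .
  have L: "fls_conv_radius L > 0" using c'(2) by (simp add: has_laurent_expansion_def)
  hence "eventually (\<lambda>q. q \<in> eball 0 (fls_conv_radius L) - {0}) (at 0)"
    by (intro eventually_at_in_open) (auto simp: zero_ereal_def)
  then obtain c'' where c'': "c'' > 0" "\<And>z. Im z > c'' \<Longrightarrow> ex (z / of_nat h) \<in> eball 0 (fls_conv_radius L) - {0}"
    by (rule eventually_at_0_ex[OF _ h(1)]) blast
  show ?thesis
  proof (rule that[of "max c' c''"])
    fix z assume z: "Im z > max c' c''"
    have "eval_fls L analytic_on {ex (z / of_nat h)}"
      by (rule analytic_on_eval_fls) (use c''(2)[of z] z in auto)
    hence "isCont (eval_fls L) (ex (z / of_nat h))" by (rule analytic_at_imp_isCont)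
    moreover have "isCont (\<lambda>z. ex (z / of_nat h)) z" unfolding ex_def by (intro continuous_intros) (use h in auto)
    ultimately have "isCont (\<lambda>z. eval_fls L (ex (z / of_nat h))) z"
      using isCont_o2 by blast
    hence "has_limit_at (\<lambda>z. eval_fls L (ex (z / of_nat h))) z"
      unfolding has_limit_at_def by (auto dest: isContD)
    moreover have "eventually (\<lambda>z. f (mob a b c d z) = eval_fls L (ex (z / of_nat h))) (at z)"
      using c'(3) z by (simp add: eventually_cosparse_open_eq open_halfspace_Im_gt)
    hence "eventually (\<lambda>z. eval_fls L (ex (z / of_nat h)) = f (mob a b c d z)) (at z)"
      by eventually_elim simp
    ultimately show "has_limit_at (\<lambda>w. f (mob a b c d w)) z" by (rule has_limit_at_cong)
  qed
qed

lemma Re_shift_63: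
  obtains n :: int where "0 \<le> Re (z + of_int (63 * n))" "Re (z + of_int (63 * n)) \<le> 63"
proof (rule that[of "- \<lfloor>Re z / 63\<rfloor>"])
  have "of_int \<lfloor>Re z / 63\<rfloor> \<le> Re z / 63" "Re z / 63 \<le> of_int \<lfloor>Re z / 63\<rfloor> + 1" by linarith+
  thus "0 \<le> Re (z + of_int (63 * - \<lfloor>Re z / 63\<rfloor>))" "Re (z + of_int (63 * - \<lfloor>Re z / 63\<rfloor>)) \<le> 63"
    by (simp_all, linarith+)
qed

text \<open>Modulo Gamma0(63) there are only finitely many poles: with finitely many coset
  representatives every point is moved to 0 \<le> Re \<le> 63, Im \<ge> 1/5; there are no poles high
  up, and the compact remainder contains finitely many. The product of all clearing polynomials
  works because x is invariant.\<close>

lemma clear_poles: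
  assumes f: "f meromorphic_on uhp" "G0_invariant f" "mero_of f \<in> C_X0 63"
  shows "\<exists>D. D \<noteq> 0 \<and> (\<forall>z\<in>uhp. has_limit_at (\<lambda>w. poly D (fx w) * f w) z)"
proof -
  obtain R where R: "finite R" "R \<subseteq> SL2Z"
    "\<And>a b c d. a * d - b * c = 1 \<Longrightarrow> \<exists>(a', b', c', d')\<in>R. c mod 63 = c' mod 63 \<and> d mod 63 = d' mod 63"
    by (rule finite_coset_representatives) blast
  have ex_rho: "\<exists>D. D \<noteq> 0 \<and> (\<forall>z. 0 \<le> Re z \<longrightarrow> Re z \<le> 63 \<longrightarrow> 1 / 5 \<le> Im z \<longrightarrow>
            (case \<rho> of (a, b, c, d) \<Rightarrow> has_limit_at (\<lambda>w. poly D (fx (mob a b c d w)) * f (mob a b c d w)) z))"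
    if "\<rho> \<in> R" for \<rho>
  proof -
    obtain a b c d where \<rho>: "\<rho> = (a, b, c, d)" by (cases \<rho>)
    have det: "a * d - b * c = 1" using that R(2) by (auto simp: \<rho> SL2Z_def)
    obtain y where y: "\<And>z. Im z > y \<Longrightarrow> has_limit_at (\<lambda>w. f (mob a b c d w)) z"
      using has_limit_near_cusp[OF f(1,3) det] by blast
    define K where "K = cbox (Complex 0 (1 / 5)) (Complex 63 y)"
    have K: "z \<in> K \<longleftrightarrow> 0 \<le> Re z \<and> Re z \<le> 63 \<and> 1 / 5 \<le> Im z \<and> Im z \<le> y" for z
      by (auto simp: K_def in_cbox_complex_iff)
    have "K \<subseteq> uhp" by (auto simp: K uhp_def)
    define P where "P = K \<inter> {w. \<not> (\<lambda>w. f (mob a b c d w)) analytic_on {w}}"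
    have "{w. \<not> (\<lambda>w. f (mob a b c d w)) analytic_on {w}} sparse_in K"
      using meromorphic_on_imp_sparse_singularities[OF mob_compose_meromorphic[OF det f(1)]] \<open>K \<subseteq> uhp\<close>
      by (rule sparse_in_subset)
    hence "finite P" unfolding P_def by (rule sparse_in_compact_finite) (simp add: K_def)
    have "\<forall>p\<in>P. \<exists>D. D \<noteq> 0 \<and> has_limit_at (\<lambda>w. poly D (fx (mob a b c d w)) * f (mob a b c d w)) p"
      using clear_pole_at[OF f(1) det] \<open>K \<subseteq> uhp\<close> by (auto simp: P_def)
    then obtain D where D: "\<And>p. p \<in> P \<Longrightarrow> D p \<noteq> 0"
      "\<And>p. p \<in> P \<Longrightarrow> has_limit_at (\<lambda>w. poly (D p) (fx (mob a b c d w)) * f (mob a b c d w)) p"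
      by metis
    have "has_limit_at (\<lambda>w. poly (\<Prod>p\<in>P. D p) (fx (mob a b c d w)) * f (mob a b c d w)) z"
      if z: "0 \<le> Re z" "Re z \<le> 63" "1 / 5 \<le> Im z" for z
    proof -
      have zu: "z \<in> uhp" using z by (simp add: uhp_def)
      show ?thesis
      proof (cases "z \<in> P")
        case True
        thus ?thesis
          by (intro has_limit_at_dvd[OF D(2) _ det zu] dvd_prodI \<open>finite P\<close>) auto
      next
        case False
        have "has_limit_at (\<lambda>w. f (mob a b c d w)) z"
        proof (cases "Im z > y")
          case False
          hence "(\<lambda>w. f (mob a b c d w)) analytic_on {z}" using \<open>z \<notin> P\<close> z by (auto simp: P_def K)
          from analytic_at_imp_isCont[OF this] show ?thesis unfolding has_limit_at_def by (auto dest: isContD)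
        qed (rule y)
        hence "has_limit_at (\<lambda>w. poly 1 (fx (mob a b c d w)) * f (mob a b c d w)) z" by simp
        thus ?thesis by (rule has_limit_at_dvd[OF _ one_dvd det zu])
      qed
    qed
    thus ?thesis using D(1) \<open>finite P\<close> by (intro exI[of _ "\<Prod>p\<in>P. D p"]) (auto simp: \<rho>)
  qed
  have "\<exists>D. \<forall>\<rho>\<in>R. D \<rho> \<noteq> 0 \<and> (\<forall>z. 0 \<le> Re z \<longrightarrow> Re z \<le> 63 \<longrightarrow> 1 / 5 \<le> Im z \<longrightarrow>
            (case \<rho> of (a, b, c, d) \<Rightarrow> has_limit_at (\<lambda>w. poly (D \<rho>) (fx (mob a b c d w)) * f (mob a b c d w)) z))"
    using ex_rho by (intro bchoice) blast
  then obtain D where D: "\<And>\<rho>. \<rho> \<in> R \<Longrightarrow> D \<rho> \<noteq> (0 :: complex poly)"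
    "\<And>\<rho> z. \<rho> \<in> R \<Longrightarrow> 0 \<le> Re z \<Longrightarrow> Re z \<le> 63 \<Longrightarrow> 1 / 5 \<le> Im z \<Longrightarrow>
            (case \<rho> of (a, b, c, d) \<Rightarrow> has_limit_at (\<lambda>w. poly (D \<rho>) (fx (mob a b c d w)) * f (mob a b c d w)) z)"
    by blast
  define E where "E = (\<Prod>\<rho>\<in>R. D \<rho>)"
  define g where "g = (\<lambda>w. poly E (fx w) * f w)"
  have inv: "G0_invariant g"
    using f(2) f_G0_invariant(3) by (simp add: G0_invariant_def g_def)
  have "has_limit_at g z" if z: "z \<in> uhp" for z
  proof -
    obtain a b c d where det: "a * d - b * c = 1" and Im: "Im (mob a b c d z) \<ge> 1 / 5"
      using modular_reduce[OF z] .
    define z' where "z' = mob a b c d z"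
    have z': "z' \<in> uhp" unfolding z'_def by (rule mob_in_uhp) (use det z in auto)
    have zz': "z = mob d (- b) (- c) a z'" unfolding z'_def by (rule mob_inverse(2)[symmetric]) fact+
    have det': "d * a - (- b) * (- c) = 1" using det by (simp add: algebra_simps)
    obtain a' b' c' d' where \<rho>: "(a', b', c', d') \<in> R" "(- c) mod 63 = c' mod 63" "a mod 63 = d' mod 63"
      using R(3)[OF det'] by auto
    have det'': "a' * d' - b' * c' = 1" using \<rho>(1) R(2) by (auto simp: SL2Z_def)
    obtain n where n: "0 \<le> Re (z' + of_int (63 * n))" "Re (z' + of_int (63 * n)) \<le> 63"
      by (rule Re_shift_63)
    \<comment> \<open>Translating by a multiple of 63 keeps the bottom row modulo 63 and reaches the
      strip treated above. The limit found there is then carried back to z' and to z.\<close>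
    define z'' where "z'' = z' + of_int (63 * n)"
    have "Im z'' \<ge> 1 / 5" using Im by (simp add: z''_def z'_def)
    hence z'': "z'' \<in> uhp" by (simp add: uhp_def)
    have "has_limit_at (\<lambda>w. poly (D (a', b', c', d')) (fx (mob a' b' c' d' w)) * f (mob a' b' c' d' w)) z''"
      using D(2)[OF \<rho>(1), of z''] n Im by (simp add: z''_def z'_def)
    hence "has_limit_at (\<lambda>w. g (mob a' b' c' d' w)) z''"
      unfolding g_def by (rule has_limit_at_dvd[OF _ _ det'' z'']) (auto simp: E_def intro: dvd_prodI R(1) \<rho>(1))
    then obtain l where l: "(\<lambda>w. g (mob a' b' c' d' w)) \<midarrow>mob 1 (63 * n) 0 1 z'\<rightarrow> l"
      unfolding has_limit_at_def z''_def by (auto simp: mob_def)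
    have "(\<lambda>w. g (mob a' b' c' d' (mob 1 (63 * n) 0 1 w))) \<midarrow>z'\<rightarrow> l"
      by (rule tendsto_compose_mob[OF _ z' l]) simp
    moreover have "eventually (\<lambda>w. g (mob a' b' c' d' (mob 1 (63 * n) 0 1 w)) = g (mob d (- b) (- c) a w)) (at z')"
      using eventually_at_in_open'[OF open_uhp z']
    proof eventually_elim
      case (elim w)
      have "g (mob a' b' c' d' (mob 1 (63 * n) 0 1 w)) = g (mob a' b' c' d' w)"
        using G0_invariant_period[OF inv det'' elim, of n] by (simp add: mob_def)
      also have "\<dots> = g (mob d (- b) (- c) a w)"
        by (rule G0_invariant_cong_row[OF inv det'' det' \<rho>(2,3)[symmetric] elim])
      finally show ?case .
    qed
    ultimately have "(\<lambda>w. g (mob d (- b) (- c) a w)) \<midarrow>z'\<rightarrow> l" by (rule Lim_transform_eventually)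
    from tendsto_at_mob[OF det' z' this] show ?thesis unfolding has_limit_at_def zz'[symmetric] by blast
  qed
  moreover have "E \<noteq> 0" using D(1) R(1) by (simp add: E_def)
  ultimately show ?thesis unfolding g_def by blast
qed

definition evX :: "complex poly \<Rightarrow> mero_uhp" where
  "evX P = mero_of (\<lambda>z. poly P (fx z))"

lemma poly_fx_meromorphic: "(\<lambda>z. poly P (fx z)) meromorphic_on uhp"
  by (intro holomorphic_imp_meromorphic_on_uhp poly_compose_holomorphic f_holomorphic)

lemma evX_ring:
  "evX 0 = 0" "evX 1 = 1" "evX (P + Q) = evX P + evX Q" "evX (P * Q) = evX P * evX Q"
  "evX [:c:] = const_mero c" "evX [:0, 1:] = Xm"
  by (simp_all add: evX_def mero_of_add mero_of_mult poly_fx_meromorphic mero_of_const zero_mero_uhp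
      one_mero_uhp Xm_def)

lemma evX_in_C_X0: "evX P \<in> C_X0 63"
proof (induction P)
  case 0
  show ?case using is_subfield_C_X0 by (simp add: evX_ring is_subfield_def)
next
  case (pCons a P)
  have "pCons a P = [:a:] + [:0, 1:] * P" by simp
  hence "evX (pCons a P) = const_mero a + Xm * evX P" by (simp only: evX_ring)
  moreover have "Xm \<in> C_X0 63" using f_in_Q_X0(3) by (simp add: Q_X0_iff)
  ultimately show ?case
    using is_subfield_C_X0[of 63] const_mero_in_C_X0[of a 63] pCons.IH by (simp add: is_subfield_def)
qed

lemma holomorphic_multiple:
  assumes "F \<in> C_X0 63"
  obtains D G where "D \<noteq> 0" "G holomorphic_on uhp" "G0_invariant G" "mero_of G = evX D * F"
proof -
  obtain f where f: "f meromorphic_on uhp" "G0_invariant f" "F = mero_of f"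
    using C_X0_representative[OF assms] .
  obtain D where D: "D \<noteq> 0" "\<And>z. z \<in> uhp \<Longrightarrow> has_limit_at (\<lambda>w. poly D (fx w) * f w) z"
    using clear_poles[OF f(1,2)] assms f(3) by blast
  define g where "g = (\<lambda>w. poly D (fx w) * f w)"
  have g: "g meromorphic_on uhp" unfolding g_def by (intro meromorphic_intros poly_fx_meromorphic f)
  show ?thesis
  proof (rule that[OF D(1), of "remove_sings g"])
    have "remove_sings g analytic_on {z}" if zu: "z \<in> uhp" for z
    proof -
      obtain l where "g \<midarrow>z\<rightarrow> l" using D(2)[OF zu] by (auto simp: has_limit_at_def g_def)
      moreover have "isolated_singularity_at g z"
        by (rule meromorphic_on_isolated_singularity[OF meromorphic_on_subset[OF g]]) (use zu in auto)
      ultimately show ?thesis by (intro remove_sings_analytic_at)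
    qed
    hence "remove_sings g analytic_on uhp" using analytic_on_analytic_at by blast
    thus "remove_sings g holomorphic_on uhp" by (rule analytic_imp_holomorphic)
    have inv: "G0_invariant g" using f(2) f_G0_invariant(3) by (simp add: G0_invariant_def g_def)
    show "G0_invariant (remove_sings g)"
    proof (rule remove_sings_G0_invariant)
      fix a b c d :: int and z :: complex assume *: "a * d - b * c = 1" "63 dvd c" "z \<in> uhp"
      show "eventually (\<lambda>w. g (mob a b c d w) = g w) (at z)"
        using eventually_at_in_open'[OF open_uhp *(3)]
        by eventually_elim (use inv *(1,2) in \<open>auto simp: G0_invariant_def\<close>)
    qed
    have "mero_of (remove_sings g) = mero_of g"
      unfolding mero_of_eq_iff[OF remove_sings_meromorphic[OF g] g] by (rule eventually_remove_sings_eq[OF g])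
    also have "\<dots> = evX D * F"
      unfolding g_def evX_def f(3) by (rule mero_of_mult[symmetric]) (intro poly_fx_meromorphic f)+
    finally show "mero_of (remove_sings g) = evX D * F" .
  qed
qed

subsection \<open>Clearing poles at the cusps\<close>

text \<open>A pole of order at most K measured in e(z), independently of the width of the
  cusp.\<close>

definition cusp_growth :: "nat \<Rightarrow> (complex \<Rightarrow> complex) \<Rightarrow> bool" where
  "cusp_growth K f \<longleftrightarrow> (\<exists>B y0. \<forall>z. Im z > y0 \<longrightarrow> norm (f z) \<le> B * exp (2 * pi * real K * Im z))"

lemma cusp_growth_mono:
  assumes "cusp_growth K f" "K \<le> K'" shows "cusp_growth K' f"
proof -
  obtain B y0 where B: "\<And>z. Im z > y0 \<Longrightarrow> norm (f z) \<le> B * exp (2 * pi * real K * Im z)"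
    using assms(1) unfolding cusp_growth_def by blast
  have "norm (f z) \<le> \<bar>B\<bar> * exp (2 * pi * real K' * Im z)" if z: "Im z > max y0 0" for z
  proof -
    have "norm (f z) \<le> B * exp (2 * pi * real K * Im z)" using B[of z] z by simp
    also have "\<dots> \<le> \<bar>B\<bar> * exp (2 * pi * real K' * Im z)"
      using assms(2) z by (intro mult_mono) (auto intro!: mult_right_mono mult_left_mono)
    finally show ?thesis .
  qed
  thus ?thesis unfolding cusp_growth_def by blast
qed

lemma modular_cusp_growth:
  assumes G: "G holomorphic_on uhp" "G0_invariant G" "mero_of G \<in> C_X0 63" and det: "a * d - b * c = 1"
  obtains K where "cusp_growth K (\<lambda>z. G (mob a b c d z))"
proof -
  note m = holomorphic_imp_meromorphic_on_uhp[OF G(1)]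
  have hol: "(\<lambda>z. G (mob a b c d z)) holomorphic_on uhp"
    by (rule compose_mob_holomorphic[OF G(1)]) (use det in auto)
  have "mat2 (of_int a) (of_int b) (of_int c) (of_int d) \<in> Gamma0 1"
    unfolding Gamma0_def using det by auto
  moreover have "meromorphic_at_cusps (mero_of G)" using G(3) by (simp add: C_X0_def)
  ultimately have "\<exists>h>0. \<exists>L. has_q_expansion h (mero_of (\<lambda>z. G (mob a b c d z))) L"
    unfolding meromorphic_at_cusps_def pullback_mob[OF det m, symmetric] by blast
  then obtain h L where h: "h > 0" "has_q_expansion h (mero_of (\<lambda>z. G (mob a b c d z))) L" by blast
  obtain c' where c': "c' > 0" "eval_fls L has_laurent_expansion L"
    "\<forall>\<^sub>\<approx>z\<in>{z. Im z > c'}. G (mob a b c d z) = eval_fls L (ex (z / of_nat h))"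
    using has_q_expansionE[OF h(2) holomorphic_imp_meromorphic_on_uhp[OF hol]] .
  define m where "m = nat (- fls_subdegree L)"
  have lau: "(\<lambda>q. q ^ m * eval_fls L q) has_laurent_expansion fls_X ^ m * L"
    by (intro has_laurent_expansion_mult has_laurent_expansion_power has_laurent_expansion_fps_X c')
  have "fls_subdegree (fls_X ^ m * L) \<ge> 0"
  proof (cases "L = 0")
    case False
    thus ?thesis unfolding fls_subdegree_mult_fls_X_power(1)[OF False] m_def by linarith
  qed auto
  from has_laurent_expansion_imp_tendsto_0[OF lau this]
  have "eventually (\<lambda>q. norm (q ^ m * eval_fls L q) < norm (fls_nth (fls_X ^ m * L) 0) + 1) (at 0)"
    using order_tendstoD(2)[OF tendsto_norm] by fastforce
  moreover have "eventually (\<lambda>q. q \<in> eball 0 (fls_conv_radius L) - {0}) (at 0)"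
    using c'(2) by (intro eventually_at_in_open) (auto simp: has_laurent_expansion_def zero_ereal_def)
  ultimately have "eventually (\<lambda>q. norm (q ^ m * eval_fls L q) < norm (fls_nth (fls_X ^ m * L) 0) + 1 \<and>
      q \<in> eball 0 (fls_conv_radius L) - {0}) (at 0)" by (rule eventually_conj)
  then obtain c'' where c'': "c'' > 0" "\<And>z. Im z > c'' \<Longrightarrow>
      norm (ex (z / of_nat h) ^ m * eval_fls L (ex (z / of_nat h))) < norm (fls_nth (fls_X ^ m * L) 0) + 1 \<and>
      ex (z / of_nat h) \<in> eball 0 (fls_conv_radius L) - {0}"
    by (rule eventually_at_0_ex[OF _ h(1)]) blast
  define B where "B = norm (fls_nth (fls_X ^ m * L) 0) + 1"
  have "norm (G (mob a b c d z)) \<le> B * exp (2 * pi * real m * Im z)" if z: "Im z > max c' c''" for z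
  proof -
    define q where "q = ex (z / of_nat h)"
    have zu: "z \<in> uhp" using z c'(1) by (simp add: uhp_def)
    \<comment> \<open>The expansion is known only off a discrete set; since both sides are
      continuous at z, their common limit gives equality at z itself.\<close>
    have eq: "G (mob a b c d z) = eval_fls L q"
    proof (rule tendsto_unique)
      have "isCont (\<lambda>z. G (mob a b c d z)) z"
        using hol zu open_uhp by (metis holomorphic_on_imp_continuous_on continuous_on_eq_continuous_at)
      thus "(\<lambda>z. G (mob a b c d z)) \<midarrow>z\<rightarrow> G (mob a b c d z)" by (rule isContD)
      have "eval_fls L analytic_on {q}"
        by (rule analytic_on_eval_fls) (use c''(2)[of z] z in \<open>auto simp: q_def\<close>)
      hence "isCont (eval_fls L) q" by (rule analytic_at_imp_isCont)
      moreover have "isCont (\<lambda>z. ex (z / of_nat h)) z" unfolding ex_def by (intro continuous_intros) (use h in auto)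
      ultimately have "isCont (\<lambda>z. eval_fls L (ex (z / of_nat h))) z"
        unfolding q_def by (rule isCont_o2[rotated])
      hence "(\<lambda>z. eval_fls L (ex (z / of_nat h))) \<midarrow>z\<rightarrow> eval_fls L q" unfolding q_def by (rule isContD)
      moreover have "eventually (\<lambda>z. eval_fls L (ex (z / of_nat h)) = G (mob a b c d z)) (at z)"
      proof -
        have "eventually (\<lambda>z. G (mob a b c d z) = eval_fls L (ex (z / of_nat h))) (at z)"
          using c'(3) z by (simp add: eventually_cosparse_open_eq open_halfspace_Im_gt)
        thus ?thesis by eventually_elim simp
      qed
      ultimately show "(\<lambda>z. G (mob a b c d z)) \<midarrow>z\<rightarrow> eval_fls L q" by (rule Lim_transform_eventually)
    qed auto
    have nq: "norm q ^ m = exp (- (2 * pi * real m * Im z / real h))"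
      by (simp add: q_def norm_ex exp_of_nat_mult[symmetric])
    have "norm q ^ m * norm (eval_fls L q) \<le> B"
      using c''(2)[of z] z by (simp add: q_def B_def norm_mult norm_power)
    hence "norm (eval_fls L q) \<le> B * exp (2 * pi * real m * Im z / real h)"
      unfolding nq by (simp add: exp_minus field_simps)
    also have "\<dots> \<le> B * exp (2 * pi * real m * Im z)"
    proof -
      have "2 * pi * real m * Im z / real h \<le> 2 * pi * real m * Im z / 1"
        using h z c'(1) by (intro divide_left_mono) auto
      thus ?thesis unfolding B_def by (intro mult_left_mono) (auto intro: add_nonneg_nonneg)
    qed
    finally show ?thesis unfolding eq .
  qed
  hence "cusp_growth m (\<lambda>z. G (mob a b c d z))" unfolding cusp_growth_def by blast
  thus ?thesis by (rule that)
qed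

text \<open>The Riemann-Roch space of K times the sum of the cusps infinity and 0; -1/(63 z) is the
  Fricke involution, which moves 0 to infinity.\<close>

definition bounded_poles :: "nat \<Rightarrow> (complex \<Rightarrow> complex) \<Rightarrow> bool" where
  "bounded_poles K G \<longleftrightarrow> G holomorphic_on uhp \<and> G0_invariant G \<and> cusp_growth K G \<and>
     cusp_growth K (\<lambda>z. G (- 1 / (63 * z))) \<and>
     (\<forall>a b c d. a * d - b * c = 1 \<longrightarrow> \<not> 63 dvd c \<longrightarrow> 3 dvd c \<or> 7 dvd c \<longrightarrow> bounded_at_cusp (\<lambda>z. G (mob a b c d z)))"

lemma poly_fx_bounded_at_other_cusps:
  assumes "a * d - b * c = 1" "\<not> 63 dvd c" "3 dvd c \<or> 7 dvd c"
  shows "bounded_at_cusp (\<lambda>z. poly P (fx (mob a b c d z)))"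
  by (induction P)
     (simp_all add: bounded_at_cusp_const bounded_at_cusp_add bounded_at_cusp_mult f_bounded_at_other_cusps[OF assms])

text \<open>x is bounded at this cusp and takes the value \<open>A 0\<close> there, so x - A 0 is
  O(e(z/63)). Its power 63 K therefore compensates growth of order K in e(z).\<close>

lemma clear_cusp:
  assumes G: "G holomorphic_on uhp" "G0_invariant G" "mero_of G \<in> C_X0 63"
    and type: "a * d - b * c = 1" "\<not> 63 dvd c" "3 dvd c \<or> 7 dvd c"
  shows "\<exists>D. D \<noteq> 0 \<and> bounded_at_cusp (\<lambda>z. poly D (fx (mob a b c d z)) * G (mob a b c d z))"
proof -
  obtain K where K: "cusp_growth K (\<lambda>z. G (mob a b c d z))"
    using modular_cusp_growth[OF G type(1)] .
  then obtain B y0 where B: "\<And>z. Im z > y0 \<Longrightarrow> norm (G (mob a b c d z)) \<le> B * exp (2 * pi * real K * Im z)"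
    unfolding cusp_growth_def by blast
  obtain B' y' where B': "\<And>z. Im z > y' \<Longrightarrow> norm (fx (mob a b c d z)) \<le> B'"
    using f_bounded_at_other_cusps(3)[OF type] unfolding bounded_at_cusp_def by blast
  obtain A where A: "A holomorphic_on ball 0 1"
    "\<And>z. z \<in> uhp \<Longrightarrow> fx (mob a b c d z) = A (ex (z / of_nat 63)) / ex (z / of_nat 63) ^ 0"
  proof (rule periodic_function_on_disc_bounded[of "\<lambda>z. fx (mob a b c d z)" 63 y' B' 0])
    show "fx (mob a b c d (z + of_int (int 63 * n))) = fx (mob a b c d z)" if "z \<in> uhp" for z n
      using G0_invariant_period[OF f_G0_invariant(3) type(1) that, of n] by simp
  qed (use B' fx_mob_holomorphic[OF type(1)] that in auto)
  define N where "N = 63 * K"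
  have "(A has_field_derivative deriv A 0) (at 0)"
    using A(1) by (intro holomorphic_derivI[of A "ball 0 1"]) auto
  hence "((\<lambda>q. (A q - A 0) / q) \<longlongrightarrow> deriv A 0) (at 0)"
    by (simp add: has_field_derivative_iff)
  hence "eventually (\<lambda>q. norm ((A q - A 0) / q) < norm (deriv A 0) + 1) (at 0)"
    using order_tendstoD(2)[OF tendsto_norm] by fastforce
  then obtain c' where c': "c' > 0" "\<And>z. Im z > c' \<Longrightarrow>
      norm ((A (ex (z / of_nat 63)) - A 0) / ex (z / of_nat 63)) < norm (deriv A 0) + 1"
    by (rule eventually_at_0_ex[where h = 63]) auto
  define C where "C = norm (deriv A 0) + 1"
  have "norm (poly ([:- A 0, 1:] ^ N) (fx (mob a b c d z)) * G (mob a b c d z)) \<le> C ^ N * \<bar>B\<bar>"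
    if z: "Im z > max y0 c'" for z
  proof -
    define q where "q = ex (z / 63)"
    have zu: "z \<in> uhp" using z c'(1) by (simp add: uhp_def)
    have "norm (A q - A 0) \<le> C * norm q"
      using c'(2)[of z] z by (simp add: q_def C_def norm_divide divide_less_eq)
    hence "norm (A q - A 0) ^ N \<le> (C * norm q) ^ N" by (intro power_mono) auto
    also have "\<dots> = C ^ N * exp (- (2 * pi * real K * Im z))"
      by (simp add: power_mult_distrib q_def norm_ex exp_of_nat_mult[symmetric] N_def)
    finally have 1: "norm (poly ([:- A 0, 1:] ^ N) (fx (mob a b c d z))) \<le> C ^ N * exp (- (2 * pi * real K * Im z))"
      using A(2)[OF zu] by (simp add: poly_power norm_power q_def)
    have "norm (G (mob a b c d z)) \<le> B * exp (2 * pi * real K * Im z)" using B[of z] z by simp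
    also have "\<dots> \<le> \<bar>B\<bar> * exp (2 * pi * real K * Im z)" by (intro mult_right_mono) auto
    finally have "norm (poly ([:- A 0, 1:] ^ N) (fx (mob a b c d z)) * G (mob a b c d z)) \<le>
        (C ^ N * exp (- (2 * pi * real K * Im z))) * (\<bar>B\<bar> * exp (2 * pi * real K * Im z))"
      unfolding norm_mult using 1 by (intro mult_mono) (auto simp: C_def)
    also have "\<dots> = C ^ N * \<bar>B\<bar>" by (simp add: exp_minus field_simps)
    finally show ?thesis .
  qed
  hence "bounded_at_cusp (\<lambda>z. poly ([:- A 0, 1:] ^ N) (fx (mob a b c d z)) * G (mob a b c d z))"
    unfolding bounded_at_cusp_def by blast
  thus ?thesis by (intro exI[of _ "[:- A 0, 1:] ^ N"]) auto
qed

lemma bounded_poles_multiple: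
  assumes "F \<in> C_X0 63"
  obtains D G K where "D \<noteq> 0" "bounded_poles K G" "mero_of G = evX D * F"
proof -
  obtain D0 G0 where G0: "D0 \<noteq> 0" "G0 holomorphic_on uhp" "G0_invariant G0" "mero_of G0 = evX D0 * F"
    using holomorphic_multiple[OF assms] .
  have C: "mero_of G0 \<in> C_X0 63"
    unfolding G0(4) using is_subfield_C_X0[of 63] evX_in_C_X0[of D0] assms by (simp add: is_subfield_def)
  obtain R where R: "finite R" "R \<subseteq> SL2Z"
    "\<And>a b c d. a * d - b * c = 1 \<Longrightarrow> \<exists>(a', b', c', d')\<in>R. c mod 63 = c' mod 63 \<and> d mod 63 = d' mod 63"
    by (rule finite_coset_representatives) blast
  define R' where "R' = {(a, b, c, d) \<in> R. \<not> 63 dvd c \<and> (3 dvd c \<or> 7 dvd c)}"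
  have "finite R'" using R(1) by (rule finite_subset[rotated]) (auto simp: R'_def)
  have "\<exists>D. D \<noteq> 0 \<and> (case \<rho> of (a, b, c, d) \<Rightarrow> bounded_at_cusp (\<lambda>z. poly D (fx (mob a b c d z)) * G0 (mob a b c d z)))"
    if "\<rho> \<in> R'" for \<rho>
    using that R(2) clear_cusp[OF G0(2,3) C] by (auto simp: R'_def SL2Z_def)
  hence "\<exists>D. \<forall>\<rho>\<in>R'. D \<rho> \<noteq> 0 \<and> (case \<rho> of (a, b, c, d) \<Rightarrow> bounded_at_cusp (\<lambda>z. poly (D \<rho>) (fx (mob a b c d z)) * G0 (mob a b c d z)))"
    by (intro bchoice) blast
  then obtain D where D: "\<And>\<rho>. \<rho> \<in> R' \<Longrightarrow> D \<rho> \<noteq> (0 :: complex poly)"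
    "\<And>a b c d. (a, b, c, d) \<in> R' \<Longrightarrow> bounded_at_cusp (\<lambda>z. poly (D (a, b, c, d)) (fx (mob a b c d z)) * G0 (mob a b c d z))"
    by fastforce
  define E where "E = (\<Prod>\<rho>\<in>R'. D \<rho>)"
  define G where "G = (\<lambda>z. poly E (fx z) * G0 z)"
  have E0: "E \<noteq> 0" using D(1) \<open>finite R'\<close> by (simp add: E_def)
  have hol: "G holomorphic_on uhp"
    unfolding G_def by (intro holomorphic_intros poly_compose_holomorphic f_holomorphic G0)
  have inv: "G0_invariant G" using G0(3) f_G0_invariant(3) by (simp add: G0_invariant_def G_def)
  have eq: "mero_of G = evX (E * D0) * F"
    unfolding G_def mero_of_mult[OF poly_fx_meromorphic holomorphic_imp_meromorphic_on_uhp[OF G0(2)], symmetric]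
    by (simp add: G0(4) evX_ring mult.assoc flip: evX_def)
  have CG: "mero_of G \<in> C_X0 63"
    unfolding eq using is_subfield_C_X0[of 63] evX_in_C_X0[of "E * D0"] assms by (simp add: is_subfield_def)
  have bounded: "bounded_at_cusp (\<lambda>z. G (mob a b c d z))"
    if type: "a * d - b * c = 1" "\<not> 63 dvd c" "3 dvd c \<or> 7 dvd c" for a b c d
  proof -
    obtain a' b' c' d' where \<rho>: "(a', b', c', d') \<in> R" "c mod 63 = c' mod 63" "d mod 63 = d' mod 63"
      using R(3)[OF type(1)] by auto
    have det': "a' * d' - b' * c' = 1" using \<rho>(1) R(2) by (auto simp: SL2Z_def)
    have "k dvd c \<longleftrightarrow> k dvd c'" if "k dvd 63" for k
      using dvd_mod_iff[OF that, of c] dvd_mod_iff[OF that, of c'] \<rho>(2) by simp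
    from this[of 63] this[of 3] this[of 7] have "\<not> 63 dvd c'" "3 dvd c' \<or> 7 dvd c'"
      using type(2,3) by auto
    hence type': "\<not> 63 dvd c'" "3 dvd c' \<or> 7 dvd c'" and mem: "(a', b', c', d') \<in> R'"
      using \<rho>(1) by (auto simp: R'_def)
    have "D (a', b', c', d') dvd E" unfolding E_def by (rule dvd_prodI[OF \<open>finite R'\<close> mem])
    then obtain E' where E': "E = E' * D (a', b', c', d')" by (metis dvdE mult.commute)
    have "bounded_at_cusp (\<lambda>z. poly E' (fx (mob a' b' c' d' z)) *
            (poly (D (a', b', c', d')) (fx (mob a' b' c' d' z)) * G0 (mob a' b' c' d' z)))"
      by (intro bounded_at_cusp_mult D(2) mem poly_fx_bounded_at_other_cusps[OF det' type'])
    thus ?thesis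
    proof (rule bounded_at_cusp_cong)
      fix z assume z: "z \<in> uhp"
      have "G (mob a b c d z) = G (mob a' b' c' d' z)"
        by (rule G0_invariant_cong_row[OF inv type(1) det' \<rho>(2,3) z])
      thus "poly E' (fx (mob a' b' c' d' z)) * (poly (D (a', b', c', d')) (fx (mob a' b' c' d' z)) * G0 (mob a' b' c' d' z)) =
            G (mob a b c d z)"
        by (simp add: G_def E' mult.assoc)
    qed
  qed
  obtain K1 where K1: "cusp_growth K1 (\<lambda>z. G (mob 1 0 0 1 z))"
    by (rule modular_cusp_growth[OF hol inv CG, of 1 1 0 0]) auto
  obtain K2 where K2: "cusp_growth K2 (\<lambda>z. G (mob 0 (-1) 1 0 z))"
    by (rule modular_cusp_growth[OF hol inv CG, of 0 0 "-1" 1]) auto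
  have "cusp_growth (63 * K2) (\<lambda>z. G (- 1 / (63 * z)))"
  proof -
    obtain B y0 where B: "\<And>z. Im z > y0 \<Longrightarrow> norm (G (mob 0 (-1) 1 0 z)) \<le> B * exp (2 * pi * real K2 * Im z)"
      using K2 unfolding cusp_growth_def by blast
    have "norm (G (- 1 / (63 * z))) \<le> B * exp (2 * pi * real (63 * K2) * Im z)" if "Im z > \<bar>y0\<bar>" for z
      using B[of "63 * z"] that by (simp add: mob_def mult_ac)
    thus ?thesis unfolding cusp_growth_def by blast
  qed
  hence "bounded_poles (max K1 (63 * K2)) G"
    unfolding bounded_poles_def using hol inv bounded cusp_growth_mono[OF K1, of "max K1 (63 * K2)"]
    by (auto simp: mob_def intro: cusp_growth_mono)
  moreover have "E * D0 \<noteq> 0" using E0 G0(1) by simp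
  ultimately show ?thesis using eq that by blast
qed

lemma bounded_poles_mono: "bounded_poles K G \<Longrightarrow> K \<le> K' \<Longrightarrow> bounded_poles K' G"
  unfolding bounded_poles_def by (auto intro: cusp_growth_mono)

subsection \<open>Linear dependence over $\mathbb{C}(x)$\<close>

text \<open>Gaussian elimination: each equation with a nonzero coefficient is used to eliminate one
  unknown \<open>i0\<close>.\<close>

lemma underdetermined_system:
  fixes a :: "'j \<Rightarrow> 'i \<Rightarrow> complex"
  assumes "finite J" "finite I" "card J < card I"
  shows "\<exists>c. (\<exists>i\<in>I. c i \<noteq> 0) \<and> (\<forall>j\<in>J. (\<Sum>i\<in>I. c i * a j i) = 0)"
  using assms
proof (induction J arbitrary: I a rule: finite_induct)
  case empty
  hence "I \<noteq> {}" by auto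
  thus ?case by (intro exI[of _ "\<lambda>_. 1"]) auto
next
  case (insert j J)
  show ?case
  proof (cases "\<forall>i\<in>I. a j i = 0")
    case True
    obtain c where "\<exists>i\<in>I. c i \<noteq> 0" "\<forall>j\<in>J. (\<Sum>i\<in>I. c i * a j i) = 0"
      using insert.IH[of I a] insert.prems insert.hyps by auto
    thus ?thesis using True by (intro exI[of _ c]) auto
  next
    case False
    then obtain i0 where i0: "i0 \<in> I" "a j i0 \<noteq> 0" by blast
    define a' where "a' = (\<lambda>k i. a k i - a k i0 * a j i / a j i0)"
    have "card J < card (I - {i0})" using insert.prems insert.hyps i0(1) by (simp add: card_Diff_singleton)
    then obtain c where c: "\<exists>i\<in>I - {i0}. c i \<noteq> 0" "\<forall>k\<in>J. (\<Sum>i\<in>I - {i0}. c i * a' k i) = 0"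
      using insert.IH[of "I - {i0}" a'] insert.prems by auto
    define c' where "c' = c(i0 := - (\<Sum>i\<in>I - {i0}. c i * a j i) / a j i0)"
    have sum: "(\<Sum>i\<in>I. c' i * a k i) = c' i0 * a k i0 + (\<Sum>i\<in>I - {i0}. c i * a k i)" for k
      using insert.prems(1) i0(1) by (subst sum.remove[of _ i0]) (auto simp: c'_def intro!: sum.cong)
    have "(\<Sum>i\<in>I. c' i * a k i) = 0" if "k \<in> insert j J" for k
    proof (cases "k = j")
      case True
      thus ?thesis unfolding sum using i0(2) by (simp add: c'_def)
    next
      case False
      hence "(\<Sum>i\<in>I - {i0}. c i * a' k i) = 0" using c(2) that by auto
      moreover have "(\<Sum>i\<in>I - {i0}. c i * a' k i) =
          (\<Sum>i\<in>I - {i0}. c i * a k i) - (\<Sum>i\<in>I - {i0}. c i * a j i) * (a k i0 / a j i0)"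
        by (simp add: a'_def sum_subtractf sum_distrib_right algebra_simps sum_distrib_left)
      ultimately show ?thesis unfolding sum by (simp add: c'_def field_simps)
    qed
    moreover have "\<exists>i\<in>I. c' i \<noteq> 0" using c(1) by (auto simp: c'_def)
    ultimately show ?thesis by blast
  qed
qed

text \<open>Vanishing through order M makes A / q^(M+1) regular at 0, hence bounded there; one
  factor q is left over and gives decay.\<close>

lemma vanishing_order_bound:
  assumes "A holomorphic_on ball 0 1" "\<And>k. k \<le> M \<Longrightarrow> (deriv ^^ k) A 0 = 0"
  obtains C c where "\<And>z. Im z > c \<Longrightarrow> norm (A (ex z) / ex z ^ M) \<le> C * norm (ex z)"
proof -
  have "A analytic_on {0}" using assms(1) by (auto simp: analytic_at intro!: exI[of _ "ball 0 1"])
  hence lau: "A has_laurent_expansion fps_to_fls (fps_expansion A 0)"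
    by (intro has_laurent_expansion_fps analytic_at_imp_has_fps_expansion_0)
  hence "(\<lambda>q. A q * inverse (q ^ Suc M)) has_laurent_expansion fps_to_fls (fps_expansion A 0) * inverse (fls_X ^ Suc M)"
    by (intro has_laurent_expansion_mult has_laurent_expansion_inverse has_laurent_expansion_power has_laurent_expansion_fps_X)
  moreover have "fls_subdegree (fps_to_fls (fps_expansion A 0) * inverse (fls_X ^ Suc M)) \<ge> 0"
  proof (cases "fps_expansion A 0 = 0")
    case False
    have "subdegree (fps_expansion A 0) \<ge> Suc M"
      by (rule subdegree_geI) (use False assms(2) in \<open>auto simp: fps_expansion_def\<close>)
    hence "int (Suc M) \<le> fls_subdegree (fps_to_fls (fps_expansion A 0))"
      by (simp add: fls_subdegree_fls_to_fps)
    moreover have "fls_subdegree (fps_to_fls (fps_expansion A 0) * inverse (fls_X ^ Suc M)) =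
            fls_subdegree (fps_to_fls (fps_expansion A 0)) - int (Suc M)"
      using False by (subst fls_subdegree_mult) (simp_all add: fls_inverse_subdegree fls_subdegree_pow)
    ultimately show ?thesis by linarith
  qed simp
  ultimately have "((\<lambda>q. A q * inverse (q ^ Suc M)) \<longlongrightarrow>
      fls_nth (fps_to_fls (fps_expansion A 0) * inverse (fls_X ^ Suc M)) 0) (at 0)"
    by (rule has_laurent_expansion_imp_tendsto_0)
  hence "eventually (\<lambda>q. norm (A q * inverse (q ^ Suc M)) <
      norm (fls_nth (fps_to_fls (fps_expansion A 0) * inverse (fls_X ^ Suc M)) 0) + 1) (at 0)"
    using order_tendstoD(2)[OF tendsto_norm] by fastforce
  then obtain c where c: "\<And>z. Im z > c \<Longrightarrow> norm (A (ex (z / of_nat 1)) * inverse (ex (z / of_nat 1) ^ Suc M)) <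
      norm (fls_nth (fps_to_fls (fps_expansion A 0) * inverse (fls_X ^ Suc M)) 0) + 1"
    by (rule eventually_at_0_ex[OF _ zero_less_one]) blast
  show ?thesis
  proof (rule that)
    fix z assume "Im z > c"
    from c[OF this] have "norm (A (ex z) / ex z ^ M) / norm (ex z) \<le>
        norm (fls_nth (fps_to_fls (fps_expansion A 0) * inverse (fls_X ^ Suc M)) 0) + 1"
      by (simp add: norm_mult norm_divide norm_inverse norm_power divide_inverse mult_ac)
    thus "norm (A (ex z) / ex z ^ M) \<le>
        (norm (fls_nth (fps_to_fls (fps_expansion A 0) * inverse (fls_X ^ Suc M)) 0) + 1) * norm (ex z)"
      by (simp add: divide_le_eq)
  qed
qed

lemma G0_invariant_period_1: "G0_invariant g \<Longrightarrow> z \<in> uhp \<Longrightarrow> g (z + of_int n) = g z"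
  unfolding G0_invariant_def by (drule spec[of _ 1], drule spec[of _ n], drule spec[of _ 0], drule spec[of _ 1])
    (auto simp: mob_def)

lemma G0_invariant_fricke:
  assumes "G0_invariant g" shows "G0_invariant (\<lambda>z. g (fricke z))"
  unfolding G0_invariant_def
proof (intro allI impI)
  fix a b c d :: int and z :: complex assume *: "a * d - b * c = 1" "63 dvd c" "z \<in> uhp"
  show "g (fricke (mob a b c d z)) = g (fricke z)"
    unfolding fricke_mob(1)[OF *]
    using assms fricke_mob(2,3)[OF *] fricke_in_uhp[OF *(3)] unfolding G0_invariant_def by blast
qed

lemma fricke_holomorphic: "g holomorphic_on uhp \<Longrightarrow> (\<lambda>z. g (fricke z)) holomorphic_on uhp"
proof -
  assume g: "g holomorphic_on uhp"
  have "fricke holomorphic_on uhp" unfolding fricke_def by (intro holomorphic_intros) (use uhp_nonzero in auto)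
  hence "(g \<circ> fricke) holomorphic_on uhp"
    by (rule holomorphic_on_compose_gen[OF _ g]) (use fricke_in_uhp in auto)
  thus ?thesis by (simp add: o_def)
qed

lemma invariant_expansion:
  assumes "G holomorphic_on uhp" "G0_invariant G" "cusp_growth K G"
  shows "\<exists>A. A holomorphic_on ball 0 1 \<and> (\<forall>z\<in>uhp. G z = A (ex z) / ex z ^ K)"
proof -
  obtain B y0 where B: "\<And>z. Im z > y0 \<Longrightarrow> norm (G z) \<le> B * exp (2 * pi * real K * Im z)"
    using assms(3) unfolding cusp_growth_def by blast
  obtain A where "A holomorphic_on ball 0 1" "\<And>z. z \<in> uhp \<Longrightarrow> G z = A (ex (z / of_nat 1)) / ex (z / of_nat 1) ^ K"
    by (rule periodic_function_on_disc_bounded[OF assms(1), of 1 y0 B K])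
       (use B G0_invariant_period_1[OF assms(2)] in auto)
  thus ?thesis by auto
qed

lemma higher_deriv_sum:
  fixes z :: complex
  assumes "\<And>i. i \<in> I \<Longrightarrow> f i holomorphic_on S" "open S" "z \<in> S"
  shows "(deriv ^^ k) (\<lambda>w. \<Sum>i\<in>I. f i w) z = (\<Sum>i\<in>I. (deriv ^^ k) (f i) z)"
  using assms(1)
proof (induction I rule: infinite_finite_induct)
  case (insert i I)
  thus ?case
    using higher_deriv_add[of "f i" S "\<lambda>w. \<Sum>i\<in>I. f i w" z k] assms(2,3) by (auto intro!: holomorphic_intros)
qed simp_all

theorem bounded_poles_dependent:
  assumes G: "\<And>i. i < 5 \<Longrightarrow> bounded_poles K (G i)"
  obtains P :: "nat \<Rightarrow> complex poly" where "\<exists>i<5. P i \<noteq> 0"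
    "\<And>z. z \<in> uhp \<Longrightarrow> (\<Sum>i<5. poly (P i) (fx z) * G i z) = 0"
proof -
  \<comment> \<open>In \<open>\<Sum>\<^sub>i P\<^sub>i(x) G\<^sub>i\<close> with \<open>P\<^sub>i\<close> of degree at most \<open>n\<close>, the pole orders at \<open>\<infinity>\<close> and \<open>0\<close> are at most \<open>M\<close>.
    There are \<open>5 (n + 1) = 10 K + 5\<close> coefficients and \<open>2 (M + 1) = 10 K + 2\<close> conditions.\<close>
  define n where "n = 2 * K"
  define M where "M = 2 * n + K"
  have "\<forall>i\<in>{..<5}. \<exists>A. A holomorphic_on ball 0 1 \<and> (\<forall>z\<in>uhp. G i z = A (ex z) / ex z ^ K)"
    using G unfolding bounded_poles_def by (intro ballI invariant_expansion) auto
  from bchoice[OF this] obtain A where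
    A: "\<And>i. i < 5 \<Longrightarrow> A i holomorphic_on ball 0 1" "\<And>i z. i < 5 \<Longrightarrow> z \<in> uhp \<Longrightarrow> G i z = A i (ex z) / ex z ^ K"
    by auto
  have "\<forall>i\<in>{..<5}. \<exists>A. A holomorphic_on ball 0 1 \<and> (\<forall>z\<in>uhp. G i (fricke z) = A (ex z) / ex z ^ K)"
    using G unfolding bounded_poles_def fricke_def[symmetric]
    by (intro ballI invariant_expansion[of "\<lambda>z. G _ (fricke z)"] fricke_holomorphic G0_invariant_fricke) auto
  from bchoice[OF this] obtain A' where
    A': "\<And>i. i < 5 \<Longrightarrow> A' i holomorphic_on ball 0 1" "\<And>i z. i < 5 \<Longrightarrow> z \<in> uhp \<Longrightarrow> G i (fricke z) = A' i (ex z) / ex z ^ K"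
    by auto
  define I where "I = {..<5::nat} \<times> {..n}"
  \<comment> \<open>For \<rho> = (i, j) this is q^M x^j G_i as a holomorphic function of q: x^j has
    denominator q^(2j), G_i has q^K, and M = 2 (n - j) + 2 j + K.\<close>
  define T where "T = (\<lambda>(a :: nat \<Rightarrow> complex \<Rightarrow> complex) (i, j) q. q ^ (2 * (n - j)) * QX q ^ j * a i q)"
  have T_hol: "T a \<rho> holomorphic_on ball 0 1" if "\<And>i. i < 5 \<Longrightarrow> a i holomorphic_on ball 0 1" "\<rho> \<in> I" for a \<rho>
    using that by (auto simp: T_def I_def intro!: holomorphic_intros Q_holomorphic)
  \<comment> \<open>The flag s selects the cusp: \<open>True\<close> is infinity with the expansions
    \<open>A\<close>, \<open>False\<close> is 0 with the expansions \<open>A'\<close>.\<close>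
  define a where "a = (\<lambda>(s :: bool, k) \<rho>. (deriv ^^ k) (T (if s then A else A') \<rho>) 0)"
  have "card (UNIV \<times> {..M} :: (bool \<times> nat) set) < card I"
    by (simp add: I_def card_cartesian_product M_def n_def)
  from underdetermined_system[OF _ _ this, of a]
  obtain c where c: "\<exists>\<rho>\<in>I. c \<rho> \<noteq> 0" "\<And>s k. k \<le> M \<Longrightarrow> (\<Sum>\<rho>\<in>I. c \<rho> * a (s, k) \<rho>) = 0"
    by (auto simp: I_def)
  define P where "P = (\<lambda>i. \<Sum>j\<le>n. monom (c (i, j)) j)"
  define g where "g = (\<lambda>z. \<Sum>i<5. poly (P i) (fx z) * G i z)"
  have g_eq: "g z = (\<Sum>\<rho>\<in>I. c \<rho> * (fx z ^ snd \<rho> * G (fst \<rho>) z))" for z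
    unfolding g_def P_def I_def
    by (simp add: poly_sum poly_monom sum_distrib_right mult.assoc sum.cartesian_product case_prod_unfold)
  define S where "S = (\<lambda>a q. \<Sum>\<rho>\<in>I. c \<rho> * T a \<rho> q)"
  have S_hol: "S (if s then A else A') holomorphic_on ball 0 1" for s
    unfolding S_def by (intro holomorphic_intros T_hol) (use A(1) A'(1) in auto)
  have S_deriv: "(deriv ^^ k) (S (if s then A else A')) 0 = 0" if "k \<le> M" for s k
  proof -
    have "(deriv ^^ k) (S (if s then A else A')) 0 = (\<Sum>\<rho>\<in>I. (deriv ^^ k) (\<lambda>q. c \<rho> * T (if s then A else A') \<rho> q) 0)"
      unfolding S_def
      by (rule higher_deriv_sum[of _ _ "ball 0 1"]) (use A(1) A'(1) T_hol in \<open>auto intro!: holomorphic_intros\<close>)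
    also have "\<dots> = (\<Sum>\<rho>\<in>I. c \<rho> * (deriv ^^ k) (T (if s then A else A') \<rho>) 0)"
      by (intro sum.cong refl higher_deriv_cmult[of _ "ball 0 1"] T_hol) (use A(1) A'(1) in auto)
    also have "\<dots> = 0" using c(2)[OF that, of s] by (simp add: a_def)
    finally show ?thesis .
  qed
  have g_S: "g z = S A (ex z) / ex z ^ M" "g (fricke z) = S A' (ex z) / ex z ^ M" if z: "z \<in> uhp" for z
  proof -
    define q where "q = ex z"
    have q: "q \<noteq> 0" by (simp add: q_def)
    have key: "X ^ j * Y = q ^ (2 * (n - j)) * QX q ^ j * B / q ^ M"
      if "j \<le> n" "X = QX q / q ^ 2" "Y = B / q ^ K" for X Y B j
    proof -
      have "q ^ M = q ^ (2 * (n - j)) * q ^ (2 * j) * q ^ K"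
      proof -
        have "M = 2 * (n - j) + 2 * j + K" using that(1) by (simp add: M_def)
        thus ?thesis by (simp only: power_add)
      qed
      moreover have "X ^ j = QX q ^ j / q ^ (2 * j)" by (simp add: that(2) power_divide flip: power_mult)
      ultimately show ?thesis using q that(3) by (simp del: power_mult)
    qed
    have fxq: "fx z = QX q / q ^ 2" "fx (fricke z) = QX q / q ^ 2"
      using fx_fricke[OF z] by (simp_all add: fx_def q_def)
    show "g z = S A (ex z) / ex z ^ M"
      unfolding g_eq S_def sum_divide_distrib q_def[symmetric]
    proof (rule sum.cong[OF refl])
      fix \<rho> assume "\<rho> \<in> I"
      then obtain i j where \<rho>: "\<rho> = (i, j)" "i < 5" "j \<le> n" by (auto simp: I_def)
      show "c \<rho> * (fx z ^ snd \<rho> * G (fst \<rho>) z) = c \<rho> * T A \<rho> q / q ^ M"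
        using key[OF \<rho>(3) fxq(1), of "G i z" "A i q"] A(2)[OF \<rho>(2) z] by (simp add: \<rho>(1) T_def q_def)
    qed
    show "g (fricke z) = S A' (ex z) / ex z ^ M"
      unfolding g_eq S_def sum_divide_distrib q_def[symmetric]
    proof (rule sum.cong[OF refl])
      fix \<rho> assume "\<rho> \<in> I"
      then obtain i j where \<rho>: "\<rho> = (i, j)" "i < 5" "j \<le> n" by (auto simp: I_def)
      show "c \<rho> * (fx (fricke z) ^ snd \<rho> * G (fst \<rho>) (fricke z)) = c \<rho> * T A' \<rho> q / q ^ M"
        using key[OF \<rho>(3) fxq(2), of "G i (fricke z)" "A' i q"] A'(2)[OF \<rho>(2) z] by (simp add: \<rho>(1) T_def q_def)
    qed
  qed
  have hol: "g holomorphic_on uhp"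
    unfolding g_def by (intro holomorphic_intros poly_compose_holomorphic f_holomorphic) (use G in \<open>auto simp: bounded_poles_def\<close>)
  have inv: "G0_invariant g"
    using G f_G0_invariant(3) by (simp add: G0_invariant_def g_def bounded_poles_def)
  have zero: "g z = 0" if "z \<in> uhp" for z
  proof (rule modular_function_zero[OF hol inv _ _ _ that])
    fix \<epsilon> :: real assume \<epsilon>: "\<epsilon> > 0"
    obtain C y where C: "\<And>z. Im z > y \<Longrightarrow> norm (S A (ex z) / ex z ^ M) \<le> C * norm (ex z)"
      by (rule vanishing_order_bound[of "S A" M]) (use S_hol[of True] S_deriv[of _ True] in simp_all, blast)
    have "((\<lambda>q::complex. of_real C * q) \<longlongrightarrow> of_real C * 0) (at 0)" by (intro tendsto_intros)
    hence "eventually (\<lambda>q::complex. norm (of_real C * q) < \<epsilon>) (at 0)"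
      using tendstoD[OF _ \<epsilon>] by fastforce
    then obtain y' where y': "y' > 0" "\<And>z. Im z > y' \<Longrightarrow> norm (of_real C * ex (z / of_nat 1)) < \<epsilon>"
      by (rule eventually_at_0_ex[OF _ zero_less_one]) blast
    have "norm (g z) < \<epsilon>" if z: "Im z > max y y'" for z
    proof -
      have zu: "z \<in> uhp" using z y'(1) by (simp add: uhp_def)
      have "norm (g z) \<le> C * norm (ex z)" unfolding g_S(1)[OF zu] using C[of z] z by simp
      also have "\<dots> \<le> norm (of_real C * ex z)" by (simp add: norm_mult mult_right_mono)
      also have "\<dots> < \<epsilon>" using y'(2)[of z] z by simp
      finally show ?thesis .
    qed
    thus "\<exists>y0. \<forall>z. Im z > y0 \<longrightarrow> norm (g z) < \<epsilon>" by blast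
  next
    obtain C y where C: "\<And>z. Im z > y \<Longrightarrow> norm (S A' (ex z) / ex z ^ M) \<le> C * norm (ex z)"
      by (rule vanishing_order_bound[of "S A'" M]) (use S_hol[of False] S_deriv[of _ False] in simp_all, blast)
    have "norm (g (- 1 / z)) \<le> \<bar>C\<bar>" if z: "Im z > 63 * max y 0" for z
    proof -
      have zu: "z / 63 \<in> uhp" and zy: "Im (z / 63) > y" using z by (auto simp: uhp_def max_def split: if_splits)
      have "g (- 1 / z) = S A' (ex (z / 63)) / ex (z / 63) ^ M"
        using g_S(2)[OF zu] by (simp add: fricke_def)
      also have "norm \<dots> \<le> C * norm (ex (z / 63))" by (rule C[OF zy])
      also have "\<dots> \<le> \<bar>C\<bar> * 1"
        using norm_ex_less_1[OF zu] by (intro mult_mono) auto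
      finally show ?thesis by simp
    qed
    thus "bounded_at_cusp (\<lambda>z. g (- 1 / z))" unfolding bounded_at_cusp_def by blast
  next
    fix a b c d :: int assume type: "a * d - b * c = 1" "\<not> 63 dvd c" "3 dvd c \<or> 7 dvd c"
    show "bounded_at_cusp (\<lambda>z. g (mob a b c d z))"
      unfolding g_def
      by (intro bounded_at_cusp_sum bounded_at_cusp_mult poly_fx_bounded_at_other_cusps[OF type])
         (use G type in \<open>auto simp: bounded_poles_def\<close>)
  qed
  have "\<exists>i<5. P i \<noteq> 0"
  proof -
    obtain i j where ij: "i < 5" "j \<le> n" "c (i, j) \<noteq> 0" using c(1) by (auto simp: I_def)
    have "coeff (P i) j = c (i, j)"
      using ij(2) by (simp add: P_def coeff_sum coeff_monom sum.delta)
    thus ?thesis using ij by (intro exI[of _ i]) auto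
  qed
  thus ?thesis using zero unfolding g_def by (rule that)
qed

corollary C_X0_dependent:
  assumes "\<And>i. i < 5 \<Longrightarrow> F i \<in> C_X0 63"
  obtains P :: "nat \<Rightarrow> complex poly" where "\<exists>i<5. P i \<noteq> 0" "(\<Sum>i<5. evX (P i) * F i) = 0"
proof -
  have "\<exists>D G K. D \<noteq> 0 \<and> bounded_poles K G \<and> mero_of G = evX D * F i" if i: "i < 5" for i
  proof -
    obtain D G K where "D \<noteq> 0" "bounded_poles K G" "mero_of G = evX D * F i"
      using bounded_poles_multiple[OF assms[OF i]] .
    thus ?thesis by blast
  qed
  then obtain D G K where DGK: "\<And>i. i < 5 \<Longrightarrow> D i \<noteq> 0" "\<And>i. i < 5 \<Longrightarrow> bounded_poles (K i) (G i)"
    "\<And>i. i < 5 \<Longrightarrow> mero_of (G i) = evX (D i) * F i"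
    by metis
  define K' where "K' = Max (K ` {..<5})"
  have bp: "bounded_poles K' (G i)" if "i < 5" for i
    by (rule bounded_poles_mono[OF DGK(2)[OF that]]) (use that in \<open>auto simp: K'_def intro!: Max_ge\<close>)
  obtain P where P: "\<exists>i<5. P i \<noteq> 0" "\<And>z. z \<in> uhp \<Longrightarrow> (\<Sum>i<5. poly (P i) (fx z) * G i z) = 0"
    by (rule bounded_poles_dependent[of K' G, OF bp]) (assumption | rule that)+
  have mG: "G i meromorphic_on uhp" if "i < 5" for i
    using DGK(2)[OF that] by (intro holomorphic_imp_meromorphic_on_uhp) (simp add: bounded_poles_def)
  show ?thesis
  proof (rule that[of "\<lambda>i. P i * D i"])
    show "\<exists>i<5. P i * D i \<noteq> 0" using P(1) DGK(1) by auto
    have "(\<Sum>i<N. evX (P i * D i) * F i) = mero_of (\<lambda>z. \<Sum>i<N. poly (P i) (fx z) * G i z) \<and>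
          (\<lambda>z. \<Sum>i<N. poly (P i) (fx z) * G i z) meromorphic_on uhp" if "N \<le> 5" for N
      using that
    proof (induction N)
      case 0
      thus ?case by (auto simp: zero_mero_uhp intro!: meromorphic_intros)
    next
      case (Suc N)
      have m: "(\<lambda>z. poly (P N) (fx z) * G N z) meromorphic_on uhp"
        using Suc.prems by (intro meromorphic_intros poly_fx_meromorphic mG) auto
      have "evX (P N * D N) * F N = evX (P N) * mero_of (G N)"
        using Suc.prems DGK(3)[of N] by (simp add: evX_ring mult.assoc)
      also have "\<dots> = mero_of (\<lambda>z. poly (P N) (fx z) * G N z)"
        unfolding evX_def using Suc.prems by (intro mero_of_mult poly_fx_meromorphic mG) auto
      finally show ?case using Suc m by (auto simp: mero_of_add intro!: meromorphic_intros)
    qed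
    from this[of 5] have eq: "(\<Sum>i<5. evX (P i * D i) * F i) = mero_of (\<lambda>z. \<Sum>i<5. poly (P i) (fx z) * G i z)"
      and m: "(\<lambda>z. \<Sum>i<5. poly (P i) (fx z) * G i z) meromorphic_on uhp" by simp_all
    show "(\<Sum>i<5. evX (P i * D i) * F i) = 0"
      unfolding eq zero_mero_uhp by (rule mero_of_eqI[OF m]) (use P(2) in auto)
  qed
qed

section \<open>Equations over the rationals\<close>

subsection \<open>Subfields\<close>

lemma is_subfield_ops:
  assumes "is_subfield K"
  shows "0 \<in> K" "1 \<in> K" "a \<in> K \<Longrightarrow> b \<in> K \<Longrightarrow> a + b \<in> K" "a \<in> K \<Longrightarrow> b \<in> K \<Longrightarrow> a - b \<in> K"
    "a \<in> K \<Longrightarrow> b \<in> K \<Longrightarrow> a * b \<in> K" "a \<in> K \<Longrightarrow> inverse a \<in> K" "a \<in> K \<Longrightarrow> - a \<in> K"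
    "a \<in> K \<Longrightarrow> b \<in> K \<Longrightarrow> a / b \<in> K" "a \<in> K \<Longrightarrow> a ^ n \<in> K" "of_nat n \<in> K" "numeral k \<in> K"
    "of_int i \<in> K"
proof -
  have s: "0 \<in> K" "1 \<in> K" "\<And>a b. a \<in> K \<Longrightarrow> b \<in> K \<Longrightarrow> a + b \<in> K"
    "\<And>a b. a \<in> K \<Longrightarrow> b \<in> K \<Longrightarrow> a - b \<in> K" "\<And>a b. a \<in> K \<Longrightarrow> b \<in> K \<Longrightarrow> a * b \<in> K" "\<And>a. a \<in> K \<Longrightarrow> inverse a \<in> K"
    using assms by (auto simp: is_subfield_def)
  show "0 \<in> K" "1 \<in> K" "a \<in> K \<Longrightarrow> b \<in> K \<Longrightarrow> a + b \<in> K" "a \<in> K \<Longrightarrow> b \<in> K \<Longrightarrow> a - b \<in> K"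
    "a \<in> K \<Longrightarrow> b \<in> K \<Longrightarrow> a * b \<in> K" "a \<in> K \<Longrightarrow> inverse a \<in> K" by (simp_all add: s)
  have u: "- a \<in> K" if "a \<in> K" for a using s(4)[OF s(1) that] by simp
  show "a \<in> K \<Longrightarrow> - a \<in> K" by (rule u)
  show "a \<in> K \<Longrightarrow> b \<in> K \<Longrightarrow> a / b \<in> K" by (simp add: divide_inverse s)
  show "a \<in> K \<Longrightarrow> a ^ n \<in> K" by (induction n) (simp_all add: s)
  have n: "of_nat n \<in> K" for n by (induction n) (simp_all add: s)
  show "of_nat n \<in> K" by (rule n)
  show "numeral k \<in> K" using n[of "numeral k"] by simp
  show "of_int i \<in> K" using n u by (cases i rule: int_cases2) auto
qed

lemma of_rat_in_subfield: "is_subfield K \<Longrightarrow> of_rat r \<in> (K :: 'a :: field_char_0 set)"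
  by (cases r) (simp add: of_rat_rat is_subfield_ops)

lemma rat_adjoin_subset: "is_subfield K \<Longrightarrow> S \<subseteq> K \<Longrightarrow> rat_adjoin S \<subseteq> K"
  unfolding rat_adjoin_def by blast

lemma subset_rat_adjoin: "S \<subseteq> rat_adjoin S"
  unfolding rat_adjoin_def by blast

lemma is_subfield_rat_adjoin: "is_subfield (rat_adjoin S)"
  unfolding rat_adjoin_def is_subfield_def by blast

lemma rat_adjoin_mono: "S \<subseteq> S' \<Longrightarrow> rat_adjoin S \<subseteq> rat_adjoin S'"
  unfolding rat_adjoin_def by blast

lemma poly_of_rat_in_subfield: "is_subfield K \<Longrightarrow> a \<in> K \<Longrightarrow> poly (map_poly of_rat P) a \<in> K"
  by (induction P) (simp_all add: map_poly_pCons is_subfield_ops of_rat_in_subfield)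

subsection \<open>The functions $x$, $y$, $t$\<close>

lemma fx_unbounded:
  obtains y where "\<And>z. Im z > y \<Longrightarrow> norm (fx z) > B"
proof -
  have "isCont QX 0"
    using Q_holomorphic(3) by (metis holomorphic_on_imp_continuous_on continuous_on_eq_continuous_at open_ball centre_in_ball zero_less_one)
  hence "QX \<midarrow>0\<rightarrow> QX 0" by (rule isContD)
  moreover have "filterlim (\<lambda>q::complex. q ^ 2) (at 0) (at 0)"
    by (rule filterlim_atI) (auto intro!: tendsto_eq_intros simp: eventually_at_filter)
  ultimately have "filterlim (\<lambda>q. QX q / q ^ 2) at_infinity (at 0)"
    by (rule filterlim_divide_at_infinity) (simp add: Q_nonzero)
  hence "eventually (\<lambda>q. norm (QX q / q ^ 2) \<ge> \<bar>B\<bar> + 1) (at 0)"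
    by (auto simp: filterlim_at_infinity[of 0])
  then obtain c where "\<And>z. Im z > c \<Longrightarrow> norm (QX (ex (z / of_nat 1)) / ex (z / of_nat 1) ^ 2) \<ge> \<bar>B\<bar> + 1"
    by (rule eventually_at_0_ex[OF _ zero_less_one]) blast
  hence "norm (fx z) > B" if "Im z > c" for z
    using that by (fastforce simp: fx_def)
  thus ?thesis by (rule that)
qed

text \<open>x is transcendental over the constants: the roots of a nonzero P are bounded, while |x|
  tends to infinity at its pole.\<close>

lemma evX_eq_0_iff: "evX P = 0 \<longleftrightarrow> P = 0"
proof
  assume eq: "evX P = 0"
  show "P = 0"
  proof (rule ccontr)
    assume "P \<noteq> 0"
    hence "bounded {w. poly P w = 0}" by (intro finite_imp_bounded poly_roots_finite)
    then obtain B where B: "\<And>w. poly P w = 0 \<Longrightarrow> norm w \<le> B" by (auto simp: bounded_iff)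
    obtain y where y: "\<And>z. Im z > y \<Longrightarrow> norm (fx z) > B" by (rule fx_unbounded[of B]) blast
    have "\<forall>\<^sub>\<approx>z\<in>uhp. poly P (fx z) = 0"
      using eq unfolding evX_def zero_mero_uhp by (subst (asm) mero_of_eq_iff) (auto intro: poly_fx_meromorphic)
    define z where "z = Complex 0 (\<bar>y\<bar> + 1)"
    have "z \<in> uhp" "z \<in> {z. Im z > y}" by (simp_all add: z_def uhp_def)
    have "eventually (\<lambda>z. poly P (fx z) = 0) (at z)"
      using \<open>\<forall>\<^sub>\<approx>z\<in>uhp. _ z\<close> \<open>z \<in> uhp\<close> by (simp add: eventually_cosparse_open_eq open_uhp)
    moreover have "eventually (\<lambda>z. z \<in> {z. Im z > y}) (at z)"
      by (rule eventually_at_in_open'[OF open_halfspace_Im_gt]) fact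
    ultimately have "eventually (\<lambda>_. False) (at z)"
      by eventually_elim (use B y in fastforce)
    thus False by simp
  qed
qed (simp add: evX_ring)

lemma evX_diff: "evX (P - Q) = evX P - evX Q"
  using evX_ring(3)[of "P - Q" Q] by simp

lemma evX_inject: "evX P = evX Q \<longleftrightarrow> P = Q"
  using evX_eq_0_iff[of "P - Q"] by (simp add: evX_diff)

lemma evX_pCons: "evX (pCons a P) = const_mero a + Xm * evX P"
proof -
  have "pCons a P = [:a:] + [:0, 1:] * P" by simp
  thus ?thesis by (simp only: evX_ring)
qed

lemma const_mero_simps:
  "const_mero 0 = 0" "const_mero 1 = 1" "const_mero (- a) = - const_mero a" "const_mero (a * b) = const_mero a * const_mero b"
  "const_mero (of_nat n) = of_nat n" "const_mero (numeral k) = numeral k"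
proof -
  show "const_mero 0 = 0" "const_mero 1 = 1" by (simp_all add: const_mero_0 one_mero_uhp mero_of_const)
  show "const_mero (- a) = - const_mero a"
  proof -
    have "const_mero 0 - const_mero a = const_mero (0 - a)"
      unfolding mero_of_const[symmetric] by (rule mero_of_diff) auto
    thus ?thesis by (simp add: const_mero_0)
  qed
  show "const_mero (a * b) = const_mero a * const_mero b"
    unfolding mero_of_const[symmetric] by (rule mero_of_mult[symmetric]) auto
  show "const_mero (of_nat n) = of_nat n" "const_mero (numeral k) = numeral k"
    by (simp_all add: of_nat_mero_uhp numeral_mero_uhp mero_of_const)
qed

lemma const_mero_of_rat: "const_mero (of_rat r) = of_rat r"
proof -
  have int: "const_mero (of_int i) = of_int i" for i
    by (cases i rule: int_cases2) (simp_all add: const_mero_simps)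
  obtain a b where r: "r = Fract a b" "b > 0" by (cases r)
  have "of_rat r * of_int b = (of_int a :: complex)" "of_rat r * of_int b = (of_int a :: mero_uhp)"
    using r by (simp_all add: of_rat_rat)
  hence "const_mero (of_rat r) * of_int b = of_rat r * of_int b"
    by (metis int const_mero_simps(4))
  thus ?thesis using r(2) by simp
qed

lemma evX_of_rat: "evX (map_poly of_rat R) = poly (map_poly of_rat R) Xm"
  by (induction R) (simp_all add: evX_ring(1) evX_pCons map_poly_pCons const_mero_of_rat)

lemma Xm_neq_1: "Xm \<noteq> 1"
  using evX_inject[of "[:0, 1:]" 1] by (simp add: evX_ring one_pCons const_mero_simps)

definition Ym :: mero_uhp where "Ym = (Xm ^ 3 - 3 * Xm ^ 2 + 1 - (Um + 7 * Vm)) / (3 * (Xm - 1))"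
definition Tm :: mero_uhp where "Tm = Um - 7 * Vm"

lemma XYT_in_Q_X0: "Xm \<in> Q_X0 63" "Ym \<in> Q_X0 63" "Tm \<in> Q_X0 63"
  unfolding Ym_def Tm_def
  by (intro is_subfield_ops[OF is_subfield_Q_X0[of 63]] f_in_Q_X0)+

lemma sum_eq_Ym: "Um + 7 * Vm = Xm ^ 3 - 3 * Xm ^ 2 + 1 - 3 * (Xm - 1) * Ym"
  using Xm_neq_1 by (simp add: Ym_def)

lemma Ym_equation: "Ym ^ 2 + Xm * Ym = Xm ^ 3 + Xm"
proof -
  have "(3 * (Xm - 1) * Ym) ^ 2 + 3 * Xm * (Xm - 1) * (3 * (Xm - 1) * Ym) - 9 * (Xm - 1) ^ 2 * (Xm ^ 3 + Xm) = 0"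
    using eta_relation by (simp add: sum_eq_Ym)
  hence "9 * (Xm - 1) ^ 2 * (Ym ^ 2 + Xm * Ym - (Xm ^ 3 + Xm)) = 0"
    by (simp add: power2_eq_square algebra_simps)
  thus ?thesis using Xm_neq_1 by simp
qed

lemma Tm_equation:
  "Tm ^ 2 = 1 + 9 * Xm - 24 * Xm ^ 2 - 8 * Xm ^ 3 - 9 * Xm ^ 4 + 3 * Xm ^ 5 + Xm ^ 6
              - 3 * (- 2 + Xm) * (- 1 + Xm) * (1 + Xm) * (- 1 + 2 * Xm) * Ym"
proof -
  have "Tm ^ 2 = (Um + 7 * Vm) ^ 2 - 28 * (Um * Vm)" unfolding Tm_def by algebra
  hence "Tm ^ 2 = (Xm ^ 3 - 3 * Xm ^ 2 + 1 - 3 * (Xm - 1) * Ym) ^ 2 - 28 * Xm ^ 3"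
    by (simp add: sum_eq_Ym Xm_cube)
  thus ?thesis using Ym_equation by algebra
qed

abbreviation "wm \<equiv> pullback fricke_matrix"

lemma wm_numeral: "wm (numeral k) = numeral k" and wm_1: "wm 1 = 1"
  using pullback_ring(5)[of fricke_matrix] by (simp_all add: numeral_mero_uhp one_mero_uhp mero_of_const)

lemma wm_UVX: "wm Um = 7 * Vm" "wm Vm = Um / 7" "wm Xm = Xm"
  using atkin_lehner_f f_in_Q_X0 by (simp_all add: Q_X0_iff flip: atkin_lehner_eq)

lemma wm_power: "wm (F ^ n) = wm F ^ n"
  by (induction n) (simp_all add: wm_1 pullback_ring)

lemma wm_Ym: "wm Ym = Ym" and wm_Tm: "wm Tm = - Tm"
proof -
  have "wm (Xm ^ 3 - 3 * Xm ^ 2 + 1 - (Um + 7 * Vm)) = Xm ^ 3 - 3 * Xm ^ 2 + 1 - (7 * Vm + 7 * (Um / 7))"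
    by (simp only: pullback_ring wm_power wm_numeral wm_1 wm_UVX)
  thus "wm Ym = Ym"
    unfolding Ym_def divide_inverse[of _ "3 * (Xm - 1)"] by (simp only: pullback_ring wm_numeral wm_1 wm_UVX) simp
  show "wm Tm = - Tm" unfolding Tm_def by (simp only: pullback_ring wm_numeral wm_UVX) simp
qed

lemma wm_evX: "wm (evX P) = evX P"
proof (induction P)
  case 0
  show ?case using pullback_ring(2)[of fricke_matrix 0 0] by (simp add: evX_ring)
qed (simp add: evX_pCons pullback_ring wm_UVX)

lemma wm_rat_adjoin:
  assumes "F \<in> rat_adjoin {Xm, Ym}" shows "wm F = F"
proof -
  have "is_subfield {F. wm F = F}"
    using pullback_ring(2)[of fricke_matrix 0 0] by (simp add: is_subfield_def pullback_ring wm_1)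
  hence "rat_adjoin {Xm, Ym} \<subseteq> {F. wm F = F}"
    by (rule rat_adjoin_subset) (simp add: wm_UVX wm_Ym)
  thus ?thesis using assms by blast
qed

subsection \<open>Linear independence of $1$, $y$, $t$, $yt$ over $\mathbb{C}(x)$\<close>

text \<open>The assumption says that \<open>P + Q y\<close> has norm zero. It is excluded by the parity of the degrees.\<close>

lemma norm_form_degree:
  fixes P Q :: "'a :: idom poly"
  assumes "P ^ 2 - [:0, 1:] * P * Q = [:0, 1, 0, 1:] * Q ^ 2"
  shows "P = 0 \<and> Q = 0"
proof (cases "P = 0 \<or> Q = 0")
  case False
  hence nz: "P \<noteq> 0" "Q \<noteq> 0" by auto
  have eq: "P * (P - pCons 0 Q) = [:0, 1, 0, 1:] * Q ^ 2"
    using assms by (simp add: power2_eq_square algebra_simps)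
  have "[:0, 1, 0, 1:] * Q ^ 2 \<noteq> 0" using nz by (simp del: mult_pCons_left)
  hence "P - pCons 0 Q \<noteq> 0" using eq by (metis mult_zero_right)
  hence "degree P + degree (P - pCons 0 Q) = degree (P * (P - pCons 0 Q))"
    using nz by (simp add: degree_mult_eq)
  also have "\<dots> = 3 + 2 * degree Q"
    unfolding eq using nz by (subst degree_mult_eq) (auto simp: power2_eq_square degree_mult_eq)
  finally have deg: "degree P + degree (P - pCons 0 Q) = 3 + 2 * degree Q" .
  have dQ: "degree (pCons 0 Q) = Suc (degree Q)" using nz by simp
  have False
  \<comment> \<open>Let p and q be the degrees of P and Q. The sum of the degrees of the two factors
    is p + q + 1, at most 2 q + 2, or 2 p in the three cases, while it should be 2 q + 3. The first
    would force p = q + 2, against p < q + 1; the second is too small; the third has the wrong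
    parity.\<close>
  proof (cases "degree P" "Suc (degree Q)" rule: linorder_cases)
    case less
    have "degree (P - pCons 0 Q) = degree (pCons 0 Q)"
      using degree_add_eq_right[of P "- pCons 0 Q"] less dQ by (simp del: minus_pCons)
    thus False using deg dQ less by simp
  next
    case equal
    have "degree (P - pCons 0 Q) \<le> Suc (degree Q)"
      by (rule degree_diff_le) (use equal dQ in auto)
    thus False using deg equal by simp
  next
    case greater
    have "degree (P - pCons 0 Q) = degree P"
      using degree_add_eq_left[of "- pCons 0 Q" P] greater dQ by (simp del: minus_pCons)
    thus False using deg by presburger
  qed
  thus ?thesis ..
next
  case True
  thus ?thesis using assms by (auto simp: power2_eq_square simp del: mult_pCons_left)
qed

text \<open>Inserting P = -Q y into P^2 - x P Q gives Q^2 (y^2 + x y), and the equation of y turns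
  this into the relation excluded by \<open>norm_form_degree\<close>.\<close>

lemma independent_1_Ym:
  assumes "evX P + evX Q * Ym = 0" shows "P = 0 \<and> Q = 0"
proof (rule norm_form_degree)
  have 1: "evX P = - (evX Q * Ym)" using assms by (rule add_eq_0_iff2[THEN iffD1])
  have x: "evX [:0, 1, 0, 1:] = Xm ^ 3 + Xm"
    by (simp add: evX_pCons evX_ring(1) const_mero_simps power3_eq_cube algebra_simps)
  have "evX (P ^ 2 - [:0, 1:] * P * Q) = (evX Q * Ym) ^ 2 + Xm * (evX Q * Ym) * evX Q"
    by (simp only: power2_eq_square evX_diff evX_ring 1) simp
  also have "\<dots> = (Ym ^ 2 + Xm * Ym) * evX Q ^ 2" by algebra
  also have "\<dots> = evX ([:0, 1, 0, 1:] * Q ^ 2)"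
    by (simp only: Ym_equation power2_eq_square[of Q] power2_eq_square[of "evX Q"] evX_ring x)
  finally show "P ^ 2 - [:0, 1:] * P * Q = [:0, 1, 0, 1:] * Q ^ 2" unfolding evX_inject .
qed

lemma Tm_nonzero: "Tm \<noteq> 0"
proof
  assume "Tm = 0"
  have eqX: "evX [:0, 1:] = Xm" by (rule evX_ring)
  define P :: "complex poly" where "P = [:1, 9, -24, -8, -9, 3, 1:]"
  \<comment> \<open>The coefficient of y in the formula for t^2, that is -3 (x - 2) (x - 1) (x + 1)
    (2 x - 1) expanded. It is nonzero, so t^2 = 0 would contradict the independence of 1 and
    y.\<close>
  define Q :: "complex poly" where "Q = [:6, -15, 0, 15, -6:]"
  have "evX P + evX Q * Ym = Tm ^ 2"
    unfolding Tm_equation P_def Q_def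
    by (simp add: evX_pCons evX_ring(1) const_mero_simps) algebra
  hence "Q = 0" using independent_1_Ym[of P Q] \<open>Tm = 0\<close> by simp
  thus False by (simp add: Q_def)
qed

text \<open>The involution fixes x and y and changes the sign of t. Adding and subtracting the
  relation and its image separates the two parts, and t \<noteq> 0 can be cancelled.\<close>

lemma independent_1_Ym_Tm:
  assumes "evX A + evX B * Ym + (evX C + evX D * Ym) * Tm = 0"
  shows "A = 0 \<and> B = 0 \<and> C = 0 \<and> D = 0"
proof -
  have "wm (evX A + evX B * Ym + (evX C + evX D * Ym) * Tm) = wm 0" using assms by simp
  moreover have "wm 0 = 0" using wm_evX[of 0] by (simp add: evX_ring)
  ultimately have "evX A + evX B * Ym - (evX C + evX D * Ym) * Tm = 0"
    by (simp add: pullback_ring wm_evX wm_Ym wm_Tm)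
  with assms have "2 * (evX A + evX B * Ym) = 0" "2 * ((evX C + evX D * Ym) * Tm) = 0" by algebra+
  hence "evX A + evX B * Ym = 0" "evX C + evX D * Ym = 0" using Tm_nonzero by (simp_all del: distrib_left_numeral)
  thus ?thesis using independent_1_Ym by blast
qed

subsection \<open>Descent of the base field from $\mathbb{C}$ to $\mathbb{Q}$\<close>

lemma has_q_expansion_const_eq:
  assumes "has_q_expansion h (const_mero c) (fls_const d)" "h > 0"
  shows "c = d"
proof -
  have "(\<lambda>_. c) meromorphic_on uhp" by auto
  from has_q_expansionE[OF assms(1)[folded mero_of_const] this] obtain y where y: "y > 0"
    "\<forall>\<^sub>\<approx>z\<in>{z. Im z > y}. c = eval_fls (fls_const d) (ex (z / of_nat h))" by blast
  hence "\<forall>\<^sub>\<approx>z\<in>{z. Im z > y}. c = d" by simp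
  moreover have "{z. Im z > y} \<noteq> {}" by (auto intro!: exI[of _ "Complex 0 (y + 1)"])
  ultimately show ?thesis
    by (auto simp: eventually_cosparse_open_eq open_halfspace_Im_gt)
qed

text \<open>F times its inverse is the constant 0 or 1 according to whether F vanishes, and the same
  holds for L. So uniqueness of expansions is reduced to constants.\<close>

lemma has_q_expansion_zero_iff:
  assumes "has_q_expansion h F L" "h > 0" shows "F = 0 \<longleftrightarrow> L = 0"
proof -
  have "has_q_expansion h (F * inverse F) (L * inverse L)"
    by (intro has_q_expansion_binop has_q_expansion_inverse assms)
  moreover have "F * inverse F = const_mero (if F = 0 then 0 else 1)"
    by (simp add: mero_of_const[symmetric] flip: one_mero_uhp zero_mero_uhp)
  moreover have "L * inverse L = fls_const (if L = 0 then 0 else 1)" by simp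
  ultimately have "(if F = 0 then 0 else 1 :: complex) = (if L = 0 then 0 else 1)"
    using has_q_expansion_const_eq assms(2) by metis
  thus ?thesis by (auto split: if_splits)
qed

text \<open>A nonzero c is linearly independent over the rationals, so the value 1 prescribed at c
  extends to a linear map on all of the complex numbers.\<close>

lemma rational_functional:
  assumes "c \<noteq> (0 :: complex)"
  obtains \<phi> :: "complex \<Rightarrow> rat" where "\<And>a b. \<phi> (a + b) = \<phi> a + \<phi> b" "\<And>a r. \<phi> (a * of_rat r) = \<phi> a * r" "\<phi> c \<noteq> 0"
proof -
  interpret V: vector_space_pair "\<lambda>r (z :: complex). of_rat r * z" "\<lambda>(r :: rat) s. r * s"
    by unfold_locales (simp_all add: algebra_simps of_rat_add of_rat_mult)
  have "\<not> V.vs1.dependent {c}" using assms by (simp add: V.vs1.dependent_single)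
  from V.linear_independent_extend[OF this, of "\<lambda>_. 1"]
  obtain \<phi> where \<phi>: "Vector_Spaces.linear (\<lambda>r (z :: complex). of_rat r * z) (\<lambda>r s. r * s) \<phi>" "\<phi> c = 1" by auto
  show ?thesis
    by (rule that[of \<phi>]) (use \<phi> V.linear_add[OF \<phi>(1)] V.linear_scale[OF \<phi>(1)] in \<open>auto simp: mult.commute\<close>)
qed

lemma evX_expansion:
  assumes "has_q_expansion 1 Xm L"
  shows "has_q_expansion 1 (evX P) (poly (map_poly fls_const P) L)"
proof (induction P)
  case 0
  show ?case using has_q_expansion_const[of 1 0] by (simp add: evX_ring const_mero_0)
next
  case (pCons a P)
  have "has_q_expansion 1 (const_mero a + Xm * evX P) (fls_const a + L * poly (map_poly fls_const P) L)"
    by (intro has_q_expansion_binop has_q_expansion_const assms pCons.IH) simp_all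
  thus ?case by (simp add: evX_pCons map_poly_pCons)
qed

text \<open>Each coefficient of P(L) E is a combination of the coefficients of P with rational
  factors, and \<phi> is linear over the rationals. In the induction E is replaced by L E, hence it
  is kept general.\<close>

lemma rational_functional_expansion:
  fixes \<phi> :: "complex \<Rightarrow> rat"
  assumes \<phi>: "\<And>a b. \<phi> (a + b) = \<phi> a + \<phi> b" "\<And>a r. \<phi> (a * of_rat r) = \<phi> a * r"
    and "rational_fls L" "rational_fls E"
  shows "fls_nth (poly (map_poly fls_const (map_poly (\<lambda>a. of_rat (\<phi> a)) P)) L * E) n =
           of_rat (\<phi> (fls_nth (poly (map_poly fls_const P) L * E) n))"
  using assms(4)
proof (induction P arbitrary: E)
  case 0
  have "\<phi> 0 = 0" using \<phi>(1)[of 0 0] by simp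
  thus ?case by simp
next
  case (pCons a P)
  have \<phi>0: "\<phi> 0 = 0" using \<phi>(1)[of 0 0] by simp
  have LE: "rational_fls (L * E)" by (intro rational_fls_ops assms pCons.prems)
  have "fls_nth E n \<in> \<rat>" using pCons.prems by (simp add: rational_fls_def)
  then obtain r where r: "fls_nth E n = of_rat r" by (auto elim: Rats_cases)
  have split: "poly (map_poly fls_const (pCons b R)) L * E =
      fls_const b * E + poly (map_poly fls_const R) L * (L * E)" for b R
    by (simp add: map_poly_pCons algebra_simps)
  have "map_poly (\<lambda>a. complex_of_rat (\<phi> a)) (pCons a P) = pCons (of_rat (\<phi> a)) (map_poly (\<lambda>a. of_rat (\<phi> a)) P)"
    using \<phi>0 by (simp add: map_poly_pCons)
  thus ?case
    by (simp add: split pCons.IH[OF LE] \<phi> r of_rat_add of_rat_mult del: of_rat_eq_iff)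
qed

theorem Q_X0_decompose:
  assumes "F \<in> Q_X0 63"
  obtains \<alpha> \<beta> where "\<alpha> \<in> rat_adjoin {Xm, Ym}" "\<beta> \<in> rat_adjoin {Xm, Ym}" "F = \<alpha> + \<beta> * Tm"
proof -
  define e where "e = (\<lambda>i::nat. [1, Ym, Tm, Ym * Tm, F] ! i)"
  have five: "(\<Sum>i<5. g i) = g 0 + g 1 + g 2 + g 3 + g 4" for g :: "nat \<Rightarrow> 'a :: comm_monoid_add"
    by (simp add: eval_nat_numeral)
  have e: "e 0 = 1" "e 1 = Ym" "e 2 = Tm" "e 3 = Ym * Tm" "e 4 = F"
    by (simp_all add: e_def)
  have eQ: "e i \<in> Q_X0 63" if "i < 5" for i
  proof -
    have "i \<in> {0, 1, 2, 3, 4}" using that by auto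
    thus ?thesis using e XYT_in_Q_X0 assms is_subfield_ops[OF is_subfield_Q_X0[of 63]] by auto
  qed
  hence eC: "e i \<in> C_X0 63" if "i < 5" for i using that by (simp add: Q_X0_iff)
  obtain P where P: "\<exists>i<5. P i \<noteq> 0" "(\<Sum>i<5. evX (P i) * e i) = 0"
    by (rule C_X0_dependent[of e, OF eC]) (assumption | rule that)+
  have "P 4 \<noteq> 0"
  proof
    assume P4: "P 4 = 0"
    have "evX (P 0) + evX (P 1) * Ym + (evX (P 2) + evX (P 3) * Ym) * Tm = 0"
      using P(2) by (simp add: five e e(2)[unfolded One_nat_def] P4 evX_ring algebra_simps)
    from independent_1_Ym_Tm[OF this] have "\<forall>i\<in>{0, 1, 2, 3, 4}. P i = 0" using P4 by simp
    moreover have "{..<5::nat} = {0, 1, 2, 3, 4}" by auto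
    ultimately show False using P(1) by (metis lessThan_iff)
  qed
  \<comment> \<open>The functional is chosen nonzero at this coefficient, so the coefficient of F
    survives the descent and F can be solved for.\<close>
  hence "lead_coeff (P 4) \<noteq> 0" by simp
  then obtain \<phi> :: "complex \<Rightarrow> rat" where \<phi>: "\<And>a b. \<phi> (a + b) = \<phi> a + \<phi> b"
    "\<And>a r. \<phi> (a * of_rat r) = \<phi> a * r" "\<phi> (lead_coeff (P 4)) \<noteq> 0"
    using rational_functional by metis
  have \<phi>0: "\<phi> 0 = 0" using \<phi>(1)[of 0 0] by simp
  define R where "R = (\<lambda>i. map_poly \<phi> (P i))"
  have R: "map_poly of_rat (R i) = map_poly (\<lambda>a. of_rat (\<phi> a)) (P i)" for i
    by (simp add: R_def map_poly_map_poly \<phi>0 o_def)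
  obtain L where L: "has_q_expansion 1 Xm L" "rational_fls L" using XYT_in_Q_X0(1) by (auto simp: Q_X0_iff)
  have "\<forall>i\<in>{..<5}. \<exists>E. has_q_expansion 1 (e i) E \<and> rational_fls E" using eQ by (auto simp: Q_X0_iff)
  from bchoice[OF this] obtain E where E: "\<And>i. i < 5 \<Longrightarrow> has_q_expansion 1 (e i) (E i)"
    "\<And>i. i < 5 \<Longrightarrow> rational_fls (E i)" by auto
  have expansion: "has_q_expansion 1 (\<Sum>i<5. evX (S i) * e i) (\<Sum>i<5. poly (map_poly fls_const (S i)) L * E i)" for S
    unfolding five by (intro has_q_expansion_binop evX_expansion L E) simp_all
  have zero: "(\<Sum>i<5. poly (map_poly fls_const (P i)) L * E i) = 0"
    using has_q_expansion_zero_iff[OF expansion[of P]] P(2) by simp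
  have "(\<Sum>i<5. poly (map_poly fls_const (map_poly of_rat (R i))) L * E i) = 0"
  proof (rule fls_eqI)
    fix n
    have "fls_nth (\<Sum>i<5. poly (map_poly fls_const (map_poly of_rat (R i))) L * E i) n =
          of_rat (\<phi> (fls_nth (\<Sum>i<5. poly (map_poly fls_const (P i)) L * E i) n))"
      unfolding five R fls_plus_nth \<phi>(1) of_rat_add
      by (simp add: rational_functional_expansion[OF \<phi>(1,2) L(2)] E)
    thus "fls_nth (\<Sum>i<5. poly (map_poly fls_const (map_poly of_rat (R i))) L * E i) n = fls_nth 0 n"
      by (simp add: zero \<phi>0)
  qed
  hence *: "(\<Sum>i<5. evX (map_poly of_rat (R i)) * e i) = 0"
    using has_q_expansion_zero_iff[OF expansion[of "\<lambda>i. map_poly of_rat (R i)"]] by simp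
  have "coeff (R 4) (degree (P 4)) \<noteq> 0" using \<phi>(3) by (simp add: R_def coeff_map_poly \<phi>0)
  hence "map_poly of_rat (R 4) \<noteq> (0 :: complex poly)" by (auto simp: poly_eq_iff coeff_map_poly)
  hence R4: "evX (map_poly of_rat (R 4)) \<noteq> 0" by (simp add: evX_eq_0_iff)
  define r where "r = (\<lambda>i. evX (map_poly of_rat (R i)))"
  have r4: "evX (map_poly of_rat (R 4)) = r 4" by (simp only: r_def)
  define K where "K = rat_adjoin {Xm, Ym}"
  note K = is_subfield_rat_adjoin[of "{Xm, Ym}", folded K_def]
  have XY: "Xm \<in> K" "Ym \<in> K" using subset_rat_adjoin[of "{Xm, Ym}"] by (auto simp: K_def)
  have rK: "r i \<in> K" for i
    unfolding r_def evX_of_rat by (rule poly_of_rat_in_subfield[OF K XY(1)])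
  have "r 0 + r 1 * Ym + r 2 * Tm + r 3 * (Ym * Tm) + r 4 * F = 0"
    using * unfolding five e by (simp only: r_def mult_1_right)
  hence "r 4 * F = - (r 0 + r 1 * Ym) + - (r 2 + r 3 * Ym) * Tm" by algebra
  hence "F = (- (r 0 + r 1 * Ym) + - (r 2 + r 3 * Ym) * Tm) / r 4"
    using R4 unfolding r4 by (metis nonzero_mult_div_cancel_left)
  hence "F = - (r 0 + r 1 * Ym) / r 4 + - (r 2 + r 3 * Ym) / r 4 * Tm"
    by (simp only: add_divide_distrib times_divide_eq_left)
  moreover have "- (r 0 + r 1 * Ym) / r 4 \<in> K" "- (r 2 + r 3 * Ym) / r 4 \<in> K"
    by (intro is_subfield_ops[OF K] rK XY)+
  ultimately show ?thesis using that unfolding K_def by blast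
qed

corollary Q_X0_eq_rat_adjoin: "Q_X0 63 = rat_adjoin {Xm, Ym, Tm}"
proof
  show "rat_adjoin {Xm, Ym, Tm} \<subseteq> Q_X0 63"
    by (rule rat_adjoin_subset[OF is_subfield_Q_X0]) (simp add: XYT_in_Q_X0)
  show "Q_X0 63 \<subseteq> rat_adjoin {Xm, Ym, Tm}"
  proof
    fix F assume "F \<in> Q_X0 63"
    then obtain \<alpha> \<beta> where *: "\<alpha> \<in> rat_adjoin {Xm, Ym}" "\<beta> \<in> rat_adjoin {Xm, Ym}" "F = \<alpha> + \<beta> * Tm"
      by (rule Q_X0_decompose)
    have "rat_adjoin {Xm, Ym} \<subseteq> rat_adjoin {Xm, Ym, Tm}" by (rule rat_adjoin_mono) auto
    hence "\<alpha> \<in> rat_adjoin {Xm, Ym, Tm}" "\<beta> \<in> rat_adjoin {Xm, Ym, Tm}" using * by auto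
    moreover have "Tm \<in> rat_adjoin {Xm, Ym, Tm}" by (rule subsetD[OF subset_rat_adjoin]) simp
    ultimately show "F \<in> rat_adjoin {Xm, Ym, Tm}"
      unfolding *(3) by (intro is_subfield_ops(3,5)[OF is_subfield_rat_adjoin])
  qed
qed

corollary invariants_eq_rat_adjoin: "{F \<in> Q_X0 63. atkin_lehner 63 63 F = F} = rat_adjoin {Xm, Ym}"
proof (intro equalityI subsetI)
  fix F assume "F \<in> {F \<in> Q_X0 63. atkin_lehner 63 63 F = F}"
  hence F: "F \<in> Q_X0 63" "wm F = F" using atkin_lehner_eq by (auto simp: Q_X0_iff)
  obtain \<alpha> \<beta> where *: "\<alpha> \<in> rat_adjoin {Xm, Ym}" "\<beta> \<in> rat_adjoin {Xm, Ym}" "F = \<alpha> + \<beta> * Tm"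
    using Q_X0_decompose[OF F(1)] .
  have "\<alpha> + \<beta> * Tm = \<alpha> - \<beta> * Tm" using F(2) by (simp add: * pullback_ring wm_rat_adjoin wm_Tm)
  hence "2 * (\<beta> * Tm) = 0" by algebra
  thus "F \<in> rat_adjoin {Xm, Ym}" using * by (auto simp: Tm_nonzero)
next
  fix F assume F: "F \<in> rat_adjoin {Xm, Ym}"
  moreover have "rat_adjoin {Xm, Ym} \<subseteq> rat_adjoin {Xm, Ym, Tm}" by (rule rat_adjoin_mono) auto
  ultimately have Q: "F \<in> Q_X0 63" unfolding Q_X0_eq_rat_adjoin by (rule rev_subsetD)
  hence "atkin_lehner 63 63 F = F" using wm_rat_adjoin[OF F] by (simp add: Q_X0_iff atkin_lehner_eq)
  with Q show "F \<in> {F \<in> Q_X0 63. atkin_lehner 63 63 F = F}" by simp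
qed

subsection \<open>The ideal of relations\<close>

definition is_ring_hom :: "('a :: comm_ring_1 \<Rightarrow> 'b :: comm_ring_1) \<Rightarrow> bool" where
  "is_ring_hom h \<longleftrightarrow> h 0 = 0 \<and> h 1 = 1 \<and> (\<forall>a b. h (a + b) = h a + h b) \<and> (\<forall>a b. h (a * b) = h a * h b)"

lemma is_ring_hom_simps:
  assumes "is_ring_hom h"
  shows "h 0 = 0" "h 1 = 1" "h (a + b) = h a + h b" "h (a * b) = h a * h b" "h (- a) = - h a"
    "h (a - b) = h a - h b" "h (a ^ n) = h a ^ n" "h (of_nat n) = of_nat n" "h (numeral k) = numeral k"
proof -
  have s: "h 0 = 0" "h 1 = 1" "\<And>a b. h (a + b) = h a + h b" "\<And>a b. h (a * b) = h a * h b"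
    using assms by (auto simp: is_ring_hom_def)
  have u: "h (- a) = - h a" for a using s(3)[of a "- a"] by (simp add: s(1) eq_neg_iff_add_eq_0 add.commute)
  show "h 0 = 0" "h 1 = 1" "h (a + b) = h a + h b" "h (a * b) = h a * h b" "h (- a) = - h a"
    by (simp_all only: s u)
  show "h (a - b) = h a - h b" using s(3)[of a "- b"] by (simp add: u)
  show "h (a ^ n) = h a ^ n" by (induction n) (simp_all add: s)
  have n: "h (of_nat n) = of_nat n" for n by (induction n) (simp_all add: s)
  show "h (of_nat n) = of_nat n" "h (numeral k) = numeral k" using n n[of "numeral k"] by simp_all
qed

text \<open>Used three times for \<open>eval_XYT\<close>, once for each layer of the nested
  polynomial ring.\<close>

lemma is_ring_hom_poly:
  assumes h: "is_ring_hom h" shows "is_ring_hom (\<lambda>P. poly (map_poly h P) a)"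
proof -
  note s = is_ring_hom_simps[OF h]
  have add: "map_poly h (P + Q) = map_poly h P + map_poly h Q" for P Q
    by (simp add: poly_eq_iff coeff_map_poly s)
  have smult: "map_poly h (smult c P) = smult (h c) (map_poly h P)" for c P
    by (simp add: poly_eq_iff coeff_map_poly s)
  have "poly (map_poly h (P * Q)) a = poly (map_poly h P) a * poly (map_poly h Q) a" for P Q
    by (induction P) (simp_all add: add smult map_poly_pCons s algebra_simps)
  thus ?thesis unfolding is_ring_hom_def by (simp add: add s map_poly_1')
qed

lemma is_ring_hom_eval_XYT: "is_ring_hom (eval_XYT x y t)"
proof -
  have "is_ring_hom (of_rat :: rat \<Rightarrow> 'a)" by (simp add: is_ring_hom_def of_rat_add of_rat_mult)
  thus ?thesis unfolding eval_XYT_def[abs_def] by (intro is_ring_hom_poly)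
qed

lemma eval_XYT_simps:
  "eval_XYT x y t var_X = x" "eval_XYT x y t var_Y = y" "eval_XYT x y t var_T = t"
  "eval_XYT x y t [:[:a, b:], [:c, d:]:] =
     poly (map_poly of_rat a) x + poly (map_poly of_rat b) x * y +
     (poly (map_poly of_rat c) x + poly (map_poly of_rat d) x * y) * t"
  by (simp_all add: eval_XYT_def var_X_def var_Y_def var_T_def map_poly_pCons algebra_simps)

text \<open>The coefficients are themselves polynomials, so division has to work over a commutative
  ring; this is possible because the divisor is monic.\<close>

lemma monic_quadratic_division:
  fixes P :: "'a :: comm_ring_1 poly"
  obtains B r s where "P = B * [:m, g, 1:] + [:r, s:]"
proof -
  have "\<exists>B r s. P = B * [:m, g, 1:] + [:r, s:]"
  proof (induction P)
    case 0
    show ?case by (intro exI[of _ 0]) simp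
  next
    case (pCons q P)
    then obtain B r s where "P = B * [:m, g, 1:] + [:r, s:]" by blast
    hence "pCons q P = (pCons s B) * [:m, g, 1:] + [:q - s * m, r - s * g:]" by simp
    thus ?case by blast
  qed
  thus ?thesis using that by blast
qed

text \<open>G is monic of degree 2 in T and F is monic of degree 2 in Y and free of T. Dividing by G
  and then by F leaves a + b Y + (c + d Y) T, and evaluation kills such a remainder only if it is 0,
  by the independence of 1, y, t, yt over the complex polynomials in x.\<close>

lemma relations_ideal:
  defines "F \<equiv> var_Y ^ 2 + var_X * var_Y - (var_X ^ 3 + var_X)"
    and "G \<equiv> var_T ^ 2 - (1 + 9 * var_X - 24 * var_X ^ 2 - 8 * var_X ^ 3 - 9 * var_X ^ 4
                      + 3 * var_X ^ 5 + var_X ^ 6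
                    - 3 * (- 2 + var_X) * (- 1 + var_X) * (1 + var_X) * (- 1 + 2 * var_X) * var_Y)"
  shows "{P. eval_XYT Xm Ym Tm P = 0} = {A * F + B * G |A B. True}"
proof -
  note hom = is_ring_hom_simps[OF is_ring_hom_eval_XYT[of Xm Ym Tm]] eval_XYT_simps(1-3)[of Xm Ym Tm]
  have F0: "eval_XYT Xm Ym Tm F = 0" unfolding F_def hom Ym_equation by simp
  have G0: "eval_XYT Xm Ym Tm G = 0" unfolding G_def hom Tm_equation by simp
  have "F = [:[:- [:0, 1, 0, 1:], [:0, 1:], 1:]:]"
    by (simp add: F_def var_X_def var_Y_def power2_eq_square power3_eq_cube)
  then obtain f0 f1 where F: "F = [:[:f0, f1, 1:]:]" by blast
  \<comment> \<open>The right-hand side is a constant polynomial in T; the shape T^2 - g, with g a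
    polynomial in X and Y, is what the division by G uses.\<close>
  have "\<exists>g. G = var_T ^ 2 - [:g:]"
    unfolding G_def var_X_def var_Y_def pCons_one[symmetric] numeral_poly
    by (simp add: poly_const_pow) (rule exI, rule minus_minus[symmetric])
  then obtain g where "G = var_T ^ 2 - [:g:]" by blast
  hence G: "G = [:- g, 0, 1:]" by (simp add: var_T_def power2_eq_square)
  show ?thesis
  proof (intro equalityI subsetI)
    fix P assume "P \<in> {P. eval_XYT Xm Ym Tm P = 0}"
    hence P0: "eval_XYT Xm Ym Tm P = 0" by simp
    obtain B r s where 1: "P = B * G + [:r, s:]" unfolding G by (rule monic_quadratic_division)
    obtain A0 a b where 2: "r = A0 * [:f0, f1, 1:] + [:a, b:]" by (rule monic_quadratic_division)
    obtain A1 c d where 3: "s = A1 * [:f0, f1, 1:] + [:c, d:]" by (rule monic_quadratic_division)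
    have P: "P = [:A0, A1:] * F + B * G + [:[:a, b:], [:c, d:]:]"
      unfolding 1 2 3 F by (simp add: algebra_simps)
    have "eval_XYT Xm Ym Tm [:[:a, b:], [:c, d:]:] = 0"
      using P0 unfolding P hom F0 G0 by simp
    hence "map_poly of_rat a = (0 :: complex poly) \<and> map_poly of_rat b = (0 :: complex poly) \<and>
           map_poly of_rat c = (0 :: complex poly) \<and> map_poly of_rat d = (0 :: complex poly)"
      unfolding eval_XYT_simps evX_of_rat[symmetric] by (rule independent_1_Ym_Tm)
    hence "a = 0 \<and> b = 0 \<and> c = 0 \<and> d = 0" by (simp add: poly_eq_iff coeff_map_poly)
    hence "P = [:A0, A1:] * F + B * G" unfolding P by simp
    thus "P \<in> {A * F + B * G |A B. True}" by blast
  next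
    fix P assume "P \<in> {A * F + B * G |A B. True}"
    thus "P \<in> {P. eval_XYT Xm Ym Tm P = 0}" by (auto simp: hom F0 G0)
  qed
qed

theorem mainTheorem15:
  shows "\<exists>x\<in>Q_X0 63. \<exists>y\<in>Q_X0 63. \<exists>t\<in>Q_X0 63.
    Q_X0 63 = rat_adjoin {x, y, t} \<and>
    {f \<in> Q_X0 63. atkin_lehner 63 63 f = f} = rat_adjoin {x, y} \<and>
    atkin_lehner 63 63 t = - t \<and>
    y ^ 2 + x * y = x ^ 3 + x \<and>
    t ^ 2 = 1 + 9 * x - 24 * x ^ 2 - 8 * x ^ 3 - 9 * x ^ 4 + 3 * x ^ 5 + x ^ 6
              - 3 * (- 2 + x) * (- 1 + x) * (1 + x) * (- 1 + 2 * x) * y \<and>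
    are_equations_for
      (var_Y ^ 2 + var_X * var_Y - (var_X ^ 3 + var_X))
      (var_T ^ 2 - (1 + 9 * var_X - 24 * var_X ^ 2 - 8 * var_X ^ 3 - 9 * var_X ^ 4
                      + 3 * var_X ^ 5 + var_X ^ 6
                    - 3 * (- 2 + var_X) * (- 1 + var_X) * (1 + var_X) * (- 1 + 2 * var_X) * var_Y))
      (Q_X0 63) x y t"
proof (intro bexI conjI)
  show "Q_X0 63 = rat_adjoin {Xm, Ym, Tm}" by (rule Q_X0_eq_rat_adjoin)
  show "{f \<in> Q_X0 63. atkin_lehner 63 63 f = f} = rat_adjoin {Xm, Ym}" by (rule invariants_eq_rat_adjoin)
  show "atkin_lehner 63 63 Tm = - Tm"
    using atkin_lehner_eq[of Tm] XYT_in_Q_X0(3) wm_Tm by (simp add: Q_X0_iff)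
  show "are_equations_for
      (var_Y ^ 2 + var_X * var_Y - (var_X ^ 3 + var_X))
      (var_T ^ 2 - (1 + 9 * var_X - 24 * var_X ^ 2 - 8 * var_X ^ 3 - 9 * var_X ^ 4
                      + 3 * var_X ^ 5 + var_X ^ 6
                    - 3 * (- 2 + var_X) * (- 1 + var_X) * (1 + var_X) * (- 1 + 2 * var_X) * var_Y))
      (Q_X0 63) Xm Ym Tm"
    unfolding are_equations_for_def using Q_X0_eq_rat_adjoin relations_ideal by blast
qed (rule Ym_equation Tm_equation XYT_in_Q_X0)+

end
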